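(* Let $(X(t))$ be a strong Markov process on $E\subset\mathbb{R}^d$ as in the context, satisfying Assumption (A) (stated in the context), and let $r^*_e$ be its essential spectral radius. Then for any $x,y\in\mathcal{E}$, $$\log r^*_e \;=\; -I^*_0 \;=\; -\limsup_{t\to+\infty}\frac{I_0(t,x,y)}{t} \;=\; -\limsup_{t\to+\infty}\frac{\hat I(t,x,y)}{t} \;=\; -\inf_{\substack{\phi(0)=\phi(1),\\ \phi(t)\neq0\ \forall\,0<t<1}} I_{[0,1]}(\phi),$$ where the infimum is taken over all continuous functions $\phi:[0,1]\to\mathcal{E}$ with $\phi(0)=\phi(1)$ such that $\phi(t)\neq 0$ for all $0<t<1$.
   Context: **Process.** $E\subset\mathbb{R}^d$ is closed and unbounded, endowed with a non-negative Radon measure $m$ such that $m(O)\neq 0$ for every non-empty (relatively) open $O\subset E$. $(X(t))_{t\ge 0}$ is a strong Markov process on $E$ with right continuous sample paths having left limits; $\mathbb{P}_x,\mathbb{E}_x$ refer to $X(0)=x$. For closed $V\subset E$, $\tau(V)=\inf\{t>0: X(t)\in V\}$, $\tau(\emptyset)=+\infty$. For every closed $V\subset E$ and every bounded measurable $\varphi:E\to\mathbb{R}$, the map $(t,x)\mapsto\mathbb{E}_x(\varphi(X(t));\,\tau(V)>t)$ is assumed Borel measurable on $\mathbb{R}_+\times E$. **Essential spectral radius.** $r_e^*$ is the infimum of all $r>0$ for which there is a compact set $K\subset E$ such that, for every compact $W\subset E\setminus K$, the function $x\mapsto\int_0^\infty r^{-t}\,\mathbb{P}_x(X(t)\in W,\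 \tau(K)>t)\,dt$ is $m$-integrable on compact subsets of $E\setminus K$. **Assumption (A).** Let $\mathcal{E}$ be the set of all possible limits $\lim_{a\to\infty}x_a/a$ with $x_a\in E$. $D([0,T],\mathcal{E})$ is the space of functions $[0,T]\to\mathcal{E}$ that are right continuous with left limits, with the Skorohod metric. Put $Z_a(t)=X(at)/a$; $\mathbb{P}_{az}$ means $Z_a(0)=z$, i.e. $X(0)=az$. - $(a_0)$ $E\subset\mathcal{E}\neq\{0\}$ and $\mathcal{E}\setminus\{0\}$ is convex. - $(a_1)$ For every $T>0$ the family $(Z_a(t),t\in[0,T])$ satisfies the sample path large deviation principle in $D([0,T],\mathcal{E})$ with a good rate function $I_{[0,T]}:D([0,T],\mathcal{E})\to[0,+\infty]$. That is: for any $c>0$ and compact $V\subset\mathcal{E}$ the set $\{\phi:\phi(0)\in V,\ I_{[0,T]}(\phi)\le c\}$ is compact; and for every $x\in\mathcal{E}$, for every open $\mathcal{O}\subset D([0,T],\mathcal{E})$, $\lim_{\varepsilon\to0}\liminf_{a\to\infty}\inf_{z}\frac1a\log\mathbb{P}_{az}(Z_a(\cdot)\in\mathcal{O})\ge-\inf_{\phi\in\mathcal{O}:\phi(0)=x}I_{[0,T]}(\phi)$, and for every closed $F\subset D([0,T],\mathcal{E})$, $\lim_{\varepsilon\to0}\limsup_{a\to\infty}\sup_{z}\frac1a\log\mathbb{P}_{az}(Z_a(\cdot)\in F)\le-\inf_{\phi\in F:\phi(0)=x}I_{[0,T]}(\phi)$, where $z$ ranges over $z\in\frac1aE$ with $|z-x|<\varepsilon$.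 - $(a_2)$ There is a function $L:\mathcal{E}\times\mathbb{R}^d\to\mathbb{R}_+$ such that $I_{[0,T]}(\phi)=\int_0^TL(\phi(t),\dot\phi(t))\,dt$ if $\phi:[0,T]\to\mathcal{E}$ is absolutely continuous, and $I_{[0,T]}(\phi)=+\infty$ otherwise. - $(a_3)$ There are convex functions $l_1,l_2$ on $\mathbb{R}^d$ ($l_2$ may take the value $+\infty$) with $0\le l_1(v)\le L(x,v)\le l_2(v)$ for all $x\in\mathcal{E}$, $v\in\mathbb{R}^d$; $l_2$ is finite in a neighborhood of zero; and $\lim_{n\to\infty}\inf_{|v|\ge n}l_1(v)/|v|>0$. **Notation.** For $x,y\in\mathcal{E}$, $t>0$: $\hat I(t,x,y)$ is the infimum of $I_{[0,t]}(\phi)$ over all continuous $\phi:[0,t]\to\mathcal{E}$ with $\phi(0)=x$, $\phi(t)=y$ for which $\{s\in[0,t]:\phi(s)=0\}$ has Lebesgue measure zero; $I_0(t,x,y)$ is the infimum of $I_{[0,t]}(\phi)$ over all continuous $\phi:[0,t]\to\mathcal{E}$ with $\phi(0)=x$, $\phi(t)=y$ and $\phi(s)\neq0$ for all $0<s<t$. $I^*_0=\hat I(1,0,0)$. *)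

theory Defs
  imports "HOL-Probability.Probability" "HOL-Probability.Stopping_Time"
begin

text \<open>First hitting time over strictly positive times; the infimum of the empty set in
  \<^typ>\<open>ennreal\<close> is \<open>\<infinity>\<close>, so in particular the hitting time of \<open>{}\<close> is \<open>\<infinity>\<close>.\<close>

definition hitting_time :: "(real \<Rightarrow> 'w \<Rightarrow> 'a) \<Rightarrow> 'a set \<Rightarrow> 'w \<Rightarrow> ennreal" where
  "hitting_time X V \<omega> = Inf (ennreal ` {t. 0 < t \<and> X t \<omega> \<in> V})"

text \<open>A strong Markov family \<open>(P x)\<close> on one measurable space \<open>M\<close> (only the \<open>\<sigma>\<close>-algebra of \<open>M\<close>
  matters, not its measure). The index set of the filtration is \<open>[0,\<infinity>]\<close> so that stopping times
  may be infinite; the process itself is indexed by \<open>t \<ge> 0\<close>. Neither completeness nor right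
  continuity of the filtration is imposed.\<close>

locale strong_markov_process = filtration "space M" F
  for M :: "'w measure" and F :: "ennreal \<Rightarrow> 'w measure" +
  fixes E :: "'a::euclidean_space set"
    and P :: "'a \<Rightarrow> 'w measure"
    and X :: "real \<Rightarrow> 'w \<Rightarrow> 'a"
  assumes sets_F_subset: "\<And>t. sets (F t) \<subseteq> sets M"
    and sets_P: "\<And>x. x \<in> E \<Longrightarrow> sets (P x) = sets M"
    and prob_space_P: "\<And>x. x \<in> E \<Longrightarrow> prob_space (P x)"
    and X_in_E: "\<And>t \<omega>. 0 \<le> t \<Longrightarrow> \<omega> \<in> space M \<Longrightarrow> X t \<omega> \<in> E"
    and adapted: "\<And>t. 0 \<le> t \<Longrightarrow> X t \<in> borel_measurable (F (ennreal t))"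
    and initial: "\<And>x. x \<in> E \<Longrightarrow> AE \<omega> in P x. X 0 \<omega> = x"
    and right_continuous:
      "\<And>t \<omega>. 0 \<le> t \<Longrightarrow> \<omega> \<in> space M \<Longrightarrow> ((\<lambda>s. X s \<omega>) \<longlongrightarrow> X t \<omega>) (at_right t)"
    and left_limits:
      "\<And>t \<omega>. 0 < t \<Longrightarrow> \<omega> \<in> space M \<Longrightarrow> \<exists>l\<in>E. ((\<lambda>s. X s \<omega>) \<longlongrightarrow> l) (at_left t)"
    and transition_measurable:
      "\<And>t B. 0 \<le> t \<Longrightarrow> B \<in> sets borel \<Longrightarrow>
        (\<lambda>x. emeasure (P x) {\<omega> \<in> space M. X t \<omega> \<in> B}) \<in> borel_measurable (restrict_space borel E)"
    and strong_markov:
      "\<And>x T A B s. x \<in> E \<Longrightarrow> stopping_time F T \<Longrightarrow> A \<in> sets (pre_sigma T) \<Longrightarrow>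
        B \<in> sets borel \<Longrightarrow> 0 \<le> s \<Longrightarrow>
        emeasure (P x) {\<omega> \<in> A. T \<omega> < \<infinity> \<and> X (enn2real (T \<omega>) + s) \<omega> \<in> B} =
        (\<integral>\<^sup>+\<omega>\<in>{\<omega> \<in> A. T \<omega> < \<infinity>}.
           emeasure (P (X (enn2real (T \<omega>)) \<omega>)) {\<omega>' \<in> space M. X s \<omega>' \<in> B} \<partial>P x)"

locale process_setting = strong_markov_process M F E P X
  for M :: "'w measure" and F :: "ennreal \<Rightarrow> 'w measure" and E :: "'a::euclidean_space set"
    and P :: "'a \<Rightarrow> 'w measure" and X :: "real \<Rightarrow> 'w \<Rightarrow> 'a" +
  fixes m :: "'a measure"
  assumes closed_E: "closed E"
    and unbounded_E: "\<not> bounded E"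
    and sets_m: "sets m = sets (restrict_space borel E)"
    \<comment> \<open>On a closed subset of a Euclidean space the Radon measures are exactly the Borel
      measures that are finite on compact sets; regularity is automatic.\<close>
    and radon_m: "\<And>C. compact C \<Longrightarrow> C \<subseteq> E \<Longrightarrow> emeasure m C < \<infinity>"
    and positive_m: "\<And>U. openin (top_of_set E) U \<Longrightarrow> U \<noteq> {} \<Longrightarrow> emeasure m U \<noteq> 0"
    \<comment> \<open>Automatic for right-continuous complete filtrations (debut theorem). It gives a meaning
      to the events \<open>\<tau>(V) > t\<close> below, and the strong Markov property applies at \<open>\<tau>(V)\<close>.\<close>
    and hitting_stopping: "\<And>V. closed V \<Longrightarrow> V \<subseteq> E \<Longrightarrow> stopping_time F (hitting_time X V)"
    and killed_measurable:
      "\<And>V (\<phi>::'a \<Rightarrow> real). closed V \<Longrightarrow> V \<subseteq> E \<Longrightarrow>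
        \<phi> \<in> borel_measurable (restrict_space borel E) \<Longrightarrow> bounded (\<phi> ` E) \<Longrightarrow>
        (\<lambda>(t, x). \<integral>\<omega>. indicator {\<omega>. hitting_time X V \<omega> > ennreal t} \<omega> * \<phi> (X t \<omega>) \<partial>P x)
          \<in> borel_measurable (restrict_space borel ({0..} \<times> E))"

definition elog :: "ennreal \<Rightarrow> ereal" where
  "elog p = (if p = 0 then -\<infinity> else if p = \<infinity> then \<infinity> else ereal (ln (enn2real p)))"

text \<open>The integrands are non-negative, so integrability on a compact set \<open>C\<close> is finiteness of the
  integral over \<open>C\<close>. (Measurability of the inner integral in \<open>x\<close> is a consequence of the joint
  measurability assumed of the killed process.)\<close>

definition ess_spectral_radius ::
  "'a::euclidean_space set \<Rightarrow> ('a \<Rightarrow> 'w measure) \<Rightarrow> (real \<Rightarrow> 'w \<Rightarrow> 'a) \<Rightarrow> 'a measure \<Rightarrow> ennreal" where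
  "ess_spectral_radius E P X m =
    Inf (ennreal ` {r. 0 < r \<and> (\<exists>K. compact K \<and> K \<subseteq> E \<and>
      (\<forall>W. compact W \<and> W \<subseteq> E - K \<longrightarrow>
        (\<forall>C. compact C \<and> C \<subseteq> E - K \<longrightarrow>
          (\<integral>\<^sup>+x\<in>C. (\<integral>\<^sup>+t\<in>{0..}. ennreal (r powr (-t)) *
              emeasure (P x) {\<omega> \<in> space (P x). X t \<omega> \<in> W \<and> hitting_time X K \<omega> > ennreal t}
            \<partial>lborel) \<partial>m) < \<infinity>)))})"

text \<open>Paths on \<open>[0,T]\<close> are represented by functions on \<^typ>\<open>real\<close> that are \<^const>\<open>undefined\<close>
  outside \<open>[0,T]\<close>.\<close>

definition skorohod_space :: "real \<Rightarrow> 'a::metric_space set \<Rightarrow> (real \<Rightarrow> 'a) set" where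
  "skorohod_space T S = {\<phi> \<in> {0..T} \<rightarrow>\<^sub>E S.
     (\<forall>t\<in>{0..<T}. (\<phi> \<longlongrightarrow> \<phi> t) (at_right t)) \<and>
     (\<forall>t\<in>{0<..T}. \<exists>l\<in>S. (\<phi> \<longlongrightarrow> l) (at_left t))}"

definition time_changes :: "real \<Rightarrow> (real \<Rightarrow> real) set" where
  "time_changes T = {l. strict_mono_on {0..T} l \<and> bij_betw l {0..T} {0..T}}"

definition skorohod_dist :: "real \<Rightarrow> (real \<Rightarrow> 'a::metric_space) \<Rightarrow> (real \<Rightarrow> 'a) \<Rightarrow> real" where
  "skorohod_dist T \<phi> \<psi> = enn2real (INF l\<in>time_changes T. SUP t\<in>{0..T}.
     max (ennreal \<bar>l t - t\<bar>) (ennreal (dist (\<phi> t) (\<psi> (l t)))))"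

definition skorohod_metric :: "real \<Rightarrow> 'a::metric_space set \<Rightarrow> (real \<Rightarrow> 'a) metric" where
  "skorohod_metric T S = metric (skorohod_space T S, skorohod_dist T)"

text \<open>\<^const>\<open>skorohod_dist\<close> is a metric on \<^const>\<open>skorohod_space\<close>, so that
  \<^const>\<open>skorohod_metric\<close> is the intended metric space.\<close>

lemma id_time_change: "(\<lambda>t. t) \<in> time_changes T"
  by (auto simp: time_changes_def strict_mono_on_def bij_betw_def)

lemma time_change_inv:
  assumes "l \<in> time_changes T"
  shows "inv_into {0..T} l \<in> time_changes T"
proof -
  have b: "bij_betw l {0..T} {0..T}" and sm: "strict_mono_on {0..T} l"
    using assms by (auto simp: time_changes_def)
  have b': "bij_betw (inv_into {0..T} l) {0..T} {0..T}"
    using b by (rule bij_betw_inv_into)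
  have "strict_mono_on {0..T} (inv_into {0..T} l)"
  proof (rule strict_mono_onI)
    fix r s assume rs: "r \<in> {0..T}" "s \<in> {0..T}" "r < s"
    let ?r = "inv_into {0..T} l r" and ?s = "inv_into {0..T} l s"
    have mem: "?r \<in> {0..T}" "?s \<in> {0..T}" using b' rs by (auto dest: bij_betwE)
    have eq: "l ?r = r" "l ?s = s" using b rs by (auto intro: bij_betw_inv_into_right)
    show "?r < ?s"
    proof (rule ccontr)
      assume "\<not> ?r < ?s"
      then have "?s \<le> ?r" by simp
      then have "l ?s \<le> l ?r"
        using sm mem by (meson strict_mono_on_leD)
      then show False using eq rs by simp
    qed
  qed
  then show ?thesis using b' by (simp add: time_changes_def)
qed

lemma time_change_comp:
  assumes "l \<in> time_changes T" "k \<in> time_changes T"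
  shows "k \<circ> l \<in> time_changes T"
proof -
  have "l t \<in> {0..T}" if "t \<in> {0..T}" for t
    using assms(1) that by (auto simp: time_changes_def dest: bij_betwE)
  then show ?thesis
    using assms unfolding time_changes_def
    by (auto intro: bij_betw_trans simp: strict_mono_on_def)
qed

lemma skorohod_bounded:
  assumes "\<phi> \<in> skorohod_space T S"
  shows "bounded (\<phi> ` {0..T})"
proof -
  have loc: "\<exists>e>0. bounded (\<phi> ` ({0..T} \<inter> ball t e))" if t: "t \<in> {0..T}" for t
  proof -
    have "\<exists>e>0. bounded (\<phi> ` ({0..T} \<inter> {t<..<t+e}))"
    proof (cases "t < T")
      case True
      then have "(\<phi> \<longlongrightarrow> \<phi> t) (at_right t)"
        using assms t by (auto simp: skorohod_space_def)
      then have "eventually (\<lambda>s. dist (\<phi> s) (\<phi> t) < 1) (at_right t)"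
        by (rule tendstoD) simp
      then obtain b where b: "b > t" "\<And>s. t < s \<Longrightarrow> s < b \<Longrightarrow> dist (\<phi> s) (\<phi> t) < 1"
        by (auto simp: eventually_at_right_field)
      then have "\<phi> ` ({0..T} \<inter> {t<..<t+(b - t)}) \<subseteq> cball (\<phi> t) 1"
        by (fastforce simp: dist_commute)
      then show ?thesis
        using b(1) bounded_subset[OF bounded_cball] by (intro exI[of _ "b - t"]) auto
    next
      case False
      then have "{0..T} \<inter> {t<..<t+1} = {}" using t by auto
      then show ?thesis by (intro exI[of _ 1]) (simp only: image_empty bounded_empty, simp)
    qed
    then obtain e1 where e1: "e1 > 0" "bounded (\<phi> ` ({0..T} \<inter> {t<..<t+e1}))" by blast
    have "\<exists>e>0. bounded (\<phi> ` ({0..T} \<inter> {t-e<..<t}))"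
    proof (cases "t > 0")
      case True
      then obtain l where "(\<phi> \<longlongrightarrow> l) (at_left t)"
        using assms t unfolding skorohod_space_def by fastforce
      then have "eventually (\<lambda>s. dist (\<phi> s) l < 1) (at_left t)"
        by (rule tendstoD) simp
      then obtain b where b: "b < t" "\<And>s. b < s \<Longrightarrow> s < t \<Longrightarrow> dist (\<phi> s) l < 1"
        by (auto simp: eventually_at_left_field)
      then have "\<phi> ` ({0..T} \<inter> {t-(t-b)<..<t}) \<subseteq> cball l 1"
        by (fastforce simp: dist_commute)
      then show ?thesis
        using b(1) bounded_subset[OF bounded_cball] by (intro exI[of _ "t - b"]) auto
    next
      case False
      then have "{0..T} \<inter> {t-1<..<t} = {}" using t by auto
      then show ?thesis by (intro exI[of _ 1]) (simp only: image_empty bounded_empty, simp)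
    qed
    then obtain e2 where e2: "e2 > 0" "bounded (\<phi> ` ({0..T} \<inter> {t-e2<..<t}))" by blast
    have "\<phi> ` ({0..T} \<inter> ball t (min e1 e2)) \<subseteq>
      \<phi> ` ({0..T} \<inter> {t<..<t+e1}) \<union> \<phi> ` ({0..T} \<inter> {t-e2<..<t}) \<union> {\<phi> t}"
    proof
      fix u assume "u \<in> \<phi> ` ({0..T} \<inter> ball t (min e1 e2))"
      then obtain s where s: "u = \<phi> s" "s \<in> {0..T}" "\<bar>t - s\<bar> < min e1 e2"
        by (auto simp: dist_real_def)
      then show "u \<in> \<phi> ` ({0..T} \<inter> {t<..<t+e1}) \<union> \<phi> ` ({0..T} \<inter> {t-e2<..<t}) \<union> {\<phi> t}"
        by (cases s t rule: linorder_cases) auto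
    qed
    then have "bounded (\<phi> ` ({0..T} \<inter> ball t (min e1 e2)))"
      by (rule bounded_subset[rotated]) (use e1 e2 in \<open>simp add: bounded_Un\<close>)
    then show ?thesis using e1 e2 by (intro exI[of _ "min e1 e2"]) auto
  qed
  then obtain e where e: "\<And>t. t \<in> {0..T} \<Longrightarrow> e t > 0 \<and> bounded (\<phi> ` ({0..T} \<inter> ball t (e t)))"
    by metis
  obtain C where C: "C \<subseteq> {0..T}" "finite C" "{0..T} \<subseteq> (\<Union>t\<in>C. ball t (e t))"
  proof (rule compactE_image[of "{0..T}" "{0..T}" "\<lambda>t. ball t (e t)"])
    show "{0..T} \<subseteq> (\<Union>t\<in>{0..T}. ball t (e t))" using e by force
  qed auto
  have "bounded (\<Union>t\<in>C. \<phi> ` ({0..T} \<inter> ball t (e t)))"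
    using C e by (intro bounded_UN) auto
  moreover have "\<phi> ` {0..T} \<subseteq> (\<Union>t\<in>C. \<phi> ` ({0..T} \<inter> ball t (e t)))"
    using C(3) by blast
  ultimately show ?thesis by (rule bounded_subset)
qed

lemma skorohod_dist_finite:
  assumes "\<phi> \<in> skorohod_space T S" "\<psi> \<in> skorohod_space T S"
  shows "(INF l\<in>time_changes T. SUP t\<in>{0..T}.
     max (ennreal \<bar>l t - t\<bar>) (ennreal (dist (\<phi> t) (\<psi> (l t))))) < \<infinity>"
proof -
  have "bounded (\<phi> ` {0..T} \<union> \<psi> ` {0..T})"
    using skorohod_bounded[OF assms(1)] skorohod_bounded[OF assms(2)] by simp
  then obtain c where c: "\<And>u v. u \<in> \<phi> ` {0..T} \<union> \<psi> ` {0..T} \<Longrightarrow> v \<in> \<phi> ` {0..T} \<union> \<psi> ` {0..T} \<Longrightarrow> dist u v \<le> c"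
    unfolding bounded_two_points by blast
  have "(SUP t\<in>{0..T}. max (ennreal \<bar>t - t\<bar>) (ennreal (dist (\<phi> t) (\<psi> t)))) \<le> ennreal c"
    by (intro SUP_least) (auto intro!: ennreal_leI c)
  also have "\<dots> < \<infinity>" by simp
  finally show ?thesis
    by (intro le_less_trans[OF INF_lower[OF id_time_change]])
qed

lemma skorohod_dist_less:
  assumes "\<phi> \<in> skorohod_space T S" "\<psi> \<in> skorohod_space T S" "skorohod_dist T \<phi> \<psi> < e"
  obtains l where "l \<in> time_changes T"
    "\<And>t. t \<in> {0..T} \<Longrightarrow> \<bar>l t - t\<bar> < e \<and> dist (\<phi> t) (\<psi> (l t)) < e"
proof -
  let ?G = "\<lambda>l. SUP t\<in>{0..T}. max (ennreal \<bar>l t - t\<bar>) (ennreal (dist (\<phi> t) (\<psi> (l t))))"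
  have "e > 0" using assms(3) enn2real_nonneg le_less_trans unfolding skorohod_dist_def by blast
  have "(INF l\<in>time_changes T. ?G l) = ennreal (skorohod_dist T \<phi> \<psi>)"
    using skorohod_dist_finite[OF assms(1,2)] by (simp add: skorohod_dist_def)
  also have "\<dots> < ennreal e"
    using assms(3) \<open>e > 0\<close> by (rule ennreal_lessI[rotated])
  finally obtain l where l: "l \<in> time_changes T" "?G l < ennreal e"
    unfolding INF_less_iff by blast
  have "\<bar>l t - t\<bar> < e \<and> dist (\<phi> t) (\<psi> (l t)) < e" if t: "t \<in> {0..T}" for t
  proof -
    have "max (ennreal \<bar>l t - t\<bar>) (ennreal (dist (\<phi> t) (\<psi> (l t)))) \<le> ?G l"
      using t by (rule SUP_upper)
    with l(2) have "max (ennreal \<bar>l t - t\<bar>) (ennreal (dist (\<phi> t) (\<psi> (l t)))) < ennreal e"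
      by (rule le_less_trans[rotated])
    then show ?thesis by (simp add: ennreal_less_iff)
  qed
  with l(1) show ?thesis by (rule that)
qed

lemma skorohod_dist_le:
  assumes "l \<in> time_changes T" "0 \<le> e"
    "\<And>t. t \<in> {0..T} \<Longrightarrow> \<bar>l t - t\<bar> \<le> e \<and> dist (\<phi> t) (\<psi> (l t)) \<le> e"
  shows "skorohod_dist T \<phi> \<psi> \<le> e"
proof -
  have "(INF l\<in>time_changes T. SUP t\<in>{0..T}.
     max (ennreal \<bar>l t - t\<bar>) (ennreal (dist (\<phi> t) (\<psi> (l t))))) \<le> ennreal e"
    using assms(3) by (intro INF_lower2[OF assms(1)] SUP_least) (auto intro!: ennreal_leI)
  then show ?thesis
    unfolding skorohod_dist_def using enn2real_leI[OF assms(2)] by blast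
qed

lemma skorohod_dist_commute_le:
  "(INF l\<in>time_changes T. SUP t\<in>{0..T}. max (ennreal \<bar>l t - t\<bar>) (ennreal (dist (\<phi> t) (\<psi> (l t)))))
   \<le> (INF l\<in>time_changes T. SUP t\<in>{0..T}. max (ennreal \<bar>l t - t\<bar>) (ennreal (dist (\<psi> t) (\<phi> (l t)))))"
proof (rule INF_greatest)
  fix l assume l: "l \<in> time_changes T"
  then have b: "bij_betw l {0..T} {0..T}" by (simp add: time_changes_def)
  let ?k = "inv_into {0..T} l"
  have "(SUP t\<in>{0..T}. max (ennreal \<bar>?k t - t\<bar>) (ennreal (dist (\<phi> t) (\<psi> (?k t)))))
    \<le> (SUP t\<in>{0..T}. max (ennreal \<bar>l t - t\<bar>) (ennreal (dist (\<psi> t) (\<phi> (l t)))))"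
  proof (rule SUP_least)
    fix t assume t: "t \<in> {0..T}"
    have k: "?k t \<in> {0..T}" using bij_betw_inv_into[OF b] t by (auto dest: bij_betwE)
    have lk: "l (?k t) = t" using b t by (rule bij_betw_inv_into_right)
    show "max (ennreal \<bar>?k t - t\<bar>) (ennreal (dist (\<phi> t) (\<psi> (?k t))))
      \<le> (SUP t\<in>{0..T}. max (ennreal \<bar>l t - t\<bar>) (ennreal (dist (\<psi> t) (\<phi> (l t)))))"
      by (rule SUP_upper2[OF k]) (simp add: lk dist_commute abs_minus_commute)
  qed
  then show "(INF l\<in>time_changes T. SUP t\<in>{0..T}. max (ennreal \<bar>l t - t\<bar>) (ennreal (dist (\<phi> t) (\<psi> (l t)))))
    \<le> (SUP t\<in>{0..T}. max (ennreal \<bar>l t - t\<bar>) (ennreal (dist (\<psi> t) (\<phi> (l t)))))"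
    by (rule INF_lower2[OF time_change_inv[OF l]])
qed

lemma skorohod_dist_zero_imp_eq:
  assumes \<phi>: "\<phi> \<in> skorohod_space T S" and \<psi>: "\<psi> \<in> skorohod_space T S"
    and d0: "skorohod_dist T \<phi> \<psi> = 0"
  shows "\<phi> = \<psi>"
proof
  fix t
  consider "t \<notin> {0..T}" | "t = T" "t \<in> {0..T}" | "0 \<le> t" "t < T" by force
  then show "\<phi> t = \<psi> t"
  proof cases
    case 1
    then show ?thesis
      using \<phi> \<psi> by (auto simp: skorohod_space_def PiE_def extensional_def)
  next
    case 2
    have "dist (\<phi> t) (\<psi> t) \<le> 0"
    proof (rule field_le_epsilon)
      fix e :: real assume e: "e > 0"
      obtain l where l: "l \<in> time_changes T" "\<And>t. t \<in> {0..T} \<Longrightarrow> \<bar>l t - t\<bar> < e \<and> dist (\<phi> t) (\<psi> (l t)) < e"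
        using skorohod_dist_less[OF \<phi> \<psi>, of e] d0 e by metis
      have b: "bij_betw l {0..T} {0..T}" and sm: "strict_mono_on {0..T} l"
        using l(1) by (auto simp: time_changes_def)
      obtain s where s: "s \<in> {0..T}" "l s = T"
        using b 2 by (metis bij_betw_iff_bijections)
      have "s \<le> T" using s by simp
      then have "l s \<le> l T" using sm s 2 by (meson strict_mono_on_leD)
      moreover have "l T \<in> {0..T}" using b 2 by (metis bij_betwE)
      ultimately have "l T = T" using s by simp
      then show "dist (\<phi> t) (\<psi> t) \<le> 0 + e" using l(2)[of T] 2 by auto
    qed
    then show ?thesis by simp
  next
    case 3
    have "dist (\<phi> t) (\<psi> t) \<le> 0"
    proof (rule field_le_epsilon)
      fix e :: real assume e: "e > 0"
      have "(\<phi> \<longlongrightarrow> \<phi> t) (at_right t)" "(\<psi> \<longlongrightarrow> \<psi> t) (at_right t)"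
        using \<phi> \<psi> 3 by (auto simp: skorohod_space_def)
      then have "eventually (\<lambda>s. dist (\<phi> s) (\<phi> t) < e/3) (at_right t)"
        "eventually (\<lambda>s. dist (\<psi> s) (\<psi> t) < e/3) (at_right t)"
        using e tendstoD[where e = "e/3"] by simp_all
      then have "eventually (\<lambda>s. dist (\<phi> s) (\<phi> t) < e/3 \<and> dist (\<psi> s) (\<psi> t) < e/3) (at_right t)"
        by (rule eventually_conj)
      then obtain b where b: "b > t"
        "\<And>s. t < s \<Longrightarrow> s < b \<Longrightarrow> dist (\<phi> s) (\<phi> t) < e/3 \<and> dist (\<psi> s) (\<psi> t) < e/3"
        by (auto simp: eventually_at_right_field)
      define h where "h = (min b T - t) / 2"
      have "2 * h = min b T - t" by (simp add: h_def)
      then have h: "h > 0" "t + 2 * h \<le> b" "t + 2 * h \<le> T" using b(1) 3 by auto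
      obtain l where l: "\<And>t. t \<in> {0..T} \<Longrightarrow> \<bar>l t - t\<bar> < min h (e/3) \<and> dist (\<phi> t) (\<psi> (l t)) < min h (e/3)"
        using skorohod_dist_less[OF \<phi> \<psi>, of "min h (e/3)"] d0 e h(1)
        by (metis min_less_iff_conj divide_pos_pos zero_less_numeral)
      have s: "t + h \<in> {0..T}" using h 3 by auto
      have ls: "t < l (t + h)" "l (t + h) < b" using l[OF s] h by auto
      have "dist (\<phi> t) (\<psi> t) \<le> dist (\<phi> t) (\<phi> (t+h)) + dist (\<phi> (t+h)) (\<psi> t)"
        by (rule dist_triangle)
      also have "dist (\<phi> (t+h)) (\<psi> t) \<le> dist (\<phi> (t+h)) (\<psi> (l (t+h))) + dist (\<psi> (l (t+h))) (\<psi> t)"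
        by (rule dist_triangle)
      finally show "dist (\<phi> t) (\<psi> t) \<le> 0 + e"
        using b(2)[of "t+h"] b(2)[OF ls] l[OF s] h by (simp add: dist_commute)
    qed
    then show ?thesis by simp
  qed
qed

lemma Metric_space_skorohod: "Metric_space (skorohod_space T S) (skorohod_dist T)"
proof
  fix \<phi> \<psi> :: "real \<Rightarrow> 'a"
  show "0 \<le> skorohod_dist T \<phi> \<psi>" by (simp add: skorohod_dist_def)
  show "skorohod_dist T \<phi> \<psi> = skorohod_dist T \<psi> \<phi>"
    unfolding skorohod_dist_def
    by (rule arg_cong[where f = enn2real], rule antisym) (rule skorohod_dist_commute_le)+
next
  fix \<phi> \<psi> :: "real \<Rightarrow> 'a"
  assume A: "\<phi> \<in> skorohod_space T S" "\<psi> \<in> skorohod_space T S"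
  have "skorohod_dist T \<phi> \<phi> \<le> 0"
    by (rule skorohod_dist_le[OF id_time_change]) auto
  then have "skorohod_dist T \<phi> \<phi> = 0"
    unfolding skorohod_dist_def using enn2real_nonneg by (rule antisym)
  then show "skorohod_dist T \<phi> \<psi> = 0 \<longleftrightarrow> \<phi> = \<psi>"
    using skorohod_dist_zero_imp_eq[OF A] by auto
next
  fix \<phi> \<psi> \<xi> :: "real \<Rightarrow> 'a"
  assume A: "\<phi> \<in> skorohod_space T S" "\<psi> \<in> skorohod_space T S" "\<xi> \<in> skorohod_space T S"
  show "skorohod_dist T \<phi> \<xi> \<le> skorohod_dist T \<phi> \<psi> + skorohod_dist T \<psi> \<xi>"
  proof (rule field_le_epsilon)
    fix e :: real assume e: "e > 0"
    let ?a = "skorohod_dist T \<phi> \<psi> + e/2" and ?b = "skorohod_dist T \<psi> \<xi> + e/2"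
    obtain l where l: "l \<in> time_changes T" "\<And>t. t \<in> {0..T} \<Longrightarrow> \<bar>l t - t\<bar> < ?a \<and> dist (\<phi> t) (\<psi> (l t)) < ?a"
      using skorohod_dist_less[OF A(1,2), of ?a] e by (metis half_gt_zero less_add_same_cancel1)
    obtain k where k: "k \<in> time_changes T" "\<And>t. t \<in> {0..T} \<Longrightarrow> \<bar>k t - t\<bar> < ?b \<and> dist (\<psi> t) (\<xi> (k t)) < ?b"
      using skorohod_dist_less[OF A(2,3), of ?b] e by (metis half_gt_zero less_add_same_cancel1)
    have "skorohod_dist T \<phi> \<xi> \<le> ?a + ?b"
    proof (rule skorohod_dist_le[OF time_change_comp[OF l(1) k(1)]])
      show "0 \<le> ?a + ?b" using e by (simp add: skorohod_dist_def)
      fix t assume t: "t \<in> {0..T}"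
      have lt: "l t \<in> {0..T}" using l(1) t by (auto simp: time_changes_def dest: bij_betwE)
      have "dist (\<phi> t) (\<xi> (k (l t))) \<le> dist (\<phi> t) (\<psi> (l t)) + dist (\<psi> (l t)) (\<xi> (k (l t)))"
        by (rule dist_triangle)
      then show "\<bar>(k \<circ> l) t - t\<bar> \<le> ?a + ?b \<and> dist (\<phi> t) (\<xi> ((k \<circ> l) t)) \<le> ?a + ?b"
        using l(2)[OF t] k(2)[OF lt] by (auto simp: o_def)
    qed
    then show "skorohod_dist T \<phi> \<xi> \<le> skorohod_dist T \<phi> \<psi> + skorohod_dist T \<psi> \<xi> + e" by simp
  qed
qed

lemma mspace_skorohod_metric [simp]: "mspace (skorohod_metric T S) = skorohod_space T S"
  and mdist_skorohod_metric [simp]: "mdist (skorohod_metric T S) = skorohod_dist T"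
  unfolding skorohod_metric_def
  by (simp_all add: Metric_space.mspace_metric Metric_space.mdist_metric Metric_space_skorohod)
text \<open>The set \<open>\<E>\<close> of all limits of \<open>x\<^sub>a/a\<close> as \<open>a \<rightarrow> \<infinity>\<close> through the reals.\<close>

definition scaling_limits :: "'a::euclidean_space set \<Rightarrow> 'a set" where
  "scaling_limits E = {z. \<exists>x::real \<Rightarrow> 'a. (\<forall>a. x a \<in> E) \<and> ((\<lambda>a. x a /\<^sub>R a) \<longlongrightarrow> z) at_top}"

definition rescaled_path ::
  "(real \<Rightarrow> 'w \<Rightarrow> 'a::euclidean_space) \<Rightarrow> real \<Rightarrow> real \<Rightarrow> 'w \<Rightarrow> real \<Rightarrow> 'a" where
  "rescaled_path X T a \<omega> = restrict (\<lambda>t. X (a * t) \<omega> /\<^sub>R a) {0..T}"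

definition rescaled_log_prob ::
  "('a::euclidean_space \<Rightarrow> 'w measure) \<Rightarrow> (real \<Rightarrow> 'w \<Rightarrow> 'a) \<Rightarrow> real \<Rightarrow> (real \<Rightarrow> 'a) set \<Rightarrow> real \<Rightarrow> 'a \<Rightarrow> ereal" where
  "rescaled_log_prob P X T U a z = ereal (1 / a) *
     elog (emeasure (P (a *\<^sub>R z)) {\<omega> \<in> space (P (a *\<^sub>R z)). rescaled_path X T a \<omega> \<in> U})"

definition good_rate_function ::
  "'a::euclidean_space set \<Rightarrow> real \<Rightarrow> ((real \<Rightarrow> 'a) \<Rightarrow> ennreal) \<Rightarrow> bool" where
  "good_rate_function S T J \<longleftrightarrow>
     (\<forall>c V. 0 < c \<and> compact V \<and> V \<subseteq> S \<longrightarrow>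
        compactin (mtopology_of (skorohod_metric T S))
          {\<phi> \<in> skorohod_space T S. \<phi> 0 \<in> V \<and> J \<phi> \<le> ennreal c})"

text \<open>Both limits in \<open>\<epsilon>\<close> exist, by monotonicity.\<close>

definition sample_path_ldp ::
  "'a::euclidean_space set \<Rightarrow> ('a \<Rightarrow> 'w measure) \<Rightarrow> (real \<Rightarrow> 'w \<Rightarrow> 'a) \<Rightarrow> real \<Rightarrow>
    ((real \<Rightarrow> 'a) \<Rightarrow> ennreal) \<Rightarrow> bool" where
  "sample_path_ldp E P X T J \<longleftrightarrow>
     (\<forall>x\<in>scaling_limits E.
        (\<forall>U. openin (mtopology_of (skorohod_metric T (scaling_limits E))) U \<longrightarrow>
           Lim (at_right 0) (\<lambda>\<epsilon>::real. Liminf at_top (\<lambda>a::real.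
             INF z\<in>{z. a *\<^sub>R z \<in> E \<and> norm (z - x) < \<epsilon>}. rescaled_log_prob P X T U a z))
           \<ge> - (INF \<phi>\<in>{\<phi> \<in> U. \<phi> 0 = x}. enn2ereal (J \<phi>))) \<and>
        (\<forall>C. closedin (mtopology_of (skorohod_metric T (scaling_limits E))) C \<longrightarrow>
           Lim (at_right 0) (\<lambda>\<epsilon>::real. Limsup at_top (\<lambda>a::real.
             SUP z\<in>{z. a *\<^sub>R z \<in> E \<and> norm (z - x) < \<epsilon>}. rescaled_log_prob P X T C a z))
           \<le> - (INF \<phi>\<in>{\<phi> \<in> C. \<phi> 0 = x}. enn2ereal (J \<phi>))))"

definition abs_continuous_path :: "real \<Rightarrow> (real \<Rightarrow> 'a::real_normed_vector) \<Rightarrow> bool" where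
  "abs_continuous_path T \<phi> \<longleftrightarrow>
     (\<forall>\<epsilon>>0. \<exists>\<delta>>0. \<forall>(n::nat) a b.
        (\<forall>i<n. 0 \<le> a i \<and> a i \<le> b i \<and> b i \<le> T) \<and>
        disjoint_family_on (\<lambda>i. {a i<..<b i}) {..<n} \<and> (\<Sum>i<n. b i - a i) < \<delta> \<longrightarrow>
        (\<Sum>i<n. norm (\<phi> (b i) - \<phi> (a i))) < \<epsilon>)"

text \<open>The integrand of the action. Off the null set where \<open>\<phi>\<close> is not differentiable its value is
  arbitrary, which is why the Lebesgue (complete) measure is used.\<close>

definition lagrangian_along :: "('a \<Rightarrow> 'a \<Rightarrow> real) \<Rightarrow> real \<Rightarrow> (real \<Rightarrow> 'a::real_normed_vector) \<Rightarrow> real \<Rightarrow> real" where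
  "lagrangian_along L T \<phi> t = L (\<phi> t) (vector_derivative \<phi> (at t within {0..T}))"

text \<open>Measurability of the integrand is part of the requirement that the rate function is given by
  the integral.\<close>

definition rate_has_lagrangian ::
  "'a::euclidean_space set \<Rightarrow> (real \<Rightarrow> (real \<Rightarrow> 'a) \<Rightarrow> ennreal) \<Rightarrow> ('a \<Rightarrow> 'a \<Rightarrow> real) \<Rightarrow> bool" where
  "rate_has_lagrangian S I L \<longleftrightarrow>
     (\<forall>x\<in>S. \<forall>v. 0 \<le> L x v) \<and>
     (\<forall>T>0. \<forall>\<phi>\<in>skorohod_space T S.
        (abs_continuous_path T \<phi> \<longrightarrow>
           lagrangian_along L T \<phi> \<in> borel_measurable (lebesgue_on {0..T}) \<and>
           I T \<phi> = (\<integral>\<^sup>+t. ennreal (lagrangian_along L T \<phi> t) \<partial>lebesgue_on {0..T})) \<and>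
        (\<not> abs_continuous_path T \<phi> \<longrightarrow> I T \<phi> = \<infinity>))"

definition ereal_convex :: "('a::real_vector \<Rightarrow> ereal) \<Rightarrow> bool" where
  "ereal_convex f \<longleftrightarrow> (\<forall>x y u. 0 < u \<and> u < 1 \<longrightarrow>
     f (u *\<^sub>R x + (1 - u) *\<^sub>R y) \<le> ereal u * f x + ereal (1 - u) * f y)"

definition lagrangian_bounds :: "'a::euclidean_space set \<Rightarrow> ('a \<Rightarrow> 'a \<Rightarrow> real) \<Rightarrow> bool" where
  "lagrangian_bounds S L \<longleftrightarrow>
     (\<exists>(l1 :: 'a \<Rightarrow> real) (l2 :: 'a \<Rightarrow> ereal).
        convex_on UNIV l1 \<and> ereal_convex l2 \<and>
        (\<forall>x\<in>S. \<forall>v. 0 \<le> l1 v \<and> l1 v \<le> L x v \<and> ereal (L x v) \<le> l2 v) \<and>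
        (\<exists>\<delta>>0. \<forall>v\<in>ball 0 \<delta>. l2 v < \<infinity>) \<and>
        Lim sequentially (\<lambda>n. INF v\<in>{v. real n \<le> norm v}. ereal (l1 v / norm v)) > 0)"

definition assumption_A ::
  "'a::euclidean_space set \<Rightarrow> ('a \<Rightarrow> 'w measure) \<Rightarrow> (real \<Rightarrow> 'w \<Rightarrow> 'a) \<Rightarrow>
    (real \<Rightarrow> (real \<Rightarrow> 'a) \<Rightarrow> ennreal) \<Rightarrow> bool" where
  "assumption_A E P X I \<longleftrightarrow>
     E \<subseteq> scaling_limits E \<and> scaling_limits E \<noteq> {0} \<and> convex (scaling_limits E - {0}) \<and>
     (\<forall>T>0. good_rate_function (scaling_limits E) T (I T) \<and> sample_path_ldp E P X T (I T)) \<and>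
     (\<exists>L. rate_has_lagrangian (scaling_limits E) I L \<and> lagrangian_bounds (scaling_limits E) L)"

definition continuous_paths :: "real \<Rightarrow> 'a::metric_space set \<Rightarrow> (real \<Rightarrow> 'a) set" where
  "continuous_paths t S = {\<phi> \<in> {0..t} \<rightarrow>\<^sub>E S. continuous_on {0..t} \<phi>}"

definition I_hat ::
  "'a::euclidean_space set \<Rightarrow> (real \<Rightarrow> (real \<Rightarrow> 'a) \<Rightarrow> ennreal) \<Rightarrow> real \<Rightarrow> 'a \<Rightarrow> 'a \<Rightarrow> ereal" where
  "I_hat S I t x y = (INF \<phi>\<in>{\<phi> \<in> continuous_paths t S. \<phi> 0 = x \<and> \<phi> t = y \<and>
     {s \<in> {0..t}. \<phi> s = 0} \<in> null_sets lborel}. enn2ereal (I t \<phi>))"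

definition I_zero ::
  "'a::euclidean_space set \<Rightarrow> (real \<Rightarrow> (real \<Rightarrow> 'a) \<Rightarrow> ennreal) \<Rightarrow> real \<Rightarrow> 'a \<Rightarrow> 'a \<Rightarrow> ereal" where
  "I_zero S I t x y = (INF \<phi>\<in>{\<phi> \<in> continuous_paths t S. \<phi> 0 = x \<and> \<phi> t = y \<and>
     (\<forall>s. 0 < s \<and> s < t \<longrightarrow> \<phi> s \<noteq> 0)}. enn2ereal (I t \<phi>))"

definition I_star :: "'a::euclidean_space set \<Rightarrow> (real \<Rightarrow> (real \<Rightarrow> 'a) \<Rightarrow> ennreal) \<Rightarrow> ereal" where
  "I_star S I = I_hat S I 1 0 0"

end

theory Submission
  imports Defs
begin

text \<open>
  Let \<open>lam\<close> be the infimum of the action over loops of duration \<open>1\<close> that avoid the origin. Uniqueness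
  of the rate function, applied at two scales, shows that the action is invariant under
  \<open>\<phi> \<mapsto> c \<phi>(\<cdot> / c)\<close> up to the factor \<open>c\<close>; hence a loop of duration \<open>T\<close> costs at least \<open>lam T\<close>.
  Splitting a path with a null zero set into its excursions and closing them up, one gets
  \<open>lam t - O(1)\<close> as a lower bound for the action of such a path, and repeating a near-optimal loop
  gives a matching upper bound. This identifies all the variational expressions with \<open>lam\<close>.

  For the spectral radius, let \<open>V z\<close> be the least value of action minus \<open>lam\<close> times the duration over
  the paths from \<open>z\<close> that avoid the origin, plus a multiple of the norm of the end point. It is
  Lipschitz and positively homogeneous, and by the Laplace principle \<open>exp (- V)\<close> is multiplied by
  at most \<open>exp (- \<kappa> t)\<close>, for any \<open>\<kappa> < lam\<close>, when the process starts far from the origin and runs for a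
  time \<open>t\<close> proportional to its distance from it. So survival outside a large ball decays at rate \<open>\<kappa>\<close>.
  Conversely, following a near-optimal loop again and again at one fixed large scale keeps the
  process away from any given compact set with a probability that decays no faster than
  \<open>exp (- \<mu> t)\<close>, where \<open>\<mu> > lam\<close> is arbitrary.
\<close>

section \<open>Skorohod space\<close>

text \<open>The large deviation bounds hold at one scale at a time, on a bounded time interval and
  for starts in a compact set, whereas the spectral radius involves arbitrarily long times. For the
  upper bound the process is therefore restarted again and again, at a scale that follows its
  position. Two obstacles shape this step. \<open>V\<close> only controls paths that avoid the
  origin, since time spent there may cost less than \<open>lam\<close>; hence a step is kept so
  short, \<open>d\<close> relative to the scale, that getting to the origin costs more than
  \<open>V\<close> can change. Moreover \<open>exp (- V)\<close> may grow exponentially at infinity,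
  so large displacements are estimated separately; the same short step makes them improbable enough.
  Straight connections do most of the work on paths: \<open>L\<close> is at most \<open>C0\<close>
  at speeds up to \<open>d0\<close>, because \<open>l2\<close> is convex and finite near zero, and
  convexity of \<open>S - {0}\<close> keeps the connections off the origin. The Markov assumption
  speaks of a single later time; events about whole stretches of a path are reached through finite
  time grids and right continuity.\<close>

lemma time_change_mem: "l \<in> time_changes T \<Longrightarrow> t \<in> {0..T} \<Longrightarrow> l t \<in> {0..T}"
  by (auto simp: time_changes_def dest: bij_betwE)

lemma time_change_surj: "l \<in> time_changes T \<Longrightarrow> t \<in> {0..T} \<Longrightarrow> \<exists>s\<in>{0..T}. l s = t"
  unfolding time_changes_def by (metis (no_types, lifting) bij_betw_iff_bijections mem_Collect_eq)

lemma time_change_mono: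
  "l \<in> time_changes T \<Longrightarrow> s \<in> {0..T} \<Longrightarrow> t \<in> {0..T} \<Longrightarrow> s \<le> t \<Longrightarrow> l s \<le> l t"
  unfolding time_changes_def by (auto intro: strict_mono_on_leD)

lemma time_change_0: assumes "l \<in> time_changes T" "0 \<le> T" shows "l 0 = 0"
proof -
  obtain s where "s \<in> {0..T}" "l s = 0"
    using time_change_surj[OF assms(1), of 0] assms(2) by auto
  then show ?thesis
    using time_change_mono[OF assms(1), of 0 s] time_change_mem[OF assms(1), of 0] assms(2) by auto
qed

lemma time_change_T: assumes "l \<in> time_changes T" "0 \<le> T" shows "l T = T"
proof -
  obtain s where "s \<in> {0..T}" "l s = T"
    using time_change_surj[OF assms(1), of T] assms(2) by auto
  then show ?thesis
    using time_change_mono[OF assms(1), of s T] time_change_mem[OF assms(1), of T] assms(2) by auto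
qed

lemma skorohod_dist_le_sup:
  assumes "0 \<le> e" "\<And>t. t \<in> {0..T} \<Longrightarrow> dist (\<phi> t) (\<psi> t) \<le> e"
  shows "skorohod_dist T \<phi> \<psi> \<le> e"
  using assms by (intro skorohod_dist_le[OF id_time_change]) auto

lemma continuous_in_skorohod:
  assumes "continuous_on {0..T} \<phi>" "\<phi> ` {0..T} \<subseteq> S"
  shows "restrict \<phi> {0..T} \<in> skorohod_space T S"
proof -
  have *: "(restrict \<phi> {0..T} \<longlongrightarrow> \<phi> t) (at t within A)" if t: "t \<in> {0..T}"
    and A: "\<forall>\<^sub>F s in at t within A. s \<in> {0..T}" for t A
  proof -
    have "(\<phi> \<longlongrightarrow> \<phi> t) (at t within {0..T})"
      using assms(1) t by (auto simp: continuous_on_def)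
    \<comment> \<open>A one-sided neighbourhood that eventually stays in \<open>[0, T]\<close>
      refines the filter in which continuity on \<open>[0, T]\<close> is expressed.\<close>
    moreover have "at t within A \<le> at t within {0..T}"
      unfolding le_filter_def
    proof (intro allI impI)
      fix Q assume "eventually Q (at t within {0..T})"
      then have "\<forall>\<^sub>F s in nhds t. s \<noteq> t \<longrightarrow> s \<in> {0..T} \<longrightarrow> Q s"
        by (simp only: eventually_at_filter)
      moreover have "\<forall>\<^sub>F s in nhds t. s \<noteq> t \<longrightarrow> s \<in> A \<longrightarrow> s \<in> {0..T}"
        using A by (simp only: eventually_at_filter)
      ultimately show "eventually Q (at t within A)"
        unfolding eventually_at_filter by eventually_elim blast
    qed
    ultimately have "(\<phi> \<longlongrightarrow> \<phi> t) (at t within A)"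
      by (rule tendsto_mono[rotated])
    moreover have "\<forall>\<^sub>F s in at t within A. \<phi> s = restrict \<phi> {0..T} s"
      using A by eventually_elim auto
    ultimately show ?thesis by (rule Lim_transform_eventually)
  qed
  have "(restrict \<phi> {0..T} \<longlongrightarrow> \<phi> t) (at_right t)" if "t \<in> {0..<T}" for t
    using that by (intro *) (auto simp: eventually_at_right_field intro!: exI[of _ T])
  moreover have "(restrict \<phi> {0..T} \<longlongrightarrow> \<phi> t) (at_left t)" if "t \<in> {0<..T}" for t
    using that by (intro *) (auto simp: eventually_at_left_field intro!: exI[of _ 0])
  ultimately show ?thesis
    using assms(2) unfolding skorohod_space_def
    by (intro CollectI conjI ballI) (auto simp: image_subset_iff intro!: bexI)
qed

lemma topspace_skorohod [simp]:
  "topspace (mtopology_of (skorohod_metric T S)) = skorohod_space T S"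
  by simp

lemma in_mball_of_skorohod:
  "\<psi> \<in> mball_of (skorohod_metric T S) \<phi> e \<longleftrightarrow>
    \<phi> \<in> skorohod_space T S \<and> \<psi> \<in> skorohod_space T S \<and> skorohod_dist T \<phi> \<psi> < e"
  by (simp add: in_mball_of)

lemma openin_skorohod:
  "openin (mtopology_of (skorohod_metric T S)) U \<longleftrightarrow>
    U \<subseteq> skorohod_space T S \<and>
    (\<forall>\<phi>\<in>U. \<exists>e>0. \<forall>\<psi>\<in>skorohod_space T S. skorohod_dist T \<phi> \<psi> < e \<longrightarrow> \<psi> \<in> U)"
proof -
  interpret M: Metric_space "skorohod_space T S" "skorohod_dist T"
    by (rule Metric_space_skorohod)
  show ?thesis
    unfolding mtopology_of_def mspace_skorohod_metric mdist_skorohod_metric M.openin_mtopology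
    by (rule conj_cong[OF refl], rule iffI) (force simp: M.mball_def)+
qed

lemma openin_skorohod_ball:
  "openin (mtopology_of (skorohod_metric T S)) (mball_of (skorohod_metric T S) \<phi> e)"
  by (simp add: Metric_space.openin_mball[OF Metric_space_skorohod] mball_of_def mtopology_of_def)

lemma closedin_skorohodI:
  assumes "C \<subseteq> skorohod_space T S"
    "\<And>\<phi>. \<phi> \<in> skorohod_space T S \<Longrightarrow> \<phi> \<notin> C \<Longrightarrow>
      \<exists>e>0. \<forall>\<psi>\<in>skorohod_space T S. skorohod_dist T \<phi> \<psi> < e \<longrightarrow> \<psi> \<notin> C"
  shows "closedin (mtopology_of (skorohod_metric T S)) C"
  using assms by (auto simp: closedin_def openin_skorohod)

text \<open>Uniform continuity of \<open>\<phi>\<close> absorbs the time change, so near a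
  continuous path Skorohod closeness is uniform closeness. This converts the open balls of the lower
  large deviation bound into tubes.\<close>

lemma skorohod_near_continuous:
  fixes \<phi> :: "real \<Rightarrow> 'a::metric_space"
  assumes "\<phi> \<in> skorohod_space T S" "continuous_on {0..T} \<phi>" "0 < r"
  shows "\<exists>e>0. \<forall>\<psi>\<in>skorohod_space T S. skorohod_dist T \<phi> \<psi> < e \<longrightarrow> (\<forall>t\<in>{0..T}. dist (\<psi> t) (\<phi> t) < r)"
proof -
  have "uniformly_continuous_on {0..T} \<phi>"
    using assms(2) compact_uniformly_continuous by blast
  then obtain d where d: "d > 0" "\<And>s t. s \<in> {0..T} \<Longrightarrow> t \<in> {0..T} \<Longrightarrow> dist s t < d \<Longrightarrow> dist (\<phi> s) (\<phi> t) < r/2"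
    unfolding uniformly_continuous_on_def using assms(3) by (metis half_gt_zero)
  show ?thesis
  proof (intro exI[of _ "min d (r/2)"] conjI ballI impI)
    fix \<psi> s assume \<psi>: "\<psi> \<in> skorohod_space T S" "skorohod_dist T \<phi> \<psi> < min d (r/2)" and s: "s \<in> {0..T}"
    obtain l where l: "l \<in> time_changes T"
      "\<And>t. t \<in> {0..T} \<Longrightarrow> \<bar>l t - t\<bar> < min d (r/2) \<and> dist (\<phi> t) (\<psi> (l t)) < min d (r/2)"
      using skorohod_dist_less[OF assms(1) \<psi>] by blast
    obtain t where t: "t \<in> {0..T}" "l t = s" using time_change_surj[OF l(1) s] by blast
    have "dist (\<phi> t) (\<phi> s) < r/2" using d(2)[OF t(1) s] l(2)[OF t(1)] t by (auto simp: dist_real_def)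
    moreover have "dist (\<phi> t) (\<psi> s) < r/2" using l(2)[OF t(1)] t by auto
    moreover have "dist (\<psi> s) (\<phi> s) \<le> dist (\<phi> t) (\<psi> s) + dist (\<phi> t) (\<phi> s)"
      by (metis dist_commute dist_triangle)
    ultimately show "dist (\<psi> s) (\<phi> s) < r" by linarith
  qed (use d assms in auto)
qed

text \<open>A violation at time \<open>s\<close> is carried by the time change to
  \<open>l s\<close>, and continuity of the centre keeps it a violation there: half of the excess
  \<open>h\<close> pays for the path, half for the centre.\<close>

lemma closedin_tube:
  fixes \<phi> :: "real \<Rightarrow> 'a::metric_space"
  assumes "continuous_on {0..T} \<phi>"
  shows "closedin (mtopology_of (skorohod_metric T S))
    {\<psi> \<in> skorohod_space T S. \<forall>t\<in>{0..T}. dist (\<psi> t) (\<phi> t) \<le> r}"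
proof (rule closedin_skorohodI)
  fix \<psi> assume \<psi>: "\<psi> \<in> skorohod_space T S"
    "\<psi> \<notin> {\<psi> \<in> skorohod_space T S. \<forall>t\<in>{0..T}. dist (\<psi> t) (\<phi> t) \<le> r}"
  then obtain s where s: "s \<in> {0..T}" "dist (\<psi> s) (\<phi> s) > r" by force
  define h where "h = dist (\<psi> s) (\<phi> s) - r"
  have h: "h > 0" using s by (simp add: h_def)
  obtain d where d: "d > 0" "\<And>t. t \<in> {0..T} \<Longrightarrow> dist t s < d \<Longrightarrow> dist (\<phi> t) (\<phi> s) < h/2"
    using assms s(1) h unfolding continuous_on_iff by (metis half_gt_zero)
  show "\<exists>e>0. \<forall>\<xi>\<in>skorohod_space T S. skorohod_dist T \<psi> \<xi> < e \<longrightarrow>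
    \<xi> \<notin> {\<psi> \<in> skorohod_space T S. \<forall>t\<in>{0..T}. dist (\<psi> t) (\<phi> t) \<le> r}"
  proof (intro exI[of _ "min d (h/2)"] conjI ballI impI)
    fix \<xi> assume \<xi>: "\<xi> \<in> skorohod_space T S" "skorohod_dist T \<psi> \<xi> < min d (h/2)"
    obtain l where l: "l \<in> time_changes T"
      "\<And>t. t \<in> {0..T} \<Longrightarrow> \<bar>l t - t\<bar> < min d (h/2) \<and> dist (\<psi> t) (\<xi> (l t)) < min d (h/2)"
      using skorohod_dist_less[OF \<psi>(1) \<xi>] by blast
    have ls: "l s \<in> {0..T}" using time_change_mem[OF l(1) s(1)] .
    have 1: "dist (\<phi> (l s)) (\<phi> s) < h/2" using d(2)[OF ls] l(2)[OF s(1)] by (auto simp: dist_real_def)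
    have 2: "dist (\<psi> s) (\<xi> (l s)) < h/2" using l(2)[OF s(1)] by auto
    have "dist (\<psi> s) (\<phi> s) \<le> dist (\<psi> s) (\<xi> (l s)) + dist (\<xi> (l s)) (\<phi> (l s)) + dist (\<phi> (l s)) (\<phi> s)"
      using dist_triangle[of "\<psi> s" "\<phi> s" "\<xi> (l s)"] dist_triangle[of "\<xi> (l s)" "\<phi> s" "\<phi> (l s)"] by linarith
    then have "dist (\<xi> (l s)) (\<phi> (l s)) > r" using 1 2 by (simp add: h_def)
    then show "\<xi> \<notin> {\<psi> \<in> skorohod_space T S. \<forall>t\<in>{0..T}. dist (\<psi> t) (\<phi> t) \<le> r}"
      using ls by force
  qed (use d h in auto)
qed auto

text \<open>Time changes fix \<open>T\<close>, so evaluation at \<open>T\<close> is 1-Lipschitz for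
  the Skorohod distance; evaluation at an interior time would not even be continuous.\<close>

lemma closedin_endpoint:
  fixes w :: "'a::metric_space"
  assumes "0 \<le> T"
  shows "closedin (mtopology_of (skorohod_metric T S)) {\<psi> \<in> skorohod_space T S. dist (\<psi> T) w \<le> r}"
proof (rule closedin_skorohodI)
  fix \<psi> assume \<psi>: "\<psi> \<in> skorohod_space T S" "\<psi> \<notin> {\<psi> \<in> skorohod_space T S. dist (\<psi> T) w \<le> r}"
  show "\<exists>e>0. \<forall>\<xi>\<in>skorohod_space T S. skorohod_dist T \<psi> \<xi> < e \<longrightarrow>
    \<xi> \<notin> {\<psi> \<in> skorohod_space T S. dist (\<psi> T) w \<le> r}"
  proof (intro exI[of _ "dist (\<psi> T) w - r"] conjI ballI impI)
    fix \<xi> assume \<xi>: "\<xi> \<in> skorohod_space T S" "skorohod_dist T \<psi> \<xi> < dist (\<psi> T) w - r"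
    obtain l where l: "l \<in> time_changes T"
      "\<And>t. t \<in> {0..T} \<Longrightarrow> \<bar>l t - t\<bar> < dist (\<psi> T) w - r \<and> dist (\<psi> t) (\<xi> (l t)) < dist (\<psi> T) w - r"
      using skorohod_dist_less[OF \<psi>(1) \<xi>] by blast
    have "dist (\<psi> T) (\<xi> T) < dist (\<psi> T) w - r"
      using l(2)[of T] time_change_T[OF l(1) assms] assms by simp
    then show "\<xi> \<notin> {\<psi> \<in> skorohod_space T S. dist (\<psi> T) w \<le> r}"
      using dist_triangle[of "\<psi> T" w "\<xi> T"] by auto
  qed (use \<psi> in auto)
qed auto

text \<open>The paths with \<open>sup\<^sub>t dist (\<psi> t) (\<psi> 0) \<ge> r\<close>; the supremum need not be attained.\<close>

definition displaced :: "real \<Rightarrow> 'a::metric_space set \<Rightarrow> real \<Rightarrow> (real \<Rightarrow> 'a) set" where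
  "displaced T S r = {\<psi> \<in> skorohod_space T S. \<forall>c<r. \<exists>t\<in>{0..T}. c < dist (\<psi> t) (\<psi> 0)}"

text \<open>A time change fixes 0 and is onto, so the largest displacement from the start moves by
  at most twice the Skorohod distance; a distance below a third of the gap \<open>r - c\<close>
  keeps it below \<open>r\<close>.\<close>

lemma closedin_displaced:
  assumes "0 \<le> T"
  shows "closedin (mtopology_of (skorohod_metric T S)) (displaced T S r)"
proof (rule closedin_skorohodI)
  fix \<psi> assume \<psi>: "\<psi> \<in> skorohod_space T S" "\<psi> \<notin> displaced T S r"
  then have "\<exists>c<r. \<forall>t\<in>{0..T}. dist (\<psi> t) (\<psi> 0) \<le> c"
    unfolding displaced_def by (simp add: not_less)
  then obtain c where c: "c < r" "\<And>t. t \<in> {0..T} \<Longrightarrow> dist (\<psi> t) (\<psi> 0) \<le> c"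
    by blast
  show "\<exists>e>0. \<forall>\<xi>\<in>skorohod_space T S. skorohod_dist T \<psi> \<xi> < e \<longrightarrow> \<xi> \<notin> displaced T S r"
  proof (intro exI[of _ "(r-c)/3"] conjI ballI impI)
    fix \<xi> assume \<xi>: "\<xi> \<in> skorohod_space T S" "skorohod_dist T \<psi> \<xi> < (r-c)/3"
    obtain l where l: "l \<in> time_changes T"
      "\<And>t. t \<in> {0..T} \<Longrightarrow> \<bar>l t - t\<bar> < (r-c)/3 \<and> dist (\<psi> t) (\<xi> (l t)) < (r-c)/3"
      using skorohod_dist_less[OF \<psi>(1) \<xi>] by blast
    have 0: "dist (\<psi> 0) (\<xi> 0) < (r-c)/3" using l(2)[of 0] time_change_0[OF l(1) assms] assms by simp
    have "dist (\<xi> t) (\<xi> 0) \<le> c + 2 * ((r-c)/3)" if t: "t \<in> {0..T}" for t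
    proof -
      obtain s where s: "s \<in> {0..T}" "l s = t" using time_change_surj[OF l(1) t] by blast
      have "dist (\<xi> t) (\<xi> 0) \<le> dist (\<psi> s) (\<xi> t) + dist (\<psi> s) (\<psi> 0) + dist (\<psi> 0) (\<xi> 0)"
        using dist_triangle[of "\<xi> t" "\<xi> 0" "\<psi> s"] dist_triangle[of "\<psi> s" "\<xi> 0" "\<psi> 0"]
        by (simp add: dist_commute)
      moreover have "dist (\<psi> s) (\<xi> t) < (r-c)/3" using l(2)[OF s(1)] s(2) by blast
      ultimately show ?thesis using c(2)[OF s(1)] 0 by linarith
    qed
    moreover have "c + 2 * ((r-c)/3) < r" using c(1) by (simp add: field_simps)
    ultimately show "\<xi> \<notin> displaced T S r" unfolding displaced_def by (auto simp: not_less)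
  qed (use c in auto)
qed (auto simp: displaced_def)

text \<open>Right continuity at 0 gives a time for each single path; a finite subcover by Skorohod
  balls makes it uniform. Applied to the level sets of a good rate function, this limits how far
  cheap paths move in a short time.\<close>

lemma compactin_skorohod_equicontinuous_0:
  fixes K :: "(real \<Rightarrow> 'a::metric_space) set"
  assumes K: "compactin (mtopology_of (skorohod_metric T S)) K" and T: "0 < T" and e: "0 < e"
  shows "\<exists>d>0. d \<le> T \<and> (\<forall>\<phi>\<in>K. \<forall>t\<in>{0..d}. dist (\<phi> t) (\<phi> 0) < e)"
proof -
  have KS: "K \<subseteq> skorohod_space T S" using compactin_subset_topspace[OF K] by simp
  \<comment> \<open>The factor 2 leaves room for the time change, which may shift a time in
    \<open>[0, D \<phi>]\<close> by up to \<open>D \<phi>\<close>.\<close>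
  have "\<exists>d>0. 2 * d \<le> T \<and> (\<forall>t\<in>{0..2*d}. dist (\<phi> t) (\<phi> 0) < e/3)" if "\<phi> \<in> K" for \<phi>
  proof -
    have "(\<phi> \<longlongrightarrow> \<phi> 0) (at_right 0)"
      using that KS T by (auto simp: skorohod_space_def)
    then have "eventually (\<lambda>s. dist (\<phi> s) (\<phi> 0) < e/3) (at_right 0)"
      using e by (intro tendstoD) auto
    then obtain b where b: "b > 0" "\<And>s. 0 < s \<Longrightarrow> s < b \<Longrightarrow> dist (\<phi> s) (\<phi> 0) < e/3"
      by (auto simp: eventually_at_right_field)
    have "dist (\<phi> t) (\<phi> 0) < e/3" if "t \<in> {0..2 * (min b T / 3)}" for t
    proof (cases "t = 0")
      case True then show ?thesis using e by simp
    next
      case False then show ?thesis using that b T by (intro b(2)) (auto simp: min_def split: if_splits)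
    qed
    then show ?thesis using b T by (intro exI[of _ "min b T / 3"]) auto
  qed
  then obtain D where D: "\<And>\<phi>. \<phi> \<in> K \<Longrightarrow> D \<phi> > 0 \<and> 2 * D \<phi> \<le> T \<and> (\<forall>t\<in>{0..2 * D \<phi>}. dist (\<phi> t) (\<phi> 0) < e/3)"
    by metis
  let ?B = "\<lambda>\<phi>. mball_of (skorohod_metric T S) \<phi> (min (D \<phi>) (e/3))"
  have "\<exists>F. finite F \<and> F \<subseteq> ?B ` K \<and> K \<subseteq> \<Union>F"
  proof -
    have "\<phi> \<in> ?B \<phi>" if "\<phi> \<in> K" for \<phi>
      using that KS D[OF that] e Metric_space.zero[OF Metric_space_skorohod, of \<phi> T S \<phi>]
      by (auto simp: in_mball_of_skorohod)
    then have "K \<subseteq> \<Union>(?B ` K)" by blast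
    then show ?thesis
      by (rule compactinD[OF K, rotated]) (auto simp: openin_skorohod_ball)
  qed
  then obtain G where G: "finite G" "G \<subseteq> K" "K \<subseteq> (\<Union>\<phi>\<in>G. ?B \<phi>)"
    by (metis (no_types, lifting) finite_subset_image)
  define d where "d = Min (insert T (D ` G))"
  have dpos: "d > 0" unfolding d_def using G D T by (subst Min_gr_iff) auto
  have dle: "d \<le> T" "\<And>\<phi>. \<phi> \<in> G \<Longrightarrow> d \<le> D \<phi>" unfolding d_def using G by auto
  show ?thesis
  proof (intro exI[of _ d] conjI ballI)
    fix \<psi> t assume \<psi>: "\<psi> \<in> K" and t: "t \<in> {0..d}"
    obtain \<phi> where \<phi>: "\<phi> \<in> G" "\<psi> \<in> ?B \<phi>" using G \<psi> by blast
    then have \<phi>S: "\<phi> \<in> skorohod_space T S" "\<psi> \<in> skorohod_space T S" "skorohod_dist T \<phi> \<psi> < min (D \<phi>) (e/3)"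
      unfolding in_mball_of_skorohod by auto
    obtain l where l: "l \<in> time_changes T"
      "\<And>t. t \<in> {0..T} \<Longrightarrow> \<bar>l t - t\<bar> < min (D \<phi>) (e/3) \<and> dist (\<phi> t) (\<psi> (l t)) < min (D \<phi>) (e/3)"
      using skorohod_dist_less[OF \<phi>S] by blast
    have 0: "dist (\<phi> 0) (\<psi> 0) < e/3" using l(2)[of 0] time_change_0[OF l(1)] T by auto
    obtain s where s: "s \<in> {0..T}" "l s = t" using time_change_surj[OF l(1), of t] t dle by auto
    have "s \<le> 2 * D \<phi>" using l(2)[OF s(1)] s t dle(2)[OF \<phi>(1)] by auto
    then have 1: "dist (\<phi> s) (\<phi> 0) < e/3" using D[of \<phi>] \<phi>(1) G(2) s by auto
    have "dist (\<phi> s) (\<psi> t) < e/3" using l(2)[OF s(1)] s by auto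
    then show "dist (\<psi> t) (\<psi> 0) < e"
      using 0 1 dist_triangle[of "\<psi> t" "\<psi> 0" "\<phi> s"] dist_triangle[of "\<phi> s" "\<psi> 0" "\<phi> 0"]
      by (simp add: dist_commute)
  qed (use dpos dle in auto)
qed

section \<open>Absolutely continuous paths and their action\<close>

lemma abs_continuous_path_cong:
  fixes \<phi> \<psi> :: "real \<Rightarrow> 'a::real_normed_vector"
  assumes "\<And>t. t \<in> {0..T} \<Longrightarrow> \<phi> t = \<psi> t"
  shows "abs_continuous_path T \<phi> \<longleftrightarrow> abs_continuous_path T \<psi>"
proof -
  have *: "abs_continuous_path T \<psi>" if ac: "abs_continuous_path T \<phi>" and eq: "\<And>t. t \<in> {0..T} \<Longrightarrow> \<phi> t = \<psi> t"
    for \<phi> \<psi> :: "real \<Rightarrow> 'a"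
    unfolding abs_continuous_path_def
  proof (intro allI impI)
    fix \<epsilon> :: real assume "\<epsilon> > 0"
    then obtain \<delta> where \<delta>: "\<delta> > 0" "\<And>(n::nat) a b.
        (\<forall>i<n. 0 \<le> a i \<and> a i \<le> b i \<and> b i \<le> T) \<and>
        disjoint_family_on (\<lambda>i. {a i<..<b i}) {..<n} \<and> (\<Sum>i<n. b i - a i) < \<delta> \<Longrightarrow>
        (\<Sum>i<n. norm (\<phi> (b i) - \<phi> (a i))) < \<epsilon>"
      using ac unfolding abs_continuous_path_def by meson
    show "\<exists>\<delta>>0. \<forall>(n::nat) a b.
        (\<forall>i<n. 0 \<le> a i \<and> a i \<le> b i \<and> b i \<le> T) \<and>
        disjoint_family_on (\<lambda>i. {a i<..<b i}) {..<n} \<and> (\<Sum>i<n. b i - a i) < \<delta> \<longrightarrow>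
        (\<Sum>i<n. norm (\<psi> (b i) - \<psi> (a i))) < \<epsilon>"
    proof (intro exI[of _ \<delta>] conjI allI impI)
      fix n :: nat and a b :: "nat \<Rightarrow> real"
      assume H: "(\<forall>i<n. 0 \<le> a i \<and> a i \<le> b i \<and> b i \<le> T) \<and>
        disjoint_family_on (\<lambda>i. {a i<..<b i}) {..<n} \<and> (\<Sum>i<n. b i - a i) < \<delta>"
      have "a i \<in> {0..T} \<and> b i \<in> {0..T}" if "i < n" for i
        using H that by fastforce
      then have "(\<Sum>i<n. norm (\<psi> (b i) - \<psi> (a i))) = (\<Sum>i<n. norm (\<phi> (b i) - \<phi> (a i)))"
        by (intro sum.cong) (auto simp: eq)
      then show "(\<Sum>i<n. norm (\<psi> (b i) - \<psi> (a i))) < \<epsilon>" using \<delta>(2)[OF H] by simp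
    qed (rule \<delta>)
  qed
  show ?thesis using *[of \<phi> \<psi>] *[of \<psi> \<phi>] assms by metis
qed

lemma abs_continuous_path_shift:
  assumes "abs_continuous_path T \<phi>" "0 \<le> u" "u + s \<le> T"
  shows "abs_continuous_path s (\<lambda>r. \<phi> (u + r))"
  unfolding abs_continuous_path_def
proof (intro allI impI)
  fix \<epsilon> :: real assume "\<epsilon> > 0"
  then obtain \<delta> where \<delta>: "\<delta> > 0" "\<And>(n::nat) a b.
      (\<forall>i<n. 0 \<le> a i \<and> a i \<le> b i \<and> b i \<le> T) \<and>
      disjoint_family_on (\<lambda>i. {a i<..<b i}) {..<n} \<and> (\<Sum>i<n. b i - a i) < \<delta> \<Longrightarrow>
      (\<Sum>i<n. norm (\<phi> (b i) - \<phi> (a i))) < \<epsilon>"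
    using assms(1) unfolding abs_continuous_path_def by meson
  show "\<exists>\<delta>>0. \<forall>(n::nat) a b.
      (\<forall>i<n. 0 \<le> a i \<and> a i \<le> b i \<and> b i \<le> s) \<and>
      disjoint_family_on (\<lambda>i. {a i<..<b i}) {..<n} \<and> (\<Sum>i<n. b i - a i) < \<delta> \<longrightarrow>
      (\<Sum>i<n. norm (\<phi> (u + b i) - \<phi> (u + a i))) < \<epsilon>"
  proof (intro exI[of _ \<delta>] conjI allI impI)
    fix n :: nat and a b :: "nat \<Rightarrow> real"
    assume H: "(\<forall>i<n. 0 \<le> a i \<and> a i \<le> b i \<and> b i \<le> s) \<and>
      disjoint_family_on (\<lambda>i. {a i<..<b i}) {..<n} \<and> (\<Sum>i<n. b i - a i) < \<delta>"
    have "disjoint_family_on (\<lambda>i. {u + a i<..<u + b i}) {..<n}"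
      unfolding disjoint_family_on_def
    proof (intro ballI impI)
      fix i j assume ij: "i \<in> {..<n}" "j \<in> {..<n}" "i \<noteq> j"
      then have "{a i<..<b i} \<inter> {a j<..<b j} = {}"
        using H unfolding disjoint_family_on_def by blast
      moreover have "x - u \<in> {a i<..<b i} \<inter> {a j<..<b j}"
        if "x \<in> {u + a i<..<u + b i} \<inter> {u + a j<..<u + b j}" for x
        using that by auto
      ultimately show "{u + a i<..<u + b i} \<inter> {u + a j<..<u + b j} = {}" by blast
    qed
    then show "(\<Sum>i<n. norm (\<phi> (u + b i) - \<phi> (u + a i))) < \<epsilon>"
      using H assms(2,3) by (intro \<delta>(2)) (force simp: add_nonneg_nonneg)
  qed (rule \<delta>)
qed

lemma abs_continuous_path_concat:
  assumes "abs_continuous_path s \<phi>" "abs_continuous_path t (\<lambda>r. \<phi> (s + r))" "0 \<le> s" "0 \<le> t"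
  shows "abs_continuous_path (s + t) \<phi>"
  unfolding abs_continuous_path_def
proof (intro allI impI)
  fix \<epsilon> :: real assume "\<epsilon> > 0"
  then have e2: "\<epsilon>/2 > 0" by simp
  obtain \<delta>1 where \<delta>1: "\<delta>1 > 0" "\<And>(n::nat) a b.
      (\<forall>i<n. 0 \<le> a i \<and> a i \<le> b i \<and> b i \<le> s) \<and>
      disjoint_family_on (\<lambda>i. {a i<..<b i}) {..<n} \<and> (\<Sum>i<n. b i - a i) < \<delta>1 \<Longrightarrow>
      (\<Sum>i<n. norm (\<phi> (b i) - \<phi> (a i))) < \<epsilon>/2"
    using assms(1) e2 unfolding abs_continuous_path_def by meson
  obtain \<delta>2 where \<delta>2: "\<delta>2 > 0" "\<And>(n::nat) a b.
      (\<forall>i<n. 0 \<le> a i \<and> a i \<le> b i \<and> b i \<le> t) \<and>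
      disjoint_family_on (\<lambda>i. {a i<..<b i}) {..<n} \<and> (\<Sum>i<n. b i - a i) < \<delta>2 \<Longrightarrow>
      (\<Sum>i<n. norm (\<phi> (s + b i) - \<phi> (s + a i))) < \<epsilon>/2"
    using assms(2) e2 unfolding abs_continuous_path_def by meson
  show "\<exists>\<delta>>0. \<forall>(n::nat) a b.
      (\<forall>i<n. 0 \<le> a i \<and> a i \<le> b i \<and> b i \<le> s + t) \<and>
      disjoint_family_on (\<lambda>i. {a i<..<b i}) {..<n} \<and> (\<Sum>i<n. b i - a i) < \<delta> \<longrightarrow>
      (\<Sum>i<n. norm (\<phi> (b i) - \<phi> (a i))) < \<epsilon>"
  proof (intro exI[of _ "min \<delta>1 \<delta>2"] conjI allI impI)
    fix n :: nat and a b :: "nat \<Rightarrow> real"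
    assume H: "(\<forall>i<n. 0 \<le> a i \<and> a i \<le> b i \<and> b i \<le> s + t) \<and>
      disjoint_family_on (\<lambda>i. {a i<..<b i}) {..<n} \<and> (\<Sum>i<n. b i - a i) < min \<delta>1 \<delta>2"
    \<comment> \<open>Each interval is cut at \<open>s\<close>; a part on the wrong side collapses
      to a point and contributes nothing. Only an interval that straddles \<open>s\<close> needs the
      triangle inequality.\<close>
    define a1 b1 where "a1 i = min (a i) s" and "b1 i = min (b i) s" for i
    define a2 b2 where "a2 i = max (a i) s - s" and "b2 i = max (b i) s - s" for i
    have dj: "{a i<..<b i} \<inter> {a j<..<b j} = {}" if "i < n" "j < n" "i \<noteq> j" for i j
      using H that unfolding disjoint_family_on_def by blast
    have d1: "disjoint_family_on (\<lambda>i. {a1 i<..<b1 i}) {..<n}"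
      unfolding disjoint_family_on_def
    proof (intro ballI impI)
      fix i j assume ij: "i \<in> {..<n}" "j \<in> {..<n}" "i \<noteq> j"
      have "{a1 k<..<b1 k} \<subseteq> {a k<..<b k}" for k by (auto simp: a1_def b1_def min_def split: if_splits)
      then show "{a1 i<..<b1 i} \<inter> {a1 j<..<b1 j} = {}" using dj[of i j] ij by blast
    qed
    have d2: "disjoint_family_on (\<lambda>i. {a2 i<..<b2 i}) {..<n}"
      unfolding disjoint_family_on_def
    proof (intro ballI impI)
      fix i j assume ij: "i \<in> {..<n}" "j \<in> {..<n}" "i \<noteq> j"
      have "x + s \<in> {a k<..<b k}" if "x \<in> {a2 k<..<b2 k}" for x k
        using that by (auto simp: a2_def b2_def max_def split: if_splits)
      then show "{a2 i<..<b2 i} \<inter> {a2 j<..<b2 j} = {}" using dj[of i j] ij by blast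
    qed
    have s1: "(\<Sum>i<n. b1 i - a1 i) < \<delta>1"
    proof -
      have "(\<Sum>i<n. b1 i - a1 i) \<le> (\<Sum>i<n. b i - a i)"
        using H by (intro sum_mono) (auto simp: a1_def b1_def min_def)
      then show ?thesis using H by simp
    qed
    have s2: "(\<Sum>i<n. b2 i - a2 i) < \<delta>2"
    proof -
      have "(\<Sum>i<n. b2 i - a2 i) \<le> (\<Sum>i<n. b i - a i)"
        using H by (intro sum_mono) (auto simp: a2_def b2_def max_def)
      then show ?thesis using H by simp
    qed
    have "\<forall>i<n. 0 \<le> a1 i \<and> a1 i \<le> b1 i \<and> b1 i \<le> s"
      using H assms(3) by (auto simp: a1_def b1_def min_def)
    then have m1: "(\<Sum>i<n. norm (\<phi> (b1 i) - \<phi> (a1 i))) < \<epsilon>/2" using d1 s1 by (intro \<delta>1(2)) auto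
    have "\<forall>i<n. 0 \<le> a2 i \<and> a2 i \<le> b2 i \<and> b2 i \<le> t"
      using H assms(3,4) by (auto simp: a2_def b2_def max_def)
    then have m2: "(\<Sum>i<n. norm (\<phi> (s + b2 i) - \<phi> (s + a2 i))) < \<epsilon>/2"
      using d2 s2 by (intro \<delta>2(2)) auto
    have "norm (\<phi> (b i) - \<phi> (a i)) \<le>
      norm (\<phi> (b1 i) - \<phi> (a1 i)) + norm (\<phi> (s + b2 i) - \<phi> (s + a2 i))" if "i < n" for i
    proof -
      have ab: "a i \<le> b i" using H that by blast
      consider "b i \<le> s" | "s \<le> a i" "s < b i" | "a i < s" "s < b i" by linarith
      then show ?thesis
      proof cases
        case 3
        then have "b1 i = s" "a1 i = a i" "s + b2 i = b i" "s + a2 i = s"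
          by (auto simp: a1_def b1_def a2_def b2_def)
        then show ?thesis using norm_triangle_ineq[of "\<phi> (b i) - \<phi> s" "\<phi> s - \<phi> (a i)"] by (simp add: add.commute)
      qed (use ab in \<open>auto simp: a1_def b1_def a2_def b2_def min_def max_def\<close>)
    qed
    then have "(\<Sum>i<n. norm (\<phi> (b i) - \<phi> (a i))) \<le>
      (\<Sum>i<n. norm (\<phi> (b1 i) - \<phi> (a1 i)) + norm (\<phi> (s + b2 i) - \<phi> (s + a2 i)))"
      by (intro sum_mono) auto
    then show "(\<Sum>i<n. norm (\<phi> (b i) - \<phi> (a i))) < \<epsilon>"
      using m1 m2 by (simp add: sum.distrib)
  qed (use \<delta>1 \<delta>2 in auto)
qed

lemma abs_continuous_path_lipschitz:
  assumes K: "0 \<le> K" and lip: "\<And>a b. 0 \<le> a \<Longrightarrow> a \<le> b \<Longrightarrow> b \<le> T \<Longrightarrow> norm (\<phi> b - \<phi> a) \<le> K * (b - a)"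
  shows "abs_continuous_path T \<phi>"
  unfolding abs_continuous_path_def
proof (intro allI impI)
  fix \<epsilon> :: real assume e: "\<epsilon> > 0"
  show "\<exists>\<delta>>0. \<forall>(n::nat) a b.
      (\<forall>i<n. 0 \<le> a i \<and> a i \<le> b i \<and> b i \<le> T) \<and>
      disjoint_family_on (\<lambda>i. {a i<..<b i}) {..<n} \<and> (\<Sum>i<n. b i - a i) < \<delta> \<longrightarrow>
      (\<Sum>i<n. norm (\<phi> (b i) - \<phi> (a i))) < \<epsilon>"
  proof (intro exI[of _ "\<epsilon> / (K+1)"] conjI allI impI)
    fix n :: nat and a b :: "nat \<Rightarrow> real"
    assume H: "(\<forall>i<n. 0 \<le> a i \<and> a i \<le> b i \<and> b i \<le> T) \<and>
      disjoint_family_on (\<lambda>i. {a i<..<b i}) {..<n} \<and> (\<Sum>i<n. b i - a i) < \<epsilon> / (K+1)"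
    have "(\<Sum>i<n. norm (\<phi> (b i) - \<phi> (a i))) \<le> (\<Sum>i<n. K * (b i - a i))"
      using H by (intro sum_mono lip) auto
    also have "\<dots> = K * (\<Sum>i<n. b i - a i)" by (simp add: sum_distrib_left)
    also have "\<dots> \<le> (K + 1) * (\<Sum>i<n. b i - a i)"
      using H K by (intro mult_right_mono sum_nonneg) auto
    also have "\<dots> < \<epsilon>" using H K by (simp add: field_simps)
    finally show "(\<Sum>i<n. norm (\<phi> (b i) - \<phi> (a i))) < \<epsilon>" .
  qed (use e K in auto)
qed

lemma vector_derivative_shift:
  "vector_derivative (\<lambda>r. f (u + r)) (at r) = vector_derivative f (at (u + r))" for u r :: real
proof -
  have "((\<lambda>r. f (u + r)) has_vector_derivative D) (at r) \<longleftrightarrow> (f has_vector_derivative D) (at (u + r))" for D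
  proof
    assume "((\<lambda>r. f (u + r)) has_vector_derivative D) (at r)"
    then have *: "((\<lambda>r. f (u + r)) has_vector_derivative D) (at ((\<lambda>x. x - u) (u + r)))" by simp
    have "((\<lambda>x. x - u) has_vector_derivative 1) (at (u + r))"
      by (auto intro!: derivative_eq_intros)
    from vector_diff_chain_at[OF this *] show "(f has_vector_derivative D) (at (u + r))"
      by (simp add: o_def)
  next
    assume "(f has_vector_derivative D) (at (u + r))"
    then have *: "(f has_vector_derivative D) (at ((\<lambda>r. u + r) r))" by simp
    have "((\<lambda>r. u + r) has_vector_derivative 1) (at r)"
      by (auto intro!: derivative_eq_intros)
    from vector_diff_chain_at[OF this *] show "((\<lambda>r. f (u + r)) has_vector_derivative D) (at r)"
      by (simp add: o_def)
  qed
  then show ?thesis by (simp add: vector_derivative_def)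
qed

text \<open>At interior times the derivative within the interval is the two-sided one, which does
  not see the length of the interval. At the end points it is one-sided and the identity may
  fail.\<close>

lemma lagrangian_along_shift:
  assumes "0 \<le> u" "u + s \<le> T" "0 < r" "r < s" "\<And>r. r \<in> {0..s} \<Longrightarrow> \<psi> r = \<phi> (u + r)"
  shows "lagrangian_along L s \<psi> r = lagrangian_along L T \<phi> (u + r)"
proof -
  have "at r within {0..s} = at r" "at (u + r) within {0..T} = at (u + r)"
    using assms by (auto intro!: at_within_interior)
  moreover have "vector_derivative \<psi> (at r) = vector_derivative (\<lambda>r. \<phi> (u + r)) (at r)"
  proof (rule vector_derivative_cong_eq)
    have "\<forall>\<^sub>F x in nhds r. x \<in> {0<..<s}"
      using assms by (intro eventually_nhds_in_open) auto
    then show "\<forall>\<^sub>F x in nhds r. x \<in> UNIV \<longrightarrow> \<psi> x = \<phi> (u + x)"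
      by eventually_elim (use assms(5) in auto)
  qed auto
  ultimately show ?thesis
    using assms by (simp add: lagrangian_along_def vector_derivative_shift)
qed

lemma nn_integral_lagrangian_shift:
  assumes m: "lagrangian_along L T \<phi> \<in> borel_measurable (lebesgue_on {0..T})"
    and u: "0 \<le> u" "u + s \<le> T" and \<psi>: "\<And>r. r \<in> {0..s} \<Longrightarrow> \<psi> r = \<phi> (u + r)"
  shows "(\<integral>\<^sup>+r. ennreal (lagrangian_along L s \<psi> r) \<partial>lebesgue_on {0..s}) =
    (\<integral>\<^sup>+r\<in>{u..u+s}. ennreal (lagrangian_along L T \<phi> r) \<partial>lebesgue)"
proof -
  let ?g = "\<lambda>r. ennreal (lagrangian_along L T \<phi> r) * indicator {u..u+s} r"
  have "(\<lambda>r. ennreal (lagrangian_along L T \<phi> r)) \<in> borel_measurable (lebesgue_on {0..T})"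
    using m by (rule measurable_compose[OF _ measurable_ennreal])
  then have "(\<lambda>r. ennreal (lagrangian_along L T \<phi> r) * indicator {0..T} r) \<in> borel_measurable lebesgue"
    by (rule borel_measurable_restrict_space_iff_ennreal[THEN iffD1, rotated]) simp
  then have "(\<lambda>r. (ennreal (lagrangian_along L T \<phi> r) * indicator {0..T} r) * indicator {u..u+s} r)
    \<in> borel_measurable lebesgue"
    by (rule borel_measurable_times_ennreal[OF _ borel_measurable_indicator]) simp
  also have "(\<lambda>r. (ennreal (lagrangian_along L T \<phi> r) * indicator {0..T} r) * indicator {u..u+s} r) = ?g"
    using u by (auto simp: fun_eq_iff split: split_indicator)
  finally have gm: "?g \<in> borel_measurable lebesgue" .
  have "(\<integral>\<^sup>+r. ?g r \<partial>lebesgue) = (\<integral>\<^sup>+r. ?g (u + 1 * r) \<partial>lebesgue)"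
    using nn_integral_real_affine_lebesgue[OF gm, of 1 u] by simp
  also have "\<dots> = (\<integral>\<^sup>+r. ennreal (lagrangian_along L s \<psi> r) * indicator {0..s} r \<partial>lebesgue)"
  proof (rule nn_integral_cong_AE)
    \<comment> \<open>The two end points, where the integrands may differ, are negligible.\<close>
    have "{0, s} \<in> null_sets lebesgue"
      by (simp add: null_sets_completionI)
    then have "AE r in lebesgue. r \<notin> {0, s}" by (rule AE_not_in)
    then show "AE r in lebesgue. ?g (u + 1 * r) = ennreal (lagrangian_along L s \<psi> r) * indicator {0..s} r"
    proof eventually_elim
      case (elim r)
      show ?case
      proof (cases "r \<in> {0..s}")
        case True
        then have "lagrangian_along L s \<psi> r = lagrangian_along L T \<phi> (u + r)"
          using elim u \<psi> by (intro lagrangian_along_shift) auto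
        then show ?thesis using True by simp
      qed (auto split: split_indicator)
    qed
  qed
  also have "\<dots> = (\<integral>\<^sup>+r. ennreal (lagrangian_along L s \<psi> r) \<partial>lebesgue_on {0..s})"
    by (subst nn_integral_restrict_space) auto
  finally show ?thesis by simp
qed

text \<open>No extensionality here, unlike in \<open>continuous_paths\<close>: shifted, rescaled and
  joined paths can be written as plain functions. \<open>path_cost\<close> does the restriction
  before the rate function is applied.\<close>

definition path_in :: "'a::metric_space set \<Rightarrow> real \<Rightarrow> (real \<Rightarrow> 'a) \<Rightarrow> bool" where
  "path_in S T \<phi> \<longleftrightarrow> continuous_on {0..T} \<phi> \<and> \<phi> ` {0..T} \<subseteq> S"

lemma path_inD: "path_in S T \<phi> \<Longrightarrow> t \<in> {0..T} \<Longrightarrow> \<phi> t \<in> S"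
  by (auto simp: path_in_def)

lemma path_in_cong: "(\<And>t. t \<in> {0..T} \<Longrightarrow> \<phi> t = \<psi> t) \<Longrightarrow> path_in S T \<phi> \<longleftrightarrow> path_in S T \<psi>"
  unfolding path_in_def by (metis (no_types, lifting) continuous_on_cong image_cong)

lemma path_in_mono: "path_in S T \<phi> \<Longrightarrow> S \<subseteq> S' \<Longrightarrow> path_in S' T \<phi>"
  by (auto simp: path_in_def)

lemma path_in_shift:
  assumes "path_in S T \<phi>" "0 \<le> u" "u + s \<le> T"
  shows "path_in S s (\<lambda>r. \<phi> (u + r))"
proof -
  have "continuous_on {0..s} (\<phi> \<circ> (\<lambda>r. u + r))"
    using assms by (intro continuous_on_compose continuous_intros)
      (auto simp: path_in_def intro!: continuous_on_subset[of "{0..T}"])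
  then show ?thesis using assms by (auto simp: path_in_def o_def)
qed

lemma path_in_concat:
  assumes "path_in S s \<phi>" "path_in S t (\<lambda>r. \<phi> (s + r))" "0 \<le> s" "0 \<le> t"
  shows "path_in S (s + t) \<phi>"
proof -
  have "continuous_on {s..s+t} ((\<lambda>r. \<phi> (s + r)) \<circ> (\<lambda>r. r - s))"
    using assms by (intro continuous_on_compose continuous_intros)
      (auto simp: path_in_def intro!: continuous_on_subset[of "{0..t}" "\<lambda>r. \<phi> (s + r)"])
  then have "continuous_on {s..s+t} \<phi>" by (simp add: o_def)
  then have "continuous_on ({0..s} \<union> {s..s+t}) \<phi>"
    using assms(1) by (intro continuous_on_closed_Un) (auto simp: path_in_def)
  moreover have "{0..s} \<union> {s..s+t} = {0..s+t}" using assms by auto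
  moreover have "\<phi> r \<in> S" if "r \<in> {0..s+t}" for r
    using that path_inD[OF assms(1), of r] path_inD[OF assms(2), of "r - s"] by (cases "r \<le> s") auto
  ultimately show ?thesis by (auto simp: path_in_def)
qed

definition path_join :: "real \<Rightarrow> (real \<Rightarrow> 'a) \<Rightarrow> (real \<Rightarrow> 'a) \<Rightarrow> real \<Rightarrow> 'a" where
  "path_join s \<phi> \<psi> r = (if r \<le> s then \<phi> r else \<psi> (r - s))"

lemma path_join_right: "\<phi> s = \<psi> 0 \<Longrightarrow> 0 \<le> r \<Longrightarrow> path_join s \<phi> \<psi> (s + r) = \<psi> r"
  by (auto simp: path_join_def)

lemma path_join_left: "r \<le> s \<Longrightarrow> path_join s \<phi> \<psi> r = \<phi> r"
  by (auto simp: path_join_def)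

lemma path_in_join:
  assumes "path_in S s \<phi>" "path_in S t \<psi>" "\<phi> s = \<psi> 0" "0 \<le> s" "0 \<le> t"
  shows "path_in S (s + t) (path_join s \<phi> \<psi>)"
proof (rule path_in_concat)
  show "path_in S s (path_join s \<phi> \<psi>)"
    using assms(1) by (subst path_in_cong[of _ _ \<phi>]) (auto simp: path_join_left)
  show "path_in S t (\<lambda>r. path_join s \<phi> \<psi> (s + r))"
    using assms(2,3) by (subst path_in_cong[of _ _ \<psi>]) (auto simp: path_join_right)
qed (use assms in auto)

definition path_cost :: "(real \<Rightarrow> (real \<Rightarrow> 'a) \<Rightarrow> ennreal) \<Rightarrow> real \<Rightarrow> (real \<Rightarrow> 'a) \<Rightarrow> ennreal" where
  "path_cost I T \<phi> = I T (restrict \<phi> {0..T})"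

lemma path_cost_cong: "(\<And>t. t \<in> {0..T} \<Longrightarrow> \<phi> t = \<psi> t) \<Longrightarrow> path_cost I T \<phi> = path_cost I T \<psi>"
  unfolding path_cost_def by (metis restrict_ext)

lemma abs_continuous_path_continuous:
  assumes "abs_continuous_path T \<phi>"
  shows "continuous_on {0..T} \<phi>"
  unfolding continuous_on_iff
proof (intro ballI allI impI)
  fix x \<epsilon> :: real assume x: "x \<in> {0..T}" and e: "\<epsilon> > 0"
  obtain \<delta> where \<delta>: "\<delta> > 0" "\<And>(n::nat) a b.
      (\<forall>i<n. 0 \<le> a i \<and> a i \<le> b i \<and> b i \<le> T) \<and>
      disjoint_family_on (\<lambda>i. {a i<..<b i}) {..<n} \<and> (\<Sum>i<n. b i - a i) < \<delta> \<Longrightarrow>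
      (\<Sum>i<n. norm (\<phi> (b i) - \<phi> (a i))) < \<epsilon>"
    using assms e unfolding abs_continuous_path_def by meson
  have "dist (\<phi> y) (\<phi> x) < \<epsilon>" if y: "y \<in> {0..T}" "dist y x < \<delta>" for y
  proof -
    have "norm (\<phi> (max x y) - \<phi> (min x y)) < \<epsilon>"
      using \<delta>(2)[of 1 "\<lambda>_. min x y" "\<lambda>_. max x y"] x y
      by (cases "x \<le> y") (auto simp: disjoint_family_on_def dist_real_def)
    then show ?thesis
      by (cases "x \<le> y") (auto simp: dist_norm norm_minus_commute max_def min_def)
  qed
  then show "\<exists>d>0. \<forall>y\<in>{0..T}. dist y x < d \<longrightarrow> dist (\<phi> y) (\<phi> x) < \<epsilon>"
    using \<delta>(1) by blast
qed

section \<open>Loops avoiding the origin\<close>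

text \<open>The deterministic part of the problem. \<open>C0\<close> and \<open>d0\<close> come from
  the bound of \<open>L\<close> by \<open>l2\<close> at small speeds, \<open>scaling\<close> from
  the uniqueness of the rate function; \<open>ex_action_space\<close> derives both from assumption
  (A).\<close>

locale action_space =
  fixes S :: "'a::euclidean_space set"
    and I :: "real \<Rightarrow> (real \<Rightarrow> 'a) \<Rightarrow> ennreal"
    and L :: "'a \<Rightarrow> 'a \<Rightarrow> real"
    and C0 d0 :: real
  assumes rate: "rate_has_lagrangian S I L"
    and closed_S: "closed S"
    and zero_S: "0 \<in> S"
    and cone: "\<And>z c. z \<in> S \<Longrightarrow> 0 < c \<Longrightarrow> c *\<^sub>R z \<in> S"
    and convex_0: "convex (S - {0})"
    and nonzero: "S - {0} \<noteq> {}"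
    and C0: "0 \<le> C0" and d0: "0 < d0"
    and L_bound: "\<And>x v. x \<in> S \<Longrightarrow> norm v \<le> d0 \<Longrightarrow> L x v \<le> C0"
    and scaling: "\<And>T c \<phi>. path_in S T \<phi> \<Longrightarrow> 0 < T \<Longrightarrow> 0 < c \<Longrightarrow>
      path_cost I (c * T) (\<lambda>t. c *\<^sub>R \<phi> (t / c)) = ennreal c * path_cost I T \<phi>"
    and good: "\<And>T. 0 < T \<Longrightarrow> good_rate_function S T (I T)"
begin

abbreviation J :: "real \<Rightarrow> (real \<Rightarrow> 'a) \<Rightarrow> ennreal" where "J \<equiv> path_cost I"
abbreviation S0 :: "'a set" where "S0 \<equiv> S - {0}"

lemma path_in_S0D: "path_in S0 T \<phi> \<Longrightarrow> path_in S T \<phi>"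
  by (rule path_in_mono) auto

lemma cone_0: "z \<in> S \<Longrightarrow> 0 \<le> c \<Longrightarrow> c *\<^sub>R z \<in> S"
  using cone[of z c] zero_S by (cases "c = 0") auto

lemma convex_S: "convex S"
proof (rule convexI)
  fix x y and u v :: real
  assume xy: "x \<in> S" "y \<in> S" and uv: "0 \<le> u" "0 \<le> v" "u + v = 1"
  consider "x = 0" | "y = 0" | "x \<in> S0" "y \<in> S0" using xy by auto
  then show "u *\<^sub>R x + v *\<^sub>R y \<in> S"
    using xy uv cone_0 convexD[OF convex_0 _ _ uv] by cases auto
qed

lemma J_infinite:
  assumes "path_in S T \<phi>" "0 < T" "\<not> abs_continuous_path T \<phi>"
  shows "J T \<phi> = \<infinity>"
proof -
  have "\<not> abs_continuous_path T (restrict \<phi> {0..T})"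
    using assms(3) abs_continuous_path_cong[of T \<phi> "restrict \<phi> {0..T}"] by auto
  then show ?thesis
    using rate continuous_in_skorohod[of T \<phi> S] assms unfolding rate_has_lagrangian_def path_cost_def path_in_def by blast
qed

lemma J_integral:
  assumes "path_in S T \<phi>" "0 < T" "abs_continuous_path T \<phi>"
  shows "lagrangian_along L T (restrict \<phi> {0..T}) \<in> borel_measurable (lebesgue_on {0..T})"
    "J T \<phi> = (\<integral>\<^sup>+t. ennreal (lagrangian_along L T (restrict \<phi> {0..T}) t) \<partial>lebesgue_on {0..T})"
proof -
  have "abs_continuous_path T (restrict \<phi> {0..T})"
    using assms(3) abs_continuous_path_cong[of T \<phi> "restrict \<phi> {0..T}"] by auto
  then show "lagrangian_along L T (restrict \<phi> {0..T}) \<in> borel_measurable (lebesgue_on {0..T})"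
    "J T \<phi> = (\<integral>\<^sup>+t. ennreal (lagrangian_along L T (restrict \<phi> {0..T}) t) \<partial>lebesgue_on {0..T})"
    using rate continuous_in_skorohod[of T \<phi> S] assms unfolding rate_has_lagrangian_def path_cost_def path_in_def by blast+
qed

text \<open>Every piece of a path has as its action the integral of one and the same integrand over
  a subinterval, so additivity and monotonicity of the action become those of the integral.\<close>

lemma J_shift:
  assumes "path_in S T \<phi>" "abs_continuous_path T \<phi>" "0 \<le> u" "0 < s" "u + s \<le> T"
  shows "J s (\<lambda>r. \<phi> (u + r)) =
    (\<integral>\<^sup>+r\<in>{u..u+s}. ennreal (lagrangian_along L T (restrict \<phi> {0..T}) r) \<partial>lebesgue)"
proof -
  have T: "0 < T" using assms by linarith
  have p: "path_in S s (\<lambda>r. \<phi> (u + r))" using assms by (intro path_in_shift) auto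
  have ac: "abs_continuous_path s (\<lambda>r. \<phi> (u + r))" using assms by (intro abs_continuous_path_shift) auto
  show ?thesis
    unfolding J_integral(2)[OF p assms(4) ac]
    using assms by (intro nn_integral_lagrangian_shift J_integral(1)) auto
qed

lemma J_add:
  assumes p: "path_in S (s + t) \<phi>" and s: "0 < s" and t: "0 < t"
  shows "J (s + t) \<phi> = J s \<phi> + J t (\<lambda>r. \<phi> (s + r))"
proof (cases "abs_continuous_path (s + t) \<phi>")
  case True
  let ?l = "\<lambda>r. ennreal (lagrangian_along L (s + t) (restrict \<phi> {0..s+t}) r)"
  have st: "0 < s + t" using s t by simp
  have m: "?l \<in> borel_measurable (lebesgue_on {0..s+t})"
    using J_integral(1)[OF p st True] by (rule measurable_compose[OF _ measurable_ennreal])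
  then have m': "(\<lambda>r. ?l r * indicator {0..s+t} r) \<in> borel_measurable lebesgue"
    by (rule borel_measurable_restrict_space_iff_ennreal[THEN iffD1, rotated]) simp
  have "(\<lambda>r. (?l r * indicator {0..s+t} r) * indicator {0..s} r) \<in> borel_measurable lebesgue"
    using m' by (rule borel_measurable_times_ennreal[OF _ borel_measurable_indicator]) simp
  also have "(\<lambda>r. (?l r * indicator {0..s+t} r) * indicator {0..s} r) = (\<lambda>r. ?l r * indicator {0..s} r)"
    using s t by (auto simp: fun_eq_iff split: split_indicator)
  finally have m1: "(\<lambda>r. ?l r * indicator {0..s} r) \<in> borel_measurable lebesgue" .
  have "(\<lambda>r. (?l r * indicator {0..s+t} r) * indicator {s..s+t} r) \<in> borel_measurable lebesgue"
    using m' by (rule borel_measurable_times_ennreal[OF _ borel_measurable_indicator]) simp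
  also have "(\<lambda>r. (?l r * indicator {0..s+t} r) * indicator {s..s+t} r) = (\<lambda>r. ?l r * indicator {s..s+t} r)"
    using s t by (auto simp: fun_eq_iff split: split_indicator)
  finally have m2: "(\<lambda>r. ?l r * indicator {s..s+t} r) \<in> borel_measurable lebesgue" .
  have "J (s + t) \<phi> = (\<integral>\<^sup>+r\<in>{0..0+(s+t)}. ?l r \<partial>lebesgue)"
    using J_shift[OF p True, of 0 "s+t"] s t by simp
  also have "\<dots> = (\<integral>\<^sup>+r. ?l r * indicator {0..s} r + ?l r * indicator {s..s+t} r \<partial>lebesgue)"
  proof (rule nn_integral_cong_AE)
    have "AE r in lebesgue. r \<notin> {s}"
      by (rule AE_not_in) (simp add: null_sets_completionI)
    then show "AE r in lebesgue. ?l r * indicator {0..0+(s+t)} r =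
      ?l r * indicator {0..s} r + ?l r * indicator {s..s+t} r"
      by eventually_elim (use s t in \<open>auto split: split_indicator\<close>)
  qed
  also have "\<dots> = (\<integral>\<^sup>+r\<in>{0..0+s}. ?l r \<partial>lebesgue) + (\<integral>\<^sup>+r\<in>{s..s+t}. ?l r \<partial>lebesgue)"
    using m1 m2 by (simp add: nn_integral_add)
  also have "\<dots> = J s (\<lambda>r. \<phi> (0 + r)) + J t (\<lambda>r. \<phi> (s + r))"
    using J_shift[OF p True, of 0 s] J_shift[OF p True, of s t] s t by simp
  finally show ?thesis by simp
next
  \<comment> \<open>If the whole path is not absolutely continuous, at least one of the pieces is
    not either, and both sides are infinite.\<close>
  case False
  then consider "\<not> abs_continuous_path s \<phi>" | "\<not> abs_continuous_path t (\<lambda>r. \<phi> (s + r))"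
    using abs_continuous_path_concat[of s \<phi> t] s t by auto
  then have "J s \<phi> = \<infinity> \<or> J t (\<lambda>r. \<phi> (s + r)) = \<infinity>"
    using J_infinite[OF _ s, of \<phi>] J_infinite[OF _ t, of "\<lambda>r. \<phi> (s + r)"]
      path_in_shift[OF p, of 0 s] path_in_shift[OF p, of s t] s t by fastforce
  moreover have "J (s + t) \<phi> = \<infinity>" using J_infinite[OF p _ False] s t by simp
  ultimately show ?thesis by auto
qed

lemma J_join:
  assumes "path_in S s \<phi>" "path_in S t \<psi>" "\<phi> s = \<psi> 0" "0 < s" "0 < t"
  shows "J (s + t) (path_join s \<phi> \<psi>) = J s \<phi> + J t \<psi>"
proof -
  have "J (s + t) (path_join s \<phi> \<psi>) = J s (path_join s \<phi> \<psi>) + J t (\<lambda>r. path_join s \<phi> \<psi> (s + r))"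
    using assms path_in_join[of S s \<phi> t \<psi>] by (intro J_add) auto
  also have "J s (path_join s \<phi> \<psi>) = J s \<phi>"
    by (rule path_cost_cong) (auto simp: path_join_left)
  also have "J t (\<lambda>r. path_join s \<phi> \<psi> (s + r)) = J t \<psi>"
    using assms(3) by (intro path_cost_cong) (auto simp: path_join_right)
  finally show ?thesis .
qed

definition segment :: "real \<Rightarrow> 'a \<Rightarrow> 'a \<Rightarrow> real \<Rightarrow> 'a" where
  "segment t x y r = x + (r / t) *\<^sub>R (y - x)"

lemma segment_0 [simp]: "segment t x y 0 = x"
  and segment_end [simp]: "t \<noteq> 0 \<Longrightarrow> segment t x y t = y"
  by (simp_all add: segment_def)

lemma segment_convex: "segment t x y r = (1 - r / t) *\<^sub>R x + (r / t) *\<^sub>R y"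
  by (simp add: segment_def algebra_simps)

lemma segment_mem:
  assumes "convex A" "x \<in> A" "y \<in> A" "0 < t" "r \<in> {0..t}"
  shows "segment t x y r \<in> A"
  unfolding segment_convex using assms by (intro convexD) auto

lemma path_in_segment:
  assumes "convex A" "x \<in> A" "y \<in> A" "0 < t"
  shows "path_in A t (segment t x y)"
  using segment_mem[OF assms]
  by (auto simp: path_in_def segment_def divide_inverse intro!: continuous_intros)

text \<open>If one end is the origin, the interior points are positive multiples of the other end;
  otherwise convexity of \<open>S0\<close> applies.\<close>

lemma segment_nonzero:
  assumes "x \<in> S" "y \<in> S" "0 < t" "0 < r" "r < t" "x \<noteq> 0 \<or> y \<noteq> 0"
  shows "segment t x y r \<noteq> 0"
proof (cases "x = 0 \<or> y = 0")
  case True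
  then show ?thesis using assms by (auto simp: segment_convex)
next
  case False
  then show ?thesis using segment_mem[OF convex_0, of x y t r] assms by auto
qed

text \<open>The speed is constant and at most \<open>d0\<close>, where \<open>L\<close> is bounded
  by \<open>C0\<close>.\<close>

lemma J_segment:
  assumes "x \<in> S" "y \<in> S" "0 < t" "norm (y - x) \<le> d0 * t"
  shows "J t (segment t x y) \<le> ennreal (C0 * t)"
proof -
  let ?v = "(1 / t) *\<^sub>R (y - x)"
  have p: "path_in S t (segment t x y)" using path_in_segment[OF convex_S] assms by auto
  have ac: "abs_continuous_path t (segment t x y)"
  proof (rule abs_continuous_path_lipschitz)
    show "0 \<le> norm ?v" by simp
    fix a b :: real assume "0 \<le> a" "a \<le> b" "b \<le> t"
    have "segment t x y b - segment t x y a = (b - a) *\<^sub>R ?v"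
      by (simp add: segment_def diff_divide_distrib scaleR_diff_left)
    then show "norm (segment t x y b - segment t x y a) \<le> norm ?v * (b - a)"
      using \<open>a \<le> b\<close> by (simp add: mult.commute)
  qed
  have "lagrangian_along L t (restrict (segment t x y) {0..t}) r \<le> C0" if r: "r \<in> {0..t}" for r
  proof -
    have "(segment t x y has_vector_derivative ?v) (at r within {0..t})"
      unfolding segment_def using assms(3)
      by (auto intro!: derivative_eq_intros simp: divide_inverse)
    then have "(restrict (segment t x y) {0..t} has_vector_derivative ?v) (at r within {0..t})"
      by (rule has_vector_derivative_transform[rotated 2]) (use r in auto)
    then have "vector_derivative (restrict (segment t x y) {0..t}) (at r within {0..t}) = ?v"
      using r assms(3) by (intro vector_derivative_within_closed_interval) auto
    moreover have "norm ?v = norm (y - x) / t" using assms(3) by simp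
    then have "norm ?v \<le> d0" using assms(3,4) by (simp only:) (simp add: field_simps)
    then have "L (segment t x y r) ?v \<le> C0"
      using path_inD[OF p r] by (intro L_bound)
    ultimately show ?thesis using r by (simp add: lagrangian_along_def)
  qed
  then have "J t (segment t x y) \<le> (\<integral>\<^sup>+r. ennreal C0 \<partial>lebesgue_on {0..t})"
    unfolding J_integral(2)[OF p assms(3) ac]
    by (intro nn_integral_mono ennreal_leI) (auto simp: space_restrict_space)
  also have "\<dots> = ennreal (C0 * t)"
    using assms(3) C0 by (simp add: emeasure_restrict_space ennreal_mult)
  finally show ?thesis .
qed

text \<open>Price per unit length of a straight connection run at speed \<open>d0\<close>: length
  \<open>v\<close> takes time \<open>v / d0\<close>, at a cost of at most \<open>C0\<close> per unit
  of time.\<close>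

definition C :: real where "C = C0 / d0"

lemma C_nonneg: "0 \<le> C" using C0 d0 by (simp add: C_def)

text \<open>These loops avoid the origin at their end points too, so that they can be repeated and
  joined to segments inside \<open>S0\<close>; by \<open>INF_loops\<close> the infimum is that of
  the theorem. A constant loop shows it to be finite, so \<open>enn2real\<close> loses
  nothing.\<close>

definition lam :: real where
  "lam = enn2real (INF \<phi>\<in>{\<phi>. path_in S0 1 \<phi> \<and> \<phi> 0 = \<phi> 1}. J 1 \<phi>)"

lemma lam_INF: "(INF \<phi>\<in>{\<phi>. path_in S0 1 \<phi> \<and> \<phi> 0 = \<phi> 1}. J 1 \<phi>) = ennreal lam"
proof -
  obtain z where z: "z \<in> S0" using nonzero by blast
  have "(INF \<phi>\<in>{\<phi>. path_in S0 1 \<phi> \<and> \<phi> 0 = \<phi> 1}. J 1 \<phi>) \<le> J 1 (segment 1 z z)"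
    using path_in_segment[OF convex_0 z z] by (intro INF_lower) auto
  also have "\<dots> \<le> ennreal (C0 * 1)" using z d0 by (intro J_segment) auto
  finally have "(INF \<phi>\<in>{\<phi>. path_in S0 1 \<phi> \<and> \<phi> 0 = \<phi> 1}. J 1 \<phi>) < \<infinity>"
    using le_less_trans by fastforce
  then show ?thesis by (simp add: lam_def)
qed

lemma lam_nonneg: "0 \<le> lam" by (simp add: lam_def)

lemma near_optimal_loop:
  assumes "0 < \<eta>"
  obtains \<phi> where "path_in S0 1 \<phi>" "\<phi> 0 = \<phi> 1" "J 1 \<phi> < ennreal (lam + \<eta>)"
proof -
  have "(INF \<phi>\<in>{\<phi>. path_in S0 1 \<phi> \<and> \<phi> 0 = \<phi> 1}. J 1 \<phi>) < ennreal (lam + \<eta>)"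
    unfolding lam_INF using assms lam_nonneg by (simp add: ennreal_less_iff)
  then show ?thesis using that unfolding INF_less_iff by blast
qed

lemma path_in_scale:
  fixes A :: "'a set"
  assumes "path_in A T \<phi>" "0 < c" "\<And>z. z \<in> A \<Longrightarrow> c *\<^sub>R z \<in> A"
  shows "path_in A (c * T) (\<lambda>t. c *\<^sub>R \<phi> (t / c))"
proof -
  have "continuous_on {0..c*T} (\<phi> \<circ> (\<lambda>t. t / c))"
    using assms(1,2)
    by (intro continuous_on_compose continuous_intros)
      (auto simp: path_in_def field_simps intro!: continuous_on_subset[of "{0..T}"])
  then have "continuous_on {0..c*T} (\<lambda>t. c *\<^sub>R \<phi> (t / c))"
    by (auto simp: o_def intro!: continuous_on_scaleR continuous_on_const)
  moreover have "c *\<^sub>R \<phi> (t / c) \<in> A" if "t \<in> {0..c*T}" for t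
    using that assms(2) by (intro assms(3) path_inD[OF assms(1)]) (auto simp: field_simps)
  ultimately show ?thesis by (auto simp: path_in_def)
qed

lemma path_in_S0_scale: "path_in S0 T \<phi> \<Longrightarrow> 0 < c \<Longrightarrow> path_in S0 (c * T) (\<lambda>t. c *\<^sub>R \<phi> (t / c))"
  by (rule path_in_scale) (auto intro: cone)

lemma J_unit:
  assumes "path_in S T \<phi>" "0 < T"
  shows "J T \<phi> = ennreal T * J 1 (\<lambda>t. (1/T) *\<^sub>R \<phi> (T * t))"
proof -
  have "path_in S 1 (\<lambda>t. (1/T) *\<^sub>R \<phi> (T * t))"
    using path_in_scale[OF assms(1), of "1/T"] assms(2) cone by (simp add: mult.commute)
  from scaling[OF this _ assms(2)] have "ennreal T * J 1 (\<lambda>t. (1/T) *\<^sub>R \<phi> (T * t)) =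
      J T (\<lambda>t. T *\<^sub>R (1/T) *\<^sub>R \<phi> (T * (t / T)))" by simp
  also have "\<dots> = J T \<phi>" using assms(2) by simp
  finally show ?thesis by simp
qed

lemma loop_cost:
  assumes p: "path_in S0 T \<phi>" and T: "0 < T" and "\<phi> 0 = \<phi> T"
  shows "ennreal (lam * T) \<le> J T \<phi>"
proof -
  have "path_in S0 1 (\<lambda>t. (1/T) *\<^sub>R \<phi> (T * t))"
    using path_in_S0_scale[OF p, of "1/T"] T by (simp add: mult.commute)
  then have "ennreal lam \<le> J 1 (\<lambda>t. (1/T) *\<^sub>R \<phi> (T * t))"
    unfolding lam_INF[symmetric] using assms by (intro INF_lower) auto
  then have "ennreal T * ennreal lam \<le> J T \<phi>"
    unfolding J_unit[OF path_in_S0D[OF p] T] by (rule mult_left_mono) simp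
  then show ?thesis using T lam_nonneg by (simp add: ennreal_mult mult.commute)
qed

text \<open>A segment back to the start, run at speed \<open>d0\<close>, closes the path into a loop
  at the price \<open>C * norm (\<phi> T - \<phi> 0)\<close>. The loop lasts longer than
  \<open>T\<close>, which only helps because \<open>lam\<close> is nonnegative.\<close>

lemma path_cost_ge:
  assumes p: "path_in S0 T \<phi>" and T: "0 < T"
  shows "ennreal (lam * T - C * norm (\<phi> T - \<phi> 0)) \<le> J T \<phi>"
proof (cases "\<phi> 0 = \<phi> T")
  case True
  then show ?thesis using loop_cost[OF p T] by simp
next
  case False
  define s where "s = norm (\<phi> T - \<phi> 0) / d0"
  have s: "s > 0" using False d0 by (simp add: s_def)
  have m: "\<phi> 0 \<in> S0" "\<phi> T \<in> S0" using p T by (auto simp: path_in_def image_subset_iff)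
  let ?g = "segment s (\<phi> T) (\<phi> 0)"
  have pg: "path_in S0 s ?g" using path_in_segment[OF convex_0] m s by blast
  have "ennreal (lam * (T + s)) \<le> J (T + s) (path_join T \<phi> ?g)"
    using p pg T s path_in_join[OF p pg] path_join_right[of \<phi> T ?g s]
    by (intro loop_cost) (auto simp: path_join_left)
  also have "\<dots> = J T \<phi> + J s ?g"
    using path_in_S0D[OF p] path_in_S0D[OF pg] T s by (intro J_join) auto
  also have "J s ?g \<le> ennreal (C0 * s)"
    using m s d0 by (intro J_segment) (auto simp: s_def norm_minus_commute)
  finally have *: "ennreal (lam * (T + s)) \<le> J T \<phi> + ennreal (C0 * s)" by (simp add: add_left_mono)
  show ?thesis
  proof (cases "J T \<phi>")
    case (real j)
    then have "lam * (T + s) \<le> j + C0 * s"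
      using * s C0 by (simp flip: ennreal_plus)
    moreover have "C0 * s = C * norm (\<phi> T - \<phi> 0)" by (simp add: s_def C_def)
    moreover have "0 \<le> lam * s" using lam_nonneg s by simp
    ultimately show ?thesis using real by (simp add: algebra_simps ennreal_leI)
  qed simp
qed

lemma J_middle_le:
  assumes p: "path_in S T \<phi>" and u: "0 \<le> u" "0 < s" "u + s \<le> T"
  shows "J s (\<lambda>r. \<phi> (u + r)) \<le> J T \<phi>"
proof (cases "abs_continuous_path T \<phi>")
  case True
  have "J s (\<lambda>r. \<phi> (u + r)) = (\<integral>\<^sup>+r\<in>{u..u+s}. ennreal (lagrangian_along L T (restrict \<phi> {0..T}) r) \<partial>lebesgue)"
    using J_shift[OF p True] u by simp
  also have "\<dots> \<le> (\<integral>\<^sup>+r\<in>{0..0+T}. ennreal (lagrangian_along L T (restrict \<phi> {0..T}) r) \<partial>lebesgue)"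
    using u by (intro nn_integral_mono) (auto split: split_indicator)
  also have "\<dots> = J T \<phi>" using J_shift[OF p True, of 0 T] u by simp
  finally show ?thesis .
next
  case False
  then show ?thesis using J_infinite[OF p] u by simp
qed

text \<open>Here the end points may be the origin. \<open>path_cost_ge\<close> applies on
  \<open>[s, T - s]\<close>, and continuity at the ends permits \<open>s\<close> to tend to
  0.\<close>

lemma open_path_cost_ge:
  assumes p: "path_in S T \<phi>" and T: "0 < T" and nz: "\<And>t. 0 < t \<Longrightarrow> t < T \<Longrightarrow> \<phi> t \<noteq> 0"
  shows "ennreal (lam * T - C * norm (\<phi> T - \<phi> 0)) \<le> J T \<phi>"
proof (cases "J T \<phi>")
  case (real j)
  have *: "lam * (T - 2 * s) - C * norm (\<phi> (T - s) - \<phi> s) \<le> j" if s: "0 < s" "s < T/2" for s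
  proof -
    have q: "path_in S0 (T - 2 * s) (\<lambda>r. \<phi> (s + r))"
      using path_in_shift[OF p, of s "T - 2 * s"] s nz
      by (auto simp: path_in_def image_subset_iff)
    have "ennreal (lam * (T - 2 * s) - C * norm (\<phi> (s + (T - 2 * s)) - \<phi> (s + 0))) \<le> J (T - 2 * s) (\<lambda>r. \<phi> (s + r))"
      using path_cost_ge[OF q] s by simp
    also have "\<dots> \<le> J T \<phi>" using s by (intro J_middle_le[OF p]) auto
    finally show ?thesis using real by (simp add: algebra_simps)
  qed
  have c: "continuous_on {0..T} \<phi>" using p by (simp add: path_in_def)
  have l0: "(\<phi> \<longlongrightarrow> \<phi> 0) (at_right 0)"
    using c T by (simp add: continuous_on_Icc_at_rightD)
  have lT: "((\<lambda>s. \<phi> (T - s)) \<longlongrightarrow> \<phi> T) (at_right 0)"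
  proof (rule filterlim_compose[of \<phi> _ "at_left T"])
    show "(\<phi> \<longlongrightarrow> \<phi> T) (at_left T)" using c T by (simp add: continuous_on_Icc_at_leftD)
    have "((\<lambda>s. T - s) \<longlongrightarrow> T - 0) (at_right (0::real))" by (intro tendsto_intros)
    then show "filterlim (\<lambda>s. T - s) (at_left T) (at_right 0)"
      by (auto simp: filterlim_at eventually_at_filter)
  qed
  have "((\<lambda>s. lam * (T - 2 * s) - C * norm (\<phi> (T - s) - \<phi> s)) \<longlongrightarrow>
    lam * (T - 2 * 0) - C * norm (\<phi> T - \<phi> 0)) (at_right 0)"
    by (intro tendsto_intros l0 lT)
  moreover have "\<forall>\<^sub>F s in at_right 0. lam * (T - 2 * s) - C * norm (\<phi> (T - s) - \<phi> s) \<le> j"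
    unfolding eventually_at_right_field using T * by (intro exI[of _ "T/2"]) auto
  ultimately have "lam * (T - 2 * 0) - C * norm (\<phi> T - \<phi> 0) \<le> j"
    by (rule tendsto_upperbound) simp
  then show ?thesis using real by (simp add: ennreal_leI)
qed simp

end

section \<open>Excursions of a path away from the origin\<close>

lemma open_real_component:
  fixes U :: "real set"
  assumes "open U" "bounded U" and K: "K \<in> components U"
  obtains u v where "u < v" "K = {u<..<v}" "u \<notin> U" "v \<notin> U" "u \<in> closure U" "v \<in> closure U"
proof -
  have KU: "K \<subseteq> U" using in_components_subset[OF K] .
  have ne: "K \<noteq> {}" using in_components_nonempty[OF K] .
  have conn: "connected K" using in_components_connected[OF K] .
  have op: "open K" using K \<open>open U\<close> unfolding components_iff by (metis open_connected_component)
  have bK: "bdd_below K" "bdd_above K"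
    using bounded_subset[OF \<open>bounded U\<close> KU] bounded_imp_bdd_below bounded_imp_bdd_above by auto
  define u v where "u = Inf K" and "v = Sup K"
  have uK: "u \<notin> K"
  proof
    assume "u \<in> K"
    then obtain e where "e > 0" "ball u e \<subseteq> K" using op openE by blast
    then have "u - e/2 \<in> K" by (auto simp: subset_eq dist_real_def)
    then have "u \<le> u - e/2" unfolding u_def using bK by (intro cInf_lower)
    then show False using \<open>e > 0\<close> by simp
  qed
  have vK: "v \<notin> K"
  proof
    assume "v \<in> K"
    then obtain e where "e > 0" "ball v e \<subseteq> K" using op openE by blast
    then have "v + e/2 \<in> K" by (auto simp: subset_eq dist_real_def)
    then have "v + e/2 \<le> v" unfolding v_def using bK by (intro cSup_upper)
    then show False using \<open>e > 0\<close> by simp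
  qed
  have Keq: "K = {u<..<v}"
  proof (intro set_eqI iffI)
    fix x assume x: "x \<in> K"
    have "u \<le> x" "x \<le> v" unfolding u_def v_def using x bK by (auto intro: cInf_lower cSup_upper)
    then show "x \<in> {u<..<v}" using x uK vK by (cases "x = u"; cases "x = v") auto
  next
    fix x assume x: "x \<in> {u<..<v}"
    obtain a where a: "a \<in> K" "a < x" using x cInf_lessD[OF ne, of x] unfolding u_def by auto
    obtain b where b: "b \<in> K" "x < b" using x less_cSupD[OF ne, of x] unfolding v_def by auto
    show "x \<in> K" using connectedD_interval[OF conn a(1) b(1)] a b by auto
  qed
  have uv: "u < v" using ne Keq by (auto simp: not_less[symmetric])
  have "u \<notin> U"
  proof
    assume "u \<in> U"
    \<comment> \<open>Adding the end point would give a larger connected subset of \<open>U\<close>,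
      against the maximality of the component.\<close>
    have "{u..<v} \<subseteq> U"
    proof
      fix x assume "x \<in> {u..<v}"
      then have "x = u \<or> x \<in> K" unfolding Keq by auto
      then show "x \<in> U" using KU \<open>u \<in> U\<close> by blast
    qed
    moreover have "K \<inter> {u..<v} \<noteq> {}"
      using dense[OF uv] unfolding Keq by auto
    ultimately have "{u..<v} \<subseteq> K"
      using components_maximal[OF K, of "{u..<v}"] by simp
    then show False using uK uv by auto
  qed
  moreover have "v \<notin> U"
  proof
    assume "v \<in> U"
    have "{u<..v} \<subseteq> U"
    proof
      fix x assume "x \<in> {u<..v}"
      then have "x = v \<or> x \<in> K" unfolding Keq by auto
      then show "x \<in> U" using KU \<open>v \<in> U\<close> by blast
    qed
    moreover have "K \<inter> {u<..v} \<noteq> {}"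
      using dense[OF uv] unfolding Keq by auto
    ultimately have "{u<..v} \<subseteq> K"
      using components_maximal[OF K, of "{u<..v}"] by simp
    then show False using vK uv by auto
  qed
  moreover have "u \<in> closure U" "v \<in> closure U"
    using closure_mono[OF KU] uv unfolding Keq by auto
  ultimately show ?thesis using uv Keq by (intro that[of u v])
qed

definition null_zeros :: "real \<Rightarrow> (real \<Rightarrow> 'a::zero) \<Rightarrow> bool" where
  "null_zeros T \<phi> \<longleftrightarrow> {s \<in> {0..T}. \<phi> s = 0} \<in> null_sets lborel"

lemma path_closed_zeros: "path_in S T \<phi> \<Longrightarrow> closed {s \<in> {0..T}. \<phi> s = (0::'a::real_normed_vector)}"
  unfolding path_in_def by (intro continuous_closed_preimage_constant) auto

lemma null_zeros_join:
  fixes \<phi> \<psi> :: "real \<Rightarrow> 'a::real_normed_vector"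
  assumes n: "null_zeros s \<phi>" "null_zeros t \<psi>" and p: "path_in S (s + t) (path_join s \<phi> \<psi>)" "0 \<le> s"
    and eq: "\<phi> s = \<psi> 0"
  shows "null_zeros (s + t) (path_join s \<phi> \<psi>)"
  unfolding null_zeros_def
proof (rule null_sets_subset)
  show "{r \<in> {0..s}. \<phi> r = 0} \<union> {r. r - s \<in> {r \<in> {0..t}. \<psi> r = 0}} \<in> null_sets lborel"
    using n null_sets_translation unfolding null_zeros_def by blast
  show "{r \<in> {0..s+t}. path_join s \<phi> \<psi> r = 0} \<in> sets lborel"
    using path_closed_zeros[OF p(1)] by (simp add: borel_closed)
  show "{r \<in> {0..s+t}. path_join s \<phi> \<psi> r = 0} \<subseteq>
    {r \<in> {0..s}. \<phi> r = 0} \<union> {r. r - s \<in> {r \<in> {0..t}. \<psi> r = 0}}"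
    using eq by (auto simp: path_join_def split: if_splits)
qed

lemma null_zeros_open:
  fixes \<phi> :: "real \<Rightarrow> 'a::zero"
  assumes "\<And>s. 0 < s \<Longrightarrow> s < T \<Longrightarrow> \<phi> s \<noteq> 0"
  shows "null_zeros T \<phi>"
proof -
  have *: "{s \<in> {0..T}. \<phi> s = 0} \<subseteq> {0, T}"
  proof
    fix s assume "s \<in> {s \<in> {0..T}. \<phi> s = 0}"
    then show "s \<in> {0, T}" using assms[of s] by (cases "0 < s"; cases "s < T") auto
  qed
  then have "countable {s \<in> {0..T}. \<phi> s = 0}" by (rule countable_subset) simp
  then show ?thesis unfolding null_zeros_def by (rule countable_imp_null_set_lborel)
qed

context action_space
begin

text \<open>Between two zeros the path makes an excursion from the origin to the origin, which costs
  at least \<open>lam\<close> times its length by \<open>open_path_cost_ge\<close>. There may be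
  infinitely many excursions; their lengths add up to \<open>T\<close> because the zeros form a null
  set.\<close>

lemma null_loop_cost:
  assumes p: "path_in S T \<phi>" and T: "0 < T" and end0: "\<phi> 0 = 0" "\<phi> T = 0" and nz: "null_zeros T \<phi>"
  shows "ennreal (lam * T) \<le> J T \<phi>"
proof (cases "abs_continuous_path T \<phi>")
  case True
  define l where "l r = ennreal (lagrangian_along L T (restrict \<phi> {0..T}) r) * indicator {0..T} r" for r
  have "(\<lambda>r. ennreal (lagrangian_along L T (restrict \<phi> {0..T}) r)) \<in> borel_measurable (lebesgue_on {0..T})"
    using J_integral(1)[OF p T True] by (rule measurable_compose[OF _ measurable_ennreal])
  then have lm: "l \<in> borel_measurable lebesgue"
    unfolding l_def by (rule borel_measurable_restrict_space_iff_ennreal[THEN iffD1, rotated]) simp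
  \<comment> \<open>The action as a measure on the time axis: countable additivity then sums the
    costs of the excursions, as it does their lengths for Lebesgue measure.\<close>
  define \<nu> where "\<nu> = density lebesgue l"
  define Z where "Z = {s \<in> {0..T}. \<phi> s = 0}"
  define U where "U = {0<..<T} - Z"
  have U: "open U" "bounded U" unfolding U_def Z_def
    using path_closed_zeros[OF p] bounded_subset[OF bounded_closed_interval[of 0 T]] by (auto intro!: open_Diff)
  have Zn: "Z \<in> null_sets lebesgue" using nz by (simp add: Z_def null_zeros_def null_sets_completionI)
  have comp: "ennreal lam * emeasure lebesgue K \<le> emeasure \<nu> K \<and> open K" if K: "K \<in> components U" for K
  proof -
    obtain u v where uv: "u < v" "K = {u<..<v}" "u \<notin> U" "v \<notin> U" "u \<in> closure U" "v \<in> closure U"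
      using open_real_component[OF U K] by blast
    \<comment> \<open>An end point of an excursion lies in \<open>[0, T]\<close> but not in
      \<open>U\<close>, so it is a zero of the path or one of 0 and \<open>T\<close>, where the path
      vanishes as well.\<close>
    have "closure U \<subseteq> {0..T}" by (rule closure_minimal) (auto simp: U_def)
    then have uvT: "u \<in> {0..T}" "v \<in> {0..T}" using uv by auto
    have zero: "\<phi> u = 0" "\<phi> v = 0" using uv uvT end0 by (force simp: U_def Z_def)+
    have "K \<subseteq> U" using in_components_subset[OF K] .
    then have nzK: "\<phi> (u + r) \<noteq> 0" if "0 < r" "r < v - u" for r
      using that uv(2) uvT unfolding U_def Z_def by (auto simp: subset_eq)
    have "ennreal lam * emeasure lebesgue K = ennreal (lam * (v - u))"
      using uv lam_nonneg by (simp add: ennreal_mult)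
    also have "\<dots> \<le> J (v - u) (\<lambda>r. \<phi> (u + r))"
      using open_path_cost_ge[OF path_in_shift[OF p], of u "v - u"] uv uvT nzK zero by simp
    also have "\<dots> = (\<integral>\<^sup>+r\<in>{u..u+(v-u)}. ennreal (lagrangian_along L T (restrict \<phi> {0..T}) r) \<partial>lebesgue)"
      using uv uvT by (intro J_shift[OF p True]) auto
    also have "\<dots> = (\<integral>\<^sup>+r\<in>K. l r \<partial>lebesgue)"
    proof (rule nn_integral_cong_AE)
      have "AE r in lebesgue. r \<notin> {u, v}"
        by (rule AE_not_in) (simp add: null_sets_completionI)
      then show "AE r in lebesgue. ennreal (lagrangian_along L T (restrict \<phi> {0..T}) r) * indicator {u..u+(v-u)} r
          = l r * indicator K r"
        by eventually_elim (use uv uvT in \<open>auto simp: l_def split: split_indicator\<close>)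
    qed
    also have "\<dots> = emeasure \<nu> K" unfolding \<nu>_def using lm uv(2)
      by (subst emeasure_density) auto
    finally show ?thesis using uv(2) by simp
  qed
  have cc: "countable (components U)"
  proof (rule countable_disjoint_open_subsets)
    show "disjoint (components U)"
      using pairwise_disjoint_components[of U] by (simp add: pairwise_def disjnt_def)
  qed (use comp in auto)
  have dj: "disjoint_family_on (\<lambda>K. K) (components U)"
    using components_nonoverlap[of _ U] unfolding disjoint_family_on_def by blast
  have "emeasure lebesgue U = T"
    using emeasure_Diff_null_set[OF Zn, of "{0<..<T}"] T by (simp add: U_def)
  then have "ennreal (lam * T) = ennreal lam * emeasure lebesgue U"
    using T lam_nonneg by (simp add: ennreal_mult)
  also have "emeasure lebesgue U = (\<integral>\<^sup>+K. emeasure lebesgue K \<partial>count_space (components U))"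
    using emeasure_UN_countable[OF _ cc dj, of lebesgue] comp by simp
  also have "ennreal lam * \<dots> = (\<integral>\<^sup>+K. ennreal lam * emeasure lebesgue K \<partial>count_space (components U))"
    by (simp add: nn_integral_cmult)
  also have "\<dots> \<le> (\<integral>\<^sup>+K. emeasure \<nu> K \<partial>count_space (components U))"
    by (rule nn_integral_mono) (simp only: space_count_space comp)
  also have "\<dots> = emeasure \<nu> U"
    using emeasure_UN_countable[OF _ cc dj, of \<nu>] comp by (simp add: \<nu>_def)
  also have "\<dots> = (\<integral>\<^sup>+r. l r * indicator U r \<partial>lebesgue)"
    unfolding \<nu>_def using lm U by (subst emeasure_density) auto
  also have "\<dots> \<le> (\<integral>\<^sup>+r\<in>{0..0+T}. ennreal (lagrangian_along L T (restrict \<phi> {0..T}) r) \<partial>lebesgue)"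
    by (intro nn_integral_mono) (auto simp: l_def split: split_indicator)
  also have "\<dots> = J T \<phi>" using J_shift[OF p True, of 0 T] T by simp
  finally show ?thesis .
qed (use J_infinite[OF p T] in simp)

lemma J_segment_speed:
  assumes "x \<in> S" "y \<in> S" "x \<noteq> y"
  shows "0 < norm (y - x) / d0" "J (norm (y - x) / d0) (segment (norm (y - x) / d0) x y) \<le> ennreal (C * norm (y - x))"
proof -
  show "0 < norm (y - x) / d0" using assms d0 by simp
  from J_segment[OF assms(1,2) this] show "J (norm (y - x) / d0) (segment (norm (y - x) / d0) x y) \<le> ennreal (C * norm (y - x))"
    using d0 by (simp add: C_def)
qed

text \<open>Straight connections from the origin to the start and from the end to the origin make a
  loop for \<open>null_loop_cost\<close>, at a price of \<open>C\<close> times the two norms. They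
  vanish only at the origin end, so the zero set stays null. A connection of length 0 is skipped
  because durations must be positive.\<close>

lemma null_path_cost_ge:
  assumes p: "path_in S T \<phi>" and T: "0 < T" and nz: "null_zeros T \<phi>"
  shows "ennreal (lam * T - C * (norm (\<phi> 0) + norm (\<phi> T))) \<le> J T \<phi>"
proof -
  have m: "\<phi> 0 \<in> S" "\<phi> T \<in> S" using p T by (auto simp: path_in_def image_subset_iff)
  have "\<exists>T1 \<sigma>. path_in S T1 \<sigma> \<and> null_zeros T1 \<sigma> \<and> T \<le> T1 \<and> \<sigma> 0 = 0 \<and> \<sigma> T1 = \<phi> T \<and>
    J T1 \<sigma> \<le> J T \<phi> + ennreal (C * norm (\<phi> 0))"
  proof (cases "\<phi> 0 = 0")
    case True then show ?thesis using p nz by (intro exI[of _ T] exI[of _ \<phi>]) auto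
  next
    case False
    define s where "s = norm (\<phi> 0 - 0) / d0"
    have s: "s > 0" "J s (segment s 0 (\<phi> 0)) \<le> ennreal (C * norm (\<phi> 0))"
      using J_segment_speed[OF zero_S m(1)] False unfolding s_def by auto
    let ?\<sigma> = "path_join s (segment s 0 (\<phi> 0)) \<phi>"
    have pg: "path_in S s (segment s 0 (\<phi> 0))" using path_in_segment[OF convex_S zero_S m(1)] s by simp
    have p\<sigma>: "path_in S (s + T) ?\<sigma>" using pg p s T by (intro path_in_join) auto
    have "null_zeros s (segment s 0 (\<phi> 0))"
      using segment_nonzero[OF zero_S m(1) s(1)] False by (intro null_zeros_open) auto
    then have "null_zeros (s + T) ?\<sigma>" using nz p\<sigma> s by (intro null_zeros_join[where S = S]) auto
    moreover have "J (s + T) ?\<sigma> \<le> J T \<phi> + ennreal (C * norm (\<phi> 0))"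
      using J_join[OF pg p _ s(1) T] s by (simp add: add.commute add_left_mono)
    moreover have "?\<sigma> 0 = 0" "?\<sigma> (s + T) = \<phi> T" using s T by (auto simp: path_join_def)
    ultimately show ?thesis using p\<sigma> s by (intro exI[of _ "s + T"] exI[of _ ?\<sigma>]) auto
  qed
  then obtain T1 \<sigma> where \<sigma>: "path_in S T1 \<sigma>" "null_zeros T1 \<sigma>" "T \<le> T1" "\<sigma> 0 = 0" "\<sigma> T1 = \<phi> T"
    "J T1 \<sigma> \<le> J T \<phi> + ennreal (C * norm (\<phi> 0))" by blast
  have T1: "0 < T1" using T \<sigma> by simp
  have "ennreal (lam * T) \<le> J T1 \<sigma> + ennreal (C * norm (\<phi> T))"
  proof (cases "\<phi> T = 0")
    case True
    have "ennreal (lam * T) \<le> ennreal (lam * T1)" using \<sigma> lam_nonneg by (intro ennreal_leI mult_left_mono)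
    also have "\<dots> \<le> J T1 \<sigma>" using True \<sigma> T1 by (intro null_loop_cost) auto
    finally show ?thesis using True by simp
  next
    case False
    define s where "s = norm (0 - \<phi> T) / d0"
    have s: "s > 0" "J s (segment s (\<phi> T) 0) \<le> ennreal (C * norm (\<phi> T))"
      using J_segment_speed[OF m(2) zero_S] False unfolding s_def by auto
    let ?\<xi> = "path_join T1 \<sigma> (segment s (\<phi> T) 0)"
    have pg: "path_in S s (segment s (\<phi> T) 0)" using path_in_segment[OF convex_S m(2) zero_S] s by simp
    have p\<xi>: "path_in S (T1 + s) ?\<xi>" using pg \<sigma> s T1 by (intro path_in_join) auto
    have "null_zeros s (segment s (\<phi> T) 0)"
      using segment_nonzero[OF m(2) zero_S s(1)] False by (intro null_zeros_open) auto
    then have nz\<xi>: "null_zeros (T1 + s) ?\<xi>" using \<sigma> p\<xi> T1 by (intro null_zeros_join[where S = S]) auto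
    have "ennreal (lam * T) \<le> ennreal (lam * (T1 + s))"
      using \<sigma> lam_nonneg s by (intro ennreal_leI mult_left_mono) auto
    also have "\<dots> \<le> J (T1 + s) ?\<xi>"
      using p\<xi> nz\<xi> T1 s \<sigma> by (intro null_loop_cost) (auto simp: path_join_def)
    also have "\<dots> = J T1 \<sigma> + J s (segment s (\<phi> T) 0)"
      using \<sigma> pg T1 s by (intro J_join) auto
    also have "\<dots> \<le> J T1 \<sigma> + ennreal (C * norm (\<phi> T))" using s by (intro add_left_mono)
    finally show ?thesis .
  qed
  also have "\<dots> \<le> J T \<phi> + ennreal (C * norm (\<phi> 0)) + ennreal (C * norm (\<phi> T))"
    using \<sigma> by (intro add_right_mono)
  finally have *: "ennreal (lam * T) \<le> J T \<phi> + ennreal (C * norm (\<phi> 0)) + ennreal (C * norm (\<phi> T))" .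
  show ?thesis
  proof (cases "J T \<phi>")
    case (real j)
    then have "lam * T \<le> j + C * norm (\<phi> 0) + C * norm (\<phi> T)"
      using * C_nonneg by (simp flip: ennreal_plus)
    then show ?thesis using real by (simp add: algebra_simps ennreal_leI)
  qed simp
qed

text \<open>Counted from one repetition on, since \<open>J_join\<close> wants positive
  durations.\<close>

lemma repeated_loop:
  assumes "path_in S0 1 \<psi>" "\<psi> 0 = \<psi> 1" "J 1 \<psi> \<le> ennreal c" "0 \<le> c"
  shows "\<exists>\<phi>. path_in S0 (real n + 1) \<phi> \<and> \<phi> 0 = \<psi> 0 \<and> \<phi> (real n + 1) = \<psi> 0 \<and>
    J (real n + 1) \<phi> \<le> ennreal (c * (real n + 1))"
proof (induction n)
  case 0
  then show ?case using assms by (intro exI[of _ \<psi>]) auto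
next
  case (Suc n)
  then obtain \<phi> where \<phi>: "path_in S0 (real n + 1) \<phi>" "\<phi> 0 = \<psi> 0" "\<phi> (real n + 1) = \<psi> 0"
    "J (real n + 1) \<phi> \<le> ennreal (c * (real n + 1))" by blast
  let ?\<sigma> = "path_join (real n + 1) \<phi> \<psi>"
  have "path_in S0 (real n + 1 + 1) ?\<sigma>" using \<phi> assms by (intro path_in_join) auto
  moreover have "J (real n + 1 + 1) ?\<sigma> \<le> ennreal (c * (real n + 1)) + ennreal c"
    using \<phi> assms path_in_S0D J_join[of "real n + 1" \<phi> 1 \<psi>] by (simp add: add_mono)
  moreover have "ennreal (c * (real n + 1)) + ennreal c = ennreal (c * (real n + 1 + 1))"
    using assms(4) by (simp add: algebra_simps flip: ennreal_plus)
  moreover have "?\<sigma> 0 = \<psi> 0" "?\<sigma> (real n + 1 + 1) = \<psi> 0" using \<phi> assms by (auto simp: path_join_def)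
  ultimately show ?case by (intro exI[of _ ?\<sigma>]) (simp add: add.commute)
qed

text \<open>Go straight to the base point \<open>z\<close> of a near-optimal loop, run through it
  \<open>N\<close> times, go straight to \<open>y\<close>. The two connections have bounded
  duration, so their cost is a constant independent of \<open>t\<close>.\<close>

lemma connecting_path:
  assumes x: "x \<in> S" and y: "y \<in> S" and \<eta>: "0 < \<eta>"
  shows "\<exists>D\<ge>0. \<exists>t0>0. \<forall>t\<ge>t0. \<exists>\<phi>. path_in S t \<phi> \<and> \<phi> 0 = x \<and> \<phi> t = y \<and>
    (\<forall>s. 0 < s \<and> s < t \<longrightarrow> \<phi> s \<noteq> 0) \<and> J t \<phi> \<le> ennreal ((lam + \<eta>) * t + D)"
proof -
  obtain \<psi> where \<psi>: "path_in S0 1 \<psi>" "\<psi> 0 = \<psi> 1" "J 1 \<psi> < ennreal (lam + \<eta>)"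
    using near_optimal_loop[OF \<eta>] by blast
  define z where "z = \<psi> 0"
  have z: "z \<in> S0" using \<psi>(1) by (auto simp: z_def path_in_def image_subset_iff)
  \<comment> \<open>The summand 1 keeps the durations positive when the points coincide; the speeds
    stay at most \<open>d0\<close>.\<close>
  define t1 t3 where "t1 = norm (z - x) / d0 + 1" and "t3 = norm (y - z) / d0 + 1"
  have t13: "0 < t1" "0 < t3" using d0 by (auto simp: t1_def t3_def intro!: add_nonneg_pos)
  have lp: "0 < lam + \<eta>" using lam_nonneg \<eta> by simp
  show ?thesis
  proof (rule exI[of _ "C0 * (t1 + t3 + 1)"], rule conjI[rotated], rule exI[of _ "t1 + t3 + 1"],
      intro conjI allI impI)
    fix t assume t: "t1 + t3 + 1 \<le> t"
    \<comment> \<open>The loops fill a whole number of time units; the fractional rest goes into the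
      last segment, whose duration \<open>u\<close> lies between \<open>t3\<close> and
      \<open>t3 + 1\<close>.\<close>
    define N where "N = nat \<lfloor>t - t1 - t3\<rfloor>"
    have N: "real N \<le> t - t1 - t3" "t - t1 - t3 < real N + 1" "1 \<le> N"
      using t by (auto simp: N_def le_nat_iff le_floor_iff)
    define u where "u = t - t1 - real N"
    have u: "t3 \<le> u" "u \<le> t3 + 1" "0 < u" using N t13 by (auto simp: u_def)
    have tsum: "t = t1 + (real N + u)" by (simp add: u_def)
    obtain \<sigma> where \<sigma>: "path_in S0 (real N) \<sigma>" "\<sigma> 0 = z" "\<sigma> (real N) = z" "J (real N) \<sigma> \<le> ennreal ((lam + \<eta>) * real N)"
      using repeated_loop[OF \<psi>(1,2) less_imp_le[OF \<psi>(3)], of "N - 1"] lp N(3) by (auto simp: z_def of_nat_diff)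
    let ?g = "segment t1 x z" and ?h = "segment u z y"
    have pg: "path_in S t1 ?g" using path_in_segment[OF convex_S x] z t13 by auto
    have ph: "path_in S u ?h" using path_in_segment[OF convex_S _ y] z u by auto
    let ?r = "path_join (real N) \<sigma> ?h"
    let ?p = "path_join t1 ?g ?r"
    have N0: "0 < real N" using N by simp
    have pr: "path_in S (real N + u) ?r" using path_in_S0D[OF \<sigma>(1)] ph \<sigma> N0 u by (intro path_in_join) auto
    have r0: "?r 0 = z" using \<sigma> N0 by (simp add: path_join_def)
    have pp: "path_in S t ?p" unfolding tsum by (rule path_in_join[OF pg pr]) (use r0 t13 N0 u in auto)
    have Jg: "J t1 ?g \<le> ennreal (C0 * t1)"
      using x z t13 d0 by (intro J_segment) (auto simp: t1_def field_simps)
    have Jh: "J u ?h \<le> ennreal (C0 * u)"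
    proof (rule J_segment)
      have "norm (y - z) \<le> d0 * t3" using d0 by (simp add: t3_def field_simps)
      also have "\<dots> \<le> d0 * u" using u d0 by simp
      finally show "norm (y - z) \<le> d0 * u" .
    qed (use y z u in auto)
    have "J t ?p = J t1 ?g + J (real N + u) ?r"
      unfolding tsum by (rule J_join[OF pg pr]) (use r0 t13 N0 u in auto)
    also have "J (real N + u) ?r = J (real N) \<sigma> + J u ?h"
      using path_in_S0D[OF \<sigma>(1)] ph \<sigma> N0 u by (intro J_join) auto
    also have "J t1 ?g + (J (real N) \<sigma> + J u ?h) \<le>
        ennreal (C0 * t1) + (ennreal ((lam + \<eta>) * real N) + ennreal (C0 * u))"
      by (intro add_mono Jg \<sigma>(4) Jh)
    also have "\<dots> = ennreal (C0 * t1 + ((lam + \<eta>) * real N + C0 * u))"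
      using C0 t13 u lp by (simp flip: ennreal_plus)
    also have "\<dots> \<le> ennreal ((lam + \<eta>) * t + C0 * (t1 + t3 + 1))"
    proof (rule ennreal_leI)
      have "(lam + \<eta>) * real N \<le> (lam + \<eta>) * t" using N t13 lp by (intro mult_left_mono) auto
      moreover have "C0 * u \<le> C0 * (t3 + 1)" using u C0 by (intro mult_left_mono) auto
      ultimately show "C0 * t1 + ((lam + \<eta>) * real N + C0 * u) \<le> (lam + \<eta>) * t + C0 * (t1 + t3 + 1)"
        by (simp add: algebra_simps)
    qed
    finally have cost: "J t ?p \<le> ennreal ((lam + \<eta>) * t + C0 * (t1 + t3 + 1))" .
    have nz: "?p s \<noteq> 0" if s: "0 < s" "s < t" for s
    proof -
      consider "s < t1" | "t1 \<le> s" "s \<le> t1 + real N" | "t1 + real N < s" by linarith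
      then show ?thesis
      proof cases
        case 1 then show ?thesis
          using segment_nonzero[OF x _ t13(1) s(1), of z] z by (simp add: path_join_def)
      next
        case 2
        then have "?p s = \<sigma> (s - t1)" using t13 r0 \<sigma> by (auto simp: path_join_def)
        then show ?thesis using path_inD[OF \<sigma>(1), of "s - t1"] 2 by auto
      next
        case 3
        then have "?p s = ?h (s - t1 - real N)" using t13 by (auto simp: path_join_def)
        then show ?thesis
          using segment_nonzero[of z y u "s - t1 - real N"] 3 s z y u by (auto simp: u_def)
      qed
    qed
    have "?p 0 = x" "?p t = y" using t13 N0 u by (auto simp: path_join_def u_def)
    then show "\<exists>\<phi>. path_in S t \<phi> \<and> \<phi> 0 = x \<and> \<phi> t = y \<and>
      (\<forall>s. 0 < s \<and> s < t \<longrightarrow> \<phi> s \<noteq> 0) \<and> J t \<phi> \<le> ennreal ((lam + \<eta>) * t + C0 * (t1 + t3 + 1))"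
      using pp nz cost by (intro exI[of _ ?p]) auto
  qed (use C0 t13 in auto)
qed

end

section \<open>Identification of the variational expressions\<close>

lemma ereal_le_enn2ereal: "ennreal c \<le> x \<Longrightarrow> ereal c \<le> enn2ereal x"
  by (metis enn2ereal_ennreal enn2ereal_nonneg ereal_less_eq(3) less_eq_ennreal.rep_eq linear
      order.trans zero_ereal_def)

lemma enn2ereal_le_ereal: "x \<le> ennreal c \<Longrightarrow> 0 \<le> c \<Longrightarrow> enn2ereal x \<le> ereal c"
  by (metis enn2ereal_ennreal less_eq_ennreal.rep_eq)

lemma ereal_le_add_all: 
  fixes a :: ereal
  assumes "\<And>\<eta>. 0 < \<eta> \<Longrightarrow> a \<le> ereal (b + \<eta>)"
  shows "a \<le> ereal b"
  by (rule ereal_le_epsilon2) (use assms in auto)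

context action_space
begin

lemma continuous_pathsD:
  assumes "\<phi> \<in> continuous_paths t S"
  shows "path_in S t \<phi>" "I t \<phi> = J t \<phi>"
proof -
  have "restrict \<phi> {0..t} = \<phi>" using assms by (auto simp: continuous_paths_def PiE_restrict)
  then show "I t \<phi> = J t \<phi>" by (simp add: path_cost_def)
  show "path_in S t \<phi>" using assms by (auto simp: continuous_paths_def path_in_def)
qed

lemma restrict_continuous_paths:
  assumes "path_in S t \<phi>"
  shows "restrict \<phi> {0..t} \<in> continuous_paths t S"
proof -
  have "continuous_on {0..t} (restrict \<phi> {0..t}) \<longleftrightarrow> continuous_on {0..t} \<phi>"
    by (rule continuous_on_cong) auto
  then show ?thesis using assms by (auto simp: continuous_paths_def path_in_def)
qed

lemma I_zero_le:
  assumes "path_in S t \<phi>" "0 < t" "\<And>s. 0 < s \<Longrightarrow> s < t \<Longrightarrow> \<phi> s \<noteq> 0"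
  shows "I_zero S I t (\<phi> 0) (\<phi> t) \<le> enn2ereal (J t \<phi>)"
  unfolding I_zero_def path_cost_def
  using assms by (intro INF_lower) (auto intro: restrict_continuous_paths)

lemma I_hat_le_I_zero:
  assumes "0 < t"
  shows "I_hat S I t x y \<le> I_zero S I t x y"
  unfolding I_hat_def I_zero_def
  using null_zeros_open[of t] by (intro INF_superset_mono) (auto simp: null_zeros_def)

lemma I_hat_ge:
  assumes "0 < t"
  shows "ereal (lam * t - C * (norm x + norm y)) \<le> I_hat S I t x y"
  unfolding I_hat_def
proof (rule INF_greatest)
  fix \<phi> assume \<phi>: "\<phi> \<in> {\<phi> \<in> continuous_paths t S. \<phi> 0 = x \<and> \<phi> t = y \<and> {s \<in> {0..t}. \<phi> s = 0} \<in> null_sets lborel}"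
  then have "ennreal (lam * t - C * (norm (\<phi> 0) + norm (\<phi> t))) \<le> J t \<phi>"
    using assms by (intro null_path_cost_ge continuous_pathsD) (auto simp: null_zeros_def)
  then show "ereal (lam * t - C * (norm x + norm y)) \<le> enn2ereal (I t \<phi>)"
    using \<phi> continuous_pathsD[of \<phi> t] ereal_le_enn2ereal by auto
qed

lemma I_zero_upper:
  assumes "x \<in> S" "y \<in> S" "0 < \<eta>"
  shows "\<exists>D. \<forall>\<^sub>F t in at_top. I_zero S I t x y \<le> ereal ((lam + \<eta>) * t + D)"
proof -
  obtain D t0 where D: "D \<ge> 0" "t0 > 0" "\<forall>t\<ge>t0. \<exists>\<phi>. path_in S t \<phi> \<and> \<phi> 0 = x \<and> \<phi> t = y \<and>
    (\<forall>s. 0 < s \<and> s < t \<longrightarrow> \<phi> s \<noteq> 0) \<and> J t \<phi> \<le> ennreal ((lam + \<eta>) * t + D)"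
    using connecting_path[OF assms] by blast
  have "I_zero S I t x y \<le> ereal ((lam + \<eta>) * t + D)" if t: "t \<ge> t0" for t
  proof -
    obtain \<phi> where \<phi>: "path_in S t \<phi>" "\<phi> 0 = x" "\<phi> t = y"
      "\<forall>s. 0 < s \<and> s < t \<longrightarrow> \<phi> s \<noteq> 0" "J t \<phi> \<le> ennreal ((lam + \<eta>) * t + D)" using D(3) t by blast
    have "I_zero S I t x y \<le> enn2ereal (J t \<phi>)"
      using I_zero_le[OF \<phi>(1)] \<phi>(2-4) t D(2) by auto
    also have "\<dots> \<le> ereal ((lam + \<eta>) * t + D)"
      using \<phi>(5) t D(1,2) lam_nonneg assms(3) by (intro enn2ereal_le_ereal) auto
    finally show ?thesis .
  qed
  then show ?thesis by (intro exI[of _ D]) (auto simp: eventually_at_top_linorder)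
qed

lemma Limsup_I_zero_le:
  assumes "x \<in> S" "y \<in> S"
  shows "Limsup at_top (\<lambda>t. I_zero S I t x y / ereal t) \<le> ereal lam"
proof (rule ereal_le_add_all)
  fix \<eta> :: real assume \<eta>: "0 < \<eta>"
  obtain D where D: "\<forall>\<^sub>F t in at_top. I_zero S I t x y \<le> ereal ((lam + \<eta>) * t + D)"
    using I_zero_upper[OF assms \<eta>] by blast
  have lim: "((\<lambda>t. ereal (lam + \<eta> + D / t)) \<longlongrightarrow> ereal (lam + \<eta> + 0)) at_top"
    by (intro tendsto_ereal tendsto_add tendsto_const tendsto_divide_0[OF tendsto_const] filterlim_at_top_imp_at_infinity filterlim_ident)
  have "Limsup at_top (\<lambda>t. I_zero S I t x y / ereal t) \<le> Limsup at_top (\<lambda>t. ereal (lam + \<eta> + D / t))"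
  proof (rule Limsup_mono)
    show "\<forall>\<^sub>F t in at_top. I_zero S I t x y / ereal t \<le> ereal (lam + \<eta> + D / t)"
      using D eventually_gt_at_top[of 0]
    proof eventually_elim
      case (elim t)
      have "I_zero S I t x y / ereal t \<le> ereal ((lam + \<eta>) * t + D) / ereal t"
        using elim by (intro ereal_divide_right_mono) auto
      also have "\<dots> = ereal (lam + \<eta> + D / t)" using elim by (simp add: field_simps)
      finally show ?case .
    qed
  qed
  also have "\<dots> = ereal (lam + \<eta>)" using lim_imp_Limsup[OF _ lim] by simp
  finally show "Limsup at_top (\<lambda>t. I_zero S I t x y / ereal t) \<le> ereal (lam + \<eta>)" .
qed

lemma Limsup_I_hat_ge: "ereal lam \<le> Limsup at_top (\<lambda>t. I_hat S I t x y / ereal t)"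
proof -
  define D where "D = C * (norm x + norm y)"
  have lim: "((\<lambda>t. ereal (lam - D / t)) \<longlongrightarrow> ereal (lam - 0)) at_top"
    by (intro tendsto_ereal tendsto_diff tendsto_const tendsto_divide_0[OF tendsto_const] filterlim_at_top_imp_at_infinity filterlim_ident)
  have "ereal lam = Limsup at_top (\<lambda>t. ereal (lam - D / t))"
    using lim_imp_Limsup[OF _ lim] by simp
  also have "\<dots> \<le> Limsup at_top (\<lambda>t. I_hat S I t x y / ereal t)"
  proof (rule Limsup_mono)
    show "\<forall>\<^sub>F t in at_top. ereal (lam - D / t) \<le> I_hat S I t x y / ereal t"
      using eventually_gt_at_top[of 0]
    proof eventually_elim
      case (elim t)
      have "ereal (lam - D / t) = ereal (lam * t - D) / ereal t"
        using elim by (simp add: field_simps)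
      also have "\<dots> \<le> I_hat S I t x y / ereal t"
        using elim I_hat_ge[OF elim, of x y] by (intro ereal_divide_right_mono) (auto simp: D_def)
      finally show ?case .
    qed
  qed
  finally show ?thesis .
qed

lemma Limsup_I_hat_le: "Limsup at_top (\<lambda>t. I_hat S I t x y / ereal t) \<le> Limsup at_top (\<lambda>t. I_zero S I t x y / ereal t)"
proof (rule Limsup_mono)
  show "\<forall>\<^sub>F t in at_top. I_hat S I t x y / ereal t \<le> I_zero S I t x y / ereal t"
    using eventually_gt_at_top[of 0]
    by eventually_elim (auto intro!: ereal_divide_right_mono I_hat_le_I_zero)
qed

text \<open>\<open>I_hat\<close> is below \<open>I_zero\<close>, so a lower bound for the former and
  an upper bound for the latter settle both.\<close>

lemma Limsup_I_zero: "x \<in> S \<Longrightarrow> y \<in> S \<Longrightarrow> Limsup at_top (\<lambda>t. I_zero S I t x y / ereal t) = ereal lam"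
  by (intro antisym Limsup_I_zero_le order_trans[OF Limsup_I_hat_ge Limsup_I_hat_le])

lemma Limsup_I_hat: "x \<in> S \<Longrightarrow> y \<in> S \<Longrightarrow> Limsup at_top (\<lambda>t. I_hat S I t x y / ereal t) = ereal lam"
  by (intro antisym Limsup_I_hat_ge order_trans[OF Limsup_I_hat_le Limsup_I_zero_le])

text \<open>Starting and ending at the origin leaves no correction in \<open>I_hat_ge\<close>. For
  the other direction a long path from the origin to itself is shrunk to duration 1; this divides
  its action by its duration, which makes the constant \<open>D\<close> negligible.\<close>

lemma I_star_eq: "I_star S I = ereal lam"
proof (rule antisym)
  show "ereal lam \<le> I_star S I" using I_hat_ge[of 1 0 0] by (simp add: I_star_def)
  show "I_star S I \<le> ereal lam"
  proof (rule ereal_le_add_all)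
    fix \<eta> :: real assume \<eta>: "0 < \<eta>"
    then have \<eta>2: "0 < \<eta>/2" by simp
    have lp: "0 < lam + \<eta>/2" using lam_nonneg \<eta> by simp
    obtain D t0 where D: "D \<ge> 0" "t0 > 0" "\<forall>t\<ge>t0. \<exists>\<phi>. path_in S t \<phi> \<and> \<phi> 0 = 0 \<and> \<phi> t = 0 \<and>
      (\<forall>s. 0 < s \<and> s < t \<longrightarrow> \<phi> s \<noteq> 0) \<and> J t \<phi> \<le> ennreal ((lam + \<eta>/2) * t + D)"
      using connecting_path[OF zero_S zero_S \<eta>2] by blast
    define t where "t = max t0 (2 * D / \<eta>)"
    have t: "t0 \<le> t" "0 < t" "D / t \<le> \<eta>/2"
    proof -
      show "t0 \<le> t" "0 < t" using D(2) by (auto simp: t_def)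
      have "2 * D / \<eta> \<le> t" by (simp add: t_def)
      then show "D / t \<le> \<eta>/2" using \<eta> \<open>0 < t\<close> by (simp add: field_simps)
    qed
    obtain \<phi> where \<phi>: "path_in S t \<phi>" "\<phi> 0 = 0" "\<phi> t = 0"
      "\<forall>s. 0 < s \<and> s < t \<longrightarrow> \<phi> s \<noteq> 0" "J t \<phi> \<le> ennreal ((lam + \<eta>/2) * t + D)" using D(3) t(1) by blast
    let ?\<psi> = "\<lambda>s. (1/t) *\<^sub>R \<phi> (t * s)"
    have p: "path_in S 1 ?\<psi>"
      using path_in_scale[OF \<phi>(1), of "1/t"] t cone by (simp add: mult.commute)
    have "ennreal t * J 1 ?\<psi> \<le> ennreal ((lam + \<eta>/2) * t + D)"
      using J_unit[OF \<phi>(1) t(2)] \<phi>(5) by simp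
    also have "(lam + \<eta>/2) * t + D = t * (lam + \<eta>/2 + D/t)" using t by (simp add: field_simps)
    also have "ennreal \<dots> = ennreal t * ennreal (lam + \<eta>/2 + D/t)"
      using t lp D(1) by (intro ennreal_mult) auto
    finally have "J 1 ?\<psi> \<le> ennreal (lam + \<eta>/2 + D/t)"
      using t by (subst (asm) ennreal_mult_le_mult_iff) auto
    also have "\<dots> \<le> ennreal (lam + \<eta>)" using t(3) by (intro ennreal_leI) linarith
    finally have J1: "J 1 ?\<psi> \<le> ennreal (lam + \<eta>)" .
    have nz: "?\<psi> s \<noteq> 0" if "0 < s" "s < 1" for s
      using \<phi>(4) that t by simp
    have "I_star S I \<le> I_zero S I 1 (?\<psi> 0) (?\<psi> 1)"
      using I_hat_le_I_zero[of 1 0 0] \<phi>(2,3) by (simp add: I_star_def)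
    also have "\<dots> \<le> enn2ereal (J 1 ?\<psi>)" using nz by (intro I_zero_le p) auto
    also have "\<dots> \<le> ereal (lam + \<eta>)" using J1 lam_nonneg \<eta> by (intro enn2ereal_le_ereal) auto
    finally show "I_star S I \<le> ereal (lam + \<eta>)" .
  qed
qed

text \<open>In \<open>open_path_cost_ge\<close> the correction vanishes for a loop, so admitting
  loops based at the origin does not lower the infimum.\<close>

lemma INF_loops:
  "(INF \<phi>\<in>{\<phi> \<in> continuous_paths 1 S. \<phi> 0 = \<phi> 1 \<and> (\<forall>t. 0 < t \<and> t < 1 \<longrightarrow> \<phi> t \<noteq> 0)}. enn2ereal (I 1 \<phi>)) = ereal lam"
proof (rule antisym)
  show "ereal lam \<le> (INF \<phi>\<in>{\<phi> \<in> continuous_paths 1 S. \<phi> 0 = \<phi> 1 \<and> (\<forall>t. 0 < t \<and> t < 1 \<longrightarrow> \<phi> t \<noteq> 0)}. enn2ereal (I 1 \<phi>))"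
  proof (rule INF_greatest)
    fix \<phi> assume \<phi>: "\<phi> \<in> {\<phi> \<in> continuous_paths 1 S. \<phi> 0 = \<phi> 1 \<and> (\<forall>t. 0 < t \<and> t < 1 \<longrightarrow> \<phi> t \<noteq> 0)}"
    then have "ennreal (lam * 1 - C * norm (\<phi> 1 - \<phi> 0)) \<le> J 1 \<phi>"
      by (intro open_path_cost_ge continuous_pathsD) auto
    then show "ereal lam \<le> enn2ereal (I 1 \<phi>)"
      using \<phi> continuous_pathsD[of \<phi> 1] ereal_le_enn2ereal by auto
  qed
  show "(INF \<phi>\<in>{\<phi> \<in> continuous_paths 1 S. \<phi> 0 = \<phi> 1 \<and> (\<forall>t. 0 < t \<and> t < 1 \<longrightarrow> \<phi> t \<noteq> 0)}. enn2ereal (I 1 \<phi>)) \<le> ereal lam"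
  proof (rule ereal_le_add_all)
    fix \<eta> :: real assume \<eta>: "0 < \<eta>"
    obtain \<psi> where \<psi>: "path_in S0 1 \<psi>" "\<psi> 0 = \<psi> 1" "J 1 \<psi> < ennreal (lam + \<eta>)"
      using near_optimal_loop[OF \<eta>] by blast
    have nz: "\<psi> t \<noteq> 0" if "0 < t" "t < 1" for t using path_inD[OF \<psi>(1), of t] that by auto
    have "(INF \<phi>\<in>{\<phi> \<in> continuous_paths 1 S. \<phi> 0 = \<phi> 1 \<and> (\<forall>t. 0 < t \<and> t < 1 \<longrightarrow> \<phi> t \<noteq> 0)}. enn2ereal (I 1 \<phi>))
      \<le> enn2ereal (I 1 (restrict \<psi> {0..1}))"
      using restrict_continuous_paths[OF path_in_S0D[OF \<psi>(1)]] \<psi>(2) nz by (intro INF_lower) auto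
    also have "\<dots> \<le> ereal (lam + \<eta>)"
      using \<psi>(3) lam_nonneg \<eta> by (intro enn2ereal_le_ereal) (auto simp: path_cost_def)
    finally show "(INF \<phi>\<in>{\<phi> \<in> continuous_paths 1 S. \<phi> 0 = \<phi> 1 \<and> (\<forall>t. 0 < t \<and> t < 1 \<longrightarrow> \<phi> t \<noteq> 0)}. enn2ereal (I 1 \<phi>)) \<le> ereal (lam + \<eta>)" .
  qed
qed

section \<open>The value function\<close>

text \<open>Time spent away from the origin is credited at rate \<open>lam\<close>; the terminal term bounds the cost
  of the return, which keeps \<open>V\<close> finite.\<close>

definition values_from :: "'a \<Rightarrow> real set" where
  "values_from z = {enn2real (J T \<phi>) - lam * T + C * norm (\<phi> T) |T \<phi>.
     0 < T \<and> path_in S0 T \<phi> \<and> \<phi> 0 = z \<and> J T \<phi> \<noteq> \<infinity>}"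

text \<open>No path in \<open>S0\<close> starts at the origin, so the value there is set by hand; 0
  is the one that makes \<open>V\<close> continuous, as the absolute value of \<open>V z\<close> is
  at most \<open>C * norm z\<close>.\<close>

definition V :: "'a \<Rightarrow> real" where
  "V z = (if z = 0 then 0 else Inf (values_from z))"

lemma values_fromE:
  assumes "v \<in> values_from z"
  obtains T \<phi> j where "v = j - lam * T + C * norm (\<phi> T)" "0 < T" "path_in S0 T \<phi>" "\<phi> 0 = z"
    "J T \<phi> = ennreal j" "0 \<le> j"
proof -
  obtain T \<phi> where v: "v = enn2real (J T \<phi>) - lam * T + C * norm (\<phi> T)"
    "0 < T" "path_in S0 T \<phi>" "\<phi> 0 = z" "J T \<phi> \<noteq> \<infinity>" using assms unfolding values_from_def by blast
  show ?thesis
    by (rule that[of "enn2real (J T \<phi>)" T \<phi>]) (use v in \<open>auto simp: less_top\<close>)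
qed

lemma values_fromI:
  assumes "0 < T" "path_in S0 T \<phi>" "J T \<phi> = ennreal j" "0 \<le> j"
  shows "j - lam * T + C * norm (\<phi> T) \<in> values_from (\<phi> 0)"
  unfolding values_from_def using assms by (intro CollectI exI[of _ T] exI[of _ \<phi>]) auto

text \<open>By \<open>path_cost_ge\<close> the credit \<open>lam * T\<close> exceeds the action by
  at most \<open>C\<close> times the distance between the end points, and the terminal term pays for
  this up to \<open>C * norm z\<close>.\<close>

lemma values_from_ge:
  assumes "v \<in> values_from z"
  shows "- C * norm z \<le> v"
proof -
  obtain T \<phi> j where v: "v = j - lam * T + C * norm (\<phi> T)" "0 < T" "path_in S0 T \<phi>" "\<phi> 0 = z"
    "J T \<phi> = ennreal j" "0 \<le> j" using values_fromE[OF assms] by metis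
  have "lam * T - C * norm (\<phi> T - z) \<le> j"
    using path_cost_ge[OF v(3,2)] v(4-6) by simp
  moreover have "C * norm (\<phi> T - z) \<le> C * (norm (\<phi> T) + norm z)"
    using C_nonneg norm_triangle_ineq4 by (intro mult_left_mono) auto
  ultimately show ?thesis using v(1) by (simp add: algebra_simps)
qed

lemma bdd_below_values_from: "bdd_below (values_from z)"
  using values_from_ge unfolding bdd_below_def by blast

lemma values_from_const:
  assumes "z \<in> S0" "0 < t"
  shows "\<exists>v\<in>values_from z. v \<le> C0 * t + C * norm z"
proof -
  have p: "path_in S0 t (segment t z z)" using path_in_segment[OF convex_0 assms(1,1,2)] .
  have "J t (segment t z z) \<le> ennreal (C0 * t)" using assms d0 by (intro J_segment) auto
  then obtain j where j: "J t (segment t z z) = ennreal j" "0 \<le> j" "j \<le> C0 * t"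
    using assms C0 by (cases "J t (segment t z z)") (auto simp: top_unique)
  have "j - lam * t + C * norm z \<in> values_from z"
    using values_fromI[OF assms(2) p j(1,2)] assms(2) by simp
  moreover have "j - lam * t + C * norm z \<le> C0 * t + C * norm z"
    using j lam_nonneg assms(2) mult_nonneg_nonneg[of lam t] by linarith
  ultimately show ?thesis by blast
qed

lemma values_from_nonempty: "z \<in> S \<Longrightarrow> z \<noteq> 0 \<Longrightarrow> values_from z \<noteq> {}"
  using values_from_const[of z 1] by auto

lemma V_le_value: "v \<in> values_from z \<Longrightarrow> z \<noteq> 0 \<Longrightarrow> V z \<le> v"
  using bdd_below_values_from by (simp add: V_def cInf_lower)

lemma V_greatest: "z \<in> S \<Longrightarrow> z \<noteq> 0 \<Longrightarrow> (\<And>v. v \<in> values_from z \<Longrightarrow> c \<le> v) \<Longrightarrow> c \<le> V z"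
  using values_from_nonempty by (simp add: V_def cInf_greatest)

lemma V_ge: "z \<in> S \<Longrightarrow> - C * norm z \<le> V z"
  using V_greatest[of z "- C * norm z"] values_from_ge by (cases "z = 0") (auto simp: V_def)

lemma V_le:
  assumes z: "z \<in> S"
  shows "V z \<le> C * norm z"
proof (cases "z = 0")
  case False
  show ?thesis
  proof (rule field_le_epsilon)
    fix e :: real assume e: "0 < e"
    \<comment> \<open>Durations must be positive, so the bound is approached by constant paths of
      vanishing duration.\<close>
    define t where "t = e / (C0 + 1)"
    have t: "0 < t" "C0 * t \<le> e" using e C0 by (auto simp: t_def field_simps)
    obtain v where v: "v \<in> values_from z" "v \<le> C0 * t + C * norm z"
      using values_from_const[of z t] z False t by auto
    show "V z \<le> C * norm z + e" using V_le_value[OF v(1) False] v t by linarith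
  qed
qed (simp add: V_def)

text \<open>Dynamic programming: \<open>\<phi>\<close> followed by a path from
  \<open>\<phi> T\<close> competes in the infimum for \<open>V (\<phi> 0)\<close>.\<close>

lemma V_step:
  assumes p: "path_in S0 T \<phi>" and T: "0 < T"
  shows "ennreal (V (\<phi> 0) - V (\<phi> T) + lam * T) \<le> J T \<phi>"
proof (cases "J T \<phi>")
  case (real j)
  have m: "\<phi> 0 \<in> S0" "\<phi> T \<in> S0" using p T by (auto simp: path_in_def image_subset_iff)
  have "V (\<phi> 0) - j + lam * T \<le> v" if v: "v \<in> values_from (\<phi> T)" for v
  proof -
    obtain U \<psi> k where \<psi>: "v = k - lam * U + C * norm (\<psi> U)" "0 < U" "path_in S0 U \<psi>" "\<psi> 0 = \<phi> T"
      "J U \<psi> = ennreal k" "0 \<le> k" using values_fromE[OF v] by metis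
    let ?p = "path_join T \<phi> \<psi>"
    have Jp: "J (T + U) ?p = ennreal (j + k)"
      using J_join[OF path_in_S0D[OF p] path_in_S0D[OF \<psi>(3)]] \<psi> T real by simp
    have "path_in S0 (T + U) ?p" by (rule path_in_join[OF p \<psi>(3)]) (use \<psi> T in auto)
    from values_fromI[OF _ this Jp] have
      "(j + k) - lam * (T + U) + C * norm (?p (T + U)) \<in> values_from (?p 0)"
      using T \<psi>(2,6) real by simp
    moreover have "?p (T + U) = \<psi> U" "?p 0 = \<phi> 0" using \<psi>(2) T by (auto simp: path_join_def)
    ultimately have "V (\<phi> 0) \<le> (j + k) - lam * (T + U) + C * norm (\<psi> U)"
      using m by (intro V_le_value) auto
    then show ?thesis using \<psi>(1) by (simp add: algebra_simps)
  qed
  then have "V (\<phi> 0) - j + lam * T \<le> V (\<phi> T)" using m by (intro V_greatest) auto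
  then show ?thesis using real by (simp add: ennreal_leI)
qed simp

text \<open>\<open>V_step\<close> along the straight connection at speed \<open>d0\<close>. The
  origin, which no path in \<open>S0\<close> may touch, is covered by the two-sided bound by
  \<open>C * norm z\<close>.\<close>

lemma V_lipschitz_le:
  assumes z: "z \<in> S" and w: "w \<in> S"
  shows "V z \<le> V w + C * norm (z - w)"
proof -
  consider "z = w" | "z = 0" | "w = 0" | "z \<noteq> w" "z \<noteq> 0" "w \<noteq> 0" by blast
  then show ?thesis
  proof cases
    case 1 then show ?thesis using C_nonneg by simp
  next
    case 2 then show ?thesis using V_ge[OF w] by (simp add: V_def)
  next
    case 3 then show ?thesis using V_le[OF z] by (simp add: V_def)
  next
    case 4
    define t where "t = norm (w - z) / d0"
    have t: "0 < t" "J t (segment t z w) \<le> ennreal (C * norm (w - z))"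
      using J_segment_speed[OF z w] 4 by (auto simp: t_def)
    have "path_in S0 t (segment t z w)" using path_in_segment[OF convex_0] z w 4 t by auto
    from V_step[OF this t(1)] have "ennreal (V z - V w + lam * t) \<le> J t (segment t z w)"
      using t(1) by simp
    also note t(2)
    finally have "ennreal (V z - V w + lam * t) \<le> ennreal (C * norm (w - z))" .
    then have "V z - V w + lam * t \<le> C * norm (w - z)"
      using C_nonneg by (simp add: ennreal_le_iff)
    moreover have "0 \<le> lam * t" using lam_nonneg t by simp
    ultimately show ?thesis by (simp add: norm_minus_commute)
  qed
qed

text \<open>The scaling multiplies action, duration and terminal term alike by \<open>c\<close>. The
  inverse scaling then yields equality in \<open>V_scale\<close>.\<close>

lemma V_scale_le:
  assumes z: "z \<in> S" and c: "0 < c"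
  shows "V (c *\<^sub>R z) \<le> c * V z"
proof (cases "z = 0")
  case False
  have "V (c *\<^sub>R z) / c \<le> v" if v: "v \<in> values_from z" for v
  proof -
    obtain T \<phi> j where \<phi>: "v = j - lam * T + C * norm (\<phi> T)" "0 < T" "path_in S0 T \<phi>" "\<phi> 0 = z"
      "J T \<phi> = ennreal j" "0 \<le> j" using values_fromE[OF v] by metis
    let ?\<psi> = "\<lambda>t. c *\<^sub>R \<phi> (t / c)"
    have J\<psi>: "J (c * T) ?\<psi> = ennreal (c * j)"
      using scaling[OF path_in_S0D[OF \<phi>(3)] \<phi>(2) c] \<phi>(5,6) c by (simp add: ennreal_mult)
    have "c * j - lam * (c * T) + C * norm (?\<psi> (c * T)) \<in> values_from (?\<psi> 0)"
      using path_in_S0_scale[OF \<phi>(3) c] \<phi>(2,6) c J\<psi> by (intro values_fromI) auto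
    then have "V (c *\<^sub>R z) \<le> c * j - lam * (c * T) + C * norm (?\<psi> (c * T))"
      using False c \<phi>(4) by (intro V_le_value) auto
    also have "\<dots> = c * v" unfolding \<phi>(1) using c by (simp add: algebra_simps)
    finally show ?thesis using c by (simp add: field_simps)
  qed
  then have "V (c *\<^sub>R z) / c \<le> V z" using False z by (intro V_greatest)
  then show ?thesis using c by (simp add: field_simps)
qed (simp add: V_def)

lemma V_scale:
  assumes z: "z \<in> S" and c: "0 < c"
  shows "V (c *\<^sub>R z) = c * V z"
proof (rule antisym[OF V_scale_le[OF assms]])
  have "V ((1/c) *\<^sub>R (c *\<^sub>R z)) \<le> (1/c) * V (c *\<^sub>R z)"
    using z c cone by (intro V_scale_le) auto
  then show "c * V z \<le> V (c *\<^sub>R z)" using c by (simp add: field_simps)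
qed

lemma finite_rate_path:
  assumes "\<phi> \<in> skorohod_space T S" "0 < T" "I T \<phi> \<noteq> \<infinity>"
  shows "path_in S T \<phi>" "I T \<phi> = J T \<phi>"
proof -
  have "abs_continuous_path T \<phi>" using assms rate unfolding rate_has_lagrangian_def by blast
  then show "path_in S T \<phi>"
    using assms(1) abs_continuous_path_continuous by (auto simp: path_in_def skorohod_space_def)
  have "restrict \<phi> {0..T} = \<phi>" using assms(1) by (auto simp: skorohod_space_def PiE_restrict)
  then show "I T \<phi> = J T \<phi>" by (simp add: path_cost_def)
qed

text \<open>Goodness of the rate function makes moving a fixed distance in a short time arbitrarily
  expensive; this replaces growth conditions on \<open>L\<close>.\<close>

lemma displacement_cost:
  assumes "0 \<le> N"
  shows "\<exists>d>0. d \<le> 1 \<and> (\<forall>\<phi>\<in>displaced d S (1/2). norm (\<phi> 0) \<le> 2 \<longrightarrow> ennreal N \<le> I d \<phi>)"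
proof -
  \<comment> \<open>A path on \<open>[0, d]\<close> is compared with this level set at the fixed
    horizon 1 by letting it wait at its end point, which adds at most \<open>C0\<close> to the
    action. The summand 1 makes the level positive, as goodness requires.\<close>
  define K where "K = {\<phi> \<in> skorohod_space 1 S. \<phi> 0 \<in> cball 0 2 \<inter> S \<and> I 1 \<phi> \<le> ennreal (N + C0 + 1)}"
  have "compactin (mtopology_of (skorohod_metric 1 S)) K"
    using good[of 1, unfolded good_rate_function_def, rule_format, of "N + C0 + 1" "cball 0 2 \<inter> S"]
      closed_S assms C0 unfolding K_def by (simp add: compact_Int_closed)
  from compactin_skorohod_equicontinuous_0[OF this, of "1/4"] obtain d1 where
    d1: "0 < d1" "d1 \<le> 1" "\<forall>\<phi>\<in>K. \<forall>t\<in>{0..d1}. dist (\<phi> t) (\<phi> 0) < 1/4" by auto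
  \<comment> \<open>Strictly below 1, so that the waiting time \<open>1 - d\<close> is
    positive.\<close>
  define d where "d = d1/2"
  have d: "0 < d" "d \<le> d1" "d < 1" using d1(1,2) by (auto simp: d_def)
  have "ennreal N \<le> I d \<phi>" if \<phi>: "\<phi> \<in> displaced d S (1/2)" "norm (\<phi> 0) \<le> 2" for \<phi>
  proof (rule ccontr)
    assume "\<not> ennreal N \<le> I d \<phi>"
    then have less: "I d \<phi> < ennreal N" by simp
    have sk: "\<phi> \<in> skorohod_space d S" using \<phi> by (simp add: displaced_def)
    have p: "path_in S d \<phi>" "I d \<phi> = J d \<phi>"
      using finite_rate_path[OF sk d(1)] less_le_trans[OF less top_greatest] by (auto simp: less_top)
    let ?g = "segment (1-d) (\<phi> d) (\<phi> d)"
    let ?p = "path_join d \<phi> ?g"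
    have \<phi>d: "\<phi> d \<in> S" using path_inD[OF p(1)] d by auto
    have pg: "path_in S (1-d) ?g" using path_in_segment[OF convex_S \<phi>d \<phi>d] d by auto
    have pp: "path_in S (d + (1-d)) ?p" by (rule path_in_join[OF p(1) pg]) (use d in auto)
    have "J (d + (1-d)) ?p = J d \<phi> + J (1-d) ?g" by (rule J_join[OF p(1) pg]) (use d in auto)
    also have "\<dots> \<le> ennreal N + ennreal (C0 * (1-d))"
      using less p \<phi>d d d0 by (intro add_mono J_segment) auto
    also have "\<dots> = ennreal (N + C0 * (1-d))" using assms C0 d by (simp flip: ennreal_plus)
    also have "\<dots> \<le> ennreal (N + C0 + 1)"
      using C0 d mult_nonneg_nonneg[of C0 d] by (intro ennreal_leI) (simp add: algebra_simps)
    finally have "J 1 ?p \<le> ennreal (N + C0 + 1)" by simp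
    moreover have "restrict ?p {0..1} \<in> skorohod_space 1 S"
      using pp continuous_in_skorohod[of 1 ?p S] by (simp add: path_in_def)
    moreover have "?p 0 = \<phi> 0" using d by (simp add: path_join_def)
    ultimately have pK: "restrict ?p {0..1} \<in> K"
      using \<phi>(2) d path_inD[OF p(1), of 0] by (simp add: K_def path_cost_def)
    have near: "dist (restrict ?p {0..1} t) (restrict ?p {0..1} 0) < 1/4"
      if "t \<in> {0..d}" for t
    proof -
      have "t \<in> {0..d1}" using that d(2) by simp
      then show ?thesis using d1(3) pK by blast
    qed
    have "dist (\<phi> t) (\<phi> 0) < 1/4" if "t \<in> {0..d}" for t
      using near[OF that] that d by (simp add: path_join_def)
    moreover have "\<exists>t\<in>{0..d}. 1/4 < dist (\<phi> t) (\<phi> 0)"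
    proof -
      have "\<forall>c<1/2. \<exists>t\<in>{0..d}. c < dist (\<phi> t) (\<phi> 0)" using \<phi>(1) unfolding displaced_def by blast
      from this[rule_format, of "1/4"] show ?thesis by simp
    qed
    ultimately show False by force
  qed
  then show ?thesis using d by (intro exI[of _ d]) auto
qed

text \<open>A path that is displaced by \<open>1/2\<close> within time \<open>d\<close> costs at
  least \<open>N\<close>, and the left-hand side is no larger: \<open>V\<close> contributes at most
  \<open>2 * C\<close> at the start and \<open>5 * C\<close> at the end, and
  \<open>lam * d \<le> lam\<close>. Any other path, starting at norm at least 1, avoids the origin,
  and \<open>V_step\<close> applies.\<close>

lemma V_decrease_rate:
  assumes d: "0 < d" "d \<le> 1" and N: "7 * C + lam \<le> N"
    and disp: "\<forall>\<phi>\<in>displaced d S (1/2). norm (\<phi> 0) \<le> 2 \<longrightarrow> ennreal N \<le> I d \<phi>"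
    and \<phi>: "\<phi> \<in> skorohod_space d S" "1 \<le> norm (\<phi> 0)" "norm (\<phi> 0) \<le> 2" "norm (\<phi> d) \<le> 5"
  shows "ennreal (V (\<phi> 0) - V (\<phi> d) + lam * d) \<le> I d \<phi>"
proof (cases "\<phi> \<in> displaced d S (1/2) \<or> I d \<phi> = \<infinity>")
  case True
  have m: "\<phi> 0 \<in> S" "\<phi> d \<in> S" using \<phi>(1) d by (auto simp: skorohod_space_def)
  have "V (\<phi> 0) \<le> C * norm (\<phi> 0)" "- (C * norm (\<phi> d)) \<le> V (\<phi> d)" using V_le[OF m(1)] V_ge[OF m(2)] by auto
  moreover have "C * norm (\<phi> 0) \<le> C * 2" "C * norm (\<phi> d) \<le> C * 5"
    using \<phi> C_nonneg by (auto intro: mult_left_mono)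
  moreover have "lam * d \<le> lam" using d lam_nonneg by (simp add: mult_left_le)
  ultimately have "V (\<phi> 0) - V (\<phi> d) + lam * d \<le> N" using N by linarith
  then have *: "ennreal (V (\<phi> 0) - V (\<phi> d) + lam * d) \<le> ennreal N" by (rule ennreal_leI)
  show ?thesis using True
  proof
    assume "\<phi> \<in> displaced d S (1/2)"
    then have "ennreal N \<le> I d \<phi>" using disp \<phi>(3) by blast
    with * show ?thesis by (rule order_trans)
  qed simp
next
  case False
  then have p: "path_in S d \<phi>" "I d \<phi> = J d \<phi>" using finite_rate_path[OF \<phi>(1) d(1)] by auto
  have "\<exists>c<1/2. \<forall>t\<in>{0..d}. dist (\<phi> t) (\<phi> 0) \<le> c"
    using False \<phi>(1) unfolding displaced_def by (simp add: not_less)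
  then obtain c where c: "c < 1/2" "\<forall>t\<in>{0..d}. dist (\<phi> t) (\<phi> 0) \<le> c" by blast
  have "\<phi> t \<noteq> 0" if t: "t \<in> {0..d}" for t
  proof
    assume "\<phi> t = 0"
    then have "norm (\<phi> 0) \<le> c" using c(2)[rule_format, OF t] by simp
    then show False using \<phi>(2) c(1) by simp
  qed
  then have "path_in S0 d \<phi>" using p(1) by (auto simp: path_in_def)
  from V_step[OF this d(1)] show ?thesis using p by simp
qed

end

section \<open>The cone of scaling limits, and tools for limits and right continuous paths\<close>

lemma scaling_limits_cone:
  assumes "z \<in> scaling_limits E" "0 < c"
  shows "c *\<^sub>R z \<in> scaling_limits E"
proof -
  obtain x where x: "\<And>a. x a \<in> E" "((\<lambda>a. x a /\<^sub>R a) \<longlongrightarrow> z) at_top"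
    using assms(1) unfolding scaling_limits_def by blast
  have "filterlim (\<lambda>a. c * a) at_top at_top"
    using assms(2) by (intro filterlim_tendsto_pos_mult_at_top[OF tendsto_const] filterlim_ident)
  then have "((\<lambda>a. x (c * a) /\<^sub>R (c * a)) \<longlongrightarrow> z) at_top"
    by (rule filterlim_compose[OF x(2)])
  then have "((\<lambda>a. c *\<^sub>R (x (c * a) /\<^sub>R (c * a))) \<longlongrightarrow> c *\<^sub>R z) at_top"
    by (intro tendsto_intros)
  moreover have "c *\<^sub>R (x (c * a) /\<^sub>R (c * a)) = x (c * a) /\<^sub>R a" for a
  proof -
    have "c * inverse (c * a) = inverse a" using assms(2) by simp
    then show ?thesis by (simp only: scaleR_scaleR)
  qed
  ultimately have "((\<lambda>a. x (c * a) /\<^sub>R a) \<longlongrightarrow> c *\<^sub>R z) at_top" by (simp only:)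
  then show ?thesis
    using x(1) unfolding scaling_limits_def by (intro CollectI exI[of _ "\<lambda>a. x (c * a)"]) auto
qed

lemma scaling_limits_0:
  assumes "E \<noteq> {}"
  shows "0 \<in> scaling_limits E"
proof -
  obtain e where e: "e \<in> E" using assms by blast
  have "((\<lambda>a::real. inverse a *\<^sub>R e) \<longlongrightarrow> 0 *\<^sub>R e) at_top"
    by (intro tendsto_intros tendsto_inverse_0_at_top filterlim_ident)
  then show ?thesis using e unfolding scaling_limits_def by (intro CollectI exI[of _ "\<lambda>_. e"]) auto
qed

lemma scaling_limits_eventually:
  assumes "z \<in> scaling_limits E" "0 < \<epsilon>"
  shows "\<forall>\<^sub>F a in at_top. \<exists>w. a *\<^sub>R w \<in> E \<and> norm (w - z) < \<epsilon>"
proof -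
  obtain x where x: "\<And>a. x a \<in> E" "((\<lambda>a. x a /\<^sub>R a) \<longlongrightarrow> z) at_top"
    using assms(1) unfolding scaling_limits_def by blast
  have "\<forall>\<^sub>F a in at_top. dist (x a /\<^sub>R a) z < \<epsilon>" using x(2) assms(2) by (rule tendstoD)
  then show ?thesis using eventually_gt_at_top[of 0]
  proof eventually_elim
    case (elim a)
    then show ?case using x(1) by (intro exI[of _ "x a /\<^sub>R a"]) (auto simp: dist_norm)
  qed
qed

text \<open>The definition asks for one selection \<open>x\<close> that serves every precision.
  Projecting \<open>a *\<^sub>R z\<close> to the closed set \<open>E\<close> gives it, since the
  closest point is at least as good as any \<open>a *\<^sub>R w\<close>.\<close>

lemma scaling_limitsI:
  fixes E :: "'a::euclidean_space set"
  assumes "closed E" and ev: "\<And>\<epsilon>. 0 < \<epsilon> \<Longrightarrow> \<forall>\<^sub>F a in at_top. \<exists>w. a *\<^sub>R w \<in> E \<and> norm (w - z) < \<epsilon>"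
  shows "z \<in> scaling_limits E"
proof -
  have ne: "E \<noteq> {}" using eventually_happens[OF ev[of 1]] by auto
  let ?x = "\<lambda>a. closest_point E (a *\<^sub>R z)"
  have "((\<lambda>a. ?x a /\<^sub>R a) \<longlongrightarrow> z) at_top"
  proof (rule tendstoI)
    fix \<epsilon> :: real assume "0 < \<epsilon>"
    from ev[OF this] eventually_gt_at_top[of 0] show "\<forall>\<^sub>F a in at_top. dist (?x a /\<^sub>R a) z < \<epsilon>"
    proof eventually_elim
      case (elim a)
      then obtain w where w: "a *\<^sub>R w \<in> E" "norm (w - z) < \<epsilon>" by blast
      have eq: "?x a /\<^sub>R a - z = (?x a - a *\<^sub>R z) /\<^sub>R a" using elim by (simp add: scaleR_diff_right)
      have "dist (?x a /\<^sub>R a) z = dist (a *\<^sub>R z) (?x a) / a"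
        unfolding dist_norm eq norm_scaleR using elim by (simp add: norm_minus_commute divide_inverse mult.commute)
      also have "\<dots> \<le> dist (a *\<^sub>R z) (a *\<^sub>R w) / a"
        using elim w by (intro divide_right_mono closest_point_le assms(1)) auto
      also have "\<dots> = norm (w - z)"
      proof -
        have "a *\<^sub>R z - a *\<^sub>R w = a *\<^sub>R (z - w)" by (simp add: scaleR_diff_right)
        then show ?thesis using elim by (simp add: dist_norm norm_minus_commute[of z w])
      qed
      finally show ?case using w by simp
    qed
  qed
  then show ?thesis
    unfolding scaling_limits_def
    by (intro CollectI exI[of _ ?x] conjI allI closest_point_in_set assms(1) ne)
qed

lemma closed_scaling_limits:
  fixes E :: "'a::euclidean_space set"
  assumes "closed E"
  shows "closed (scaling_limits E)"
proof -
  have "z \<in> scaling_limits E" if z: "z \<in> closure (scaling_limits E)" for z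
  proof (rule scaling_limitsI[OF assms])
    fix \<epsilon> :: real assume e: "0 < \<epsilon>"
    then obtain y where y: "y \<in> scaling_limits E" "dist y z < \<epsilon>/2"
      using z unfolding closure_approachable by (metis half_gt_zero)
    from scaling_limits_eventually[OF y(1), of "\<epsilon>/2"] e
    have "\<forall>\<^sub>F a in at_top. \<exists>w. a *\<^sub>R w \<in> E \<and> norm (w - y) < \<epsilon>/2" by simp
    then show "\<forall>\<^sub>F a in at_top. \<exists>w. a *\<^sub>R w \<in> E \<and> norm (w - z) < \<epsilon>"
    proof eventually_elim
      case (elim a)
      then obtain w where w: "a *\<^sub>R w \<in> E" "norm (w - y) < \<epsilon>/2" by blast
      have "norm (w - z) < \<epsilon>" using w y norm_triangle_ineq[of "w - y" "y - z"] by (simp add: dist_norm)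
      then show ?case using w by blast
    qed
  qed
  then show ?thesis by (metis closure_subset closure_eq subsetI subset_antisym)
qed

text \<open>\<open>Lim\<close> is a definite description and says nothing until convergence is
  shown. Monotonicity gives it and identifies the limit with an infimum, from which a single
  \<open>\<epsilon>\<close> can be extracted.\<close>

lemma Lim_at_right_0_mono:
  fixes g :: "real \<Rightarrow> ereal"
  assumes "\<And>s t. 0 < s \<Longrightarrow> s \<le> t \<Longrightarrow> g s \<le> g t"
  shows "Lim (at_right 0) g = (INF \<epsilon>\<in>{0<..}. g \<epsilon>)"
proof (rule tendsto_Lim)
  show "(g \<longlongrightarrow> (INF \<epsilon>\<in>{0<..}. g \<epsilon>)) (at_right 0)"
  proof (rule order_tendstoI)
    fix b assume "b < (INF \<epsilon>\<in>{0<..}. g \<epsilon>)"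
    then have "b < g \<epsilon>" if "0 < \<epsilon>" for \<epsilon> using that by (meson INF_lower greaterThan_iff less_le_trans)
    then show "\<forall>\<^sub>F \<epsilon> in at_right 0. b < g \<epsilon>"
      unfolding eventually_at_right_field by (intro exI[of _ 1]) auto
  next
    fix b assume "(INF \<epsilon>\<in>{0<..}. g \<epsilon>) < b"
    then obtain \<epsilon> where "0 < \<epsilon>" "g \<epsilon> < b" unfolding INF_less_iff by auto
    then have "g y < b" if "0 < y" "y < \<epsilon>" for y
      using le_less_trans[OF assms[of y \<epsilon>]] that by simp
    then show "\<forall>\<^sub>F \<epsilon> in at_right 0. g \<epsilon> < b"
      unfolding eventually_at_right_field using \<open>0 < \<epsilon>\<close> by (intro exI[of _ \<epsilon>]) auto
  qed
qed simp

lemma Lim_at_right_0_antimono: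
  fixes g :: "real \<Rightarrow> ereal"
  assumes "\<And>s t. 0 < s \<Longrightarrow> s \<le> t \<Longrightarrow> g t \<le> g s"
  shows "Lim (at_right 0) g = (SUP \<epsilon>\<in>{0<..}. g \<epsilon>)"
proof (rule tendsto_Lim)
  show "(g \<longlongrightarrow> (SUP \<epsilon>\<in>{0<..}. g \<epsilon>)) (at_right 0)"
  proof (rule order_tendstoI)
    fix b assume "(SUP \<epsilon>\<in>{0<..}. g \<epsilon>) < b"
    then have "g \<epsilon> < b" if "0 < \<epsilon>" for \<epsilon> using that by (meson SUP_upper greaterThan_iff le_less_trans)
    then show "\<forall>\<^sub>F \<epsilon> in at_right 0. g \<epsilon> < b"
      unfolding eventually_at_right_field by (intro exI[of _ 1]) auto
  next
    fix b assume "b < (SUP \<epsilon>\<in>{0<..}. g \<epsilon>)"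
    then obtain \<epsilon> where "0 < \<epsilon>" "b < g \<epsilon>" unfolding less_SUP_iff by auto
    then have "b < g y" if "0 < y" "y < \<epsilon>" for y
      using less_le_trans[OF _ assms[of y \<epsilon>]] that by simp
    then show "\<forall>\<^sub>F \<epsilon> in at_right 0. b < g \<epsilon>"
      unfolding eventually_at_right_field using \<open>0 < \<epsilon>\<close> by (intro exI[of _ \<epsilon>]) auto
  qed
qed simp

lemma elog_upper:
  assumes "ereal (1 / a) * elog p < ereal (- c)" "0 < a"
  shows "p \<le> ennreal (exp (- c * a))"
proof (cases p)
  case (real r)
  show ?thesis
  proof (cases "r = 0")
    case False
    then have "ln r / a < - c" using assms real by (simp add: elog_def)
    then have "ln r < - c * a" using assms(2) by (simp add: field_simps)
    then have "r < exp (- c * a)" using False real(1) by (metis exp_less_mono exp_ln less_eq_real_def)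
    then show ?thesis using real by (simp add: ennreal_leI)
  qed (use real in simp)
qed (use assms in \<open>simp add: elog_def\<close>)

lemma elog_lower:
  assumes "ereal (- c) < ereal (1 / a) * elog p" "0 < a"
  shows "ennreal (exp (- c * a)) \<le> p"
proof (cases p)
  case (real r)
  have r: "r \<noteq> 0" using assms real by (auto simp: elog_def)
  then have "- c < ln r / a" using assms real by (simp add: elog_def)
  then have "- c * a < ln r" using assms(2) by (simp add: field_simps)
  then have "exp (- c * a) < r" using r real(1) by (metis exp_less_mono exp_ln less_eq_real_def)
  then show ?thesis using real by (simp add: ennreal_leI)
qed simp

text \<open>If the point at time \<open>t\<close> misses the closed set, right continuity makes a
  slightly later rational time miss it too. Only \<open>T\<close> has no later time and joins the
  grid by itself. Path conditions are thus reduced to countably many times.\<close>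

lemma cadlag_dense:
  fixes f :: "real \<Rightarrow> 'b::metric_space"
  assumes rc: "\<And>t. 0 \<le> t \<Longrightarrow> t < T \<Longrightarrow> (f \<longlongrightarrow> f t) (at_right t)"
    and G: "closed G" and D: "\<And>q. q \<in> insert T ({0..T} \<inter> \<rat>) \<Longrightarrow> (q, f q) \<in> G"
    and t: "t \<in> {0..T}"
  shows "(t, f t) \<in> G"
proof (rule ccontr)
  assume n: "(t, f t) \<notin> G"
  have "t < T" using n t D[of T] by (cases "t = T") auto
  have "((\<lambda>s. (s, f s)) \<longlongrightarrow> (t, f t)) (at_right t)"
    using rc[of t] t \<open>t < T\<close> by (intro tendsto_intros) auto
  then have "\<forall>\<^sub>F s in at_right t. (s, f s) \<in> - G"
    using G n by (intro topological_tendstoD) auto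
  then obtain b where b: "t < b" "\<And>s. t < s \<Longrightarrow> s < b \<Longrightarrow> (s, f s) \<notin> G"
    unfolding eventually_at_right_field by auto
  obtain q where q: "t < real_of_rat q" "real_of_rat q < min b T" using of_rat_dense[of t "min b T"] b \<open>t < T\<close> by auto
  define p :: real where "p = of_rat q"
  have "p \<in> \<rat>" by (simp add: p_def)
  moreover have "t < p" "p < min b T" using q unfolding p_def by blast+
  ultimately have "(p, f p) \<in> G" using t by (intro D) auto
  then show False using b(2) \<open>t < p\<close> \<open>p < min b T\<close> by auto
qed

lemma countable_time_grid: "countable (insert T ({0..T} \<inter> (\<rat> :: real set)))"
  using countable_rat by auto

section \<open>The scaled process\<close>

context process_setting
begin

lemma space_P: "x \<in> E \<Longrightarrow> space (P x) = space M"
  using sets_P sets_eq_imp_space_eq by blast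

lemma F_sets_M: "A \<in> sets (F t) \<Longrightarrow> A \<in> sets M"
  using sets_F_subset by blast

lemma X_measurable: "0 \<le> t \<Longrightarrow> X t \<in> borel_measurable M"
  using adapted[of t] sets_F_subset[of "ennreal t"] space_F[of "ennreal t"]
  by (metis measurable_from_subalg subalgebra_def)

lemma X_measurable_P: "x \<in> E \<Longrightarrow> 0 \<le> t \<Longrightarrow> X t \<in> borel_measurable (P x)"
  using X_measurable[of t] measurable_cong_sets[OF sets_P] by blast

end

locale ldp_process = process_setting M F E P X m
  for M :: "'w measure" and F :: "ennreal \<Rightarrow> 'w measure" and E :: "'a::euclidean_space set"
    and P :: "'a \<Rightarrow> 'w measure" and X :: "real \<Rightarrow> 'w \<Rightarrow> 'a" and m :: "'a measure" +
  fixes I :: "real \<Rightarrow> (real \<Rightarrow> 'a) \<Rightarrow> ennreal"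
  assumes assumption_A: "assumption_A E P X I"
begin

abbreviation S :: "'a set" where "S \<equiv> scaling_limits E"

lemma E_nonempty: "E \<noteq> {}"
  using unbounded_E by auto

lemma zero_in_S: "0 \<in> S" and S_closed: "closed S" and E_subset_S: "E \<subseteq> S"
  and S_convex: "convex (S - {0})" and S_nontrivial: "S \<noteq> {0}"
  using scaling_limits_0[OF E_nonempty] closed_scaling_limits[OF closed_E] assumption_A
  unfolding assumption_A_def by auto

lemma scale_E_in_S: "y \<in> E \<Longrightarrow> 0 < c \<Longrightarrow> c *\<^sub>R y \<in> S"
  using E_subset_S scaling_limits_cone[of y E c] by auto

lemma rescaled_path_skorohod:
  assumes a: "0 < a" and \<omega>: "\<omega> \<in> space M"
  shows "rescaled_path X T a \<omega> \<in> skorohod_space T S"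
proof -
  have S: "X (a * t) \<omega> /\<^sub>R a \<in> S" if "0 \<le> t" for t
    using X_in_E[of "a * t" \<omega>] that a \<omega> by (intro scale_E_in_S) auto
  have r: "(rescaled_path X T a \<omega> \<longlongrightarrow> X (a * t) \<omega> /\<^sub>R a) (at_right t)" if t: "0 \<le> t" "t < T" for t
  proof -
    have fl: "filterlim (\<lambda>s. a * s) (at_right (a * t)) (at_right t)"
      unfolding filterlim_at using a
      by (auto simp: eventually_at_filter intro!: tendsto_intros tendsto_eq_intros)
    have "((\<lambda>s. X s \<omega>) \<longlongrightarrow> X (a * t) \<omega>) (at_right (a * t))"
      using right_continuous[of "a * t" \<omega>] t a \<omega> by simp
    from filterlim_compose[OF this fl] have "((\<lambda>s. X (a * s) \<omega>) \<longlongrightarrow> X (a * t) \<omega>) (at_right t)" .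
    then have "((\<lambda>s. X (a * s) \<omega> /\<^sub>R a) \<longlongrightarrow> X (a * t) \<omega> /\<^sub>R a) (at_right t)"
      by (intro tendsto_intros)
    moreover have "\<forall>\<^sub>F s in at_right t. X (a * s) \<omega> /\<^sub>R a = rescaled_path X T a \<omega> s"
      using t unfolding eventually_at_right_field
      by (intro exI[of _ T]) (auto simp: rescaled_path_def)
    ultimately show ?thesis by (rule Lim_transform_eventually)
  qed
  have l: "\<exists>l\<in>S. (rescaled_path X T a \<omega> \<longlongrightarrow> l) (at_left t)" if t: "0 < t" "t \<le> T" for t
  proof -
    obtain l where l: "l \<in> E" "((\<lambda>s. X s \<omega>) \<longlongrightarrow> l) (at_left (a * t))"
      using left_limits[of "a * t" \<omega>] t a \<omega> by auto
    have fl: "filterlim (\<lambda>s. a * s) (at_left (a * t)) (at_left t)"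
      unfolding filterlim_at using a
      by (auto simp: eventually_at_filter intro!: tendsto_intros tendsto_eq_intros)
    from filterlim_compose[OF l(2) fl] have "((\<lambda>s. X (a * s) \<omega>) \<longlongrightarrow> l) (at_left t)" .
    then have "((\<lambda>s. X (a * s) \<omega> /\<^sub>R a) \<longlongrightarrow> l /\<^sub>R a) (at_left t)"
      by (intro tendsto_intros)
    moreover have "\<forall>\<^sub>F s in at_left t. X (a * s) \<omega> /\<^sub>R a = rescaled_path X T a \<omega> s"
      using t unfolding eventually_at_left_field
      by (intro exI[of _ 0]) (auto simp: rescaled_path_def)
    ultimately have "(rescaled_path X T a \<omega> \<longlongrightarrow> l /\<^sub>R a) (at_left t)"
      by (rule Lim_transform_eventually)
    then show ?thesis using l a by (intro bexI[of _ "l /\<^sub>R a"] scale_E_in_S) auto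
  qed
  have "rescaled_path X T a \<omega> \<in> {0..T} \<rightarrow>\<^sub>E S"
    using S by (auto simp: rescaled_path_def)
  moreover have "(rescaled_path X T a \<omega> \<longlongrightarrow> rescaled_path X T a \<omega> t) (at_right t)" if "t \<in> {0..<T}" for t
    using r[of t] that by (simp add: rescaled_path_def)
  moreover have "\<exists>l\<in>S. (rescaled_path X T a \<omega> \<longlongrightarrow> l) (at_left t)" if "t \<in> {0<..T}" for t
    using l[of t] that by simp
  ultimately show ?thesis unfolding skorohod_space_def by blast
qed

lemma closed_path_event:
  assumes T: "0 \<le> T" and \<omega>: "\<omega> \<in> space M" and G: "closed G"
  shows "(\<forall>t\<in>{0..T}. (t, X t \<omega>) \<in> G) \<longleftrightarrow> (\<forall>q\<in>insert T ({0..T} \<inter> \<rat>). (q, X q \<omega>) \<in> G)"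
proof
  assume "\<forall>q\<in>insert T ({0..T} \<inter> \<rat>). (q, X q \<omega>) \<in> G"
  then show "\<forall>t\<in>{0..T}. (t, X t \<omega>) \<in> G"
    using cadlag_dense[where f = "\<lambda>t. X t \<omega>", OF _ G] right_continuous[OF _ \<omega>] by blast
qed (use T in auto)

lemma sets_countable_Ball:
  assumes "countable D" "\<And>q. q \<in> D \<Longrightarrow> {\<omega> \<in> space M. Q q \<omega>} \<in> sets N" "space N = space M"
  shows "{\<omega> \<in> space M. \<forall>q\<in>D. Q q \<omega>} \<in> sets N"
proof (cases "D = {}")
  case True
  then show ?thesis using sets.top[of N] assms(3) by simp
next
  case False
  then have "{\<omega> \<in> space M. \<forall>q\<in>D. Q q \<omega>} = (\<Inter>q\<in>D. {\<omega> \<in> space M. Q q \<omega>})" by blast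
  also have "\<dots> \<in> sets N"
    using False assms(1,2) by (intro sets.countable_INT') auto
  finally show ?thesis .
qed

text \<open>Closed sets in space-time express constraints that change with time, such as tubes or
  the return to a ball after a given time; the reduction to countably many times makes their events
  measurable at time \<open>T\<close>.\<close>

lemma closed_path_event_sets:
  assumes T: "0 \<le> T" and G: "closed G"
  shows "{\<omega> \<in> space M. \<forall>t\<in>{0..T}. (t, X t \<omega>) \<in> G} \<in> sets (F (ennreal T))"
proof -
  have "{\<omega> \<in> space M. \<forall>t\<in>{0..T}. (t, X t \<omega>) \<in> G} =
    {\<omega> \<in> space M. \<forall>q\<in>insert T ({0..T} \<inter> \<rat>). (q, X q \<omega>) \<in> G}"
    using closed_path_event[OF T _ G] by auto
  also have "\<dots> \<in> sets (F (ennreal T))"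
  proof (rule sets_countable_Ball[OF countable_time_grid])
    fix q assume "q \<in> insert T ({0..T} \<inter> \<rat>)"
    then have q: "0 \<le> q" "q \<le> T" using T by auto
    have "X q \<in> borel_measurable (F (ennreal q))" using adapted q by simp
    moreover have "{y. (q, y) \<in> G} \<in> sets borel"
    proof -
      have "closed ((\<lambda>y. (q, y)) -` G)"
        by (intro closed_vimage G continuous_intros)
      then show ?thesis by (simp add: vimage_def borel_closed)
    qed
    ultimately have "X q -` {y. (q, y) \<in> G} \<inter> space (F (ennreal q)) \<in> sets (F (ennreal q))"
      by (rule measurable_sets)
    moreover have "X q -` {y. (q, y) \<in> G} \<inter> space (F (ennreal q)) = {\<omega> \<in> space M. (q, X q \<omega>) \<in> G}"
      by (auto simp: space_F)
    ultimately show "{\<omega> \<in> space M. (q, X q \<omega>) \<in> G} \<in> sets (F (ennreal T))"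
      using sets_F_mono[of "ennreal q" "ennreal T"] q by (auto simp: ennreal_leI)
  qed (simp add: space_F)
  finally show ?thesis .
qed

lemma tube_event_sets:
  assumes a: "0 < a" and T: "0 \<le> T" and \<phi>: "continuous_on {0..T} \<phi>"
  shows "{\<omega> \<in> space M. rescaled_path X T a \<omega> \<in> {\<psi> \<in> skorohod_space T S. \<forall>t\<in>{0..T}. dist (\<psi> t) (\<phi> t) \<le> r}} \<in> sets M"
proof -
  \<comment> \<open>The tube around \<open>\<phi>\<close>, transported back to unscaled time and
    space.\<close>
  define G where "G = {p \<in> {0..a*T} \<times> UNIV. dist (snd p /\<^sub>R a) (\<phi> (fst p / a)) \<le> r}"
  have "closed G" unfolding G_def
  proof (rule continuous_on_closed_Collect_le)
    have "continuous_on ({0..a*T} \<times> UNIV) (\<phi> \<circ> (\<lambda>p. fst p / a))"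
      using a by (intro continuous_on_compose continuous_intros continuous_on_subset[OF \<phi>])
        (auto simp: field_simps)
    then show "continuous_on ({0..a*T} \<times> (UNIV::'a set)) (\<lambda>p. dist (snd p /\<^sub>R a) (\<phi> (fst p / a)))"
      by (intro continuous_intros) (simp_all add: o_def)
  qed (auto intro!: continuous_intros closed_Times)
  have "{\<omega> \<in> space M. rescaled_path X T a \<omega> \<in> {\<psi> \<in> skorohod_space T S. \<forall>t\<in>{0..T}. dist (\<psi> t) (\<phi> t) \<le> r}} =
    {\<omega> \<in> space M. \<forall>t\<in>{0..a*T}. (t, X t \<omega>) \<in> G}" (is "?l = ?r")
  proof (intro set_eqI iffI)
    fix \<omega> assume "\<omega> \<in> ?l"
    then have \<omega>: "\<omega> \<in> space M" "\<And>t. t \<in> {0..T} \<Longrightarrow> dist (X (a * t) \<omega> /\<^sub>R a) (\<phi> t) \<le> r"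
      by (auto simp: rescaled_path_def)
    have "(t, X t \<omega>) \<in> G" if t: "t \<in> {0..a*T}" for t
      using \<omega>(2)[of "t / a"] t a by (auto simp: G_def field_simps)
    then show "\<omega> \<in> ?r" using \<omega>(1) by blast
  next
    fix \<omega> assume \<omega>: "\<omega> \<in> ?r"
    have "dist (rescaled_path X T a \<omega> t) (\<phi> t) \<le> r" if t: "t \<in> {0..T}" for t
    proof -
      have "a * t \<in> {0..a*T}" using t a by auto
      then have "(a * t, X (a * t) \<omega>) \<in> G" using \<omega> by blast
      then show ?thesis using t a by (simp add: G_def rescaled_path_def)
    qed
    then show "\<omega> \<in> ?l" using \<omega> rescaled_path_skorohod[OF a, of \<omega> T] by auto
  qed
  also have "\<dots> \<in> sets M"
    using closed_path_event_sets[OF _ \<open>closed G\<close>, of "a * T"] sets_F_subset a T by auto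
  finally show ?thesis .
qed

text \<open>The reference point \<open>X 0 \<omega>\<close> is random, so the event is not of the
  form treated in \<open>closed_path_event_sets\<close>. The grid reduction is applied to each
  \<open>\<omega>\<close> separately and measurability is checked on the grid; the levels
  \<open>c < r\<close> are exhausted by a sequence.\<close>

lemma displaced_event_sets:
  assumes a: "0 < a" and T: "0 \<le> T"
  shows "{\<omega> \<in> space M. rescaled_path X T a \<omega> \<in> displaced T S r} \<in> sets M"
proof -
  define B where "B c = {\<omega> \<in> space M. \<forall>t\<in>insert (a*T) ({0..a*T} \<inter> \<rat>). dist (X t \<omega> /\<^sub>R a) (X 0 \<omega> /\<^sub>R a) \<le> c}" for c
  have B: "B c \<in> sets M" for c unfolding B_def
  proof (rule sets_countable_Ball[OF countable_time_grid])
    fix t assume "t \<in> insert (a * T) ({0..a * T} \<inter> \<rat>)"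
    then have [measurable]: "X t \<in> borel_measurable M" "X 0 \<in> borel_measurable M"
      using a T by (auto intro!: X_measurable)
    show "{\<omega> \<in> space M. dist (X t \<omega> /\<^sub>R a) (X 0 \<omega> /\<^sub>R a) \<le> c} \<in> sets M" by measurable
  qed simp
  have Beq: "\<omega> \<in> B c \<longleftrightarrow> (\<forall>t\<in>{0..T}. dist (rescaled_path X T a \<omega> t) (rescaled_path X T a \<omega> 0) \<le> c)"
    if \<omega>: "\<omega> \<in> space M" for \<omega> c
  proof -
    let ?G = "{p::real \<times> 'a. dist (snd p /\<^sub>R a) (X 0 \<omega> /\<^sub>R a) \<le> c}"
    have "closed ?G" by (intro closed_Collect_le continuous_intros)
    from closed_path_event[OF _ \<omega> this, of "a * T"] have
      "\<omega> \<in> B c \<longleftrightarrow> (\<forall>t\<in>{0..a*T}. dist (X t \<omega> /\<^sub>R a) (X 0 \<omega> /\<^sub>R a) \<le> c)"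
      using a T \<omega> by (simp add: B_def)
    also have "\<dots> \<longleftrightarrow> (\<forall>t\<in>{0..T}. dist (X (a * t) \<omega> /\<^sub>R a) (X 0 \<omega> /\<^sub>R a) \<le> c)"
    proof
      assume H: "\<forall>t\<in>{0..T}. dist (X (a * t) \<omega> /\<^sub>R a) (X 0 \<omega> /\<^sub>R a) \<le> c"
      show "\<forall>t\<in>{0..a*T}. dist (X t \<omega> /\<^sub>R a) (X 0 \<omega> /\<^sub>R a) \<le> c"
      proof
        fix t assume "t \<in> {0..a*T}"
        then show "dist (X t \<omega> /\<^sub>R a) (X 0 \<omega> /\<^sub>R a) \<le> c"
          using H[rule_format, of "t / a"] a by (auto simp: field_simps)
      qed
    qed (use a in auto)
    finally show ?thesis using T by (auto simp: rescaled_path_def)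
  qed
  have "{\<omega> \<in> space M. rescaled_path X T a \<omega> \<in> displaced T S r} = space M - (\<Union>n::nat. B (r - 1 / (real n + 1)))"
  proof (intro set_eqI iffI)
    fix \<omega> assume \<omega>: "\<omega> \<in> {\<omega> \<in> space M. rescaled_path X T a \<omega> \<in> displaced T S r}"
    have "\<omega> \<notin> B (r - 1 / (real n + 1))" for n
    proof -
      have "r - 1 / (real n + 1) < r" by simp
      moreover have "\<forall>c<r. \<exists>t\<in>{0..T}. c < dist (rescaled_path X T a \<omega> t) (rescaled_path X T a \<omega> 0)"
        using \<omega> unfolding displaced_def by blast
      ultimately have "\<exists>t\<in>{0..T}. r - 1 / (real n + 1) < dist (rescaled_path X T a \<omega> t) (rescaled_path X T a \<omega> 0)"
        by blast
      then show ?thesis using \<omega> Beq[of \<omega>] by (auto simp: not_le)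
    qed
    then show "\<omega> \<in> space M - (\<Union>n::nat. B (r - 1 / (real n + 1)))" using \<omega> by auto
  next
    fix \<omega> assume \<omega>: "\<omega> \<in> space M - (\<Union>n::nat. B (r - 1 / (real n + 1)))"
    have "\<exists>t\<in>{0..T}. c < dist (rescaled_path X T a \<omega> t) (rescaled_path X T a \<omega> 0)" if c: "c < r" for c
    proof -
      obtain n :: nat where n: "1 / (real n + 1) < r - c"
        using c reals_Archimedean[of "r - c"] by (auto simp: inverse_eq_divide add.commute)
      have "\<omega> \<notin> B (r - 1 / (real n + 1))" using \<omega> by blast
      then have "\<exists>t\<in>{0..T}. r - 1 / (real n + 1) < dist (rescaled_path X T a \<omega> t) (rescaled_path X T a \<omega> 0)"
        using Beq[of \<omega> "r - 1 / (real n + 1)"] \<omega> by (simp add: not_le)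
      then obtain t where "t \<in> {0..T}" "r - 1 / (real n + 1) < dist (rescaled_path X T a \<omega> t) (rescaled_path X T a \<omega> 0)"
        by blast
      then show ?thesis using n by (intro bexI[of _ t]) auto
    qed
    then show "\<omega> \<in> {\<omega> \<in> space M. rescaled_path X T a \<omega> \<in> displaced T S r}"
      using \<omega> rescaled_path_skorohod[OF a, of \<omega> T] by (auto simp: displaced_def)
  qed
  then show ?thesis using B by auto
qed

definition scaled_prob :: "real \<Rightarrow> (real \<Rightarrow> 'a) set \<Rightarrow> real \<Rightarrow> 'a \<Rightarrow> ennreal" where
  "scaled_prob T U a z = emeasure (P (a *\<^sub>R z)) {\<omega> \<in> space M. rescaled_path X T a \<omega> \<in> U}"

lemma rescaled_log_prob_eq:
  "a *\<^sub>R z \<in> E \<Longrightarrow> rescaled_log_prob P X T U a z = ereal (1 / a) * elog (scaled_prob T U a z)"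
  by (simp add: rescaled_log_prob_def scaled_prob_def space_P)

text \<open>The margin between \<open>c'\<close> and \<open>c\<close> turns the double limit into an
  honest bound: one \<open>\<epsilon>\<close> and all large \<open>a\<close>, uniformly in the
  starting point.\<close>

lemma ldp_upper_at:
  assumes T: "0 < T" and x: "x \<in> S"
    and C: "closedin (mtopology_of (skorohod_metric T S)) C"
    and c: "\<And>\<phi>. \<phi> \<in> C \<Longrightarrow> \<phi> 0 = x \<Longrightarrow> ennreal c \<le> I T \<phi>" and c': "c' < c"
  shows "\<exists>\<epsilon>>0. \<forall>\<^sub>F a in at_top. \<forall>z. a *\<^sub>R z \<in> E \<longrightarrow> norm (z - x) < \<epsilon> \<longrightarrow>
    scaled_prob T C a z \<le> ennreal (exp (- c' * a))"
proof -
  define g where "g \<epsilon> = Limsup at_top (\<lambda>a::real.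
    SUP z\<in>{z. a *\<^sub>R z \<in> E \<and> norm (z - x) < \<epsilon>}. rescaled_log_prob P X T C a z)" for \<epsilon>
  have "Lim (at_right 0) g \<le> - (INF \<phi>\<in>{\<phi> \<in> C. \<phi> 0 = x}. enn2ereal (I T \<phi>))"
    using assumption_A T x C unfolding assumption_A_def sample_path_ldp_def g_def by blast
  also have "Lim (at_right 0) g = (INF \<epsilon>\<in>{0<..}. g \<epsilon>)"
  proof (rule Lim_at_right_0_mono)
    fix s t :: real assume "0 < s" "s \<le> t"
    then show "g s \<le> g t" unfolding g_def
      by (intro Limsup_mono always_eventually allI SUP_subset_mono) auto
  qed
  also have "- (INF \<phi>\<in>{\<phi> \<in> C. \<phi> 0 = x}. enn2ereal (I T \<phi>)) \<le> ereal (- c)"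
  proof -
    have "ereal c \<le> (INF \<phi>\<in>{\<phi> \<in> C. \<phi> 0 = x}. enn2ereal (I T \<phi>))"
      using c by (intro INF_greatest ereal_le_enn2ereal) auto
    then show ?thesis by (simp add: ereal_uminus_le_reorder)
  qed
  finally have "(INF \<epsilon>\<in>{0<..}. g \<epsilon>) < ereal (- c')"
    using c' by (simp add: le_less_trans)
  then obtain \<epsilon> where \<epsilon>: "0 < \<epsilon>" "g \<epsilon> < ereal (- c')" unfolding INF_less_iff by auto
  have "\<forall>\<^sub>F a in at_top. (SUP z\<in>{z. a *\<^sub>R z \<in> E \<and> norm (z - x) < \<epsilon>}. rescaled_log_prob P X T C a z) < ereal (- c')"
    using \<epsilon>(2) unfolding g_def by (rule Limsup_lessD)
  then have "\<forall>\<^sub>F a in at_top. \<forall>z. a *\<^sub>R z \<in> E \<longrightarrow> norm (z - x) < \<epsilon> \<longrightarrow>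
    scaled_prob T C a z \<le> ennreal (exp (- c' * a))"
    using eventually_gt_at_top[of 0]
  proof eventually_elim
    case (elim a)
    show ?case
    proof (intro allI impI)
      fix z assume z: "a *\<^sub>R z \<in> E" "norm (z - x) < \<epsilon>"
      have "rescaled_log_prob P X T C a z \<le> (SUP z\<in>{z. a *\<^sub>R z \<in> E \<and> norm (z - x) < \<epsilon>}. rescaled_log_prob P X T C a z)"
        using z by (intro SUP_upper) auto
      then show "scaled_prob T C a z \<le> ennreal (exp (- c' * a))"
        using elim by (intro elog_upper) (auto simp: rescaled_log_prob_eq[OF z(1)])
    qed
  qed
  then show ?thesis using \<epsilon>(1) by blast
qed

text \<open>A finite cover of \<open>V\<close> by the balls of \<open>ldp_upper_at\<close> makes the
  bound uniform over a compact set of starting points.\<close>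

lemma ldp_upper:
  assumes T: "0 < T" and V: "compact V" "V \<subseteq> S"
    and C: "closedin (mtopology_of (skorohod_metric T S)) C"
    and c: "\<And>\<phi>. \<phi> \<in> C \<Longrightarrow> \<phi> 0 \<in> V \<Longrightarrow> ennreal c \<le> I T \<phi>" and c': "c' < c"
  shows "\<forall>\<^sub>F a in at_top. \<forall>z\<in>V. a *\<^sub>R z \<in> E \<longrightarrow> scaled_prob T C a z \<le> ennreal (exp (- c' * a))"
proof -
  have "\<forall>x\<in>V. \<exists>\<epsilon>>0. \<forall>\<^sub>F a in at_top. \<forall>z. a *\<^sub>R z \<in> E \<longrightarrow> norm (z - x) < \<epsilon> \<longrightarrow>
    scaled_prob T C a z \<le> ennreal (exp (- c' * a))"
    using V c by (intro ballI ldp_upper_at[OF T _ C _ c']) auto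
  from bchoice[OF this] obtain \<epsilon> where \<epsilon>': "\<forall>x\<in>V. 0 < \<epsilon> x \<and> (\<forall>\<^sub>F a in at_top. \<forall>z. a *\<^sub>R z \<in> E \<longrightarrow>
    norm (z - x) < \<epsilon> x \<longrightarrow> scaled_prob T C a z \<le> ennreal (exp (- c' * a)))"
    by blast
  then have \<epsilon>: "\<And>x. x \<in> V \<Longrightarrow> 0 < \<epsilon> x" "\<And>x. x \<in> V \<Longrightarrow>
    \<forall>\<^sub>F a in at_top. \<forall>z. a *\<^sub>R z \<in> E \<longrightarrow> norm (z - x) < \<epsilon> x \<longrightarrow> scaled_prob T C a z \<le> ennreal (exp (- c' * a))"
    by blast+
  obtain D where D: "D \<subseteq> V" "finite D" "V \<subseteq> (\<Union>x\<in>D. ball x (\<epsilon> x))"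
    by (rule compactE_image[OF V(1), of V "\<lambda>x. ball x (\<epsilon> x)"]) (use \<epsilon>(1) in force)+
  have "\<forall>\<^sub>F a in at_top. \<forall>x\<in>D. \<forall>z. a *\<^sub>R z \<in> E \<longrightarrow> norm (z - x) < \<epsilon> x \<longrightarrow> scaled_prob T C a z \<le> ennreal (exp (- c' * a))"
    using \<epsilon>(2) D by (intro eventually_ball_finite) auto
  then show ?thesis
  proof eventually_elim
    case (elim a)
    show ?case
    proof (intro ballI impI)
      fix z assume z: "z \<in> V" "a *\<^sub>R z \<in> E"
      then obtain x where "x \<in> D" "norm (z - x) < \<epsilon> x" using D(3) by (auto simp: dist_norm norm_minus_commute)
      then show "scaled_prob T C a z \<le> ennreal (exp (- c' * a))" using elim z by blast
    qed
  qed
qed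

lemma ldp_lower_at:
  assumes T: "0 < T"
    and U: "openin (mtopology_of (skorohod_metric T S)) U"
    and \<phi>: "\<phi> \<in> U" "I T \<phi> < ennreal c"
  shows "\<exists>\<epsilon>>0. \<forall>\<^sub>F a in at_top. \<forall>z. a *\<^sub>R z \<in> E \<longrightarrow> norm (z - \<phi> 0) < \<epsilon> \<longrightarrow>
    ennreal (exp (- c * a)) \<le> scaled_prob T U a z"
proof -
  define x where "x = \<phi> 0"
  have "\<phi> \<in> skorohod_space T S" using openin_subset[OF U] \<phi>(1) by auto
  then have x: "x \<in> S" using T by (auto simp: x_def skorohod_space_def)
  define g where "g \<epsilon> = Liminf at_top (\<lambda>a::real.
    INF z\<in>{z. a *\<^sub>R z \<in> E \<and> norm (z - x) < \<epsilon>}. rescaled_log_prob P X T U a z)" for \<epsilon>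
  obtain j where j: "I T \<phi> = ennreal j" "0 \<le> j" "j < c"
    using \<phi>(2) by (cases "I T \<phi>") (auto simp: ennreal_less_iff)
  have "(INF \<phi>\<in>{\<phi> \<in> U. \<phi> 0 = x}. enn2ereal (I T \<phi>)) \<le> enn2ereal (I T \<phi>)"
    using \<phi> by (intro INF_lower) (auto simp: x_def)
  also have "\<dots> = ereal j" using j by (simp add: enn2ereal_ennreal)
  finally have "ereal (- j) \<le> - (INF \<phi>\<in>{\<phi> \<in> U. \<phi> 0 = x}. enn2ereal (I T \<phi>))"
    unfolding uminus_ereal.simps(1)[symmetric] ereal_minus_le_minus .
  also have "\<dots> \<le> Lim (at_right 0) g"
    using assumption_A T x U unfolding assumption_A_def sample_path_ldp_def g_def by blast
  also have "Lim (at_right 0) g = (SUP \<epsilon>\<in>{0<..}. g \<epsilon>)"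
  proof (rule Lim_at_right_0_antimono)
    fix s t :: real assume "0 < s" "s \<le> t"
    then show "g t \<le> g s" unfolding g_def
      by (intro Liminf_mono always_eventually allI INF_superset_mono) auto
  qed
  finally have "ereal (- j) \<le> (SUP \<epsilon>\<in>{0<..}. g \<epsilon>)" .
  moreover have "ereal (- c) < ereal (- j)" using j by simp
  ultimately have "ereal (- c) < (SUP \<epsilon>\<in>{0<..}. g \<epsilon>)" by (rule less_le_trans[rotated])
  then obtain \<epsilon> where \<epsilon>: "0 < \<epsilon>" "ereal (- c) < g \<epsilon>" unfolding less_SUP_iff by auto
  have "\<forall>\<^sub>F a in at_top. ereal (- c) < (INF z\<in>{z. a *\<^sub>R z \<in> E \<and> norm (z - x) < \<epsilon>}. rescaled_log_prob P X T U a z)"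
    using \<epsilon>(2) unfolding g_def by (rule less_LiminfD)
  then have "\<forall>\<^sub>F a in at_top. \<forall>z. a *\<^sub>R z \<in> E \<longrightarrow> norm (z - x) < \<epsilon> \<longrightarrow>
    ennreal (exp (- c * a)) \<le> scaled_prob T U a z"
    using eventually_gt_at_top[of 0]
  proof eventually_elim
    case (elim a)
    show ?case
    proof (intro allI impI)
      fix z assume z: "a *\<^sub>R z \<in> E" "norm (z - x) < \<epsilon>"
      have "(INF z\<in>{z. a *\<^sub>R z \<in> E \<and> norm (z - x) < \<epsilon>}. rescaled_log_prob P X T U a z) \<le> rescaled_log_prob P X T U a z"
        using z by (intro INF_lower) auto
      then show "ennreal (exp (- c * a)) \<le> scaled_prob T U a z"
        using elim by (intro elog_lower) (auto simp: rescaled_log_prob_eq[OF z(1)])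
    qed
  qed
  then show ?thesis using \<epsilon>(1) unfolding x_def by blast
qed

text \<open>Monotonicity asks for measurability of the larger event alone, as
  \<open>emeasure\<close> is 0 on a non-measurable set. So the open Skorohod balls of the lower
  bound can be used directly.\<close>

lemma scaled_prob_mono:
  assumes z: "a *\<^sub>R z \<in> E" and N: "N \<in> sets M"
    and sub: "\<And>\<omega>. \<omega> \<in> space M \<Longrightarrow> rescaled_path X T a \<omega> \<in> U \<Longrightarrow> \<omega> \<in> N"
  shows "scaled_prob T U a z \<le> emeasure (P (a *\<^sub>R z)) N"
  unfolding scaled_prob_def using z N sub by (intro emeasure_mono) (auto simp: sets_P)

end

lemma Hausdorff_skorohod: "Hausdorff_space (mtopology_of (skorohod_metric T S))"
  unfolding mtopology_of_def mspace_skorohod_metric mdist_skorohod_metric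
  by (rule Metric_space.Hausdorff_space_mtopology[OF Metric_space_skorohod])

text \<open>A finite convex function on a ball is continuous, hence bounded on the closed ball of
  half the radius, and \<open>l2\<close> dominates \<open>L\<close> uniformly in the
  position.\<close>

lemma lagrangian_locally_bounded:
  fixes S :: "'a::euclidean_space set"
  assumes "lagrangian_bounds S L" "S \<noteq> {}"
  shows "\<exists>c\<ge>0. \<exists>d>0. \<forall>x\<in>S. \<forall>v. norm v \<le> d \<longrightarrow> L x v \<le> c"
proof -
  obtain l1 :: "'a \<Rightarrow> real" and l2 :: "'a \<Rightarrow> ereal" and \<delta> where
    l2: "ereal_convex l2" "\<forall>x\<in>S. \<forall>v. 0 \<le> l1 v \<and> l1 v \<le> L x v \<and> ereal (L x v) \<le> l2 v"
    and \<delta>: "0 < \<delta>" "\<forall>v\<in>ball 0 \<delta>. l2 v < \<infinity>"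
    using assms(1) unfolding lagrangian_bounds_def by blast
  obtain s where s: "s \<in> S" using assms(2) by blast
  \<comment> \<open>\<open>l2\<close> lies above the nonnegative \<open>L\<close>, which excludes
    \<open>-\<infinity>\<close> and makes the passage to a real-valued function faithful.\<close>
  have nn: "0 \<le> l2 v" for v
  proof -
    have "0 \<le> l1 v" "l1 v \<le> L s v" "ereal (L s v) \<le> l2 v" using l2(2) s by blast+
    then show ?thesis by (meson ereal_less_eq(5) order_trans)
  qed
  define f where "f v = real_of_ereal (l2 v)" for v
  have f: "l2 v = ereal (f v)" if "v \<in> ball 0 \<delta>" for v
    using \<delta>(2) nn[of v] that by (cases "l2 v") (auto simp: f_def)
  have "convex_on (ball 0 \<delta>) f"
  proof (rule convex_onI)
    fix t :: real and x y :: 'a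
    assume t: "0 < t" "t < 1" and xy: "x \<in> ball 0 \<delta>" "y \<in> ball 0 \<delta>"
    have m: "(1 - t) *\<^sub>R x + t *\<^sub>R y \<in> ball 0 \<delta>"
      using convexD_alt[OF convex_ball xy, of t] t by simp
    have "l2 ((1 - t) *\<^sub>R x + (1 - (1 - t)) *\<^sub>R y) \<le> ereal (1 - t) * l2 x + ereal (1 - (1 - t)) * l2 y"
      using l2(1) t unfolding ereal_convex_def by (elim allE[of _ x] allE[of _ y] allE[of _ "1 - t"]) auto
    then show "f ((1 - t) *\<^sub>R x + t *\<^sub>R y) \<le> (1 - t) * f x + t * f y"
      using f[OF m] f[OF xy(1)] f[OF xy(2)] by simp
  qed simp
  then have "continuous_on (ball 0 \<delta>) f" by (intro convex_on_continuous) auto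
  then have "continuous_on (cball 0 (\<delta>/2)) f"
    using \<delta>(1) by (rule_tac continuous_on_subset) auto
  then have "bounded (f ` cball 0 (\<delta>/2))"
    by (intro compact_imp_bounded compact_continuous_image) auto
  then obtain B where B: "\<And>v. v \<in> cball 0 (\<delta>/2) \<Longrightarrow> norm (f v) \<le> B"
    unfolding bounded_iff by blast
  have "L x v \<le> max 0 B" if "x \<in> S" "norm v \<le> \<delta>/2" for x v
  proof -
    have "v \<in> ball 0 \<delta>" using that \<delta>(1) by auto
    moreover have "ereal (L x v) \<le> l2 v" using l2(2) that(1) by blast
    ultimately have "L x v \<le> f v" using f[of v] by simp
    also have "\<dots> \<le> B" using B[of v] that by auto
    finally show ?thesis by simp
  qed
  then show ?thesis using \<delta>(1) by (intro exI[of _ "max 0 B"] conjI exI[of _ "\<delta>/2"]) auto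
qed

section \<open>Uniqueness of the rate function and scaling invariance of the action\<close>

context ldp_process
begin

text \<open>Lower semicontinuity of the rate function among paths with the same start: its level
  sets are compact in a Hausdorff space, hence closed. The start is fixed because goodness speaks of
  compact sets of starting points.\<close>

lemma neighbourhood_cost:
  assumes T: "0 < T" and \<phi>: "\<phi> \<in> skorohod_space T S" and b: "0 < b" "ennreal b < I T \<phi>"
  shows "\<exists>e>0. \<forall>\<psi>\<in>skorohod_space T S. \<psi> 0 = \<phi> 0 \<longrightarrow> skorohod_dist T \<phi> \<psi> < e \<longrightarrow> ennreal b < I T \<psi>"
proof -
  define K where "K = {\<psi> \<in> skorohod_space T S. \<psi> 0 \<in> {\<phi> 0} \<and> I T \<psi> \<le> ennreal b}"
  have "\<phi> 0 \<in> S" using \<phi> T by (auto simp: skorohod_space_def)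
  moreover have "good_rate_function S T (I T)" using assumption_A T unfolding assumption_A_def by blast
  ultimately have "compactin (mtopology_of (skorohod_metric T S)) K"
    using b(1) \<open>\<phi> 0 \<in> S\<close>
    unfolding good_rate_function_def K_def by (elim allE[of _ b] allE[of _ "{\<phi> 0}"]) simp
  then have "closedin (mtopology_of (skorohod_metric T S)) K"
    by (rule compactin_imp_closedin[OF Hausdorff_skorohod])
  then have "openin (mtopology_of (skorohod_metric T S)) (skorohod_space T S - K)"
    by (simp add: closedin_def)
  moreover have "\<phi> \<in> skorohod_space T S - K" using \<phi> b by (auto simp: K_def)
  ultimately obtain e where "e > 0" "\<forall>\<psi>\<in>skorohod_space T S. skorohod_dist T \<phi> \<psi> < e \<longrightarrow> \<psi> \<in> skorohod_space T S - K"
    unfolding openin_skorohod by blast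
  then show ?thesis by (intro exI[of _ e]) (auto simp: K_def not_le)
qed

text \<open>Both sides are rate functions of the same large deviation principle, once at scale \<open>a\<close> and once
  at scale \<open>a / c\<close>, and rate functions are unique.\<close>

lemma scaling_le:
  assumes p: "path_in S T \<phi>" and T: "0 < T" and c: "0 < c"
  shows "path_cost I (c * T) (\<lambda>t. c *\<^sub>R \<phi> (t / c)) \<le> ennreal c * path_cost I T \<phi>"
proof (rule ccontr)
  define \<phi>c where "\<phi>c t = c *\<^sub>R \<phi> (t / c)" for t
  assume "\<not> path_cost I (c * T) (\<lambda>t. c *\<^sub>R \<phi> (t / c)) \<le> ennreal c * path_cost I T \<phi>"
  then have less: "ennreal c * path_cost I T \<phi> < path_cost I (c * T) \<phi>c"
    by (simp add: not_le \<phi>c_def[abs_def])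
  have cT: "0 < c * T" using c T by simp
  obtain j where j: "path_cost I T \<phi> = ennreal j" "0 \<le> j"
    using less c by (cases "path_cost I T \<phi>") (auto simp: ennreal_mult_top)
  obtain y where y: "ennreal c * path_cost I T \<phi> < y" "y < path_cost I (c * T) \<phi>c"
    using dense[OF less] by blast
  obtain b' where b': "y = ennreal b'" "0 \<le> b'" using y(2) by (cases y) auto
  have cj: "c * j < b'" using y(1) j b' c by (simp add: ennreal_mult[symmetric] ennreal_less_iff)
  \<comment> \<open>Three levels \<open>c * j < b < b'' < b'\<close>: the lower bound is used with
    rate \<open>b / c\<close> at scale \<open>a\<close>, the upper bound with rate
    \<open>b''\<close> at scale \<open>a / c\<close>, and \<open>b'\<close> bounds the action on the
    tube from below.\<close>
  define b where "b = (c * j + b') / 2"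
  define b'' where "b'' = (b + b') / 2"
  have b: "c * j < b" "b < b''" "b'' < b'" using cj by (auto simp: b_def b''_def)
  have b'pos: "0 < b'" using cj j c by (smt (verit) mult_nonneg_nonneg)
  define \<beta> where "\<beta> = b / c"
  have \<beta>: "j < \<beta>" using b(1) c by (simp add: \<beta>_def field_simps)
  have cont: "continuous_on {0..T} \<phi>" using p by (simp add: path_in_def)
  have R: "restrict \<phi> {0..T} \<in> skorohod_space T S"
    using p by (intro continuous_in_skorohod) (auto simp: path_in_def)
  have "continuous_on {0..c*T} (\<phi> \<circ> (\<lambda>t. t / c))"
    using c by (intro continuous_on_compose continuous_intros continuous_on_subset[OF cont])
      (auto simp: field_simps)
  then have contc: "continuous_on {0..c*T} \<phi>c"
    unfolding \<phi>c_def[abs_def] o_def by (rule continuous_on_scaleR[OF continuous_on_const])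
  have "\<phi>c t \<in> S" if "t \<in> {0..c*T}" for t
    unfolding \<phi>c_def using that c path_inD[OF p, of "t / c"]
    by (intro scaling_limits_cone) (auto simp: field_simps)
  then have Rc: "restrict \<phi>c {0..c*T} \<in> skorohod_space (c*T) S"
    by (intro continuous_in_skorohod[OF contc]) auto
  have "ennreal b' < I (c*T) (restrict \<phi>c {0..c*T})" using y(2) b' by (simp add: path_cost_def)
  from neighbourhood_cost[OF cT Rc b'pos this] obtain e where e: "e > 0"
    "\<forall>\<psi>\<in>skorohod_space (c*T) S. \<psi> 0 = restrict \<phi>c {0..c*T} 0 \<longrightarrow>
      skorohod_dist (c*T) (restrict \<phi>c {0..c*T}) \<psi> < e \<longrightarrow> ennreal b' < I (c*T) \<psi>" by blast
  \<comment> \<open>Multiplication by \<open>c\<close> changes the width of the tube to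
    \<open>c * r\<close>, which stays within the Skorohod neighbourhood of radius
    \<open>e\<close>.\<close>
  define r where "r = e / (2 * c)"
  have r: "0 < r" "c * r < e" using e(1) c by (auto simp: r_def)
  define Ct where "Ct = {\<psi> \<in> skorohod_space (c*T) S. \<forall>t\<in>{0..c*T}. dist (\<psi> t) (\<phi>c t) \<le> c * r}"
  have Ct: "closedin (mtopology_of (skorohod_metric (c*T) S)) Ct"
    unfolding Ct_def by (rule closedin_tube[OF contc])
  have Ctb: "ennreal b' \<le> I (c*T) \<psi>" if "\<psi> \<in> Ct" "\<psi> 0 = c *\<^sub>R \<phi> 0" for \<psi>
  proof -
    have "skorohod_dist (c*T) (restrict \<phi>c {0..c*T}) \<psi> \<le> c * r"
      using that(1) r c by (intro skorohod_dist_le_sup) (auto simp: Ct_def dist_commute)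
    then show ?thesis using e(2) r that cT by (auto simp: Ct_def \<phi>c_def intro!: less_imp_le)
  qed
  have \<phi>0: "\<phi> 0 \<in> S" using path_inD[OF p, of 0] T by simp
  obtain \<epsilon>2 where \<epsilon>2: "\<epsilon>2 > 0" "\<forall>\<^sub>F a in at_top. \<forall>z. a *\<^sub>R z \<in> E \<longrightarrow> norm (z - c *\<^sub>R \<phi> 0) < \<epsilon>2 \<longrightarrow>
      scaled_prob (c*T) Ct a z \<le> ennreal (exp (- b'' * a))"
    using ldp_upper_at[OF cT scaling_limits_cone[OF \<phi>0 c] Ct Ctb b(3)] by blast
  obtain e1 where e1: "e1 > 0" "\<forall>\<psi>\<in>skorohod_space T S. skorohod_dist T (restrict \<phi> {0..T}) \<psi> < e1 \<longrightarrow>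
      (\<forall>t\<in>{0..T}. dist (\<psi> t) (restrict \<phi> {0..T} t) < r)"
  proof -
    have "continuous_on {0..T} (restrict \<phi> {0..T}) \<longleftrightarrow> continuous_on {0..T} \<phi>"
      by (rule continuous_on_cong) auto
    then show ?thesis using skorohod_near_continuous[OF R _ r(1)] cont that by blast
  qed
  define U where "U = mball_of (skorohod_metric T S) (restrict \<phi> {0..T}) e1"
  have U: "openin (mtopology_of (skorohod_metric T S)) U" unfolding U_def by (rule openin_skorohod_ball)
  have RU: "restrict \<phi> {0..T} \<in> U"
    using R e1(1) Metric_space.zero[OF Metric_space_skorohod R R] unfolding U_def in_mball_of_skorohod by simp
  have "I T (restrict \<phi> {0..T}) < ennreal \<beta>" using j \<beta> by (simp add: path_cost_def ennreal_less_iff)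
  from ldp_lower_at[OF T U RU this] obtain \<epsilon>1 where \<epsilon>1: "\<epsilon>1 > 0"
    "\<forall>\<^sub>F a in at_top. \<forall>z. a *\<^sub>R z \<in> E \<longrightarrow> norm (z - \<phi> 0) < \<epsilon>1 \<longrightarrow>
      ennreal (exp (- \<beta> * a)) \<le> scaled_prob T U a z" using T by auto
  have "\<forall>\<^sub>F a in at_top. \<exists>w. a *\<^sub>R w \<in> E \<and> norm (w - \<phi> 0) < min \<epsilon>1 (\<epsilon>2 / c)"
    using \<epsilon>1(1) \<epsilon>2(1) c by (intro scaling_limits_eventually[OF \<phi>0]) auto
  moreover have "\<forall>\<^sub>F a in at_top. \<forall>z. (a / c) *\<^sub>R z \<in> E \<longrightarrow> norm (z - c *\<^sub>R \<phi> 0) < \<epsilon>2 \<longrightarrow>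
      scaled_prob (c*T) Ct (a / c) z \<le> ennreal (exp (- b'' * (a / c)))"
  proof -
    have "filterlim (\<lambda>a. (1 / c) * a) at_top at_top"
      using c by (intro filterlim_tendsto_pos_mult_at_top[OF tendsto_const] filterlim_ident) auto
    then have "filterlim (\<lambda>a. a / c) at_top at_top" by simp
    from eventually_compose_filterlim[OF \<epsilon>2(2) this] show ?thesis .
  qed
  ultimately have "\<forall>\<^sub>F a::real in at_top. False"
    using \<epsilon>1(2) eventually_gt_at_top[of 0]
  proof eventually_elim
    case (elim a)
    then obtain z where z: "a *\<^sub>R z \<in> E" "norm (z - \<phi> 0) < \<epsilon>1" "norm (z - \<phi> 0) < \<epsilon>2 / c" by auto
    \<comment> \<open>Both scales describe the same process started at the same point: the path at
      scale \<open>a / c\<close> over \<open>[0, c * T]\<close> is \<open>c\<close> times the path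
      at scale \<open>a\<close> over \<open>[0, T]\<close>, with time stretched by
      \<open>c\<close>.\<close>
    have ac: "(a / c) *\<^sub>R (c *\<^sub>R z) = a *\<^sub>R z" "0 < a / c" using c elim by auto
    define N where "N = {\<omega> \<in> space M. rescaled_path X (c*T) (a/c) \<omega> \<in> Ct}"
    have N: "N \<in> sets M" unfolding N_def Ct_def using ac cT contc by (intro tube_event_sets) auto
    have "ennreal (exp (- \<beta> * a)) \<le> scaled_prob T U a z" using elim z by blast
    also have "\<dots> \<le> emeasure (P (a *\<^sub>R z)) N"
    proof (rule scaled_prob_mono[OF z(1) N])
      fix \<omega> assume \<omega>: "\<omega> \<in> space M" "rescaled_path X T a \<omega> \<in> U"
      then have near: "dist (rescaled_path X T a \<omega> t) (\<phi> t) < r" if "t \<in> {0..T}" for t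
        using e1(2) that unfolding U_def in_mball_of_skorohod by auto
      have "dist (rescaled_path X (c*T) (a/c) \<omega> t) (\<phi>c t) \<le> c * r" if t: "t \<in> {0..c*T}" for t
      proof -
        have tc: "t / c \<in> {0..T}" using t c by (auto simp: field_simps)
        have "rescaled_path X (c*T) (a/c) \<omega> t = c *\<^sub>R rescaled_path X T a \<omega> (t / c)"
          using t tc c elim by (simp add: rescaled_path_def field_simps)
        then have "dist (rescaled_path X (c*T) (a/c) \<omega> t) (\<phi>c t) = c * dist (rescaled_path X T a \<omega> (t / c)) (\<phi> (t / c))"
          using c by (simp add: \<phi>c_def dist_norm flip: scaleR_diff_right)
        then show ?thesis using near[OF tc] c by (simp add: less_imp_le)
      qed
      then show "\<omega> \<in> N" using \<omega>(1) rescaled_path_skorohod[OF ac(2) \<omega>(1), of "c*T"] by (auto simp: N_def Ct_def)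
    qed
    also have "\<dots> = scaled_prob (c*T) Ct (a/c) (c *\<^sub>R z)"
      unfolding scaled_prob_def N_def ac(1) ..
    also have "\<dots> \<le> ennreal (exp (- b'' * (a / c)))"
    proof -
      have "norm (c *\<^sub>R z - c *\<^sub>R \<phi> 0) = c * norm (z - \<phi> 0)" using c by (simp flip: scaleR_diff_right)
      also have "\<dots> < \<epsilon>2" using z(3) c by (simp add: field_simps)
      finally have n: "norm (c *\<^sub>R z - c *\<^sub>R \<phi> 0) < \<epsilon>2" .
      have "(a / c) *\<^sub>R (c *\<^sub>R z) \<in> E" using z(1) unfolding ac(1) .
      then show ?thesis using elim(2) n by blast
    qed
    \<comment> \<open>This forces \<open>b'' \<le> b\<close>, against the choice of the
      levels.\<close>
    finally have "exp (- \<beta> * a) \<le> exp (- b'' * (a / c))" by simp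
    then have "b'' * a \<le> b * a" using c elim by (simp add: \<beta>_def field_simps)
    then show False using b elim by simp
  qed
  then show False by simp
qed

lemma scaling_eq:
  assumes p: "path_in S T \<phi>" and T: "0 < T" and c: "0 < c"
  shows "path_cost I (c * T) (\<lambda>t. c *\<^sub>R \<phi> (t / c)) = ennreal c * path_cost I T \<phi>"
proof (rule antisym[OF scaling_le[OF assms]])
  let ?\<phi>c = "\<lambda>t. c *\<^sub>R \<phi> (t / c)"
  have cont: "continuous_on {0..T} \<phi>" using p by (simp add: path_in_def)
  have "continuous_on {0..c*T} (\<phi> \<circ> (\<lambda>t. t / c))"
    using c by (intro continuous_on_compose continuous_intros continuous_on_subset[OF cont])
      (auto simp: field_simps)
  then have "continuous_on {0..c*T} ?\<phi>c"
    unfolding o_def by (rule continuous_on_scaleR[OF continuous_on_const])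
  moreover have "?\<phi>c t \<in> S" if "t \<in> {0..c*T}" for t
    using that c path_inD[OF p, of "t / c"]
    by (intro scaling_limits_cone) (auto simp: field_simps)
  ultimately have "path_in S (c * T) ?\<phi>c" by (auto simp: path_in_def)
  from scaling_le[OF this, of "1/c"] have "path_cost I T \<phi> \<le> ennreal (1 / c) * path_cost I (c * T) ?\<phi>c"
    using c T by simp
  then have "ennreal c * path_cost I T \<phi> \<le> ennreal c * (ennreal (1 / c) * path_cost I (c * T) ?\<phi>c)"
    by (rule mult_left_mono) simp
  also have "\<dots> = path_cost I (c * T) ?\<phi>c"
    using c by (simp add: mult.assoc[symmetric] ennreal_mult[symmetric])
  finally show "ennreal c * path_cost I T \<phi> \<le> path_cost I (c * T) ?\<phi>c" .
qed

lemma ex_action_space: "\<exists>L C0 d0. action_space S I L C0 d0"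
proof -
  obtain L where L: "rate_has_lagrangian S I L" "lagrangian_bounds S L"
    using assumption_A unfolding assumption_A_def by blast
  obtain c d where cd: "c \<ge> 0" "d > 0" "\<forall>x\<in>S. \<forall>v. norm v \<le> d \<longrightarrow> L x v \<le> c"
    using lagrangian_locally_bounded[OF L(2)] zero_in_S by blast
  have "action_space S I L c d"
  proof
    show "S - {0} \<noteq> {}" using zero_in_S S_nontrivial by blast
    show "good_rate_function S T (I T)" if "0 < T" for T
      using assumption_A that unfolding assumption_A_def by blast
  qed (use L cd zero_in_S S_closed S_convex scaling_limits_cone scaling_eq in auto)
  then show ?thesis by blast
qed

end

section \<open>The Markov property\<close>

context process_setting
begin

text \<open>The strong Markov property at the constant stopping time \<open>u\<close>.\<close>

lemma markov_emeasure:
  assumes x: "x \<in> E" and u: "0 \<le> u" and A: "A \<in> sets (F (ennreal u))" and B: "B \<in> sets borel" and s: "0 \<le> s"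
  shows "emeasure (P x) {\<omega> \<in> A. X (u + s) \<omega> \<in> B} =
    (\<integral>\<^sup>+\<omega>\<in>A. emeasure (P (X u \<omega>)) {\<omega>' \<in> space M. X s \<omega>' \<in> B} \<partial>P x)"
proof -
  have st: "stopping_time F (\<lambda>_. ennreal u)" by (rule stopping_time_const)
  have "A \<in> sets (pre_sigma (\<lambda>_. ennreal u))"
  proof (rule sets_pre_sigmaI[OF st])
    fix t show "{\<omega> \<in> A. ennreal u \<le> t} \<in> sets (F t)"
      using A sets_F_mono[of "ennreal u" t] by (cases "ennreal u \<le> t") auto
  qed
  from strong_markov[OF x st this B s] show ?thesis using u by simp
qed

text \<open>The assumptions on \<open>P y\<close> concern \<open>y\<close> in \<open>E\<close>; the
  indicator extends the kernel by 0 to a Borel function on the whole space.\<close>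

definition kernel :: "real \<Rightarrow> ('a \<Rightarrow> ennreal) \<Rightarrow> 'a \<Rightarrow> ennreal" where
  "kernel s g y = (\<integral>\<^sup>+\<omega>. g (X s \<omega>) \<partial>P y) * indicator E y"

lemma E_borel: "E \<in> sets borel"
  using closed_E by (rule borel_closed)

text \<open>Approximation from indicators. Measurability of the kernel is carried through the same
  induction because linearity and monotone convergence on the right-hand side depend on it.\<close>

lemma markov_kernel:
  fixes g :: "'a \<Rightarrow> ennreal"
  assumes g: "g \<in> borel_measurable borel" and s: "0 \<le> s"
  shows "kernel s g \<in> borel_measurable borel \<and>
    (\<forall>x u A. x \<in> E \<longrightarrow> 0 \<le> u \<longrightarrow> A \<in> sets (F (ennreal u)) \<longrightarrow>
      (\<integral>\<^sup>+\<omega>\<in>A. g (X (u + s) \<omega>) \<partial>P x) = (\<integral>\<^sup>+\<omega>\<in>A. kernel s g (X u \<omega>) \<partial>P x))"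
  using g
proof (induction g rule: borel_measurable_induct)
  case (cong f g)
  then have "f = g" by auto
  then show ?case using cong by simp
next
  case (set B)
  have k: "kernel s (indicator B) y = emeasure (P y) {\<omega> \<in> space M. X s \<omega> \<in> B} * indicator E y" for y
  proof (cases "y \<in> E")
    case True
    have "(\<integral>\<^sup>+\<omega>. indicator B (X s \<omega>) \<partial>P y) = (\<integral>\<^sup>+\<omega>. indicator {\<omega> \<in> space M. X s \<omega> \<in> B} \<omega> \<partial>P y)"
      using space_P[OF True] by (intro nn_integral_cong) (auto split: split_indicator)
    also have "\<dots> = emeasure (P y) {\<omega> \<in> space M. X s \<omega> \<in> B}"
    proof (rule nn_integral_indicator)
      have "X s -` B \<inter> space (P y) \<in> sets (P y)"
        using X_measurable_P[OF True s] set by (rule measurable_sets)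
      then show "{\<omega> \<in> space M. X s \<omega> \<in> B} \<in> sets (P y)"
        using space_P[OF True] by (simp add: vimage_def Int_def conj_commute)
    qed
    finally show ?thesis by (simp add: kernel_def)
  qed (simp add: kernel_def)
  have "(\<lambda>y. emeasure (P y) {\<omega> \<in> space M. X s \<omega> \<in> B}) \<in> borel_measurable (restrict_space borel E)"
    using transition_measurable[OF s] set by simp
  then have "(\<lambda>y. emeasure (P y) {\<omega> \<in> space M. X s \<omega> \<in> B} * indicator E y) \<in> borel_measurable borel"
    by (rule borel_measurable_restrict_space_iff_ennreal[THEN iffD1, rotated]) (simp add: E_borel)
  then have "kernel s (indicator B) \<in> borel_measurable borel" by (simp add: k[abs_def])
  moreover have "(\<integral>\<^sup>+\<omega>\<in>A. indicator B (X (u + s) \<omega>) \<partial>P x) = (\<integral>\<^sup>+\<omega>\<in>A. kernel s (indicator B) (X u \<omega>) \<partial>P x)"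
    if x: "x \<in> E" and u: "0 \<le> u" and A: "A \<in> sets (F (ennreal u))" for x u A
  proof -
    have AM: "A \<in> sets M" using F_sets_M[OF A] .
    have "X (u + s) -` B \<inter> space M \<in> sets M"
      using X_measurable[of "u + s"] u s set by (intro measurable_sets) auto
    then have "A \<inter> (X (u + s) -` B \<inter> space M) \<in> sets M" using AM by (rule sets.Int[rotated])
    moreover have "A \<inter> (X (u + s) -` B \<inter> space M) = {\<omega> \<in> A. X (u + s) \<omega> \<in> B}"
      using sets.sets_into_space[OF AM] by auto
    ultimately have m: "{\<omega> \<in> A. X (u + s) \<omega> \<in> B} \<in> sets (P x)" using sets_P[OF x] by simp
    have "(\<integral>\<^sup>+\<omega>\<in>A. indicator B (X (u + s) \<omega>) \<partial>P x) = (\<integral>\<^sup>+\<omega>. indicator {\<omega> \<in> A. X (u + s) \<omega> \<in> B} \<omega> \<partial>P x)"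
      by (intro nn_integral_cong) (auto split: split_indicator)
    also have "\<dots> = emeasure (P x) {\<omega> \<in> A. X (u + s) \<omega> \<in> B}" using m by simp
    also have "\<dots> = (\<integral>\<^sup>+\<omega>\<in>A. emeasure (P (X u \<omega>)) {\<omega>' \<in> space M. X s \<omega>' \<in> B} \<partial>P x)"
      using markov_emeasure[OF x u A _ s] set by simp
    also have "\<dots> = (\<integral>\<^sup>+\<omega>\<in>A. kernel s (indicator B) (X u \<omega>) \<partial>P x)"
      using space_P[OF x] X_in_E[OF u] by (intro nn_integral_cong) (simp add: k)
    finally show ?thesis .
  qed
  ultimately show ?case by blast
next
  case (mult h c)
  have k: "kernel s (\<lambda>x. c * h x) y = c * kernel s h y" for y
  proof (cases "y \<in> E")
    case True
    have "(\<lambda>\<omega>. h (X s \<omega>)) \<in> borel_measurable (P y)"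
      using X_measurable_P[OF True s] mult by (auto intro: measurable_compose)
    then show ?thesis by (simp add: kernel_def nn_integral_cmult mult.assoc)
  qed (simp add: kernel_def)
  have "(\<integral>\<^sup>+\<omega>\<in>A. c * h (X (u + s) \<omega>) \<partial>P x) = (\<integral>\<^sup>+\<omega>\<in>A. kernel s (\<lambda>x. c * h x) (X u \<omega>) \<partial>P x)"
    if x: "x \<in> E" and u: "0 \<le> u" and A: "A \<in> sets (F (ennreal u))" for x u A
  proof -
    have [measurable]: "A \<in> sets (P x)" "X u \<in> borel_measurable (P x)" "X (u + s) \<in> borel_measurable (P x)"
      using F_sets_M[OF A] sets_P[OF x] X_measurable_P[OF x] u s by auto
    have [measurable]: "h \<in> borel_measurable borel" "kernel s h \<in> borel_measurable borel"
      using mult by auto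
    have "(\<integral>\<^sup>+\<omega>\<in>A. c * h (X (u + s) \<omega>) \<partial>P x) = c * (\<integral>\<^sup>+\<omega>\<in>A. h (X (u + s) \<omega>) \<partial>P x)"
      by (subst nn_integral_cmult[symmetric]) (auto simp: mult.assoc)
    also have "\<dots> = c * (\<integral>\<^sup>+\<omega>\<in>A. kernel s h (X u \<omega>) \<partial>P x)" using mult x u A by simp
    also have "\<dots> = (\<integral>\<^sup>+\<omega>\<in>A. c * kernel s h (X u \<omega>) \<partial>P x)"
      by (subst nn_integral_cmult[symmetric]) (auto simp: mult.assoc)
    finally show ?thesis by (simp add: k)
  qed
  moreover have "kernel s (\<lambda>x. c * h x) \<in> borel_measurable borel"
    unfolding k[abs_def] using mult by (intro borel_measurable_times_ennreal borel_measurable_const) blast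
  ultimately show ?case by blast
next
  case (add h g)
  have k: "kernel s (\<lambda>x. g x + h x) y = kernel s g y + kernel s h y" for y
  proof (cases "y \<in> E")
    case True
    have "(\<lambda>\<omega>. h (X s \<omega>)) \<in> borel_measurable (P y)" "(\<lambda>\<omega>. g (X s \<omega>)) \<in> borel_measurable (P y)"
      using X_measurable_P[OF True s] add by (auto intro: measurable_compose)
    then show ?thesis by (simp add: kernel_def nn_integral_add distrib_right)
  qed (simp add: kernel_def)
  have "(\<integral>\<^sup>+\<omega>\<in>A. (g (X (u + s) \<omega>) + h (X (u + s) \<omega>)) \<partial>P x) = (\<integral>\<^sup>+\<omega>\<in>A. kernel s (\<lambda>x. g x + h x) (X u \<omega>) \<partial>P x)"
    if x: "x \<in> E" and u: "0 \<le> u" and A: "A \<in> sets (F (ennreal u))" for x u A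
  proof -
    have [measurable]: "A \<in> sets (P x)" "X u \<in> borel_measurable (P x)" "X (u + s) \<in> borel_measurable (P x)"
      using F_sets_M[OF A] sets_P[OF x] X_measurable_P[OF x] u s by auto
    have [measurable]: "h \<in> borel_measurable borel" "kernel s h \<in> borel_measurable borel"
      "g \<in> borel_measurable borel" "kernel s g \<in> borel_measurable borel"
      using add by auto
    have "(\<integral>\<^sup>+\<omega>\<in>A. (g (X (u + s) \<omega>) + h (X (u + s) \<omega>)) \<partial>P x) =
        (\<integral>\<^sup>+\<omega>\<in>A. g (X (u + s) \<omega>) \<partial>P x) + (\<integral>\<^sup>+\<omega>\<in>A. h (X (u + s) \<omega>) \<partial>P x)"
      by (subst nn_integral_add[symmetric]) (auto simp: distrib_right)
    also have "\<dots> = (\<integral>\<^sup>+\<omega>\<in>A. kernel s g (X u \<omega>) \<partial>P x) + (\<integral>\<^sup>+\<omega>\<in>A. kernel s h (X u \<omega>) \<partial>P x)"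
      using add x u A by simp
    also have "\<dots> = (\<integral>\<^sup>+\<omega>\<in>A. (kernel s g (X u \<omega>) + kernel s h (X u \<omega>)) \<partial>P x)"
      by (subst nn_integral_add[symmetric]) (auto simp: distrib_right)
    finally show ?thesis by (simp add: k)
  qed
  moreover have "kernel s (\<lambda>x. g x + h x) \<in> borel_measurable borel"
    unfolding k[abs_def] using add by (intro borel_measurable_add) blast+
  ultimately show ?case by blast
next
  case (seq U)
  have mono: "incseq (\<lambda>i. U i y)" for y using seq(3) by (auto simp: incseq_def le_fun_def)
  have k: "kernel s (\<lambda>y. SUP i. U i y) y = (SUP i. kernel s (U i) y)" for y
  proof (cases "y \<in> E")
    case True
    have "(\<integral>\<^sup>+\<omega>. (SUP i. U i (X s \<omega>)) \<partial>P y) = (SUP i. \<integral>\<^sup>+\<omega>. U i (X s \<omega>) \<partial>P y)"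
    proof (rule nn_integral_monotone_convergence_SUP)
      show "incseq (\<lambda>i \<omega>. U i (X s \<omega>))" using mono by (auto simp: incseq_def le_fun_def)
      show "(\<lambda>\<omega>. U i (X s \<omega>)) \<in> borel_measurable (P y)" for i
        using X_measurable_P[OF True s] seq by (auto intro: measurable_compose)
    qed
    then show ?thesis using True by (simp add: kernel_def)
  qed (simp add: kernel_def)
  have kmono: "incseq (\<lambda>i. kernel s (U i) y)" for y
    using mono by (auto simp: incseq_def kernel_def intro!: mult_right_mono nn_integral_mono)
  have "(\<integral>\<^sup>+\<omega>\<in>A. (SUP i. U i (X (u + s) \<omega>)) \<partial>P x) = (\<integral>\<^sup>+\<omega>\<in>A. kernel s (\<lambda>y. SUP i. U i y) (X u \<omega>) \<partial>P x)"
    if x: "x \<in> E" and u: "0 \<le> u" and A: "A \<in> sets (F (ennreal u))" for x u A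
  proof -
    have [measurable]: "A \<in> sets (P x)" "X u \<in> borel_measurable (P x)" "X (u + s) \<in> borel_measurable (P x)"
      using F_sets_M[OF A] sets_P[OF x] X_measurable_P[OF x] u s by auto
    have [measurable]: "U i \<in> borel_measurable borel" "kernel s (U i) \<in> borel_measurable borel" for i
      using seq by auto
    have "(\<integral>\<^sup>+\<omega>\<in>A. (SUP i. U i (X (u + s) \<omega>)) \<partial>P x) = (\<integral>\<^sup>+\<omega>. (SUP i. U i (X (u + s) \<omega>) * indicator A \<omega>) \<partial>P x)"
      by (simp add: SUP_mult_right_ennreal)
    also have "\<dots> = (SUP i. \<integral>\<^sup>+\<omega>. U i (X (u + s) \<omega>) * indicator A \<omega> \<partial>P x)"
      using mono by (intro nn_integral_monotone_convergence_SUP)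
        (auto simp: incseq_def le_fun_def intro!: mult_right_mono)
    also have "\<dots> = (SUP i. \<integral>\<^sup>+\<omega>. kernel s (U i) (X u \<omega>) * indicator A \<omega> \<partial>P x)"
      using seq.IH x u A by (intro SUP_cong refl) blast
    also have "\<dots> = (\<integral>\<^sup>+\<omega>. (SUP i. kernel s (U i) (X u \<omega>) * indicator A \<omega>) \<partial>P x)"
      using kmono by (intro nn_integral_monotone_convergence_SUP[symmetric])
        (auto simp: incseq_def le_fun_def intro!: mult_right_mono)
    also have "\<dots> = (\<integral>\<^sup>+\<omega>\<in>A. kernel s (\<lambda>y. SUP i. U i y) (X u \<omega>) \<partial>P x)"
      by (simp add: SUP_mult_right_ennreal k)
    finally show ?thesis .
  qed
  moreover have "kernel s (\<lambda>y. SUP i. U i y) \<in> borel_measurable borel"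
    unfolding k[abs_def] using seq by (intro borel_measurable_SUP) auto
  moreover have "(SUP i. U i) = (\<lambda>y. SUP i. U i y)" by (rule ext, rule SUP_apply)
  ultimately show ?case by simp
qed

text \<open>Constraints at finitely many times are stored with time increments, so that the Markov
  property at the next time peels off the head of the list; \<open>fd_prob\<close> is the
  corresponding iterated kernel.\<close>

primrec fd_event :: "(real \<times> 'a set) list \<Rightarrow> real \<Rightarrow> 'w \<Rightarrow> bool" where
  "fd_event [] u \<omega> = True"
| "fd_event (p # l) u \<omega> = (X (u + fst p) \<omega> \<in> snd p \<and> fd_event l (u + fst p) \<omega>)"

primrec fd_prob :: "(real \<times> 'a set) list \<Rightarrow> 'a \<Rightarrow> ennreal" where
  "fd_prob [] = (\<lambda>_. 1)"
| "fd_prob (p # l) = kernel (fst p) (\<lambda>y. indicator (snd p) y * fd_prob l y)"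

definition fd_valid :: "(real \<times> 'a set) list \<Rightarrow> bool" where
  "fd_valid l \<longleftrightarrow> (\<forall>p\<in>set l. 0 \<le> fst p \<and> snd p \<in> sets borel)"

lemma fd_valid_Cons: "fd_valid (p # l) \<longleftrightarrow> 0 \<le> fst p \<and> snd p \<in> sets borel \<and> fd_valid l"
  by (auto simp: fd_valid_def)

lemma fd_prob_measurable: "fd_valid l \<Longrightarrow> fd_prob l \<in> borel_measurable borel"
proof (induction l)
  case (Cons p l)
  then have "(\<lambda>y. indicator (snd p) y * fd_prob l y) \<in> borel_measurable borel"
    by (intro borel_measurable_times_ennreal borel_measurable_indicator) (auto simp: fd_valid_Cons)
  from markov_kernel[OF this, of "fst p"] show ?case using Cons.prems by (simp add: fd_valid_Cons)
qed simp

text \<open>\<open>A\<close> is general so that the first constraint can be merged into it, at the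
  later time \<open>u + fst p\<close>. The induction hypothesis for the rest of the list is then
  followed by one use of \<open>markov_kernel\<close>.\<close>

lemma fd_markov:
  assumes x: "x \<in> E"
  shows "fd_valid l \<Longrightarrow> 0 \<le> u \<Longrightarrow> A \<in> sets (F (ennreal u)) \<Longrightarrow>
    emeasure (P x) {\<omega> \<in> A. fd_event l u \<omega>} = (\<integral>\<^sup>+\<omega>\<in>A. fd_prob l (X u \<omega>) \<partial>P x)"
proof (induction l arbitrary: u A)
  case Nil
  then have "A \<in> sets (P x)" using F_sets_M sets_P[OF x] by auto
  then show ?case by simp
next
  case (Cons p l)
  obtain s B where p: "p = (s, B)" by (cases p)
  have s: "0 \<le> s" and B: "B \<in> sets borel" and l: "fd_valid l"
    using Cons.prems by (auto simp: fd_valid_Cons p)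
  let ?A = "{\<omega> \<in> A. X (u + s) \<omega> \<in> B}"
  have A': "?A \<in> sets (F (ennreal (u + s)))"
  proof -
    have "X (u + s) -` B \<inter> space (F (ennreal (u + s))) \<in> sets (F (ennreal (u + s)))"
      using adapted[of "u + s"] Cons.prems s B by (intro measurable_sets) auto
    moreover have A: "A \<in> sets (F (ennreal (u + s)))"
      using Cons.prems s sets_F_mono[of "ennreal u" "ennreal (u + s)"] by (auto simp: ennreal_leI)
    ultimately have "A \<inter> (X (u + s) -` B \<inter> space (F (ennreal (u + s)))) \<in> sets (F (ennreal (u + s)))"
      by (rule sets.Int[rotated])
    moreover have "A \<inter> (X (u + s) -` B \<inter> space (F (ennreal (u + s)))) = ?A"
      using sets.sets_into_space[OF A] by auto
    ultimately show ?thesis by simp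
  qed
  have g: "(\<lambda>y. indicator B y * fd_prob l y) \<in> borel_measurable borel"
    using B fd_prob_measurable[OF l] by (intro borel_measurable_times_ennreal borel_measurable_indicator) auto
  have "{\<omega> \<in> A. fd_event (p # l) u \<omega>} = {\<omega> \<in> ?A. fd_event l (u + s) \<omega>}" by (auto simp: p)
  then have "emeasure (P x) {\<omega> \<in> A. fd_event (p # l) u \<omega>} = (\<integral>\<^sup>+\<omega>\<in>?A. fd_prob l (X (u + s) \<omega>) \<partial>P x)"
    using Cons.IH[OF l _ A'] Cons.prems s by simp
  also have "\<dots> = (\<integral>\<^sup>+\<omega>\<in>A. (indicator B (X (u + s) \<omega>) * fd_prob l (X (u + s) \<omega>)) \<partial>P x)"
    by (intro nn_integral_cong) (auto split: split_indicator)
  also have "\<dots> = (\<integral>\<^sup>+\<omega>\<in>A. fd_prob (p # l) (X u \<omega>) \<partial>P x)"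
    using markov_kernel[OF g s] x Cons.prems by (simp add: p)
  finally show ?case .
qed

text \<open>Time 0 and the whole space in \<open>fd_markov\<close>; the process starts almost surely
  at \<open>y\<close>.\<close>

lemma fd_prob_eq:
  assumes y: "y \<in> E" and l: "fd_valid l"
  shows "emeasure (P y) {\<omega> \<in> space M. fd_event l 0 \<omega>} = fd_prob l y"
proof -
  interpret prob_space "P y" using prob_space_P[OF y] .
  have "space M \<in> sets (F (ennreal 0))" using sets.top[of "F (ennreal 0)"] space_F by simp
  from fd_markov[OF y l _ this]
  have "emeasure (P y) {\<omega> \<in> space M. fd_event l 0 \<omega>} = (\<integral>\<^sup>+\<omega>\<in>space M. fd_prob l (X 0 \<omega>) \<partial>P y)" by simp
  also have "\<dots> = (\<integral>\<^sup>+\<omega>. fd_prob l y \<partial>P y)"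
  proof (rule nn_integral_cong_AE)
    show "AE \<omega> in P y. fd_prob l (X 0 \<omega>) * indicator (space M) \<omega> = fd_prob l y"
      using initial[OF y] AE_space by eventually_elim (simp add: space_P[OF y])
  qed
  also have "\<dots> = fd_prob l y" by (simp add: emeasure_space_1)
  finally show ?thesis .
qed

primrec increments :: "(real \<Rightarrow> 'a set) \<Rightarrow> real list \<Rightarrow> real \<Rightarrow> (real \<times> 'a set) list" where
  "increments \<Gamma> [] p = []"
| "increments \<Gamma> (t # ts) p = (t - p, \<Gamma> t) # increments \<Gamma> ts t"

lemma increments:
  "sorted (p # ts) \<Longrightarrow> \<forall>t\<in>set ts. \<Gamma> t \<in> sets borel \<Longrightarrow>
    fd_valid (increments \<Gamma> ts p) \<and>
    (\<forall>u. fd_event (increments \<Gamma> ts p) (u + p) \<omega> \<longleftrightarrow> (\<forall>t\<in>set ts. X (u + t) \<omega> \<in> \<Gamma> t))"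
proof (induction ts arbitrary: p)
  case (Cons t ts)
  have "sorted (t # ts)" "p \<le> t" using Cons.prems(1) by auto
  with Cons.IH[of t] Cons.prems(2) show ?case
    by (auto simp: fd_valid_Cons)
qed (simp add: fd_valid_def)

lemma markov_finite:
  assumes Q: "finite Q" "\<And>q. q \<in> Q \<Longrightarrow> 0 \<le> q" and \<Gamma>: "\<And>q. q \<in> Q \<Longrightarrow> \<Gamma> q \<in> sets borel"
    and x: "x \<in> E" and u: "0 \<le> u" and A: "A \<in> sets (F (ennreal u))"
  shows "emeasure (P x) {\<omega> \<in> A. \<forall>q\<in>Q. X (u + q) \<omega> \<in> \<Gamma> q} =
    (\<integral>\<^sup>+\<omega>\<in>A. emeasure (P (X u \<omega>)) {\<omega>' \<in> space M. \<forall>q\<in>Q. X q \<omega>' \<in> \<Gamma> q} \<partial>P x)"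
proof -
  define ts where "ts = sorted_list_of_set Q"
  define l where "l = increments \<Gamma> ts 0"
  have ts: "sorted (0 # ts)" "set ts = Q" using Q by (auto simp: ts_def)
  have l: "fd_valid l" using increments[OF ts(1)] \<Gamma> ts by (simp add: l_def)
  have ev: "fd_event l v \<omega> \<longleftrightarrow> (\<forall>q\<in>Q. X (v + q) \<omega> \<in> \<Gamma> q)" for v \<omega>
    using increments[OF ts(1), of \<Gamma> \<omega>] \<Gamma> ts by (simp add: l_def)
  have "emeasure (P x) {\<omega> \<in> A. \<forall>q\<in>Q. X (u + q) \<omega> \<in> \<Gamma> q} = (\<integral>\<^sup>+\<omega>\<in>A. fd_prob l (X u \<omega>) \<partial>P x)"
    using fd_markov[OF x l u A] by (simp add: ev)
  also have "\<dots> = (\<integral>\<^sup>+\<omega>\<in>A. emeasure (P (X u \<omega>)) {\<omega>' \<in> space M. \<forall>q\<in>Q. X q \<omega>' \<in> \<Gamma> q} \<partial>P x)"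
    using fd_prob_eq[OF X_in_E[OF u] l] space_P[OF x] by (intro nn_integral_cong) (simp add: ev)
  finally show ?thesis .
qed

lemma X_event_sets: "0 \<le> t \<Longrightarrow> B \<in> sets borel \<Longrightarrow> {\<omega> \<in> space M. X t \<omega> \<in> B} \<in> sets (F (ennreal t))"
  using measurable_sets[OF adapted, of t B] by (simp add: space_F vimage_def Int_def conj_commute)

text \<open>On finite grids the Markov property is an equality. The grid events decrease to the
  event on the right, and each of them dominates the left-hand side by monotonicity of the integral,
  which works whether or not the probability of the full path event is measurable in the starting
  point.\<close>

lemma markov_closed:
  assumes G: "closed G" and T: "0 \<le> T"
    and x: "x \<in> E" and u: "0 \<le> u" and A: "A \<in> sets (F (ennreal u))"
  shows "(\<integral>\<^sup>+\<omega>\<in>A. emeasure (P (X u \<omega>)) {\<omega>' \<in> space M. \<forall>t\<in>{0..T}. (t, X t \<omega>') \<in> G} \<partial>P x)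
    \<le> emeasure (P x) {\<omega> \<in> A. \<forall>t\<in>{0..T}. (t, X (u + t) \<omega>) \<in> G}"
proof -
  let ?D = "insert T ({0..T} \<inter> \<rat>)"
  define q where "q = from_nat_into ?D"
  have rq: "range q = ?D" unfolding q_def by (rule range_from_nat_into) (use countable_time_grid in auto)
  define \<Gamma> where "\<Gamma> t = {y. (t, y) \<in> G}" for t
  have "closed (\<Gamma> t)" for t
    using closed_vimage[OF G, of "\<lambda>y. (t, y)"] by (simp add: \<Gamma>_def vimage_def continuous_intros)
  then have \<Gamma>: "\<Gamma> t \<in> sets borel" for t by (rule borel_closed)
  have qT: "q i \<in> {0..T}" for i
  proof -
    have "q i \<in> ?D" unfolding rq[symmetric] by (rule rangeI)
    then show ?thesis using T by auto
  qed
  then have q0: "0 \<le> q i" for i unfolding atLeastAtMost_iff by blast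
  have AM: "A \<in> sets M" using F_sets_M[OF A] .
  have XM: "{\<omega> \<in> space M. X t \<omega> \<in> \<Gamma> t'} \<in> sets M" if "0 \<le> t" for t t'
    using F_sets_M[OF X_event_sets[OF that \<Gamma>]] .
  define B where "B n = {\<omega> \<in> A. \<forall>t\<in>q ` {..n}. X (u + t) \<omega> \<in> \<Gamma> t}" for n
  have B: "B n \<in> sets (P x)" for n
  proof -
    have "B n = A \<inter> (\<Inter>t\<in>q ` {..n}. {\<omega> \<in> space M. X (u + t) \<omega> \<in> \<Gamma> t})"
      using sets.sets_into_space[OF AM] by (auto simp: B_def)
    also have "\<dots> \<in> sets M"
      by (intro sets.Int AM sets.finite_INT XM) (use q0 u in auto)
    finally show ?thesis using sets_P[OF x] by simp
  qed
  have fin: "finite_measure (P x)" using prob_space_P[OF x] by (simp add: prob_space_def)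
  have dec: "decseq B" unfolding B_def by (intro antimonoI) fastforce
  have "{\<omega> \<in> A. \<forall>t\<in>{0..T}. (t, X (u + t) \<omega>) \<in> G} = (\<Inter>n. B n)"
  proof (intro set_eqI iffI)
    fix \<omega> assume \<omega>: "\<omega> \<in> {\<omega> \<in> A. \<forall>t\<in>{0..T}. (t, X (u + t) \<omega>) \<in> G}"
    then show "\<omega> \<in> (\<Inter>n. B n)" using qT by (simp add: B_def \<Gamma>_def)
  next
    fix \<omega> assume \<omega>: "\<omega> \<in> (\<Inter>n. B n)"
    then have \<omega>A: "\<omega> \<in> A" and "(q i, X (u + q i) \<omega>) \<in> G" for i by (auto simp: B_def \<Gamma>_def)
    then have *: "(t, X (u + t) \<omega>) \<in> G" if tD: "t \<in> ?D" for t
    proof -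
      obtain i where "t = q i" using tD unfolding rq[symmetric] by blast
      then show ?thesis using \<open>\<And>i. (q i, X (u + q i) \<omega>) \<in> G\<close> by simp
    qed
    have \<omega>M: "\<omega> \<in> space M" using \<omega>A sets.sets_into_space[OF AM] by auto
    have "((\<lambda>t. X (u + t) \<omega>) \<longlongrightarrow> X (u + t) \<omega>) (at_right t)" if t: "0 \<le> t" for t
    proof -
      have fl: "filterlim (\<lambda>s. u + s) (at_right (u + t)) (at_right t)"
        unfolding filterlim_at by (auto simp: eventually_at_filter intro!: tendsto_intros)
      have "((\<lambda>s. X s \<omega>) \<longlongrightarrow> X (u + t) \<omega>) (at_right (u + t))"
        using right_continuous[OF _ \<omega>M, of "u + t"] t u by simp
      from filterlim_compose[OF this fl] show ?thesis .
    qed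
    then have "(t, X (u + t) \<omega>) \<in> G" if "t \<in> {0..T}" for t
      using cadlag_dense[where f = "\<lambda>t. X (u + t) \<omega>", OF _ G *] that by blast
    then show "\<omega> \<in> {\<omega> \<in> A. \<forall>t\<in>{0..T}. (t, X (u + t) \<omega>) \<in> G}" using \<omega>A by blast
  qed
  then have "emeasure (P x) {\<omega> \<in> A. \<forall>t\<in>{0..T}. (t, X (u + t) \<omega>) \<in> G} = (INF n. emeasure (P x) (B n))"
    using INF_emeasure_decseq[of B "P x"] B dec finite_measure.emeasure_finite[OF fin]
    by (simp add: image_subset_iff)
  also have "\<dots> \<ge> (\<integral>\<^sup>+\<omega>\<in>A. emeasure (P (X u \<omega>)) {\<omega>' \<in> space M. \<forall>t\<in>{0..T}. (t, X t \<omega>') \<in> G} \<partial>P x)"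
  proof (rule INF_greatest)
    fix n
    have "emeasure (P (X u \<omega>)) {\<omega>' \<in> space M. \<forall>t\<in>{0..T}. (t, X t \<omega>') \<in> G} \<le>
      emeasure (P (X u \<omega>)) {\<omega>' \<in> space M. \<forall>t\<in>q ` {..n}. X t \<omega>' \<in> \<Gamma> t}" if "\<omega> \<in> space M" for \<omega>
    proof (rule emeasure_mono)
      show "{\<omega>' \<in> space M. \<forall>t\<in>{0..T}. (t, X t \<omega>') \<in> G} \<subseteq> {\<omega>' \<in> space M. \<forall>t\<in>q ` {..n}. X t \<omega>' \<in> \<Gamma> t}"
        using qT by (auto simp: \<Gamma>_def simp del: atLeastAtMost_iff)
      have "{\<omega>' \<in> space M. \<forall>t\<in>q ` {..n}. X t \<omega>' \<in> \<Gamma> t} = (\<Inter>t\<in>q ` {..n}. {\<omega> \<in> space M. X t \<omega> \<in> \<Gamma> t})"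
        by auto
      also have "\<dots> \<in> sets M"
        by (intro sets.finite_INT XM) (use q0 in auto)
      finally show "{\<omega>' \<in> space M. \<forall>t\<in>q ` {..n}. X t \<omega>' \<in> \<Gamma> t} \<in> sets (P (X u \<omega>))"
        using sets_P[OF X_in_E[OF u that]] by simp
    qed
    then have "(\<integral>\<^sup>+\<omega>\<in>A. emeasure (P (X u \<omega>)) {\<omega>' \<in> space M. \<forall>t\<in>{0..T}. (t, X t \<omega>') \<in> G} \<partial>P x) \<le>
      (\<integral>\<^sup>+\<omega>\<in>A. emeasure (P (X u \<omega>)) {\<omega>' \<in> space M. \<forall>t\<in>q ` {..n}. X t \<omega>' \<in> \<Gamma> t} \<partial>P x)"
      using space_P[OF x] by (intro nn_integral_mono mult_right_mono) auto
    also have "\<dots> = emeasure (P x) (B n)"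
      unfolding B_def using q0 by (intro markov_finite[symmetric] \<Gamma> x u A) auto
    finally show "(\<integral>\<^sup>+\<omega>\<in>A. emeasure (P (X u \<omega>)) {\<omega>' \<in> space M. \<forall>t\<in>{0..T}. (t, X t \<omega>') \<in> G} \<partial>P x)
      \<le> emeasure (P x) (B n)" .
  qed
  finally show ?thesis .
qed

end

lemma dist_divideR:
  fixes x y :: "'a::real_normed_vector"
  assumes "0 < a"
  shows "dist (x /\<^sub>R a) (y /\<^sub>R a) = dist x y / a"
proof -
  have eq: "x /\<^sub>R a - y /\<^sub>R a = (x - y) /\<^sub>R a" by (simp add: scaleR_diff_right)
  show ?thesis unfolding dist_norm eq norm_scaleR using assms by (simp add: divide_inverse)
qed

section \<open>Upper bound for the essential spectral radius\<close>

locale ldp_action = ldp_process M F E P X m I + action_space "scaling_limits E" I L C0 d0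
  for M :: "'w measure" and F :: "ennreal \<Rightarrow> 'w measure" and E :: "'a::euclidean_space set"
    and P :: "'a \<Rightarrow> 'w measure" and X :: "real \<Rightarrow> 'w \<Rightarrow> 'a" and m :: "'a measure"
    and I :: "real \<Rightarrow> (real \<Rightarrow> 'a) \<Rightarrow> ennreal" and L :: "'a \<Rightarrow> 'a \<Rightarrow> real" and C0 d0 :: real
begin

text \<open>The surplus 1 in the cost is the strict margin that \<open>ldp_upper\<close> consumes,
  so that probabilities decay at rate \<open>N\<close> itself.\<close>

definition short_time :: "real \<Rightarrow> real \<Rightarrow> bool" where
  "short_time N d \<longleftrightarrow> 0 < d \<and> d \<le> 1 \<and>
    (\<forall>\<phi>\<in>displaced d S (1/2). norm (\<phi> 0) \<le> 2 \<longrightarrow> ennreal (N + 1) \<le> I d \<phi>)"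

lemma ex_short_time: "0 \<le> N \<Longrightarrow> \<exists>d. short_time N d"
  using displacement_cost[of "N + 1"] unfolding short_time_def by auto

text \<open>The event is left arbitrary so that the bound serves both for large values at a fixed
  time and for reaching a distant set. The scale \<open>b\<close> need not match the norm of
  \<open>x\<close>, so it can be adapted to the distance covered.\<close>

lemma displacement_prob:
  assumes d: "short_time N d"
  shows "\<forall>\<^sub>F b in at_top. \<forall>x\<in>E. norm x \<le> 2 * b \<longrightarrow> (\<forall>A\<in>sets M.
    (\<forall>\<omega>\<in>A. X 0 \<omega> = x \<longrightarrow> (\<exists>t\<in>{0..d * b}. b / 2 \<le> dist (X t \<omega>) x)) \<longrightarrow>
    emeasure (P x) A \<le> ennreal (exp (- N * b)))"
proof -
  have d0: "0 < d" using d by (simp add: short_time_def)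
  have "\<forall>\<^sub>F b in at_top. \<forall>z\<in>cball 0 2 \<inter> S. b *\<^sub>R z \<in> E \<longrightarrow>
    scaled_prob d (displaced d S (1/2)) b z \<le> ennreal (exp (- N * b))"
  proof (rule ldp_upper[OF d0])
    show "compact (cball 0 2 \<inter> S)" by (intro compact_Int_closed compact_cball S_closed)
    show "closedin (mtopology_of (skorohod_metric d S)) (displaced d S (1/2))"
      using d0 by (intro closedin_displaced) simp
    show "ennreal (N + 1) \<le> I d \<phi>" if "\<phi> \<in> displaced d S (1/2)" "\<phi> 0 \<in> cball 0 2 \<inter> S" for \<phi>
      using d that unfolding short_time_def by simp
  qed auto
  then show ?thesis using eventually_gt_at_top[of 0]
  proof eventually_elim
    case (elim b)
    show ?case
    proof (intro ballI impI)
      fix x A assume x: "x \<in> E" "norm x \<le> 2 * b" and A: "A \<in> sets M"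
        "\<forall>\<omega>\<in>A. X 0 \<omega> = x \<longrightarrow> (\<exists>t\<in>{0..d * b}. b / 2 \<le> dist (X t \<omega>) x)"
      let ?z = "(1 / b) *\<^sub>R x"
      have bz: "b *\<^sub>R ?z = x" using elim by simp
      have z: "?z \<in> cball 0 2 \<inter> S" using x elim scale_E_in_S[OF x(1), of "1/b"] by (simp add: field_simps)
      let ?D = "{\<omega> \<in> space M. rescaled_path X d b \<omega> \<in> displaced d S (1/2)}"
      have D: "?D \<in> sets (P x)" using displaced_event_sets[of b d] elim d0 sets_P[OF x(1)] by simp
      have "emeasure (P x) A \<le> emeasure (P x) ?D"
      proof (rule emeasure_mono_AE[OF _ D])
        show "AE \<omega> in P x. \<omega> \<in> A \<longrightarrow> \<omega> \<in> ?D"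
          using initial[OF x(1)]
        proof eventually_elim
          fix \<omega> assume X0: "X 0 \<omega> = x"
          show "\<omega> \<in> A \<longrightarrow> \<omega> \<in> ?D"
          proof
            assume \<omega>: "\<omega> \<in> A"
            then have \<omega>M: "\<omega> \<in> space M" using sets.sets_into_space[OF A(1)] by auto
            obtain t where t: "t \<in> {0..d * b}" "b / 2 \<le> dist (X t \<omega>) x" using A(2) X0 \<omega> by blast
            have tb: "t / b \<in> {0..d}" using t elim by (auto simp: field_simps)
            have "dist (X t \<omega> /\<^sub>R b) (x /\<^sub>R b) = dist (X t \<omega>) x / b"
              using elim by (intro dist_divideR)
            also have "\<dots> \<ge> 1/2" using t elim by (simp add: field_simps)
            finally have "1/2 \<le> dist (rescaled_path X d b \<omega> (t / b)) (rescaled_path X d b \<omega> 0)"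
              using tb elim d0 X0 by (simp add: rescaled_path_def)
            then have "\<forall>c<1/2. \<exists>t\<in>{0..d}. c < dist (rescaled_path X d b \<omega> t) (rescaled_path X d b \<omega> 0)"
              using tb by (intro allI impI bexI[of _ "t / b"]) auto
            then show "\<omega> \<in> ?D"
              using rescaled_path_skorohod[OF elim(2) \<omega>M, of d] \<omega>M by (simp add: displaced_def)
          qed
        qed
      qed
      also have "\<dots> = scaled_prob d (displaced d S (1/2)) b ?z"
        unfolding scaled_prob_def bz ..
      also have "\<dots> \<le> ennreal (exp (- N * b))" using elim(1) z x(1) bz by simp
      finally show "emeasure (P x) A \<le> ennreal (exp (- N * b))" .
    qed
  qed
qed

text \<open>\<open>V_decrease_rate\<close> bounds the action of the paths in question. Replacing
  their end points by \<open>z0\<close> and \<open>w\<close> costs \<open>2 * C * \<theta>\<close>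
  by the Lipschitz property, and the last \<open>\<theta>\<close> is the margin for
  \<open>ldp_upper\<close>. The radius 5 in \<open>V_decrease_rate\<close> is
  \<open>norm w \<le> 4\<close> plus \<open>\<theta> \<le> 1\<close>.\<close>

lemma endpoint_prob:
  assumes d: "short_time N d" and N: "7 * C + lam \<le> N" and \<theta>: "0 < \<theta>" "\<theta> \<le> 1"
    and z0: "z0 \<in> S" and w: "w \<in> S" "norm w \<le> 4"
  shows "\<forall>\<^sub>F a in at_top. \<forall>z\<in>{z \<in> S. 1 \<le> norm z \<and> norm z \<le> 2 \<and> dist z z0 \<le> \<theta>}. a *\<^sub>R z \<in> E \<longrightarrow>
    emeasure (P (a *\<^sub>R z)) {\<omega> \<in> space M. dist (X (a * d) \<omega> /\<^sub>R a) w \<le> \<theta>}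
      \<le> ennreal (exp (- (V z0 - V w + lam * d - 2 * C * \<theta> - \<theta>) * a))"
proof -
  have dpos: "0 < d" "d \<le> 1" using d by (auto simp: short_time_def)
  let ?V = "{z \<in> S. 1 \<le> norm z \<and> norm z \<le> 2 \<and> dist z z0 \<le> \<theta>}"
  let ?C = "{\<psi> \<in> skorohod_space d S. dist (\<psi> d) w \<le> \<theta>}"
  have disp: "\<forall>\<phi>\<in>displaced d S (1/2). norm (\<phi> 0) \<le> 2 \<longrightarrow> ennreal N \<le> I d \<phi>"
    using d unfolding short_time_def
    by (meson ennreal_leI order_trans le_add_same_cancel1 zero_le_one)
  have "\<forall>\<^sub>F a in at_top. \<forall>z\<in>?V. a *\<^sub>R z \<in> E \<longrightarrow>
    scaled_prob d ?C a z \<le> ennreal (exp (- (V z0 - V w + lam * d - 2 * C * \<theta> - \<theta>) * a))"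
  proof (rule ldp_upper[OF dpos(1)])
    have "?V = S \<inter> (cball 0 2 \<inter> cball z0 \<theta>) - ball 0 1" by (auto simp: dist_commute not_less)
    moreover have "compact (S \<inter> (cball 0 2 \<inter> cball z0 \<theta>) - ball 0 1)"
      using S_closed by (intro compact_diff closed_Int_compact compact_Int compact_cball open_ball)
    ultimately show "compact ?V" by simp
    show "closedin (mtopology_of (skorohod_metric d S)) ?C" using dpos by (intro closedin_endpoint) simp
    fix \<phi> assume \<phi>: "\<phi> \<in> ?C" "\<phi> 0 \<in> ?V"
    have m: "\<phi> d \<in> S" "\<phi> 0 \<in> S" using \<phi> dpos by (auto simp: skorohod_space_def)
    have "norm (\<phi> d) \<le> norm w + dist (\<phi> d) w" using norm_triangle_sub[of "\<phi> d" w] by (simp add: dist_norm)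
    then have nd: "norm (\<phi> d) \<le> 5" using \<phi> \<theta> w by simp
    have "ennreal (V (\<phi> 0) - V (\<phi> d) + lam * d) \<le> I d \<phi>"
      using \<phi> nd by (intro V_decrease_rate[OF dpos N disp]) auto
    moreover have "V z0 - V w + lam * d - 2 * C * \<theta> \<le> V (\<phi> 0) - V (\<phi> d) + lam * d"
    proof -
      have "V z0 \<le> V (\<phi> 0) + C * norm (z0 - \<phi> 0)" "V (\<phi> d) \<le> V w + C * norm (\<phi> d - w)"
        using V_lipschitz_le m z0 w by auto
      moreover have "C * norm (z0 - \<phi> 0) \<le> C * \<theta>" "C * norm (\<phi> d - w) \<le> C * \<theta>"
        using \<phi> C_nonneg by (auto intro!: mult_left_mono simp: dist_norm norm_minus_commute)
      ultimately show ?thesis by linarith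
    qed
    ultimately show "ennreal (V z0 - V w + lam * d - 2 * C * \<theta>) \<le> I d \<phi>"
      using ennreal_leI order_trans by blast
  qed (use \<theta> in auto)
  then show ?thesis using eventually_gt_at_top[of 0]
  proof eventually_elim
    case (elim a)
    have "{\<omega> \<in> space M. rescaled_path X d a \<omega> \<in> ?C} = {\<omega> \<in> space M. dist (X (a * d) \<omega> /\<^sub>R a) w \<le> \<theta>}"
      using rescaled_path_skorohod[OF elim(2), of _ d] dpos by (auto simp: rescaled_path_def)
    then show ?case using elim(1) by (simp add: scaled_prob_def)
  qed
qed

lemma geometric_tail:
  assumes "0 < q"
  shows "(\<Sum>k. ennreal (exp (- q * real (k + 4)))) = ennreal (exp (- 4 * q) / (1 - exp (- q)))"
proof (rule suminf_ennreal_eq)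
  have "(\<lambda>k. exp (- q) ^ k) sums (1 / (1 - exp (- q)))"
    using assms by (intro geometric_sums) simp
  then have "(\<lambda>k. exp (- 4 * q) * exp (- q) ^ k) sums (exp (- 4 * q) * (1 / (1 - exp (- q))))"
    by (rule sums_mult)
  moreover have "exp (- 4 * q) * exp (- q) ^ k = exp (- q * real (k + 4))" for k
    by (simp add: exp_of_nat_mult[symmetric] exp_add[symmetric] algebra_simps)
  ultimately show "(\<lambda>k. exp (- q * real (k + 4))) sums (exp (- 4 * q) / (1 - exp (- q)))" by simp
qed simp

text \<open>The constant \<open>N\<close> beats both the growth rate \<open>C\<close> of \<open>V\<close> and \<open>\<kappa>\<close>.\<close>

lemma far_part:
  assumes d: "short_time N d" and N: "11 * C + \<bar>\<kappa>\<bar> + 1 \<le> N"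
  shows "\<forall>\<^sub>F a in at_top. \<forall>x\<in>E. norm x \<le> 2 * a \<longrightarrow>
    (\<integral>\<^sup>+\<omega>. ennreal (exp (- V (X (a * d) \<omega>))) * indicator {\<omega>. 4 * a \<le> norm (X (a * d) \<omega>)} \<omega> \<partial>P x)
      \<le> ennreal (exp (- V x - \<kappa> * (a * d)) / 2)"
proof -
  have dpos: "0 < d" "d \<le> 1" using d by (auto simp: short_time_def)
  obtain b0 where b0: "\<And>b x A. b0 \<le> b \<Longrightarrow> x \<in> E \<Longrightarrow> norm x \<le> 2 * b \<Longrightarrow> A \<in> sets M \<Longrightarrow>
    (\<forall>\<omega>\<in>A. X 0 \<omega> = x \<longrightarrow> (\<exists>t\<in>{0..d * b}. b / 2 \<le> dist (X t \<omega>) x)) \<Longrightarrow>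
    emeasure (P x) A \<le> ennreal (exp (- N * b))"
    using displacement_prob[OF d] unfolding eventually_at_top_linorder by blast
  \<comment> \<open>What is kept of \<open>N\<close> after paying for the growth of
    \<open>exp (- V)\<close>: \<open>C * (k + 5) \<le> 2 * C * (k + 4)\<close> and
    \<open>2 * C + q \<le> N\<close>. It is large enough for \<open>exp (- (q * a))\<close> to stay
    below \<open>exp (- V x - \<kappa> * (a * d))\<close>.\<close>
  define q where "q = 2 * C + \<bar>\<kappa>\<bar> + 1"
  have q: "1 \<le> q" using C_nonneg by (simp add: q_def)
  show ?thesis
    using eventually_ge_at_top[of b0] eventually_ge_at_top[of 2]
  proof eventually_elim
    case (elim a)
    have apos: "0 < a" using elim by simp
    have ad: "0 \<le> a * d" using apos dpos by simp
    show ?case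
    proof (intro ballI impI)
      fix x assume x: "x \<in> E" "norm x \<le> 2 * a"
      let ?Y = "X (a * d)"
      have [measurable]: "?Y \<in> borel_measurable M" by (rule X_measurable[OF ad])
      \<comment> \<open>Norms are sliced at multiples of \<open>a\<close>. Between
        \<open>(k + 4) * a\<close> and \<open>(k + 5) * a\<close>, \<open>exp (- V)\<close> is at
        most \<open>exp (C * (k + 5) * a)\<close>; getting there from
        \<open>norm x \<le> 2 * a\<close> is a displacement of at least half of
        \<open>(k + 4) * a\<close>, an event for \<open>displacement_prob\<close> at scale
        \<open>(k + 4) * a\<close>.\<close>
      define A where "A k = {\<omega> \<in> space M. real (k + 4) * a \<le> norm (?Y \<omega>)}" for k :: nat
      have A: "A k \<in> sets M" for k unfolding A_def by measurable
      have PA: "emeasure (P x) (A k) \<le> ennreal (exp (- N * (real (k + 4) * a)))" for k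
      proof (rule b0)
        have ka: "4 * a \<le> real (k + 4) * a" using apos by simp
        then show "b0 \<le> real (k + 4) * a" "norm x \<le> 2 * (real (k + 4) * a)" using elim x by linarith+
        show "\<forall>\<omega>\<in>A k. X 0 \<omega> = x \<longrightarrow> (\<exists>t\<in>{0..d * (real (k + 4) * a)}. real (k + 4) * a / 2 \<le> dist (X t \<omega>) x)"
        proof (intro ballI impI bexI[of _ "a * d"])
          fix \<omega> assume "\<omega> \<in> A k"
          then have "real (k + 4) * a \<le> norm (?Y \<omega>)" by (simp add: A_def)
          moreover have "norm (?Y \<omega>) \<le> norm x + dist (?Y \<omega>) x"
            using norm_triangle_sub[of "?Y \<omega>" x] by (simp add: dist_norm)
          ultimately show "real (k + 4) * a / 2 \<le> dist (?Y \<omega>) x" using ka x by linarith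
          have "a * d \<le> (real (k + 4) * a) * d" using ka apos dpos by (intro mult_right_mono) auto
          then show "a * d \<in> {0..d * (real (k + 4) * a)}" using ad by (simp add: mult.commute)
        qed
      qed (use x A in auto)
      have "ennreal (exp (- V (?Y \<omega>))) * indicator {\<omega>. 4 * a \<le> norm (?Y \<omega>)} \<omega>
        \<le> (\<Sum>k. ennreal (exp (C * (real (k + 5) * a))) * indicator (A k) \<omega>)" if \<omega>: "\<omega> \<in> space M" for \<omega>
      proof (cases "4 * a \<le> norm (?Y \<omega>)")
        case True
        define f where "f = \<lfloor>norm (?Y \<omega>) / a\<rfloor>"
        define k where "k = nat f - 4"
        have "4 \<le> norm (?Y \<omega>) / a" using True apos by (simp add: field_simps)
        then have "4 \<le> f" by (simp add: f_def le_floor_iff)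
        then have "real (k + 4) = of_int f" by (simp add: k_def of_nat_diff)
        then have "real (k + 4) \<le> norm (?Y \<omega>) / a" "norm (?Y \<omega>) / a < real (k + 4) + 1"
          unfolding f_def by linarith+
        then have k: "real (k + 4) * a \<le> norm (?Y \<omega>)" "norm (?Y \<omega>) \<le> real (k + 5) * a"
          using apos by (auto simp: field_simps)
        have "?Y \<omega> \<in> S" using X_in_E[OF ad \<omega>] E_subset_S by blast
        from V_ge[OF this] have "- V (?Y \<omega>) \<le> C * norm (?Y \<omega>)" by simp
        also have "\<dots> \<le> C * (real (k + 5) * a)" using k C_nonneg by (intro mult_left_mono)
        finally have "ennreal (exp (- V (?Y \<omega>))) \<le> ennreal (exp (C * (real (k + 5) * a)))" by (simp add: ennreal_leI)
        also have "\<dots> = ennreal (exp (C * (real (k + 5) * a))) * indicator (A k) \<omega>"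
          using k(1) \<omega> by (simp add: A_def)
        also have "\<dots> = (\<Sum>j\<in>{k}. ennreal (exp (C * (real (j + 5) * a))) * indicator (A j) \<omega>)"
          unfolding sum.insert_if[OF finite.emptyI] by simp
        also have "\<dots> \<le> (\<Sum>k. ennreal (exp (C * (real (k + 5) * a))) * indicator (A k) \<omega>)"
          by (rule sum_le_suminf) auto
        finally show ?thesis using True by simp
      qed simp
      then have "(\<integral>\<^sup>+\<omega>. ennreal (exp (- V (?Y \<omega>))) * indicator {\<omega>. 4 * a \<le> norm (?Y \<omega>)} \<omega> \<partial>P x)
        \<le> (\<integral>\<^sup>+\<omega>. (\<Sum>k. ennreal (exp (C * (real (k + 5) * a))) * indicator (A k) \<omega>) \<partial>P x)"
        using space_P[OF x(1)] by (intro nn_integral_mono) simp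
      also have "\<dots> = (\<Sum>k. \<integral>\<^sup>+\<omega>. ennreal (exp (C * (real (k + 5) * a))) * indicator (A k) \<omega> \<partial>P x)"
        using A sets_P[OF x(1)] by (intro nn_integral_suminf) auto
      also have "\<dots> = (\<Sum>k. ennreal (exp (C * (real (k + 5) * a))) * emeasure (P x) (A k))"
        using A sets_P[OF x(1)] by (subst nn_integral_cmult_indicator) auto
      also have "\<dots> \<le> (\<Sum>k. ennreal (exp (- (q * a) * real (k + 4))))"
      proof (rule suminf_le)
        fix k
        have "ennreal (exp (C * (real (k + 5) * a))) * emeasure (P x) (A k)
          \<le> ennreal (exp (C * (real (k + 5) * a))) * ennreal (exp (- N * (real (k + 4) * a)))"
          by (intro mult_left_mono PA) simp
        also have "\<dots> = ennreal (exp (C * (real (k + 5) * a) - N * (real (k + 4) * a)))"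
          by (simp add: ennreal_mult[symmetric] exp_add[symmetric])
        also have "\<dots> \<le> ennreal (exp (- (q * a) * real (k + 4)))"
        proof -
          have "C * real (k + 5) \<le> C * (2 * real (k + 4))" using C_nonneg by (intro mult_left_mono) auto
          moreover have "(2 * C + q) * real (k + 4) \<le> N * real (k + 4)"
            using N C_nonneg by (intro mult_right_mono) (auto simp: q_def)
          ultimately have "C * real (k + 5) - N * real (k + 4) \<le> - q * real (k + 4)"
            by (simp add: algebra_simps)
          then have "(C * real (k + 5) - N * real (k + 4)) * a \<le> (- q * real (k + 4)) * a"
            using apos by (intro mult_right_mono) auto
          then show ?thesis by (intro ennreal_leI) (simp add: algebra_simps)
        qed
        finally show "ennreal (exp (C * (real (k + 5) * a))) * emeasure (P x) (A k)
          \<le> ennreal (exp (- (q * a) * real (k + 4)))" .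
      qed auto
      also have "\<dots> = ennreal (exp (- 4 * (q * a)) / (1 - exp (- (q * a))))"
        using q apos by (intro geometric_tail) simp
      also have "\<dots> \<le> ennreal (exp (- V x - \<kappa> * (a * d)) / 2)"
      proof (rule ennreal_leI)
        have qa: "2 \<le> q * a" using q elim mult_mono[of 1 q 2 a] by simp
        have "2 \<le> exp (q * a)" using exp_ge_add_one_self[of "q * a"] qa by linarith
        then have h: "exp (- (q * a)) \<le> 1/2" by (simp add: exp_minus field_simps)
        have "exp (- 4 * (q * a)) / (1 - exp (- (q * a))) \<le> exp (- 4 * (q * a)) / (1/2)"
          using h qa by (intro divide_left_mono) auto
        \<comment> \<open>One of the four factors is kept; the others, at most \<open>1/2\<close>
          each, pay for the denominator and for the final \<open>1/2\<close>.\<close>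
        also have "\<dots> = exp (- (q * a)) * (exp (- (q * a)) * exp (- (q * a))) * (2 * exp (- (q * a)))"
          by (simp add: exp_add[symmetric])
        also have "\<dots> \<le> exp (- (q * a)) * ((1/2) * 1) * (2 * (1/2))"
          using h qa by (intro mult_mono) auto
        also have "\<dots> = exp (- (q * a)) / 2" by simp
        also have "\<dots> \<le> exp (- V x - \<kappa> * (a * d)) / 2"
        proof -
          have "V x \<le> C * norm x" using V_le E_subset_S x by blast
          also have "\<dots> \<le> C * (2 * a)" using C_nonneg x by (intro mult_left_mono)
          finally have 1: "V x \<le> 2 * C * a" by simp
          have "\<kappa> * (a * d) \<le> \<bar>\<kappa>\<bar> * (a * 1)"
            using apos dpos by (intro mult_mono) auto
          then have 2: "\<kappa> * (a * d) \<le> \<bar>\<kappa>\<bar> * a" by (simp only: mult_1_right)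
          have "q * a = 2 * C * a + \<bar>\<kappa>\<bar> * a + a" by (simp add: q_def algebra_simps)
          with 1 2 have "V x + \<kappa> * (a * d) \<le> q * a" using apos by linarith
          then show ?thesis by simp
        qed
        finally show "exp (- 4 * (q * a)) / (1 - exp (- (q * a))) \<le> exp (- V x - \<kappa> * (a * d)) / 2" .
      qed
      finally show "(\<integral>\<^sup>+\<omega>. ennreal (exp (- V (?Y \<omega>))) * indicator {\<omega>. 4 * a \<le> norm (?Y \<omega>)} \<omega> \<partial>P x)
        \<le> ennreal (exp (- V x - \<kappa> * (a * d)) / 2)" .
    qed
  qed
qed

text \<open>Laplace principle by discretisation: on each of finitely many small balls with centre
  \<open>w\<close>, the value \<open>exp (- a * V w)\<close> meets the probability bound
  \<open>exp (- a * (V z0 - V w + lam * d))\<close>, up to small errors, and \<open>V w\<close>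
  cancels. The gap between \<open>\<kappa>\<close> and \<open>lam\<close> pays for the errors and
  for the number of balls.\<close>

lemma near_part:
  assumes d: "short_time N d" and N: "7 * C + lam \<le> N" and \<kappa>: "\<kappa> < lam"
  shows "\<forall>\<^sub>F a in at_top. \<forall>x\<in>E. a \<le> norm x \<longrightarrow> norm x \<le> 2 * a \<longrightarrow>
    (\<integral>\<^sup>+\<omega>. ennreal (exp (- V (X (a * d) \<omega>))) * indicator {\<omega>. norm (X (a * d) \<omega>) \<le> 4 * a} \<omega> \<partial>P x)
      \<le> ennreal (exp (- V x - \<kappa> * (a * d)) / 2)"
proof -
  have dpos: "0 < d" "d \<le> 1" using d by (auto simp: short_time_def)
  define \<eta> where "\<eta> = (lam - \<kappa>) * d"
  have \<eta>: "0 < \<eta>" using \<kappa> dpos by (simp add: \<eta>_def)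
  \<comment> \<open>The errors add up to \<open>4 * C * \<theta> + \<theta>\<close>: two Lipschitz
    errors and the margin come from \<open>endpoint_prob\<close>, one error each from replacing the
    scaled end point by \<open>w\<close> and \<open>z\<close> by \<open>z0\<close>. They use up half
    of \<open>\<eta>\<close>.\<close>
  define \<theta> where "\<theta> = min 1 (\<eta> / (2 * (4 * C + 1)))"
  have \<theta>: "0 < \<theta>" "\<theta> \<le> 1" using \<eta> C_nonneg by (auto simp: \<theta>_def)
  have \<theta>\<eta>: "4 * C * \<theta> + \<theta> \<le> \<eta> / 2"
  proof -
    have "(4 * C + 1) * \<theta> \<le> (4 * C + 1) * (\<eta> / (2 * (4 * C + 1)))"
      using C_nonneg by (intro mult_left_mono) (auto simp: \<theta>_def)
    also have "\<dots> = \<eta> / 2" using C_nonneg by (simp add: field_simps)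
    finally show ?thesis by (simp add: algebra_simps)
  qed
  have "compact (S \<inter> cball 0 4)" using S_closed by (intro closed_Int_compact) auto
  then obtain W where W: "W \<subseteq> S \<inter> cball 0 4" "finite W" "S \<inter> cball 0 4 \<subseteq> (\<Union>w\<in>W. ball w \<theta>)"
    by (rule compactE_image[of _ "S \<inter> cball 0 4" "\<lambda>w. ball w \<theta>"]) (use \<theta> in auto)
  define n where "n = real (card W)"
  have "\<forall>\<^sub>F a in at_top. \<forall>p\<in>W \<times> W. \<forall>z\<in>{z \<in> S. 1 \<le> norm z \<and> norm z \<le> 2 \<and> dist z (fst p) \<le> \<theta>}. a *\<^sub>R z \<in> E \<longrightarrow>
    emeasure (P (a *\<^sub>R z)) {\<omega> \<in> space M. dist (X (a * d) \<omega> /\<^sub>R a) (snd p) \<le> \<theta>}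
      \<le> ennreal (exp (- (V (fst p) - V (snd p) + lam * d - 2 * C * \<theta> - \<theta>) * a))"
    using W by (intro eventually_ball_finite ballI endpoint_prob[OF d N \<theta>]) auto
  \<comment> \<open>The other half of \<open>\<eta>\<close> absorbs the number \<open>n\<close> of
    balls.\<close>
  moreover have "\<forall>\<^sub>F a in at_top. n * exp (- (\<eta> / 2) * a) \<le> 1 / 2"
  proof -
    have "filterlim (\<lambda>a. - (\<eta> / 2) * a) at_bot at_top"
      using \<eta> by (intro filterlim_tendsto_neg_mult_at_bot[OF tendsto_const] filterlim_ident) auto
    then have "((\<lambda>a. n * exp (- (\<eta> / 2) * a)) \<longlongrightarrow> n * 0) at_top"
      by (intro tendsto_intros filterlim_compose[OF exp_at_bot])
    then have "\<forall>\<^sub>F a in at_top. n * exp (- (\<eta> / 2) * a) < 1 / 2" by (rule order_tendstoD) simp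
    then show ?thesis by (rule eventually_mono) simp
  qed
  ultimately show ?thesis using eventually_gt_at_top[of 0]
  proof eventually_elim
    case (elim a)
    have ad: "0 \<le> a * d" using elim dpos by simp
    show ?case
    proof (intro ballI impI)
      fix x assume x: "x \<in> E" "a \<le> norm x" "norm x \<le> 2 * a"
      let ?Y = "X (a * d)"
      have [measurable]: "?Y \<in> borel_measurable M" by (rule X_measurable[OF ad])
      define z where "z = (1 / a) *\<^sub>R x"
      have az: "a *\<^sub>R z = x" using elim by (simp add: z_def)
      have zS: "z \<in> S" unfolding z_def using elim by (intro scale_E_in_S x) simp
      have zn: "1 \<le> norm z" "norm z \<le> 2" using x elim by (auto simp: z_def field_simps)
      obtain z0 where z0: "z0 \<in> W" "dist z z0 \<le> \<theta>"
        using W(3) zS zn by (force simp: dist_commute)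
      define B where "B w = {\<omega> \<in> space M. dist (?Y \<omega> /\<^sub>R a) w \<le> \<theta>}" for w
      have B: "B w \<in> sets M" for w unfolding B_def by measurable
      have "ennreal (exp (- V (?Y \<omega>))) * indicator {\<omega>. norm (?Y \<omega>) \<le> 4 * a} \<omega>
        \<le> (\<Sum>w\<in>W. ennreal (exp (- a * V w + a * C * \<theta>)) * indicator (B w) \<omega>)" if \<omega>: "\<omega> \<in> space M" for \<omega>
      proof (cases "norm (?Y \<omega>) \<le> 4 * a")
        case True
        let ?y = "?Y \<omega> /\<^sub>R a"
        have yS: "?y \<in> S" using X_in_E[OF ad \<omega>] elim by (intro scale_E_in_S) auto
        have "norm ?y \<le> 4" using True elim by (simp add: field_simps)
        then obtain w where w: "w \<in> W" "dist ?y w \<le> \<theta>" using W(3) yS by (force simp: dist_commute)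
        have "V (?Y \<omega>) = a * V ?y"
          using V_scale[OF yS elim(3)] elim by simp
        moreover have "V w \<le> V ?y + C * norm (w - ?y)" using V_lipschitz_le[OF _ yS, of w] w W by auto
        moreover have "C * norm (w - ?y) \<le> C * \<theta>"
          using w C_nonneg by (intro mult_left_mono) (auto simp: dist_norm norm_minus_commute)
        ultimately have "a * (V w - C * \<theta>) \<le> V (?Y \<omega>)"
          using elim by (simp add: mult_left_mono)
        then have "ennreal (exp (- V (?Y \<omega>))) \<le> ennreal (exp (- a * V w + a * C * \<theta>))"
          by (intro ennreal_leI) (simp add: algebra_simps)
        also have "\<dots> = ennreal (exp (- a * V w + a * C * \<theta>)) * indicator (B w) \<omega>"
          using w \<omega> by (simp add: B_def)
        also have "\<dots> \<le> (\<Sum>w\<in>W. ennreal (exp (- a * V w + a * C * \<theta>)) * indicator (B w) \<omega>)"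
          using W(2) w(1) by (intro member_le_sum) auto
        finally show ?thesis using True by simp
      qed simp
      then have "(\<integral>\<^sup>+\<omega>. ennreal (exp (- V (?Y \<omega>))) * indicator {\<omega>. norm (?Y \<omega>) \<le> 4 * a} \<omega> \<partial>P x)
        \<le> (\<integral>\<^sup>+\<omega>. (\<Sum>w\<in>W. ennreal (exp (- a * V w + a * C * \<theta>)) * indicator (B w) \<omega>) \<partial>P x)"
        using space_P[OF x(1)] by (intro nn_integral_mono) simp
      also have "\<dots> = (\<Sum>w\<in>W. \<integral>\<^sup>+\<omega>. ennreal (exp (- a * V w + a * C * \<theta>)) * indicator (B w) \<omega> \<partial>P x)"
        using B sets_P[OF x(1)] by (intro nn_integral_sum) auto
      also have "\<dots> = (\<Sum>w\<in>W. ennreal (exp (- a * V w + a * C * \<theta>)) * emeasure (P x) (B w))"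
        using B sets_P[OF x(1)] by (intro sum.cong refl nn_integral_cmult_indicator) auto
      also have "\<dots> \<le> (\<Sum>w\<in>W. ennreal (exp (- V x - \<kappa> * (a * d)) * exp (- (\<eta> / 2) * a)))"
      proof (rule sum_mono)
        fix w assume w: "w \<in> W"
        have "emeasure (P x) (B w) \<le> ennreal (exp (- (V z0 - V w + lam * d - 2 * C * \<theta> - \<theta>) * a))"
          using elim(1)[rule_format, of "(z0, w)" z] z0 w zS zn az x(1) by (simp add: B_def)
        then have "ennreal (exp (- a * V w + a * C * \<theta>)) * emeasure (P x) (B w) \<le>
          ennreal (exp (- a * V w + a * C * \<theta>)) * ennreal (exp (- (V z0 - V w + lam * d - 2 * C * \<theta> - \<theta>) * a))"
          by (rule mult_left_mono) simp
        also have "\<dots> = ennreal (exp (- a * V w + a * C * \<theta> - (V z0 - V w + lam * d - 2 * C * \<theta> - \<theta>) * a))"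
          by (simp add: ennreal_mult[symmetric] exp_add[symmetric]) (simp add: algebra_simps)
        also have "\<dots> \<le> ennreal (exp (- V x - \<kappa> * (a * d) + - (\<eta> / 2) * a))"
        proof -
          have "V x = a * V z" using V_scale[OF zS elim(3)] az by simp
          have "V z \<le> V z0 + C * norm (z - z0)" using V_lipschitz_le[OF zS, of z0] z0 W by auto
          moreover have "C * norm (z - z0) \<le> C * \<theta>"
            using z0 C_nonneg by (intro mult_left_mono) (auto simp: dist_norm)
          moreover have "lam * d = \<kappa> * d + \<eta>" by (simp add: \<eta>_def algebra_simps)
          moreover have "4 * (C * \<theta>) + \<theta> \<le> \<eta> / 2" using \<theta>\<eta> by simp
          ultimately have "V z + \<kappa> * d + \<eta> / 2 \<le> V z0 + lam * d - 3 * (C * \<theta>) - \<theta>"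
            by linarith
          then have "a * (V z + \<kappa> * d + \<eta> / 2) \<le> a * (V z0 + lam * d - 3 * (C * \<theta>) - \<theta>)"
            using elim by (intro mult_left_mono) auto
          then show ?thesis unfolding \<open>V x = a * V z\<close>
            by (intro ennreal_leI) (simp add: algebra_simps)
        qed
        also have "\<dots> = ennreal (exp (- V x - \<kappa> * (a * d)) * exp (- (\<eta> / 2) * a))"
          by (simp only: exp_add)
        finally show "ennreal (exp (- a * V w + a * C * \<theta>)) * emeasure (P x) (B w) \<le>
          ennreal (exp (- V x - \<kappa> * (a * d)) * exp (- (\<eta> / 2) * a))" .
      qed
      also have "\<dots> = ennreal (exp (- V x - \<kappa> * (a * d)) * (n * exp (- (\<eta> / 2) * a)))"
        by (simp add: n_def ennreal_of_nat_eq_real_of_nat ennreal_mult[symmetric] ac_simps)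
      also have "\<dots> \<le> ennreal (exp (- V x - \<kappa> * (a * d)) * (1 / 2))"
        using elim(2) by (intro ennreal_leI mult_left_mono) auto
      finally show "(\<integral>\<^sup>+\<omega>. ennreal (exp (- V (?Y \<omega>))) * indicator {\<omega>. norm (?Y \<omega>) \<le> 4 * a} \<omega> \<partial>P x)
        \<le> ennreal (exp (- V x - \<kappa> * (a * d)) / 2)" by simp
    qed
  qed
qed

text \<open>\<open>V\<close> is Lipschitz, hence continuous, but only on \<open>S\<close>; cutting
  it off outside \<open>E\<close> gives a Borel function.\<close>

lemma exp_V_measurable:
  assumes x: "x \<in> E" and t: "0 \<le> t"
  shows "(\<lambda>\<omega>. ennreal (exp (- V (X t \<omega>)))) \<in> borel_measurable (P x)"
proof -
  have "continuous_on S V"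
    unfolding continuous_on_iff
  proof (intro ballI allI impI)
    fix e :: real and z assume z: "z \<in> S" and e: "0 < e"
    have "dist (V w) (V z) < e" if w: "w \<in> S" "dist w z < e / (C + 1)" for w
    proof -
      have "\<bar>V w - V z\<bar> \<le> C * dist w z"
        using V_lipschitz_le[OF w(1) z] V_lipschitz_le[OF z w(1)]
        by (simp add: dist_norm norm_minus_commute abs_le_iff)
      also have "\<dots> \<le> (C + 1) * dist w z" by (simp add: mult_right_mono)
      also have "\<dots> < e" using w(2) C_nonneg by (simp add: field_simps)
      finally show ?thesis by (simp add: dist_real_def)
    qed
    then show "\<exists>d>0. \<forall>w\<in>S. dist w z < d \<longrightarrow> dist (V w) (V z) < e"
      using e C_nonneg by (intro exI[of _ "e / (C + 1)"]) auto
  qed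
  then have "continuous_on E V" using E_subset_S continuous_on_subset by blast
  then have "(\<lambda>y. indicator E y *\<^sub>R V y) \<in> borel_measurable borel"
    using E_borel by (intro borel_measurable_continuous_on_indicator) auto
  from measurable_compose[OF X_measurable_P[OF x t] this]
  have [measurable]: "(\<lambda>\<omega>. indicator E (X t \<omega>) *\<^sub>R V (X t \<omega>)) \<in> borel_measurable (P x)" .
  have "(\<lambda>\<omega>. ennreal (exp (- (indicator E (X t \<omega>) *\<^sub>R V (X t \<omega>))))) \<in> borel_measurable (P x)"
    by measurable
  then show ?thesis
    by (rule measurable_cong[THEN iffD1, rotated]) (use X_in_E[OF t] space_P[OF x] in simp)
qed

text \<open>The two parts contribute half each; they overlap at norm \<open>4 * a\<close>, which is
  harmless for an upper bound.\<close>

lemma one_step: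
  assumes d: "short_time N d" and N: "11 * C + lam + \<bar>\<kappa>\<bar> + 1 \<le> N" and \<kappa>: "\<kappa> < lam"
  shows "\<forall>\<^sub>F a in at_top. \<forall>x\<in>E. a \<le> norm x \<longrightarrow> norm x \<le> 2 * a \<longrightarrow>
    (\<integral>\<^sup>+\<omega>. ennreal (exp (- V (X (a * d) \<omega>))) \<partial>P x) \<le> ennreal (exp (- V x - \<kappa> * (a * d)))"
proof -
  have N1: "7 * C + lam \<le> N" and N2: "11 * C + \<bar>\<kappa>\<bar> + 1 \<le> N" using N C_nonneg lam_nonneg by auto
  show ?thesis
    using near_part[OF d N1 \<kappa>] far_part[OF d N2] eventually_gt_at_top[of 0]
  proof eventually_elim
    case (elim a)
    show ?case
    proof (intro ballI impI)
      fix x assume x: "x \<in> E" "a \<le> norm x" "norm x \<le> 2 * a"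
      have ad: "0 \<le> a * d" using elim d by (simp add: short_time_def)
      let ?Y = "X (a * d)"
      have [measurable]: "?Y \<in> borel_measurable (P x)" by (rule X_measurable_P[OF x(1) ad])
      note exp_V_measurable[OF x(1) ad, measurable]
      have "(\<integral>\<^sup>+\<omega>. ennreal (exp (- V (?Y \<omega>))) \<partial>P x) \<le>
        (\<integral>\<^sup>+\<omega>. ennreal (exp (- V (?Y \<omega>))) * indicator {\<omega>. norm (?Y \<omega>) \<le> 4 * a} \<omega> +
          ennreal (exp (- V (?Y \<omega>))) * indicator {\<omega>. 4 * a \<le> norm (?Y \<omega>)} \<omega> \<partial>P x)"
        by (intro nn_integral_mono) (auto split: split_indicator)
      also have "\<dots> = (\<integral>\<^sup>+\<omega>. ennreal (exp (- V (?Y \<omega>))) * indicator {\<omega>. norm (?Y \<omega>) \<le> 4 * a} \<omega> \<partial>P x) +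
          (\<integral>\<^sup>+\<omega>. ennreal (exp (- V (?Y \<omega>))) * indicator {\<omega>. 4 * a \<le> norm (?Y \<omega>)} \<omega> \<partial>P x)"
        by (intro nn_integral_add) measurable
      also have "\<dots> \<le> ennreal (exp (- V x - \<kappa> * (a * d)) / 2) + ennreal (exp (- V x - \<kappa> * (a * d)) / 2)"
        using elim x by (intro add_mono) auto
      also have "\<dots> = ennreal (exp (- V x - \<kappa> * (a * d)))" by (simp flip: ennreal_plus)
      finally show "(\<integral>\<^sup>+\<omega>. ennreal (exp (- V (?Y \<omega>))) \<partial>P x) \<le> ennreal (exp (- V x - \<kappa> * (a * d)))" .
    qed
  qed
qed

text \<open>Testing for \<open>K\<close> at integer times only enlarges the survival event, and the Markov property at
  deterministic times then suffices.\<close>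

definition skeleton_survival :: "'a set \<Rightarrow> 'a set \<Rightarrow> real \<Rightarrow> 'w set" where
  "skeleton_survival K W t =
    {\<omega> \<in> space M. X t \<omega> \<in> W \<and> (\<forall>k\<in>{1..nat \<lfloor>t\<rfloor>}. X (real k) \<omega> \<notin> K)}"

text \<open>Brings the event into the form of \<open>markov_finite\<close>, with one Borel set per
  time. The time \<open>t\<close> may itself be an integer test time, whence the intersection in
  \<open>?\<Gamma>\<close>.\<close>

lemma skeleton_survival_finite:
  assumes "0 \<le> t"
    and "K \<in> sets borel" "W \<in> sets borel"
  shows "\<exists>Q \<Gamma>. finite Q \<and> (\<forall>q\<in>Q. 0 \<le> q) \<and> (\<forall>q. \<Gamma> q \<in> sets borel) \<and>
    (\<forall>u \<omega>. (\<forall>q\<in>Q. X (u + q) \<omega> \<in> \<Gamma> q) \<longleftrightarrow>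
      X (u + t) \<omega> \<in> W \<and> (\<forall>k\<in>{1..nat \<lfloor>t\<rfloor>}. X (u + real k) \<omega> \<notin> K))"
proof -
  let ?N = "real ` {1..nat \<lfloor>t\<rfloor>}"
  let ?Q = "insert t ?N"
  let ?\<Gamma> = "\<lambda>q. (if q = t then W else UNIV) \<inter> (if q \<in> ?N then - K else UNIV)"
  show ?thesis
  proof (rule exI[of _ ?Q], rule exI[of _ ?\<Gamma>], intro conjI allI)
    show "(\<forall>q\<in>?Q. X (u + q) \<omega> \<in> ?\<Gamma> q) \<longleftrightarrow>
      X (u + t) \<omega> \<in> W \<and> (\<forall>k\<in>{1..nat \<lfloor>t\<rfloor>}. X (u + real k) \<omega> \<notin> K)" for u \<omega>
    proof
      assume H: "\<forall>q\<in>?Q. X (u + q) \<omega> \<in> ?\<Gamma> q"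
      have "X (u + t) \<omega> \<in> W" using H by (auto split: if_splits)
      moreover have "X (u + real k) \<omega> \<notin> K" if "k \<in> {1..nat \<lfloor>t\<rfloor>}" for k
      proof -
        have "real k \<in> ?N" using that by blast
        then have "X (u + real k) \<omega> \<in> ?\<Gamma> (real k)" using H by blast
        then show ?thesis using \<open>real k \<in> ?N\<close> by simp
      qed
      ultimately show "X (u + t) \<omega> \<in> W \<and> (\<forall>k\<in>{1..nat \<lfloor>t\<rfloor>}. X (u + real k) \<omega> \<notin> K)" by blast
    next
      assume H: "X (u + t) \<omega> \<in> W \<and> (\<forall>k\<in>{1..nat \<lfloor>t\<rfloor>}. X (u + real k) \<omega> \<notin> K)"
      show "\<forall>q\<in>?Q. X (u + q) \<omega> \<in> ?\<Gamma> q"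
      proof
        fix q assume "q \<in> ?Q"
        have "q \<in> ?N \<Longrightarrow> X (u + q) \<omega> \<notin> K" using H by blast
        moreover have "q = t \<Longrightarrow> X (u + q) \<omega> \<in> W" using H by blast
        ultimately show "X (u + q) \<omega> \<in> ?\<Gamma> q" by simp
      qed
    qed
    show "?\<Gamma> q \<in> sets borel" for q
      using assms(2,3) by auto
  qed (use assms in auto)
qed

lemma skeleton_survival_sets:
  assumes t: "0 \<le> t" and KW: "K \<in> sets borel" "W \<in> sets borel"
  shows "skeleton_survival K W t \<in> sets M"
proof -
  obtain Q \<Gamma> where Q: "finite Q" "\<forall>q\<in>Q. 0 \<le> q" "\<forall>q. \<Gamma> q \<in> sets borel"
    "\<forall>u \<omega>. (\<forall>q\<in>Q. X (u + q) \<omega> \<in> \<Gamma> q) \<longleftrightarrow>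
      X (u + t) \<omega> \<in> W \<and> (\<forall>k\<in>{1..nat \<lfloor>t\<rfloor>}. X (u + real k) \<omega> \<notin> K)"
    using skeleton_survival_finite[OF t KW] by blast
  have "skeleton_survival K W t = {\<omega> \<in> space M. \<forall>q\<in>Q. X q \<omega> \<in> \<Gamma> q}"
    using Q(4)[rule_format, of 0] by (simp add: skeleton_survival_def)
  also have "\<dots> \<in> sets M"
    using Q(1-3)
    by (intro sets_countable_Ball countable_finite F_sets_M[OF X_event_sets]) blast+
  finally show ?thesis .
qed

text \<open>The restart is at an integer, so that the remaining test times are integers again; the
  test at \<open>s\<close> itself survives as the domain of integration.\<close>

lemma skeleton_survival_step:
  fixes s :: nat
  assumes s: "1 \<le> s" "real s \<le> t" and x: "x \<in> E" and KW: "K \<in> sets borel" "W \<in> sets borel"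
  shows "emeasure (P x) (skeleton_survival K W t) \<le>
    (\<integral>\<^sup>+\<omega>\<in>{\<omega> \<in> space M. X (real s) \<omega> \<in> - K}.
      emeasure (P (X (real s) \<omega>)) (skeleton_survival K W (t - real s)) \<partial>P x)"
proof -
  let ?t = "t - real s"
  have t: "0 \<le> ?t" using s by simp
  obtain Q \<Gamma> where Q: "finite Q" "\<forall>q\<in>Q. 0 \<le> q" "\<forall>q. \<Gamma> q \<in> sets borel"
    "\<forall>u \<omega>. (\<forall>q\<in>Q. X (u + q) \<omega> \<in> \<Gamma> q) \<longleftrightarrow>
      X (u + ?t) \<omega> \<in> W \<and> (\<forall>k\<in>{1..nat \<lfloor>?t\<rfloor>}. X (u + real k) \<omega> \<notin> K)"
    using skeleton_survival_finite[OF t KW] by blast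
  have \<Gamma>: "\<Gamma> q \<in> sets borel" for q using Q(3) by blast
  let ?A = "{\<omega> \<in> space M. X (real s) \<omega> \<in> - K}"
  have A: "?A \<in> sets (F (ennreal (real s)))" using KW by (intro X_event_sets) auto
  let ?B = "{\<omega> \<in> ?A. \<forall>q\<in>Q. X (real s + q) \<omega> \<in> \<Gamma> q}"
  have "{\<omega> \<in> space M. \<forall>q\<in>Q. X (real s + q) \<omega> \<in> \<Gamma> q} \<in> sets M"
  proof (intro sets_countable_Ball countable_finite F_sets_M[OF X_event_sets] \<Gamma> Q(1))
    show "0 \<le> real s + q" if "q \<in> Q" for q using Q(2) that by simp
  qed simp
  then have "?A \<inter> {\<omega> \<in> space M. \<forall>q\<in>Q. X (real s + q) \<omega> \<in> \<Gamma> q} \<in> sets M"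
    using F_sets_M[OF A] by (rule sets.Int[rotated])
  moreover have "?A \<inter> {\<omega> \<in> space M. \<forall>q\<in>Q. X (real s + q) \<omega> \<in> \<Gamma> q} = ?B" by blast
  ultimately have B: "?B \<in> sets (P x)" using sets_P[OF x] by simp
  have "skeleton_survival K W t \<subseteq> ?B"
  proof
    fix \<omega> assume \<omega>: "\<omega> \<in> skeleton_survival K W t"
    have fl: "nat \<lfloor>?t\<rfloor> + s = nat \<lfloor>t\<rfloor>"
    proof -
      have "\<lfloor>?t\<rfloor> = \<lfloor>t\<rfloor> - int s" using floor_diff_of_int[of t "int s"] by simp
      moreover have "int s \<le> \<lfloor>t\<rfloor>" using s by (simp add: le_floor_iff)
      ultimately show ?thesis by simp
    qed
    have "X (real s) \<omega> \<notin> K" using \<omega> s fl by (simp add: skeleton_survival_def)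
    moreover have "X (real s + real k) \<omega> \<notin> K" if "k \<in> {1..nat \<lfloor>?t\<rfloor>}" for k
    proof -
      have "s + k \<in> {1..nat \<lfloor>t\<rfloor>}" using that fl by auto
      then have "X (real (s + k)) \<omega> \<notin> K" using \<omega> unfolding skeleton_survival_def by blast
      then show ?thesis by simp
    qed
    ultimately show "\<omega> \<in> ?B" using \<omega> Q(4)[rule_format, of "real s" \<omega>] by (simp add: skeleton_survival_def)
  qed
  then have "emeasure (P x) (skeleton_survival K W t) \<le> emeasure (P x) ?B" using B by (rule emeasure_mono)
  also have "\<dots> = (\<integral>\<^sup>+\<omega>\<in>?A. emeasure (P (X (real s) \<omega>)) {\<omega>' \<in> space M. \<forall>q\<in>Q. X q \<omega>' \<in> \<Gamma> q} \<partial>P x)"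
    using Q(1,2) \<Gamma> x A by (intro markov_finite) auto
  also have "{\<omega>' \<in> space M. \<forall>q\<in>Q. X q \<omega>' \<in> \<Gamma> q} = skeleton_survival K W ?t"
    using Q(4)[rule_format, of 0] by (simp add: skeleton_survival_def)
  finally show ?thesis .
qed

text \<open>Induction on an integer bound for \<open>t\<close>. A step from \<open>x\<close> takes
  an integer time \<open>s\<close> close to \<open>d * norm x\<close>; surviving the test at its end
  puts the process outside the ball again, where the induction hypothesis applies to the remaining
  time, and \<open>one_step\<close> integrates the resulting \<open>exp (- V)\<close>.\<close>

lemma skeleton_survival_decay:
  assumes \<kappa>: "\<kappa> < lam"
  shows "\<exists>R>0. \<forall>W RW. W \<in> sets borel \<longrightarrow> 0 \<le> RW \<longrightarrow> W \<subseteq> cball 0 RW \<longrightarrow> (\<forall>t\<ge>0. \<forall>x\<in>E. R < norm x \<longrightarrow>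
    emeasure (P x) (skeleton_survival (E \<inter> cball 0 R) W t) \<le>
      ennreal (exp ((\<bar>\<kappa>\<bar> + C) * (2 * RW)) * exp (- V x - \<kappa> * t)))"
proof -
  define N where "N = 11 * C + lam + \<bar>\<kappa>\<bar> + 1"
  have N0: "0 \<le> N" using C_nonneg lam_nonneg by (simp add: N_def)
  obtain d where d: "short_time N d" using ex_short_time[OF N0] by blast
  have dpos: "0 < d" "d \<le> 1" using d by (auto simp: short_time_def)
  obtain a0 where a0: "\<And>a x. a0 \<le> a \<Longrightarrow> x \<in> E \<Longrightarrow> a \<le> norm x \<Longrightarrow> norm x \<le> 2 * a \<Longrightarrow>
    (\<integral>\<^sup>+\<omega>. ennreal (exp (- V (X (a * d) \<omega>))) \<partial>P x) \<le> ennreal (exp (- V x - \<kappa> * (a * d)))"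
    using one_step[OF d _ \<kappa>] unfolding N_def eventually_at_top_linorder by blast
  obtain b0 where b0: "\<And>b x A. b0 \<le> b \<Longrightarrow> x \<in> E \<Longrightarrow> norm x \<le> 2 * b \<Longrightarrow> A \<in> sets M \<Longrightarrow>
    (\<forall>\<omega>\<in>A. X 0 \<omega> = x \<longrightarrow> (\<exists>t\<in>{0..d * b}. b / 2 \<le> dist (X t \<omega>) x)) \<Longrightarrow>
    emeasure (P x) A \<le> ennreal (exp (- N * b))"
    using displacement_prob[OF d] unfolding eventually_at_top_linorder by blast
  \<comment> \<open>Outside this radius, \<open>2 * a0\<close> makes the scale
    \<open>a \<ge> norm x / 2\<close> of a step large enough for \<open>one_step\<close>,
    \<open>b0\<close> does the same for \<open>displacement_prob\<close> at scale
    \<open>norm x\<close>, and \<open>2 / d\<close> makes a step last at least one unit of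
    time.\<close>
  define R where "R = max (max (2 * a0) b0) (2 / d)"
  have R: "2 * a0 \<le> R" "b0 \<le> R" "2 / d \<le> R" by (auto simp: R_def)
  have Rpos: "0 < R" using R(3) dpos by (smt (verit) divide_pos_pos)
  have main: "emeasure (P x) (skeleton_survival (E \<inter> cball 0 R) W t) \<le>
      ennreal (exp ((\<bar>\<kappa>\<bar> + C) * (2 * RW)) * exp (- V x - \<kappa> * t))"
    if W: "W \<in> sets borel" "W \<subseteq> cball 0 RW" and RW: "0 \<le> RW"
      and "0 \<le> t" "t < real n" "x \<in> E" "R < norm x" for W RW t n x
    using that(4-)
  proof (induction n arbitrary: t x)
    case 0
    then show ?case by simp
  next
    case (Suc n)
    note t = Suc.prems(1) and x = Suc.prems(3,4)
    let ?K = "E \<inter> cball 0 R"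
    let ?A = "exp ((\<bar>\<kappa>\<bar> + C) * (2 * RW))"
    have K: "?K \<in> sets borel" using closed_E by (intro borel_closed closed_Int) auto
    have absV: "V x \<le> C * norm x" using V_le E_subset_S x by blast
    \<comment> \<open>Rounded down to an integer to respect the skeleton. Since
      \<open>d * norm x \<ge> 2\<close>, rounding loses less than a factor 2, so that the scale
      \<open>a = s / d\<close> satisfies \<open>a \<le> norm x \<le> 2 * a\<close>.\<close>
    define s where "s = nat \<lfloor>d * norm x\<rfloor>"
    have dx: "2 \<le> d * norm x"
    proof -
      have "2 / d \<le> norm x" using R(3) x(2) by simp
      then show ?thesis using dpos by (simp add: field_simps)
    qed
    have "real s = of_int \<lfloor>d * norm x\<rfloor>" using dx by (simp add: s_def)
    then have s: "real s \<le> d * norm x" "d * norm x < real s + 1" by linarith+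
    have s1: "1 \<le> s" using s(2) dx by linarith
    show ?case
    proof (cases "real s \<le> t")
      case True
      define a where "a = real s / d"
      have ad: "a * d = real s" using dpos by (simp add: a_def)
      have a: "a \<le> norm x" "norm x \<le> 2 * a" "a0 \<le> a"
      proof -
        show "a \<le> norm x" using s dpos by (simp add: a_def field_simps)
        have "d * norm x \<le> 2 * real s" using s s1 by linarith
        then show "norm x \<le> 2 * a" using dpos by (simp add: a_def field_simps)
        then show "a0 \<le> a" using R(1) x(2) by simp
      qed
      let ?S = "{\<omega> \<in> space M. X (real s) \<omega> \<in> - ?K}"
      have "emeasure (P x) (skeleton_survival ?K W t) \<le>
        (\<integral>\<^sup>+\<omega>\<in>?S. emeasure (P (X (real s) \<omega>)) (skeleton_survival ?K W (t - real s)) \<partial>P x)"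
        using s1 True x K W(1) by (intro skeleton_survival_step) auto
      also have "\<dots> \<le> (\<integral>\<^sup>+\<omega>. ennreal (?A * exp (- \<kappa> * (t - real s))) * ennreal (exp (- V (X (real s) \<omega>))) \<partial>P x)"
      proof (rule nn_integral_mono)
        fix \<omega> assume "\<omega> \<in> space (P x)"
        then have \<omega>: "\<omega> \<in> space M" using space_P[OF x(1)] by simp
        show "emeasure (P (X (real s) \<omega>)) (skeleton_survival ?K W (t - real s)) * indicator ?S \<omega>
          \<le> ennreal (?A * exp (- \<kappa> * (t - real s))) * ennreal (exp (- V (X (real s) \<omega>)))"
        proof (cases "\<omega> \<in> ?S")
          case inS: True
          have XE: "X (real s) \<omega> \<in> E" using X_in_E[OF _ \<omega>] by simp
          then have "R < norm (X (real s) \<omega>)" using inS by auto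
          then have "emeasure (P (X (real s) \<omega>)) (skeleton_survival ?K W (t - real s))
            \<le> ennreal (?A * exp (- V (X (real s) \<omega>) - \<kappa> * (t - real s)))"
            using Suc.prems(2) s1 True XE by (intro Suc.IH) auto
          also have "\<dots> = ennreal (?A * exp (- \<kappa> * (t - real s))) * ennreal (exp (- V (X (real s) \<omega>)))"
            by (simp add: ennreal_mult[symmetric] mult.assoc exp_add[symmetric] add.commute)
          finally show ?thesis using inS by simp
        qed simp
      qed
      also have "\<dots> = ennreal (?A * exp (- \<kappa> * (t - real s))) * (\<integral>\<^sup>+\<omega>. ennreal (exp (- V (X (real s) \<omega>))) \<partial>P x)"
        using exp_V_measurable[OF x(1), of "real s"] by (intro nn_integral_cmult) simp
      also have "\<dots> \<le> ennreal (?A * exp (- \<kappa> * (t - real s))) * ennreal (exp (- V x - \<kappa> * real s))"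
        using a0[OF a(3) x(1) a(1,2)] unfolding ad by (intro mult_left_mono) auto
      also have "\<dots> = ennreal (?A * exp (- V x - \<kappa> * t))"
        by (simp add: ennreal_mult[symmetric] mult.assoc exp_add[symmetric] algebra_simps)
      finally show ?thesis .
    next
      case False
      \<comment> \<open>Less than one step is left. If \<open>x\<close> is far from
        \<open>W\<close>, reaching \<open>W\<close> needs a displacement of at least half the norm
        of \<open>x\<close>; otherwise the norm is below \<open>2 * RW\<close>, and the constant
        factor outweighs whatever \<open>exp (- V x - \<kappa> * t)\<close> can lose.\<close>
      then have tx: "t \<le> d * norm x" using s by simp
      have tx1: "\<bar>\<kappa> * t\<bar> \<le> \<bar>\<kappa>\<bar> * norm x"
      proof -
        have "t \<le> norm x" using tx dpos mult_right_mono[of d 1 "norm x"] by simp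
        then show ?thesis using t by (simp add: abs_mult mult_left_mono)
      qed
      show ?thesis
      proof (cases "2 * RW \<le> norm x")
        case True
        have "emeasure (P x) (skeleton_survival ?K W t) \<le> ennreal (exp (- N * norm x))"
        proof (rule b0)
          show "skeleton_survival ?K W t \<in> sets M" using t K W(1) by (rule skeleton_survival_sets)
          show "\<forall>\<omega>\<in>skeleton_survival ?K W t. X 0 \<omega> = x \<longrightarrow> (\<exists>t\<in>{0..d * norm x}. norm x / 2 \<le> dist (X t \<omega>) x)"
          proof (intro ballI impI bexI[of _ t])
            fix \<omega> assume "\<omega> \<in> skeleton_survival ?K W t"
            then have "norm (X t \<omega>) \<le> RW" using W(2) by (auto simp: skeleton_survival_def)
            then show "norm x / 2 \<le> dist (X t \<omega>) x"
              using True norm_triangle_sub[of x "X t \<omega>"] by (simp add: dist_norm norm_minus_commute)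
          qed (use t tx in auto)
        qed (use R x in auto)
        also have "\<dots> \<le> ennreal (1 * exp (- V x - \<kappa> * t))"
        proof (rule ennreal_leI)
          have "(C + \<bar>\<kappa>\<bar>) * norm x \<le> N * norm x"
            using C_nonneg lam_nonneg by (intro mult_right_mono) (auto simp: N_def)
          then have "- N * norm x \<le> - V x - \<kappa> * t" using absV tx1 by (simp add: algebra_simps abs_le_iff)
          then show "exp (- N * norm x) \<le> 1 * exp (- V x - \<kappa> * t)" by simp
        qed
        also have "\<dots> \<le> ennreal (?A * exp (- V x - \<kappa> * t))"
          using C_nonneg RW by (intro ennreal_leI mult_right_mono) auto
        finally show ?thesis .
      next
        case False
        interpret prob_space "P x" using prob_space_P[OF x(1)] .
        have "emeasure (P x) (skeleton_survival ?K W t) \<le> 1" by (rule emeasure_le_1)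
        also have "1 \<le> ennreal (?A * exp (- V x - \<kappa> * t))"
        proof -
          have "(\<bar>\<kappa>\<bar> + C) * norm x \<le> (\<bar>\<kappa>\<bar> + C) * (2 * RW)"
            using False C_nonneg by (intro mult_left_mono) auto
          then have "0 \<le> (\<bar>\<kappa>\<bar> + C) * (2 * RW) + (- V x - \<kappa> * t)"
            using absV tx1 by (simp add: algebra_simps abs_le_iff)
          then have "1 \<le> exp ((\<bar>\<kappa>\<bar> + C) * (2 * RW) + (- V x - \<kappa> * t))" by simp
          then show ?thesis unfolding exp_add by simp
        qed
        finally show ?thesis .
      qed
    qed
  qed
  show ?thesis
  proof (intro exI[of _ R] conjI allI impI ballI Rpos)
    fix W :: "'a set" and RW t :: real and x :: 'a
    assume "W \<in> sets borel" "0 \<le> RW" "W \<subseteq> cball 0 RW" "0 \<le> t" "x \<in> E" "R < norm x"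
    moreover obtain n :: nat where "t < real n" using reals_Archimedean2 by blast
    ultimately show "emeasure (P x) (skeleton_survival (E \<inter> cball 0 R) W t) \<le>
      ennreal (exp ((\<bar>\<kappa>\<bar> + C) * (2 * RW)) * exp (- V x - \<kappa> * t))"
      by (intro main) auto
  qed
qed

lemma hitting_time_le: "0 < s \<Longrightarrow> X s \<omega> \<in> K \<Longrightarrow> hitting_time X K \<omega> \<le> ennreal s"
  unfolding hitting_time_def by (intro Inf_lower) auto

definition admissible :: "real \<Rightarrow> bool" where
  "admissible r \<longleftrightarrow> 0 < r \<and> (\<exists>K. compact K \<and> K \<subseteq> E \<and>
      (\<forall>W. compact W \<and> W \<subseteq> E - K \<longrightarrow>
        (\<forall>C. compact C \<and> C \<subseteq> E - K \<longrightarrow>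
          (\<integral>\<^sup>+x\<in>C. (\<integral>\<^sup>+t\<in>{0..}. ennreal (r powr (-t)) *
              emeasure (P x) {\<omega> \<in> space (P x). X t \<omega> \<in> W \<and> hitting_time X K \<omega> > ennreal t}
            \<partial>lborel) \<partial>m) < \<infinity>)))"

lemma ess_spectral_radius_eq: "ess_spectral_radius E P X m = Inf (ennreal ` {r. admissible r})"
  by (simp add: ess_spectral_radius_def admissible_def)

lemma nn_integral_exp_decay:
  assumes "0 < c"
  shows "(\<integral>\<^sup>+t\<in>{0..}. ennreal (exp (- c * t)) \<partial>lborel) = ennreal (1 / c)"
proof -
  have "(\<integral>\<^sup>+t\<in>{0..}. ennreal (exp (- c * t)) \<partial>lborel) = ennreal (0 - (- exp (- c * 0) / c))"
  proof (rule nn_integral_FTC_atLeast)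
    show "((\<lambda>t. - exp (- c * t) / c) has_real_derivative exp (- c * t)) (at t)" for t
      using assms by (auto intro!: derivative_eq_intros)
    have "filterlim (\<lambda>t. - c * t) at_bot at_top"
      using assms by (intro filterlim_tendsto_neg_mult_at_bot[OF tendsto_const] filterlim_ident) auto
    then have "((\<lambda>t. - exp (- c * t) / c) \<longlongrightarrow> - 0 / c) at_top"
      using assms by (intro tendsto_intros filterlim_compose[OF exp_at_bot]) auto
    then show "((\<lambda>t. - exp (- c * t) / c) \<longlongrightarrow> 0) at_top" by simp
  qed auto
  then show ?thesis by simp
qed

text \<open>With \<open>r = exp (- \<kappa>0)\<close> and \<open>\<kappa>\<close> strictly between
  \<open>\<kappa>0\<close> and \<open>lam\<close>, survival at rate \<open>\<kappa>\<close> leaves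
  the integrable weight \<open>exp (- (\<kappa> - \<kappa>0) * t)\<close>, with a bound uniform over
  the compact set of starting points.\<close>

lemma admissible_above:
  assumes r: "exp (- lam) < r"
  shows "admissible r"
proof -
  have rpos: "0 < r" using r less_trans[OF exp_gt_zero] by blast
  define \<kappa>0 where "\<kappa>0 = - ln r"
  have \<kappa>0: "\<kappa>0 < lam" using r rpos by (simp add: \<kappa>0_def) (metis exp_ln exp_less_cancel_iff minus_less_iff)
  have rpow: "r powr (- t) = exp (\<kappa>0 * t)" for t using rpos by (simp add: powr_def \<kappa>0_def)
  define \<kappa> where "\<kappa> = (\<kappa>0 + lam) / 2"
  have \<kappa>: "\<kappa> < lam" "\<kappa>0 < \<kappa>" using \<kappa>0 by (auto simp: \<kappa>_def)
  obtain R where R: "R > 0" "\<And>W RW t x. W \<in> sets borel \<Longrightarrow> 0 \<le> RW \<Longrightarrow> W \<subseteq> cball 0 RW \<Longrightarrow> 0 \<le> t \<Longrightarrow> x \<in> E \<Longrightarrow>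
    R < norm x \<Longrightarrow> emeasure (P x) (skeleton_survival (E \<inter> cball 0 R) W t) \<le>
      ennreal (exp ((\<bar>\<kappa>\<bar> + C) * (2 * RW)) * exp (- V x - \<kappa> * t))"
    using skeleton_survival_decay[OF \<kappa>(1)] by metis
  let ?K = "E \<inter> cball 0 R"
  have K: "compact ?K" using closed_E by (intro closed_Int_compact) auto
  have Kb: "?K \<in> sets borel" using K by (intro borel_closed compact_imp_closed)
  have "(\<integral>\<^sup>+x\<in>D. (\<integral>\<^sup>+t\<in>{0..}. ennreal (r powr (-t)) *
      emeasure (P x) {\<omega> \<in> space (P x). X t \<omega> \<in> W \<and> hitting_time X ?K \<omega> > ennreal t} \<partial>lborel) \<partial>m) < \<infinity>"
    if W: "compact W" and D: "compact D" "D \<subseteq> E - ?K" for W D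
  proof -
    obtain RW where RW: "0 < RW" "W \<subseteq> cball 0 RW"
      using compact_imp_bounded[OF W] unfolding bounded_subset_cball by (metis bounded_pos bounded_subset_cball compact_imp_bounded W mem_cball_0 subsetI)
    obtain RD where RD: "0 < RD" "\<And>x. x \<in> D \<Longrightarrow> norm x \<le> RD"
      using compact_imp_bounded[OF D(1)] unfolding bounded_pos by blast
    have Wb: "W \<in> sets borel" using W by (intro borel_closed compact_imp_closed)
    define A where "A = exp ((\<bar>\<kappa>\<bar> + C) * (2 * RW)) * exp (C * RD)"
    have A: "0 \<le> A" by (simp add: A_def)
    have inner: "(\<integral>\<^sup>+t\<in>{0..}. ennreal (r powr (-t)) *
      emeasure (P x) {\<omega> \<in> space (P x). X t \<omega> \<in> W \<and> hitting_time X ?K \<omega> > ennreal t} \<partial>lborel) \<le> ennreal (A / (\<kappa> - \<kappa>0))"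
      if x: "x \<in> D" for x
    proof -
      have xE: "x \<in> E" "R < norm x" using D x by auto
      have "ennreal (r powr (-t)) * emeasure (P x) {\<omega> \<in> space (P x). X t \<omega> \<in> W \<and> hitting_time X ?K \<omega> > ennreal t}
        \<le> ennreal A * ennreal (exp (- (\<kappa> - \<kappa>0) * t))" if t: "0 \<le> t" for t
      proof -
        have "{\<omega> \<in> space (P x). X t \<omega> \<in> W \<and> hitting_time X ?K \<omega> > ennreal t} \<subseteq> skeleton_survival ?K W t"
        proof
          fix \<omega> assume \<omega>: "\<omega> \<in> {\<omega> \<in> space (P x). X t \<omega> \<in> W \<and> hitting_time X ?K \<omega> > ennreal t}"
          have "X (real k) \<omega> \<notin> ?K" if k: "k \<in> {1..nat \<lfloor>t\<rfloor>}" for k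
          proof
            assume "X (real k) \<omega> \<in> ?K"
            then have "hitting_time X ?K \<omega> \<le> ennreal (real k)" using k by (intro hitting_time_le) auto
            also have "\<dots> \<le> ennreal t"
            proof (rule ennreal_leI)
              have "int k \<le> \<lfloor>t\<rfloor>" using k by auto
              then show "real k \<le> t" by (simp add: le_floor_iff)
            qed
            finally show False using \<omega> by auto
          qed
          then show "\<omega> \<in> skeleton_survival ?K W t" using \<omega> space_P[OF xE(1)] by (simp add: skeleton_survival_def)
        qed
        then have "emeasure (P x) {\<omega> \<in> space (P x). X t \<omega> \<in> W \<and> hitting_time X ?K \<omega> > ennreal t}
          \<le> emeasure (P x) (skeleton_survival ?K W t)"
          using skeleton_survival_sets[OF t Kb Wb] sets_P[OF xE(1)] by (intro emeasure_mono) auto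
        also have "\<dots> \<le> ennreal (exp ((\<bar>\<kappa>\<bar> + C) * (2 * RW)) * exp (- V x - \<kappa> * t))"
          using RW Wb t xE by (intro R(2)) auto
        also have "\<dots> \<le> ennreal (A * exp (- \<kappa> * t))"
        proof (rule ennreal_leI)
          have "- C * norm x \<le> V x" using V_ge E_subset_S xE by blast
          moreover have "C * norm x \<le> C * RD" using RD(2)[OF x] C_nonneg by (rule mult_left_mono)
          ultimately have "exp (- V x - \<kappa> * t) \<le> exp (C * RD + - \<kappa> * t)" by simp
          also have "\<dots> = exp (C * RD) * exp (- \<kappa> * t)" by (rule exp_add)
          finally show "exp ((\<bar>\<kappa>\<bar> + C) * (2 * RW)) * exp (- V x - \<kappa> * t) \<le> A * exp (- \<kappa> * t)"
            by (simp add: A_def)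
        qed
        finally have "ennreal (r powr (-t)) * emeasure (P x) {\<omega> \<in> space (P x). X t \<omega> \<in> W \<and> hitting_time X ?K \<omega> > ennreal t}
          \<le> ennreal (exp (\<kappa>0 * t)) * ennreal (A * exp (- \<kappa> * t))"
          unfolding rpow by (rule mult_left_mono) simp
        also have "\<dots> = ennreal A * ennreal (exp (- (\<kappa> - \<kappa>0) * t))"
          using A by (simp add: ennreal_mult[symmetric] exp_add[symmetric] algebra_simps)
        finally show ?thesis .
      qed
      then have "(\<integral>\<^sup>+t\<in>{0..}. ennreal (r powr (-t)) *
        emeasure (P x) {\<omega> \<in> space (P x). X t \<omega> \<in> W \<and> hitting_time X ?K \<omega> > ennreal t} \<partial>lborel)
        \<le> (\<integral>\<^sup>+t. ennreal A * (ennreal (exp (- (\<kappa> - \<kappa>0) * t)) * indicator {0..} t) \<partial>lborel)"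
        by (intro nn_integral_mono) (auto split: split_indicator)
      also have "\<dots> = ennreal A * (\<integral>\<^sup>+t\<in>{0..}. ennreal (exp (- (\<kappa> - \<kappa>0) * t)) \<partial>lborel)"
        by (intro nn_integral_cmult) auto
      also have "\<dots> = ennreal A * ennreal (1 / (\<kappa> - \<kappa>0))"
        using \<kappa> nn_integral_exp_decay[of "\<kappa> - \<kappa>0"] by simp
      also have "\<dots> = ennreal (A / (\<kappa> - \<kappa>0))" using A \<kappa> by (simp add: ennreal_mult[symmetric])
      finally show ?thesis .
    qed
    have "D \<in> sets m"
      unfolding sets_m using D compact_imp_closed[OF D(1)] E_borel
      by (auto simp: sets_restrict_space image_iff intro!: bexI[of _ D] borel_closed)
    have "(\<integral>\<^sup>+x\<in>D. (\<integral>\<^sup>+t\<in>{0..}. ennreal (r powr (-t)) *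
      emeasure (P x) {\<omega> \<in> space (P x). X t \<omega> \<in> W \<and> hitting_time X ?K \<omega> > ennreal t} \<partial>lborel) \<partial>m)
      \<le> (\<integral>\<^sup>+x. ennreal (A / (\<kappa> - \<kappa>0)) * indicator D x \<partial>m)"
      using inner by (intro nn_integral_mono) (auto split: split_indicator)
    also have "\<dots> = ennreal (A / (\<kappa> - \<kappa>0)) * emeasure m D"
      using \<open>D \<in> sets m\<close> by (rule nn_integral_cmult_indicator)
    also have "\<dots> < \<infinity>" using radon_m[OF D(1)] D(2) by (auto simp: ennreal_mult_less_top)
    finally show ?thesis .
  qed
  then show ?thesis using rpos K unfolding admissible_def by (intro conjI exI[of _ ?K]) auto
qed

end

section \<open>Lower bound for the essential spectral radius\<close>

lemma power_eventually_ge: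
  fixes g b :: real
  assumes "1 < g" "0 < b"
  shows "\<exists>n. c \<le> b * g ^ n"
proof -
  obtain n where "c / b < g ^ n" using real_arch_pow[OF assms(1)] by blast
  then have "c \<le> b * g ^ n" using assms(2) by (simp add: field_simps)
  then show ?thesis by blast
qed

context ldp_action
begin

text \<open>The window after time \<open>a * s\<close> is what the spectral radius sees, since it
  integrates over time the probability of being in a compact set. Closedness is what
  \<open>markov_closed\<close> asks for.\<close>

definition loop_set :: "'a \<Rightarrow> real \<Rightarrow> real \<Rightarrow> real \<Rightarrow> real \<Rightarrow> (real \<times> 'a) set" where
  "loop_set z \<delta> \<rho> s a = {p. a * \<delta> \<le> norm (snd p)} \<inter> ({p. fst p \<le> a * s} \<union> {p. dist (snd p) (a *\<^sub>R z) \<le> a * \<rho>})"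

lemma closed_loop_set: "closed (loop_set z \<delta> \<rho> s a)"
  unfolding loop_set_def by (intro closed_Int closed_Un closed_Collect_le continuous_intros)

definition loop_event :: "'a \<Rightarrow> real \<Rightarrow> real \<Rightarrow> real \<Rightarrow> real \<Rightarrow> real \<Rightarrow> 'w set" where
  "loop_event z \<delta> \<rho> s T a = {\<omega> \<in> space M. \<forall>t\<in>{0..a * T}. (t, X t \<omega>) \<in> loop_set z \<delta> \<rho> s a}"

text \<open>Three phases: straight from \<open>x\<close> to the base point in time \<open>h\<close>,
  the loop, waiting at the base point for time \<open>h\<close>. The first admits every start near
  \<open>z\<close>, so that loops can be repeated; the last creates the window of
  \<open>loop_set\<close>. The two short phases cost at most \<open>C0 * h\<close> each.\<close>

lemma approach_loop_wait:
  assumes \<phi>: "path_in S0 1 \<phi>" "\<phi> 0 = z" "\<phi> 1 = z" and c: "J 1 \<phi> < ennreal c"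
    and low: "\<And>t. t \<in> {0..1} \<Longrightarrow> 4 * \<delta> \<le> norm (\<phi> t)"
    and h: "0 < h" and \<rho>: "\<rho> = d0 * h" "\<rho> \<le> \<delta>"
    and x: "x \<in> S" "dist x z \<le> \<rho>"
  shows "\<exists>\<psi>. path_in S (1 + 2 * h) \<psi> \<and> \<psi> 0 = x \<and> J (1 + 2 * h) \<psi> < ennreal (c + 2 * C0 * h) \<and>
    (\<forall>t\<in>{0..1 + 2 * h}. 3 * \<delta> \<le> norm (\<psi> t)) \<and> (\<forall>t\<in>{1 + h..1 + 2 * h}. \<psi> t = z)"
proof -
  have z0: "z \<in> S0" using path_inD[OF \<phi>(1), of 0] \<phi>(2) by simp
  then have z: "z \<in> S" by simp
  have zn: "4 * \<delta> \<le> norm z" using low[of 0] \<phi>(2) by simp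
  let ?g = "segment h x z" and ?w = "segment h z z"
  let ?r = "path_join 1 \<phi> ?w"
  let ?p = "path_join h ?g ?r"
  have pg: "path_in S h ?g" using path_in_segment[OF convex_S x(1) z h] .
  have pw: "path_in S h ?w" using path_in_segment[OF convex_S z z h] .
  have p\<phi>: "path_in S 1 \<phi>" using path_in_S0D[OF \<phi>(1)] .
  have pr: "path_in S (1 + h) ?r" by (rule path_in_join[OF p\<phi> pw]) (use \<phi> h in auto)
  have r0: "?r 0 = z" using \<phi>(2) by (simp add: path_join_def)
  have T: "1 + 2 * h = h + (1 + h)" by simp
  have pp: "path_in S (1 + 2 * h) ?p" unfolding T by (rule path_in_join[OF pg pr]) (use r0 h in auto)
  have "J (1 + 2 * h) ?p = J h ?g + J (1 + h) ?r" unfolding T by (rule J_join[OF pg pr]) (use r0 h in auto)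
  also have "J (1 + h) ?r = J 1 \<phi> + J h ?w" by (rule J_join[OF p\<phi> pw]) (use \<phi> h in auto)
  also have "J h ?g + (J 1 \<phi> + J h ?w) < ennreal (c + 2 * C0 * h)"
  proof -
    obtain j where j: "J 1 \<phi> = ennreal j" "0 \<le> j" "j < c"
      using c by (cases "J 1 \<phi>") (auto simp: ennreal_less_iff)
    have "J h ?g \<le> ennreal (C0 * h)"
      using x z h \<rho> by (intro J_segment) (auto simp: dist_norm norm_minus_commute)
    moreover have "J h ?w \<le> ennreal (C0 * h)" using z h d0 by (intro J_segment) auto
    ultimately have "J h ?g + (J 1 \<phi> + J h ?w) \<le> ennreal (C0 * h) + (ennreal j + ennreal (C0 * h))"
      unfolding j by (intro add_mono) auto
    also have "\<dots> = ennreal (j + 2 * C0 * h)" using j C0 h by (simp flip: ennreal_plus)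
    also have "\<dots> < ennreal (c + 2 * C0 * h)" using j C0 h by (intro ennreal_lessI) (auto intro: add_pos_nonneg)
    finally show ?thesis .
  qed
  finally have cost: "J (1 + 2 * h) ?p < ennreal (c + 2 * C0 * h)" .
  have wait: "?w t = z" for t by (simp add: segment_def)
  have "3 * \<delta> \<le> norm (?p t)" if t: "t \<in> {0..1 + 2 * h}" for t
  proof -
    have "\<delta> \<ge> 0" using \<rho> h d0 by (smt (verit) mult_pos_pos)
    consider "t \<le> h" | "h < t" "t \<le> 1 + h" | "1 + h < t" by linarith
    then show ?thesis
    proof cases
      case 1
      have "?g t \<in> cball z \<rho>"
        using x \<rho> h d0 1 t by (intro segment_mem) (auto simp: dist_commute)
      then have "norm z - \<rho> \<le> norm (?g t)"
        using norm_triangle_sub[of z "?g t"] by (simp add: dist_norm)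
      then show ?thesis using 1 zn \<rho>(2) by (simp add: path_join_def)
    next
      case 2
      then have "?p t = \<phi> (t - h)" by (simp add: path_join_def)
      then show ?thesis using low[of "t - h"] 2 \<open>\<delta> \<ge> 0\<close> by simp
    next
      case 3
      then have "?p t = z" using h wait by (simp add: path_join_def)
      then show ?thesis using zn \<open>\<delta> \<ge> 0\<close> by simp
    qed
  qed
  moreover have "?p t = z" if "t \<in> {1 + h..1 + 2 * h}" for t
  proof (cases "t = 1 + h")
    case True
    then show ?thesis using h \<phi>(3) by (simp add: path_join_def)
  next
    case False
    then show ?thesis using that h wait by (simp add: path_join_def)
  qed
  moreover have "?p 0 = x" using h by (simp add: path_join_def)
  ultimately show ?thesis using pp cost by (intro exI[of _ ?p]) blast
qed

text \<open>The paths of \<open>approach_loop_wait\<close> feed the lower large deviation bound, and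
  a finite cover makes it uniform over all starts within \<open>a * \<rho>\<close> of
  \<open>a *\<^sub>R z\<close>. The process ends in the ball from which it started, ready for the
  next round.\<close>

lemma loop_prob:
  assumes \<mu>: "lam < \<mu>"
  shows "\<exists>z \<delta> \<rho> s T c. z \<in> S \<and> 0 < \<delta> \<and> 0 < \<rho> \<and> 2 * \<delta> \<le> norm z - \<rho> \<and> 1 \<le> s \<and> s < T \<and> c < \<mu> \<and> 0 \<le> c \<and>
    (\<forall>\<^sub>F a in at_top. \<forall>y\<in>E. dist y (a *\<^sub>R z) \<le> a * \<rho> \<longrightarrow>
      ennreal (exp (- c * a)) \<le> emeasure (P y) (loop_event z \<delta> \<rho> s T a))"
proof -
  define \<eta> where "\<eta> = (\<mu> - lam) / 2"
  have \<eta>: "0 < \<eta>" using \<mu> by (simp add: \<eta>_def)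
  obtain \<phi> where \<phi>: "path_in S0 1 \<phi>" "\<phi> 0 = \<phi> 1" "J 1 \<phi> < ennreal (lam + \<eta>)"
    using near_optimal_loop[OF \<eta>] by blast
  define z where "z = \<phi> 0"
  have zS: "z \<in> S" using path_inD[OF \<phi>(1), of 0] by (simp add: z_def)
  have "continuous_on {0..1} (\<lambda>t. norm (\<phi> t))"
    using \<phi>(1) by (auto simp: path_in_def intro: continuous_on_norm)
  then obtain t0 where t0: "t0 \<in> {0..1}" "\<And>t. t \<in> {0..1} \<Longrightarrow> norm (\<phi> t0) \<le> norm (\<phi> t)"
    using continuous_attains_inf[of "{0..1}" "\<lambda>t. norm (\<phi> t)"] by auto
  \<comment> \<open>A quarter of the distance between loop and origin: the initial segment may lose
    one \<open>\<delta>\<close>, the deviation of the process from the path another.\<close>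
  define \<delta> where "\<delta> = norm (\<phi> t0) / 4"
  have \<delta>: "0 < \<delta>" using path_inD[OF \<phi>(1) t0(1)] by (simp add: \<delta>_def)
  have low: "4 * \<delta> \<le> norm (\<phi> t)" if "t \<in> {0..1}" for t using t0(2)[OF that] by (simp add: \<delta>_def)
  \<comment> \<open>The first bound gives \<open>\<rho> \<le> \<delta>\<close>; the second makes the
    extra cost \<open>2 * C0 * h\<close> at most \<open>\<eta> / 2\<close>, so that \<open>c\<close>
    stays below \<open>\<mu> = lam + 2 * \<eta>\<close>.\<close>
  define h where "h = min (\<delta> / d0) (\<eta> / (4 * (C0 + 1)))"
  have h: "0 < h" using \<delta> d0 \<eta> C0 by (simp add: h_def)
  define \<rho> where "\<rho> = d0 * h"
  have \<rho>: "0 < \<rho>" "\<rho> \<le> \<delta>"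
  proof -
    show "0 < \<rho>" using h d0 by (simp add: \<rho>_def)
    have "h \<le> \<delta> / d0" by (simp add: h_def)
    then show "\<rho> \<le> \<delta>" using d0 by (simp add: \<rho>_def field_simps)
  qed
  define c where "c = lam + \<eta> + 2 * C0 * h"
  have c: "c < \<mu>" "0 \<le> c"
  proof -
    have "(C0 + 1) * h \<le> (C0 + 1) * (\<eta> / (4 * (C0 + 1)))"
      using C0 by (intro mult_left_mono) (auto simp: h_def)
    also have "\<dots> = \<eta> / 4" using C0 by (simp add: field_simps)
    finally have "C0 * h \<le> \<eta> / 4" using h by (simp add: algebra_simps)
    then show "c < \<mu>" using \<eta> unfolding c_def \<eta>_def by (simp add: field_simps)
    show "0 \<le> c" using lam_nonneg \<eta> C0 h by (simp add: c_def)
  qed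
  define T where "T = 1 + 2 * h"
  have T: "0 < T" "1 + h < T" using h by (auto simp: T_def)
  have local_bound: "\<exists>\<epsilon>>0. \<forall>\<^sub>F a in at_top. \<forall>w. a *\<^sub>R w \<in> E \<longrightarrow> norm (w - x) < \<epsilon> \<longrightarrow>
      ennreal (exp (- c * a)) \<le> emeasure (P (a *\<^sub>R w)) (loop_event z \<delta> \<rho> (1 + h) T a)"
    if x: "x \<in> S \<inter> cball z \<rho>" for x
  proof -
    have "\<exists>\<psi>. path_in S T \<psi> \<and> \<psi> 0 = x \<and> J T \<psi> < ennreal c \<and>
      (\<forall>t\<in>{0..T}. 3 * \<delta> \<le> norm (\<psi> t)) \<and> (\<forall>t\<in>{1 + h..T}. \<psi> t = z)"
      unfolding T_def c_def
    proof (rule approach_loop_wait[OF \<phi>(1) _ _ \<phi>(3) low h \<rho>_def \<rho>(2)])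
      show "\<phi> 0 = z" "\<phi> 1 = z" using \<phi>(2) by (simp_all add: z_def)
      show "x \<in> S" "dist x z \<le> \<rho>" using x by (simp_all add: dist_commute)
    qed
    then obtain \<psi> where \<psi>: "path_in S T \<psi>" "\<psi> 0 = x" "J T \<psi> < ennreal c"
      "\<forall>t\<in>{0..T}. 3 * \<delta> \<le> norm (\<psi> t)" "\<forall>t\<in>{1 + h..T}. \<psi> t = z"
      by blast
    let ?R = "restrict \<psi> {0..T}"
    have R: "?R \<in> skorohod_space T S" using \<psi>(1) by (intro continuous_in_skorohod) (auto simp: path_in_def)
    have "continuous_on {0..T} ?R \<longleftrightarrow> continuous_on {0..T} \<psi>" by (rule continuous_on_cong) auto
    then have contR: "continuous_on {0..T} ?R" using \<psi>(1) by (simp add: path_in_def)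
    obtain e where e: "e > 0" "\<forall>\<xi>\<in>skorohod_space T S. skorohod_dist T ?R \<xi> < e \<longrightarrow> (\<forall>t\<in>{0..T}. dist (\<xi> t) (?R t) < \<rho>)"
      using skorohod_near_continuous[OF R contR \<rho>(1)] by blast
    let ?U = "mball_of (skorohod_metric T S) ?R e"
    have RU: "?R \<in> ?U"
      using R e(1) Metric_space.zero[OF Metric_space_skorohod R R] unfolding in_mball_of_skorohod by simp
    have "I T ?R < ennreal c" using \<psi>(3) by (simp add: path_cost_def)
    from ldp_lower_at[OF T(1) openin_skorohod_ball RU this] obtain \<epsilon> where \<epsilon>: "\<epsilon> > 0"
      "\<forall>\<^sub>F a in at_top. \<forall>w. a *\<^sub>R w \<in> E \<longrightarrow> norm (w - x) < \<epsilon> \<longrightarrow> ennreal (exp (- c * a)) \<le> scaled_prob T ?U a w"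
      using \<psi>(2) T by auto
    have "\<forall>\<^sub>F a in at_top. \<forall>w. a *\<^sub>R w \<in> E \<longrightarrow> norm (w - x) < \<epsilon> \<longrightarrow>
      ennreal (exp (- c * a)) \<le> emeasure (P (a *\<^sub>R w)) (loop_event z \<delta> \<rho> (1 + h) T a)"
      using \<epsilon>(2) eventually_gt_at_top[of 0]
    proof eventually_elim
      case (elim a)
      have sets: "loop_event z \<delta> \<rho> (1 + h) T a \<in> sets M"
        unfolding loop_event_def
        by (rule F_sets_M[OF closed_path_event_sets[OF _ closed_loop_set]]) (use elim T in simp)
      have sub: "\<omega> \<in> loop_event z \<delta> \<rho> (1 + h) T a" if \<omega>: "\<omega> \<in> space M" "rescaled_path X T a \<omega> \<in> ?U" for \<omega>
      proof -
        have near: "dist (rescaled_path X T a \<omega> t) (\<psi> t) < \<rho>" if "t \<in> {0..T}" for t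
          using e(2) \<omega>(2) that unfolding in_mball_of_skorohod by auto
        have "(t, X t \<omega>) \<in> loop_set z \<delta> \<rho> (1 + h) a" if t: "t \<in> {0..a * T}" for t
        proof -
          have ta: "t / a \<in> {0..T}" using t elim by (auto simp: field_simps)
          let ?x = "X t \<omega> /\<^sub>R a"
          have dx: "dist ?x (\<psi> (t / a)) < \<rho>" using near[OF ta] ta elim by (simp add: rescaled_path_def)
          have "norm (\<psi> (t / a)) \<le> norm ?x + dist ?x (\<psi> (t / a))"
            using norm_triangle_sub[of "\<psi> (t / a)" ?x] by (simp add: dist_norm norm_minus_commute)
          moreover have "3 * \<delta> \<le> norm (\<psi> (t / a))" using \<psi>(4) ta by blast
          ultimately have "\<delta> \<le> norm ?x" using dx \<rho>(2) \<delta> by linarith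
          then have 1: "a * \<delta> \<le> norm (X t \<omega>)" using elim by (simp add: field_simps)
          have 2: "dist (X t \<omega>) (a *\<^sub>R z) \<le> a * \<rho>" if "\<not> t \<le> a * (1 + h)"
          proof -
            have "t / a \<in> {1 + h..T}" using that ta elim by (auto simp: field_simps)
            then have "\<psi> (t / a) = z" using \<psi>(5) by blast
            then have "dist ?x z \<le> \<rho>" using dx by simp
            moreover have "dist ?x ((a *\<^sub>R z) /\<^sub>R a) = dist (X t \<omega>) (a *\<^sub>R z) / a"
              by (rule dist_divideR[OF elim(2)])
            moreover have "(a *\<^sub>R z) /\<^sub>R a = z" using elim by simp
            ultimately have "dist (X t \<omega>) (a *\<^sub>R z) / a \<le> \<rho>" by metis
            then show ?thesis using elim(2) by (simp add: field_simps)
          qed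
          show ?thesis using 1 2 by (auto simp: loop_set_def)
        qed
        then show ?thesis using \<omega>(1) by (simp add: loop_event_def)
      qed
      show ?case
      proof (intro allI impI)
        fix w assume w: "a *\<^sub>R w \<in> E" "norm (w - x) < \<epsilon>"
        have "ennreal (exp (- c * a)) \<le> scaled_prob T ?U a w" using elim w by blast
        also have "\<dots> \<le> emeasure (P (a *\<^sub>R w)) (loop_event z \<delta> \<rho> (1 + h) T a)"
          using w(1) sets sub by (intro scaled_prob_mono) auto
        finally show "ennreal (exp (- c * a)) \<le> emeasure (P (a *\<^sub>R w)) (loop_event z \<delta> \<rho> (1 + h) T a)" .
      qed
    qed
    then show ?thesis using \<epsilon>(1) by blast
  qed
  then have "\<forall>x\<in>S \<inter> cball z \<rho>. \<exists>\<epsilon>>0. \<forall>\<^sub>F a in at_top. \<forall>w. a *\<^sub>R w \<in> E \<longrightarrow> norm (w - x) < \<epsilon> \<longrightarrow>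
      ennreal (exp (- c * a)) \<le> emeasure (P (a *\<^sub>R w)) (loop_event z \<delta> \<rho> (1 + h) T a)" by blast
  from bchoice[OF this] obtain \<epsilon> where \<epsilon>: "\<forall>x\<in>S \<inter> cball z \<rho>. 0 < \<epsilon> x \<and>
    (\<forall>\<^sub>F a in at_top. \<forall>w. a *\<^sub>R w \<in> E \<longrightarrow> norm (w - x) < \<epsilon> x \<longrightarrow>
      ennreal (exp (- c * a)) \<le> emeasure (P (a *\<^sub>R w)) (loop_event z \<delta> \<rho> (1 + h) T a))" by blast
  have "compact (S \<inter> cball z \<rho>)" using S_closed by (intro closed_Int_compact) auto
  then obtain D where D: "D \<subseteq> S \<inter> cball z \<rho>" "finite D" "S \<inter> cball z \<rho> \<subseteq> (\<Union>x\<in>D. ball x (\<epsilon> x))"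
    by (rule compactE_image[of _ "S \<inter> cball z \<rho>" "\<lambda>x. ball x (\<epsilon> x)"]) (use \<epsilon> in force)+
  have "\<forall>\<^sub>F a in at_top. \<forall>x\<in>D. \<forall>w. a *\<^sub>R w \<in> E \<longrightarrow> norm (w - x) < \<epsilon> x \<longrightarrow>
      ennreal (exp (- c * a)) \<le> emeasure (P (a *\<^sub>R w)) (loop_event z \<delta> \<rho> (1 + h) T a)"
    using \<epsilon> D by (intro eventually_ball_finite) auto
  then have ev: "\<forall>\<^sub>F a in at_top. \<forall>y\<in>E. dist y (a *\<^sub>R z) \<le> a * \<rho> \<longrightarrow>
      ennreal (exp (- c * a)) \<le> emeasure (P y) (loop_event z \<delta> \<rho> (1 + h) T a)"
    using eventually_gt_at_top[of 0]
  proof eventually_elim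
    case (elim a)
    show ?case
    proof (intro ballI impI)
      fix y assume y: "y \<in> E" "dist y (a *\<^sub>R z) \<le> a * \<rho>"
      let ?w = "y /\<^sub>R a"
      have aw: "a *\<^sub>R ?w = y" using elim by simp
      have "dist ?w ((a *\<^sub>R z) /\<^sub>R a) = dist y (a *\<^sub>R z) / a" by (rule dist_divideR[OF elim(2)])
      moreover have "(a *\<^sub>R z) /\<^sub>R a = z" using elim by simp
      moreover have "dist y (a *\<^sub>R z) / a \<le> \<rho>" using y(2) elim(2) by (simp add: field_simps)
      ultimately have "dist ?w z \<le> \<rho>" by metis
      moreover have "?w \<in> S" using elim y by (intro scale_E_in_S) auto
      ultimately have "?w \<in> S \<inter> cball z \<rho>" by (simp add: dist_commute)
      then obtain x where x: "x \<in> D" "?w \<in> ball x (\<epsilon> x)" using D(3) by blast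
      then have "norm (?w - x) < \<epsilon> x" by (simp add: dist_norm norm_minus_commute)
      then have "ennreal (exp (- c * a)) \<le> emeasure (P (a *\<^sub>R ?w)) (loop_event z \<delta> \<rho> (1 + h) T a)"
        using elim(1) x(1) y(1) aw by metis
      then show "ennreal (exp (- c * a)) \<le> emeasure (P y) (loop_event z \<delta> \<rho> (1 + h) T a)" unfolding aw .
    qed
  qed
  have "4 * \<delta> \<le> norm z" using low[of 0] by (simp add: z_def)
  then have "2 * \<delta> \<le> norm z - \<rho>" using \<rho> \<delta> by linarith
  then show ?thesis using zS \<delta> \<rho>(1) h T(2) c ev
    by (intro exI[of _ z] exI[of _ \<delta>] exI[of _ \<rho>] exI[of _ "1 + h"] exI[of _ T] exI[of _ c]) auto
qed

text \<open>\<open>G n\<close> records only what is used later: distance from the origin throughout,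
  and return in the last window of period \<open>n\<close>. The Markov property at time
  \<open>n * (a * T)\<close> then gains one more factor \<open>q\<close>. In \<open>G 0\<close> the
  bound \<open>- 1\<close> makes the time alternative void, so that the condition falls on the start
  itself.\<close>

lemma repeated_loops_prob:
  assumes a: "0 < a" and \<rho>: "0 < \<rho>" "2 * \<delta> \<le> norm z - \<rho>" "0 < \<delta>" and T: "0 < T" "s < T" "0 \<le> s"
    and q: "\<And>y. y \<in> E \<Longrightarrow> dist y (a *\<^sub>R z) \<le> a * \<rho> \<Longrightarrow> q \<le> emeasure (P y) (loop_event z \<delta> \<rho> s T a)"
    and y: "y \<in> E" "dist y (a *\<^sub>R z) \<le> a * \<rho>"
  defines "G n \<equiv> {p. a * \<delta> \<le> norm (snd p)} \<inter>
    ({p. fst p \<le> real n * (a * T) + (if n = 0 then - 1 else - (a * T) + a * s)} \<union> {p. dist (snd p) (a *\<^sub>R z) \<le> a * \<rho>})"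
  shows "q ^ n \<le> emeasure (P y) {\<omega> \<in> space M. \<forall>t\<in>{0..real n * (a * T)}. (t, X t \<omega>) \<in> G n}"
proof (induction n)
  case 0
  interpret prob_space "P y" using prob_space_P[OF y(1)] .
  have Gcl: "closed (G 0)" unfolding G_def by (intro closed_Int closed_Un closed_Collect_le continuous_intros)
  have sets: "{\<omega> \<in> space M. \<forall>t\<in>{0..real 0 * (a * T)}. (t, X t \<omega>) \<in> G 0} \<in> sets M"
    by (rule F_sets_M[OF closed_path_event_sets[OF _ Gcl]]) simp
  have "AE \<omega> in P y. \<omega> \<in> {\<omega> \<in> space M. \<forall>t\<in>{0..real 0 * (a * T)}. (t, X t \<omega>) \<in> G 0}"
    using initial[OF y(1)] AE_space
  proof eventually_elim
    case (elim \<omega>)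
    have "norm (a *\<^sub>R z) \<le> norm y + dist y (a *\<^sub>R z)"
      using norm_triangle_sub[of "a *\<^sub>R z" y] by (simp add: dist_norm norm_minus_commute)
    then have "a * norm z \<le> norm y + a * \<rho>" using y(2) a by simp
    moreover have "a * (2 * \<delta>) \<le> a * (norm z - \<rho>)" using \<rho>(2) a by (intro mult_left_mono) auto
    moreover have "0 < a * \<delta>" using a \<rho>(3) by simp
    ultimately have "a * \<delta> \<le> norm y" by (simp add: algebra_simps)
    then show ?case using elim y space_P[OF y(1)] by (simp add: G_def)
  qed
  then have "emeasure (P y) {\<omega> \<in> space M. \<forall>t\<in>{0..real 0 * (a * T)}. (t, X t \<omega>) \<in> G 0} = 1"
    using sets sets_P[OF y(1)] by (intro emeasure_eq_1_AE) auto
  then show ?case by simp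
next
  case (Suc n)
  let ?\<tau> = "a * T"
  let ?A = "{\<omega> \<in> space M. \<forall>t\<in>{0..real n * ?\<tau>}. (t, X t \<omega>) \<in> G n}"
  have \<tau>: "0 < ?\<tau>" using a T by simp
  have Gcl: "closed (G k)" for k unfolding G_def by (intro closed_Int closed_Un closed_Collect_le continuous_intros)
  have nt: "0 \<le> real n * ?\<tau>" using \<tau> by simp
  have A: "?A \<in> sets (F (ennreal (real n * ?\<tau>)))" by (rule closed_path_event_sets[OF nt Gcl])
  have AP: "?A \<in> sets (P y)" using F_sets_M[OF A] sets_P[OF y(1)] by simp
  \<comment> \<open>The window includes the end of the period, so every period ends where the next
    one may begin.\<close>
  have return: "dist (X (real n * ?\<tau>) \<omega>) (a *\<^sub>R z) \<le> a * \<rho>" if "\<omega> \<in> ?A" for \<omega>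
  proof -
    have "(real n * ?\<tau>, X (real n * ?\<tau>) \<omega>) \<in> G n" using that nt by auto
    moreover have "a * s < a * T" using a T by simp
    ultimately show ?thesis by (auto simp: G_def split: if_splits)
  qed
  have "q ^ Suc n = q * q ^ n" by simp
  also have "\<dots> \<le> q * emeasure (P y) ?A" using Suc.IH by (rule mult_left_mono) simp
  also have "\<dots> = (\<integral>\<^sup>+\<omega>. q * indicator ?A \<omega> \<partial>P y)" using AP by (simp add: nn_integral_cmult_indicator)
  also have "\<dots> \<le> (\<integral>\<^sup>+\<omega>\<in>?A. emeasure (P (X (real n * ?\<tau>) \<omega>))
      {\<omega>' \<in> space M. \<forall>t\<in>{0..?\<tau>}. (t, X t \<omega>') \<in> loop_set z \<delta> \<rho> s a} \<partial>P y)"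
  proof (rule nn_integral_mono)
    fix \<omega> assume "\<omega> \<in> space (P y)"
    show "q * indicator ?A \<omega> \<le> emeasure (P (X (real n * ?\<tau>) \<omega>))
      {\<omega>' \<in> space M. \<forall>t\<in>{0..?\<tau>}. (t, X t \<omega>') \<in> loop_set z \<delta> \<rho> s a} * indicator ?A \<omega>"
    proof (cases "\<omega> \<in> ?A")
      case True
      then have "X (real n * ?\<tau>) \<omega> \<in> E" using X_in_E[OF nt] by blast
      then show ?thesis using q[OF _ return[OF True]] True by (simp add: loop_event_def)
    qed simp
  qed
  also have "\<dots> \<le> emeasure (P y) {\<omega> \<in> ?A. \<forall>t\<in>{0..?\<tau>}. (t, X (real n * ?\<tau> + t) \<omega>) \<in> loop_set z \<delta> \<rho> s a}"
    using \<tau> by (intro markov_closed closed_loop_set y nt A) simp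
  also have "\<dots> \<le> emeasure (P y) {\<omega> \<in> space M. \<forall>t\<in>{0..real (Suc n) * ?\<tau>}. (t, X t \<omega>) \<in> G (Suc n)}"
  proof (rule emeasure_mono)
    have "0 \<le> real (Suc n) * ?\<tau>" using \<tau> by simp
    then show "{\<omega> \<in> space M. \<forall>t\<in>{0..real (Suc n) * ?\<tau>}. (t, X t \<omega>) \<in> G (Suc n)} \<in> sets (P y)"
      using F_sets_M[OF closed_path_event_sets[OF _ Gcl]] sets_P[OF y(1)] by simp
    show "{\<omega> \<in> ?A. \<forall>t\<in>{0..?\<tau>}. (t, X (real n * ?\<tau> + t) \<omega>) \<in> loop_set z \<delta> \<rho> s a} \<subseteq>
      {\<omega> \<in> space M. \<forall>t\<in>{0..real (Suc n) * ?\<tau>}. (t, X t \<omega>) \<in> G (Suc n)}"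
    proof
      fix \<omega> assume \<omega>: "\<omega> \<in> {\<omega> \<in> ?A. \<forall>t\<in>{0..?\<tau>}. (t, X (real n * ?\<tau> + t) \<omega>) \<in> loop_set z \<delta> \<rho> s a}"
      have "(t, X t \<omega>) \<in> G (Suc n)" if t: "t \<in> {0..real (Suc n) * ?\<tau>}" for t
      proof -
        have Gt: "real (Suc n) * ?\<tau> + (- (a * T) + a * s) = real n * ?\<tau> + a * s" by (simp add: algebra_simps)
        show ?thesis
        proof (cases "t \<le> real n * ?\<tau>")
          case True
          then have "(t, X t \<omega>) \<in> G n" using \<omega> t by auto
          then have low: "a * \<delta> \<le> norm (X t \<omega>)" by (simp add: G_def)
          have "t \<le> real n * ?\<tau> + a * s" using True a T(3) by (simp add: add_increasing2)
          then show ?thesis using low Gt by (simp add: G_def)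
        next
          case False
          let ?t = "t - real n * ?\<tau>"
          have "?t \<in> {0..?\<tau>}" using False t by (auto simp: algebra_simps)
          then have "(?t, X (real n * ?\<tau> + ?t) \<omega>) \<in> loop_set z \<delta> \<rho> s a" using \<omega> by blast
          then show ?thesis using Gt by (auto simp: G_def loop_set_def)
        qed
      qed
      then show "\<omega> \<in> {\<omega> \<in> space M. \<forall>t\<in>{0..real (Suc n) * ?\<tau>}. (t, X t \<omega>) \<in> G (Suc n)}" using \<omega> by blast
    qed
  qed
  finally show ?case .
qed

lemma survival_sets:
  assumes t: "0 \<le> t" and B: "B \<in> sets borel" and K: "closed K" "K \<subseteq> E"
  shows "{\<omega> \<in> space M. X t \<omega> \<in> B \<and> ennreal t < hitting_time X K \<omega>} \<in> sets M"
proof -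
  have "Measurable.pred (F (ennreal t)) (\<lambda>\<omega>. ennreal t < hitting_time X K \<omega>)"
    by (rule stopping_timeD2[OF hitting_stopping[OF K]])
  then have "{\<omega> \<in> space M. ennreal t < hitting_time X K \<omega>} \<in> sets (F (ennreal t))"
    unfolding pred_def space_F .
  then have "{\<omega> \<in> space M. ennreal t < hitting_time X K \<omega>} \<in> sets M"
    by (rule F_sets_M)
  moreover have "{\<omega> \<in> space M. X t \<omega> \<in> B} \<in> sets M" by (rule F_sets_M[OF X_event_sets[OF t B]])
  ultimately have "{\<omega> \<in> space M. X t \<omega> \<in> B} \<inter> {\<omega> \<in> space M. ennreal t < hitting_time X K \<omega>} \<in> sets M"
    by (intro sets.Int)
  moreover have "{\<omega> \<in> space M. X t \<omega> \<in> B} \<inter> {\<omega> \<in> space M. ennreal t < hitting_time X K \<omega>} =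
    {\<omega> \<in> space M. X t \<omega> \<in> B \<and> ennreal t < hitting_time X K \<omega>}" by blast
  ultimately show ?thesis by simp
qed

text \<open>The hitting time is an infimum: avoiding \<open>K\<close> only up to \<open>t\<close>
  would give \<open>t \<le> hitting_time\<close>, and the margin \<open>t < u\<close> makes it
  strict.\<close>

lemma hitting_time_greater:
  assumes "0 \<le> t" "t < u" "\<And>v. 0 < v \<Longrightarrow> v \<le> u \<Longrightarrow> X v \<omega> \<notin> K"
  shows "ennreal t < hitting_time X K \<omega>"
proof -
  have "ennreal u \<le> hitting_time X K \<omega>"
    unfolding hitting_time_def
  proof (rule Inf_greatest)
    fix b assume "b \<in> ennreal ` {t. 0 < t \<and> X t \<omega> \<in> K}"
    then obtain v where "b = ennreal v" "0 < v" "X v \<omega> \<in> K" by blast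
    then show "ennreal u \<le> b" using assms(3)[of v] by (cases "v \<le> u") (auto intro!: ennreal_leI)
  qed
  moreover have "ennreal t < ennreal u" using assms(1,2) by (simp add: ennreal_less_iff)
  ultimately show ?thesis by (rule less_le_trans[rotated])
qed

text \<open>Let \<open>r = exp (- \<mu>)\<close> with \<open>\<mu> > lam\<close> be admissible with
  compact set \<open>K\<close>. In the window of period \<open>n\<close> the process is in
  \<open>B\<close> without having met \<open>K\<close>, with probability at least
  \<open>exp (- c * a)\<close> to the power \<open>n + 1\<close>. The weight
  \<open>exp (\<mu> * t)\<close> outgrows this, so the time integral diverges for every start in
  \<open>B\<close>, a set of positive measure.\<close>

lemma admissible_below:
  assumes "admissible r"
  shows "exp (- lam) \<le> r"
proof (rule ccontr)
  assume "\<not> exp (- lam) \<le> r"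
  then have r: "r < exp (- lam)" by simp
  obtain K where rpos: "0 < r" and K: "compact K" "K \<subseteq> E" and fin: "\<forall>W. compact W \<and> W \<subseteq> E - K \<longrightarrow>
      (\<forall>D. compact D \<and> D \<subseteq> E - K \<longrightarrow>
    (\<integral>\<^sup>+x\<in>D. (\<integral>\<^sup>+t\<in>{0..}. ennreal (r powr (-t)) *
      emeasure (P x) {\<omega> \<in> space (P x). X t \<omega> \<in> W \<and> hitting_time X K \<omega> > ennreal t} \<partial>lborel) \<partial>m) < \<infinity>)"
    using assms unfolding admissible_def by (elim conjE exE)
  define \<mu> where "\<mu> = - ln r"
  have \<mu>: "lam < \<mu>" using r rpos by (simp add: \<mu>_def) (metis exp_ln exp_less_cancel_iff less_minus_iff)
  have \<mu>pos: "0 < \<mu>" using \<mu> lam_nonneg by simp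
  have rpow: "r powr (- t) = exp (\<mu> * t)" for t using rpos by (simp add: powr_def \<mu>_def)
  obtain z \<delta> \<rho> s T c where z: "z \<in> S" and \<delta>: "0 < \<delta>" and \<rho>: "0 < \<rho>" "2 * \<delta> \<le> norm z - \<rho>" and T: "1 \<le> s" "s < T"
    and c: "c < \<mu>" "0 \<le> c" and ev: "\<forall>\<^sub>F a in at_top. \<forall>y\<in>E. dist y (a *\<^sub>R z) \<le> a * \<rho> \<longrightarrow>
      ennreal (exp (- c * a)) \<le> emeasure (P y) (loop_event z \<delta> \<rho> s T a)"
    using loop_prob[OF \<mu>] by blast
  obtain RK where RK: "0 < RK" "\<And>y. y \<in> K \<Longrightarrow> norm y \<le> RK"
    using compact_imp_bounded[OF K(1)] unfolding bounded_pos by blast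
  have "\<forall>\<^sub>F a in at_top. 0 < a \<and> RK < a * \<delta> \<and> (\<exists>w. a *\<^sub>R w \<in> E \<and> norm (w - z) < \<rho>) \<and>
    (\<forall>y\<in>E. dist y (a *\<^sub>R z) \<le> a * \<rho> \<longrightarrow> ennreal (exp (- c * a)) \<le> emeasure (P y) (loop_event z \<delta> \<rho> s T a))"
    using ev scaling_limits_eventually[OF z \<rho>(1)] eventually_gt_at_top[of 0] eventually_gt_at_top[of "RK / \<delta>"]
    by eventually_elim (use \<delta> in \<open>auto simp: field_simps\<close>)
  \<comment> \<open>One scale is fixed for good, large enough for the loop estimate and for the ball
    of radius \<open>a * \<delta>\<close> to contain \<open>K\<close>.\<close>
  then obtain a w where a: "0 < a" "RK < a * \<delta>" and w: "a *\<^sub>R w \<in> E" "norm (w - z) < \<rho>" and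
    q: "\<And>y. y \<in> E \<Longrightarrow> dist y (a *\<^sub>R z) \<le> a * \<rho> \<Longrightarrow> ennreal (exp (- c * a)) \<le> emeasure (P y) (loop_event z \<delta> \<rho> s T a)"
    by (auto dest!: eventually_happens)
  define B where "B = E \<inter> cball (a *\<^sub>R z) (a * \<rho>)"
  have B: "compact B" unfolding B_def using closed_E by (intro closed_Int_compact) auto
  have notK: "y \<notin> K" if "a * \<delta> \<le> norm y" for y using RK(2)[of y] that a(2) by force
  have BK: "B \<subseteq> E - K"
  proof
    fix y assume y: "y \<in> B"
    have "norm (a *\<^sub>R z) \<le> norm y + dist y (a *\<^sub>R z)"
      using norm_triangle_sub[of "a *\<^sub>R z" y] by (simp add: dist_norm norm_minus_commute)
    then have "a * norm z \<le> norm y + a * \<rho>" using y a by (simp add: B_def dist_commute)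
    moreover have "a * (2 * \<delta>) \<le> a * (norm z - \<rho>)" using \<rho>(2) a by (intro mult_left_mono) auto
    moreover have "0 < a * \<delta>" using a \<delta> by simp
    ultimately have "a * \<delta> \<le> norm y" by (simp add: algebra_simps)
    then show "y \<in> E - K" using y notK by (auto simp: B_def)
  qed
  let ?f = "\<lambda>y t. ennreal (r powr (-t)) *
      emeasure (P y) {\<omega> \<in> space (P y). X t \<omega> \<in> B \<and> hitting_time X K \<omega> > ennreal t}"
  let ?\<tau> = "a * T"
  \<comment> \<open>Per period, survival loses the factor \<open>exp (- c * a)\<close> while the
    weight gains \<open>exp (\<mu> * (a * T))\<close>; \<open>b\<close> is the length of the window
    times one loss.\<close>
  define g where "g = exp (a * (\<mu> * T - c))"
  define b where "b = (a * T - a * s) * exp (- c * a)"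
  have g: "1 < g"
  proof -
    \<comment> \<open>PLACEHOLDER\<close>
    have "\<mu> * 1 \<le> \<mu> * T" using T \<mu>pos by (intro mult_left_mono) auto
    then have "c < \<mu> * T" using c by linarith
    then have "0 < a * (\<mu> * T - c)" using a by (intro mult_pos_pos) auto
    then show ?thesis by (simp add: g_def)
  qed
  have bpos: "0 < b" using a T by (simp add: b_def)
  have prob: "ennreal (exp (- c * a)) ^ Suc n \<le>
      emeasure (P y) {\<omega> \<in> space (P y). X t \<omega> \<in> B \<and> hitting_time X K \<omega> > ennreal t}"
    if y: "y \<in> B" and t: "real n * ?\<tau> + a * s < t" "t < real (Suc n) * ?\<tau>" for y n t
  proof -
    have yE: "y \<in> E" "dist y (a *\<^sub>R z) \<le> a * \<rho>" using y by (auto simp: B_def dist_commute)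
    have t0: "0 \<le> t"
    proof -
      have "0 \<le> real n * ?\<tau> + a * s" using a T by (intro add_nonneg_nonneg mult_nonneg_nonneg) auto
      then show ?thesis using t by linarith
    qed
    define G where "G = {p::real \<times> 'a. a * \<delta> \<le> norm (snd p)} \<inter>
      ({p. fst p \<le> real (Suc n) * ?\<tau> + (if Suc n = 0 then - 1 else - ?\<tau> + a * s)} \<union> {p. dist (snd p) (a *\<^sub>R z) \<le> a * \<rho>})"
    have "ennreal (exp (- c * a)) ^ Suc n \<le>
      emeasure (P y) {\<omega> \<in> space M. \<forall>t\<in>{0..real (Suc n) * ?\<tau>}. (t, X t \<omega>) \<in> G}"
      unfolding G_def using a T \<rho> \<delta> yE q by (intro repeated_loops_prob) auto
    also have "\<dots> \<le> emeasure (P y) {\<omega> \<in> space (P y). X t \<omega> \<in> B \<and> hitting_time X K \<omega> > ennreal t}"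
    proof (rule emeasure_mono)
      show "{\<omega> \<in> space (P y). X t \<omega> \<in> B \<and> hitting_time X K \<omega> > ennreal t} \<in> sets (P y)"
        using survival_sets[OF t0 borel_closed[OF compact_imp_closed[OF B]] compact_imp_closed[OF K(1)] K(2)]
        by (simp add: space_P[OF yE(1)] sets_P[OF yE(1)])
      show "{\<omega> \<in> space M. \<forall>t\<in>{0..real (Suc n) * ?\<tau>}. (t, X t \<omega>) \<in> G} \<subseteq>
        {\<omega> \<in> space (P y). X t \<omega> \<in> B \<and> hitting_time X K \<omega> > ennreal t}"
      proof
        fix \<omega> assume \<omega>: "\<omega> \<in> {\<omega> \<in> space M. \<forall>t\<in>{0..real (Suc n) * ?\<tau>}. (t, X t \<omega>) \<in> G}"
        have "real (Suc n) * ?\<tau> + (- ?\<tau> + a * s) = real n * ?\<tau> + a * s" by (simp add: algebra_simps)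
        moreover have "(t, X t \<omega>) \<in> G" using \<omega> t t0 by auto
        ultimately have "dist (X t \<omega>) (a *\<^sub>R z) \<le> a * \<rho>" using t(1) by (auto simp: G_def)
        then have "X t \<omega> \<in> B" using X_in_E[OF t0] \<omega> by (auto simp: B_def dist_commute)
        moreover have "ennreal t < hitting_time X K \<omega>"
        proof (rule hitting_time_greater[OF t0 t(2)])
          fix v assume "0 < v" "v \<le> real (Suc n) * ?\<tau>"
          then have "(v, X v \<omega>) \<in> G" using \<omega> by auto
          then show "X v \<omega> \<notin> K" by (intro notK) (simp add: G_def)
        qed
        ultimately show "\<omega> \<in> {\<omega> \<in> space (P y). X t \<omega> \<in> B \<and> hitting_time X K \<omega> > ennreal t}"
          using \<omega> space_P[OF yE(1)] by simp
      qed
    qed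
    finally show ?thesis .
  qed
  have inner_n: "ennreal (b * g ^ n) \<le> (\<integral>\<^sup>+t\<in>{0..}. ?f y t \<partial>lborel)" if y: "y \<in> B" for y n
  proof -
    let ?l = "real n * ?\<tau> + a * s" and ?u = "real (Suc n) * ?\<tau>"
    let ?c = "exp (\<mu> * (real n * ?\<tau>)) * exp (- c * a) ^ Suc n"
    have len: "?u - ?l = a * T - a * s" "?l < ?u" "0 \<le> real n * ?\<tau>"
      using a T by (auto simp: algebra_simps)
    have "ennreal (b * g ^ n) = ennreal ?c * ennreal (?u - ?l)"
    proof -
      have "exp (\<mu> * (real n * ?\<tau>)) * exp (- c * a) ^ n = g ^ n"
        by (simp add: g_def exp_of_nat_mult[symmetric] exp_add[symmetric] algebra_simps)
      then have "?c * (?u - ?l) = b * g ^ n"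
        unfolding len b_def power_Suc by (simp add: algebra_simps)
      then show ?thesis using len by (simp add: ennreal_mult[symmetric])
    qed
    also have "\<dots> = (\<integral>\<^sup>+t. ennreal ?c * indicator {?l<..<?u} t \<partial>lborel)"
      using len by (subst nn_integral_cmult_indicator) auto
    also have "\<dots> \<le> (\<integral>\<^sup>+t\<in>{0..}. ?f y t \<partial>lborel)"
    proof (rule nn_integral_mono)
      fix t
      show "ennreal ?c * indicator {?l<..<?u} t \<le> ?f y t * indicator {0..} t"
      proof (cases "t \<in> {?l<..<?u}")
        case True
        then have t: "?l < t" "t < ?u" by auto
        have nt: "real n * ?\<tau> \<le> t" using t a T by (smt (verit) mult_nonneg_nonneg)
        have "ennreal ?c = ennreal (exp (\<mu> * (real n * ?\<tau>))) * ennreal (exp (- c * a)) ^ Suc n"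
          by (simp add: ennreal_mult ennreal_power del: power_Suc)
        also have "\<dots> \<le> ?f y t"
          unfolding rpow using nt \<mu>pos by (intro mult_mono prob[OF y t] ennreal_leI) auto
        also have "\<dots> = ?f y t * indicator {0..} t"
          using order_trans[OF len(3) nt] by simp
        finally show ?thesis using True by (simp del: power_Suc)
      qed simp
    qed
    finally show ?thesis .
  qed
  have inner: "(\<integral>\<^sup>+t\<in>{0..}. ?f y t \<partial>lborel) = \<infinity>" if y: "y \<in> B" for y
  proof (rule ccontr)
    assume "(\<integral>\<^sup>+t\<in>{0..}. ?f y t \<partial>lborel) \<noteq> \<infinity>"
    then obtain k where k: "(\<integral>\<^sup>+t\<in>{0..}. ?f y t \<partial>lborel) = ennreal k" "0 \<le> k"
      by (cases "(\<integral>\<^sup>+t\<in>{0..}. ?f y t \<partial>lborel)") auto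
    obtain n where "k + 1 \<le> b * g ^ n" using power_eventually_ge[OF g bpos] by blast
    moreover have "b * g ^ n \<le> k" using inner_n[OF y, of n] k by simp
    ultimately show False by simp
  qed
  have Bm: "B \<in> sets m"
    unfolding sets_m B_def using closed_E E_borel
    by (auto simp: sets_restrict_space image_iff intro!: bexI[of _ "cball (a *\<^sub>R z) (a * \<rho>)"])
  have "emeasure m B \<noteq> 0"
  proof -
    let ?O = "E \<inter> ball (a *\<^sub>R z) (a * \<rho>)"
    have "norm (a *\<^sub>R w - a *\<^sub>R z) = a * norm (w - z)" using a by (simp flip: scaleR_diff_right)
    then have "a *\<^sub>R w \<in> ?O" using w a by (simp add: dist_norm norm_minus_commute)
    then have "emeasure m ?O \<noteq> 0" by (intro positive_m) auto
    moreover have "emeasure m ?O \<le> emeasure m B" using Bm by (intro emeasure_mono) (auto simp: B_def)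
    ultimately show ?thesis by (metis le_zero_eq)
  qed
  then have "\<infinity> = (\<integral>\<^sup>+x. \<infinity> * indicator B x \<partial>m)"
    by (subst nn_integral_cmult_indicator[OF Bm]) (simp add: ennreal_top_mult)
  also have "\<dots> \<le> (\<integral>\<^sup>+x\<in>B. (\<integral>\<^sup>+t\<in>{0..}. ?f x t \<partial>lborel) \<partial>m)"
    using inner by (intro nn_integral_mono) (auto split: split_indicator)
  also have "\<dots> < \<infinity>" using fin B BK by blast
  finally show False by simp
qed

lemma ess_spectral_radius_exp: "ess_spectral_radius E P X m = ennreal (exp (- lam))"
  unfolding ess_spectral_radius_eq
proof (rule antisym)
  show "ennreal (exp (- lam)) \<le> Inf (ennreal ` {r. admissible r})"
    using admissible_below by (intro Inf_greatest) (auto intro!: ennreal_leI)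
  show "Inf (ennreal ` {r. admissible r}) \<le> ennreal (exp (- lam))"
  proof (rule ennreal_le_epsilon)
    fix e :: real assume "0 < e"
    then have "admissible (exp (- lam) + e)" by (intro admissible_above) simp
    then have "Inf (ennreal ` {r. admissible r}) \<le> ennreal (exp (- lam) + e)"
      by (intro Inf_lower) auto
    then show "Inf (ennreal ` {r. admissible r}) \<le> ennreal (exp (- lam)) + ennreal e"
      using \<open>0 < e\<close> by simp
  qed
qed

lemma elog_ess_spectral_radius: "elog (ess_spectral_radius E P X m) = - ereal lam"
  unfolding ess_spectral_radius_exp by (simp add: elog_def)

end

theorem theorem2:
  fixes M :: "'w measure" and F :: "ennreal \<Rightarrow> 'w measure"
    and E :: "'a::euclidean_space set"
    and P :: "'a \<Rightarrow> 'w measure" and X :: "real \<Rightarrow> 'w \<Rightarrow> 'a" and m :: "'a measure"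
    and I :: "real \<Rightarrow> (real \<Rightarrow> 'a) \<Rightarrow> ennreal"
    and x y :: 'a
  assumes "process_setting M F E P X m"
    and "assumption_A E P X I"
    and "x \<in> scaling_limits E" and "y \<in> scaling_limits E"
  shows "elog (ess_spectral_radius E P X m) = - I_star (scaling_limits E) I \<and>
    - I_star (scaling_limits E) I
      = - Limsup at_top (\<lambda>t::real. I_zero (scaling_limits E) I t x y / ereal t) \<and>
    - Limsup at_top (\<lambda>t::real. I_zero (scaling_limits E) I t x y / ereal t)
      = - Limsup at_top (\<lambda>t::real. I_hat (scaling_limits E) I t x y / ereal t) \<and>
    - Limsup at_top (\<lambda>t::real. I_hat (scaling_limits E) I t x y / ereal t)
      = - (INF \<phi>\<in>{\<phi> \<in> continuous_paths 1 (scaling_limits E). \<phi> 0 = \<phi> 1 \<and>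
            (\<forall>t. 0 < t \<and> t < 1 \<longrightarrow> \<phi> t \<noteq> 0)}. enn2ereal (I 1 \<phi>))"
proof -
  interpret ldp_process M F E P X m I
    using assms(1,2) by (intro ldp_process.intro ldp_process_axioms.intro)
  obtain L C0 d0 where act: "action_space (scaling_limits E) I L C0 d0"
    using ex_action_space by blast
  interpret ldp_action M F E P X m I L C0 d0
    by (intro ldp_action.intro ldp_process_axioms act)
  show ?thesis
    using elog_ess_spectral_radius I_star_eq Limsup_I_zero[OF assms(3,4)]
      Limsup_I_hat[OF assms(3,4)] INF_loops by simp
qed

end
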